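(* Let $\Sigma$ be a complete immersed self-expander hypersurface in $\mathbb{R}^{n+1}$ with nonnegative constant scalar curvature. Then $\Sigma=\Gamma\times\mathbb{R}^{n-1}$ with the product metric, where $\Gamma$ is a complete self-expander curve immersed in $\mathbb{R}^2$.
   Context: $x$ denotes the position vector. For a (connected) immersed hypersurface of Euclidean space (including a curve in $\mathbb{R}^2$) the second fundamental form is $A(X,Y)=(\overline\nabla_XY)^\perp$ ($\overline\nabla$ the Euclidean connection), the mean curvature vector $\mathbf{H}$ is its trace, and the hypersurface is a self-expander if $\mathbf{H}=\frac12x^\perp$ ($x^\perp$ the normal component of $x$). The mean curvature $H$ is defined by $\mathbf{H}=-H\mathbf{n}$, $\mathbf{n}$ the unit normal, and the scalar curvature is $Scal_\Sigma=H^2-|A|^2$. The identity $\Sigma=\Gamma\times\mathbb{R}^{n-1}\subset\mathbb{R}^2\times\mathbb{R}^{n-1}$ is understood up to a rotation of $\mathbb{R}^{n+1}$ about the origin; $\Gamma$ may be a straight line through the origin. *)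

theory Defs
  imports "HOL-Analysis.Analysis"
begin

section \<open>Smooth maps and smooth manifolds\<close>

text \<open>These are \<open>C\<^sup>k\<close> and \<open>C\<^sup>\<infinity>\<close> in the usual sense, and are only used for open \<open>S\<close>.\<close>

fun Ck_on :: "nat \<Rightarrow> 'a::euclidean_space set \<Rightarrow> ('a \<Rightarrow> 'b::real_normed_vector) \<Rightarrow> bool" where
  "Ck_on 0 S f \<longleftrightarrow> continuous_on S f"
| "Ck_on (Suc k) S f \<longleftrightarrow>
     (\<forall>x\<in>S. f differentiable (at x)) \<and> (\<forall>v. Ck_on k S (\<lambda>x. frechet_derivative f (at x) v))"

definition smooth_on :: "'a::euclidean_space set \<Rightarrow> ('a \<Rightarrow> 'b::real_normed_vector) \<Rightarrow> bool" where
  "smooth_on S f \<longleftrightarrow> (\<forall>k. Ck_on k S f)"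

text \<open>An atlas is a set of parametrizations \<open>(D, \<psi>)\<close>: \<open>D\<close> is open in \<open>\<real>\<^sup>n\<close> and \<open>\<psi>\<close> is a
  homeomorphism of \<open>D\<close> onto an open subset of the manifold (so \<open>\<psi>\<close> is the inverse of a chart).
  The manifold is an abstract topology, so that its underlying set may be any set.\<close>

type_synonym ('n, 'p) atlas = "((real^'n) set \<times> (real^'n \<Rightarrow> 'p)) set"

definition smooth_manifold :: "'p topology \<Rightarrow> ('n::finite, 'p) atlas \<Rightarrow> bool" where
  "smooth_manifold M \<A> \<longleftrightarrow>
     Hausdorff_space M \<and> second_countable M \<and>
     (\<forall>(D,\<psi>)\<in>\<A>. open D \<and> openin M (\<psi> ` D) \<and>
        homeomorphic_map (top_of_set D) (subtopology M (\<psi> ` D)) \<psi>) \<and>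
     topspace M = (\<Union>(D,\<psi>)\<in>\<A>. \<psi> ` D) \<and>
     (\<forall>(D,\<psi>)\<in>\<A>. \<forall>(E,\<theta>)\<in>\<A>. smooth_on {u \<in> D. \<psi> u \<in> \<theta> ` E} (inv_into E \<theta> \<circ> \<psi>))"

definition smooth_map ::
  "'p topology \<Rightarrow> ('n::finite, 'p) atlas \<Rightarrow> 'q topology \<Rightarrow> ('k::finite, 'q) atlas \<Rightarrow> ('p \<Rightarrow> 'q) \<Rightarrow> bool"
  where
  "smooth_map M \<A> N \<B> G \<longleftrightarrow>
     continuous_map M N G \<and>
     (\<forall>(D,\<psi>)\<in>\<A>. \<forall>(E,\<theta>)\<in>\<B>. smooth_on {u \<in> D. G (\<psi> u) \<in> \<theta> ` E} (inv_into E \<theta> \<circ> G \<circ> \<psi>))"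

definition diffeomorphism ::
  "'p topology \<Rightarrow> ('n::finite, 'p) atlas \<Rightarrow> 'q topology \<Rightarrow> ('k::finite, 'q) atlas \<Rightarrow> ('p \<Rightarrow> 'q) \<Rightarrow> bool"
  where
  "diffeomorphism M \<A> N \<B> \<Phi> \<longleftrightarrow>
     smooth_map M \<A> N \<B> \<Phi> \<and>
     (\<exists>\<Psi>. smooth_map N \<B> M \<A> \<Psi> \<and>
        (\<forall>p\<in>topspace M. \<Psi> (\<Phi> p) = p) \<and> (\<forall>q\<in>topspace N. \<Phi> (\<Psi> q) = q))"


section \<open>Immersed hypersurfaces and completeness\<close>

text \<open>The hypersurface has dimension \<open>n = CARD('n)\<close>, the ambient space is \<open>\<real>\<^sup>n\<^sup>+\<^sup>1\<close>. A curve in the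
  plane is the case \<open>'n = 1\<close>, \<open>'m = 2\<close>.\<close>

definition immersed_hypersurface ::
  "'p topology \<Rightarrow> ('n::finite, 'p) atlas \<Rightarrow> ('p \<Rightarrow> real^'m::finite) \<Rightarrow> bool" where
  "immersed_hypersurface M \<A> F \<longleftrightarrow>
     CARD('m) = CARD('n) + 1 \<and>
     smooth_manifold M \<A> \<and> connected_space M \<and> topspace M \<noteq> {} \<and>
     (\<forall>(D,\<psi>)\<in>\<A>. smooth_on D (F \<circ> \<psi>) \<and> (\<forall>u\<in>D. inj (frechet_derivative (F \<circ> \<psi>) (at u))))"

text \<open>Piecewise \<open>C\<^sup>1\<close> curves in \<open>M\<close>. As \<open>F\<close> is an immersion, a continuous curve is \<open>C\<^sup>1\<close> in
  charts iff its image under \<open>F\<close> is. The library's notion of piecewise \<open>C\<^sup>1\<close> allows the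
  derivative to blow up at the break points; integrability of the speed excludes curves of infinite
  length, for which the library's integral would be \<open>0\<close>.\<close>

definition pw_C1_curve :: "'p topology \<Rightarrow> ('p \<Rightarrow> real^'m::finite) \<Rightarrow> (real \<Rightarrow> 'p) \<Rightarrow> bool" where
  "pw_C1_curve M F c \<longleftrightarrow>
     pathin M c \<and> (F \<circ> c) piecewise_C1_differentiable_on {0..1} \<and>
     (\<lambda>t. norm (vector_derivative (F \<circ> c) (at t))) integrable_on {0..1}"

definition curve_length :: "('p \<Rightarrow> real^'m::finite) \<Rightarrow> (real \<Rightarrow> 'p) \<Rightarrow> real" where
  "curve_length F c = integral {0..1} (\<lambda>t. norm (vector_derivative (F \<circ> c) (at t)))"

text \<open>The distance of the Riemannian metric induced by \<open>F\<close>. (The value \<open>0\<close> off \<open>M\<close> is needed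
  because \<open>Metric_space\<close> asks for a function that is nonnegative and symmetric everywhere.)\<close>

definition riem_dist :: "'p topology \<Rightarrow> ('p \<Rightarrow> real^'m::finite) \<Rightarrow> 'p \<Rightarrow> 'p \<Rightarrow> real" where
  "riem_dist M F p q =
     (if p \<in> topspace M \<and> q \<in> topspace M
      then Inf {curve_length F c | c. pw_C1_curve M F c \<and> c 0 = p \<and> c 1 = q}
      else 0)"

definition complete_hypersurface :: "'p topology \<Rightarrow> ('p \<Rightarrow> real^'m::finite) \<Rightarrow> bool" where
  "complete_hypersurface M F \<longleftrightarrow> Metric_space.mcomplete (topspace M) (riem_dist M F)"


section \<open>Extrinsic geometry in a local parametrization\<close>

text \<open>Throughout, \<open>f\<close> is an immersion of an open subset of \<open>\<real>\<^sup>n\<close>, namely \<open>f = F \<circ> \<psi>\<close> for a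
  parametrization \<open>\<psi>\<close> of the hypersurface; \<open>v \<in> \<real>\<^sup>n\<close> stands for the tangent vector \<open>df\<^sub>u v\<close>.\<close>

definition tangent_space :: "(real^'n::finite \<Rightarrow> real^'m::finite) \<Rightarrow> real^'n \<Rightarrow> (real^'m) set" where
  "tangent_space f u = range (frechet_derivative f (at u))"

definition normal_part ::
  "(real^'n::finite \<Rightarrow> real^'m::finite) \<Rightarrow> real^'n \<Rightarrow> real^'m \<Rightarrow> real^'m" where
  "normal_part f u x = (THE y. y \<in> (tangent_space f u)\<^sup>\<bottom> \<and> x - y \<in> tangent_space f u)"

definition induced_metric ::
  "(real^'n::finite \<Rightarrow> real^'m::finite) \<Rightarrow> real^'n \<Rightarrow> real^'n \<Rightarrow> real^'n \<Rightarrow> real" where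
  "induced_metric f u v w = frechet_derivative f (at u) v \<bullet> frechet_derivative f (at u) w"

text \<open>\<open>A(X,Y) = (\<nabla>\<^sub>X Y)\<^sup>\<bottom>\<close> with \<open>\<nabla>\<close> the Euclidean connection, i.e. the directional
  derivative of \<open>Y\<close>. Here \<open>X = df\<^sub>u v\<close>, and \<open>Y = df\<^sub>u w\<close> is extended to the tangent field
  \<open>x \<mapsto> df\<^sub>x w\<close>; as \<open>A\<close> is tensorial, any other tangential extension gives the same value.\<close>

definition second_ff ::
  "(real^'n::finite \<Rightarrow> real^'m::finite) \<Rightarrow> real^'n \<Rightarrow> real^'n \<Rightarrow> real^'n \<Rightarrow> real^'m" where
  "second_ff f u v w =
     normal_part f u (frechet_derivative (\<lambda>x. frechet_derivative f (at x) w) (at u) v)"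

definition inverse_metric :: "(real^'n::finite \<Rightarrow> real^'m::finite) \<Rightarrow> real^'n \<Rightarrow> real^'n^'n" where
  "inverse_metric f u = matrix_inv (\<chi> i j. induced_metric f u (axis i 1) (axis j 1))"

text \<open>\<open>\<^bold>H = g\<^sup>i\<^sup>j A\<^sub>i\<^sub>j\<close>, the trace of \<open>A\<close> with respect to the induced metric.\<close>

definition mean_curvature_vector ::
  "(real^'n::finite \<Rightarrow> real^'m::finite) \<Rightarrow> real^'n \<Rightarrow> real^'m" where
  "mean_curvature_vector f u =
     (\<Sum>i\<in>UNIV. \<Sum>j\<in>UNIV. inverse_metric f u $ i $ j *\<^sub>R second_ff f u (axis i 1) (axis j 1))"

text \<open>\<open>|A|\<^sup>2 = g\<^sup>i\<^sup>k g\<^sup>j\<^sup>l \<langle>A\<^sub>i\<^sub>j, A\<^sub>k\<^sub>l\<rangle>\<close>.\<close>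

definition second_ff_norm_sq ::
  "(real^'n::finite \<Rightarrow> real^'m::finite) \<Rightarrow> real^'n \<Rightarrow> real" where
  "second_ff_norm_sq f u =
     (\<Sum>i\<in>UNIV. \<Sum>j\<in>UNIV. \<Sum>k\<in>UNIV. \<Sum>l\<in>UNIV.
        inverse_metric f u $ i $ k * inverse_metric f u $ j $ l *
        (second_ff f u (axis i 1) (axis j 1) \<bullet> second_ff f u (axis k 1) (axis l 1)))"

text \<open>\<open>H\<^sup>2 - |A|\<^sup>2\<close>. The scalar \<open>H\<close> is given by \<open>\<^bold>H = - H n\<close> with a unit normal \<open>n\<close>, which may
  exist only locally; its square is \<open>|\<^bold>H|\<^sup>2\<close> for either choice of \<open>n\<close>.\<close>

definition scalar_curvature ::
  "(real^'n::finite \<Rightarrow> real^'m::finite) \<Rightarrow> real^'n \<Rightarrow> real" where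
  "scalar_curvature f u = (norm (mean_curvature_vector f u))\<^sup>2 - second_ff_norm_sq f u"

lemma scalar_curvature_eq:
  assumes "mean_curvature_vector f u = - (H *\<^sub>R \<nu>)" and "norm \<nu> = 1"
  shows "scalar_curvature f u = H\<^sup>2 - second_ff_norm_sq f u"
  using assms by (simp add: scalar_curvature_def)

definition self_expander :: "('n::finite, 'p) atlas \<Rightarrow> ('p \<Rightarrow> real^'m::finite) \<Rightarrow> bool" where
  "self_expander \<A> F \<longleftrightarrow>
     (\<forall>(D,\<psi>)\<in>\<A>. \<forall>u\<in>D.
        mean_curvature_vector (F \<circ> \<psi>) u = (1/2) *\<^sub>R normal_part (F \<circ> \<psi>) u (F (\<psi> u)))"


section \<open>The product \<open>\<Gamma> \<times> \<real>\<^sup>n\<^sup>-\<^sup>1\<close>\<close>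

text \<open>To include \<open>n = 1\<close>, \<open>\<real>\<^sup>n\<^sup>-\<^sup>1\<close> is rendered as the coordinate hyperplane \<open>y\<^sub>k = 0\<close> of \<open>\<real>\<^sup>n\<close>
  for a fixed index \<open>k\<close> (there is no type \<open>\<real>\<^sup>0\<close> of the form \<open>real^'k\<close>). The \<open>k\<close>-th coordinate of
  \<open>\<real>\<^sup>n\<close> then serves as the parameter of the curve \<open>\<Gamma>\<close>.\<close>

definition coord_hyperplane :: "'n::finite \<Rightarrow> (real^'n) set" where
  "coord_hyperplane k = {y. y $ k = 0}"

definition hyperplane_part :: "'n::finite \<Rightarrow> real^'n \<Rightarrow> real^'n" where
  "hyperplane_part k u = u - (u $ k) *\<^sub>R axis k 1"

definition prod_space :: "'n::finite \<Rightarrow> 'p topology \<Rightarrow> ('p \<times> (real^'n)) topology" where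
  "prod_space k C = prod_topology C (top_of_set (coord_hyperplane k))"

definition prod_param :: "'n::finite \<Rightarrow> (real^1 \<Rightarrow> 'p) \<Rightarrow> real^'n \<Rightarrow> 'p \<times> (real^'n)" where
  "prod_param k \<psi> u = (\<psi> (vec (u $ k)), hyperplane_part k u)"

definition prod_atlas :: "'n::finite \<Rightarrow> (1, 'p) atlas \<Rightarrow> ('n, 'p \<times> (real^'n)) atlas" where
  "prod_atlas k \<G> = (\<lambda>(D,\<psi>). ({u. vec (u $ k) \<in> D}, prod_param k \<psi>)) ` \<G>"

text \<open>The product of the metric of \<open>\<Gamma>\<close>, parametrized by \<open>g = \<gamma> \<circ> \<psi>\<close>, and the flat metric of
  \<open>\<real>\<^sup>n\<^sup>-\<^sup>1\<close>, in the parametrization \<open>prod_param k \<psi>\<close>.\<close>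

definition prod_metric_form ::
  "'n::finite \<Rightarrow> (real^1 \<Rightarrow> real^2) \<Rightarrow> real^'n \<Rightarrow> real^'n \<Rightarrow> real^'n \<Rightarrow> real" where
  "prod_metric_form k g u v w =
     induced_metric g (vec (u $ k)) (vec (v $ k)) (vec (w $ k))
     + hyperplane_part k v \<bullet> hyperplane_part k w"

text \<open>\<open>\<Sigma> = \<Gamma> \<times> \<real>\<^sup>n\<^sup>-\<^sup>1\<close> with the product metric, up to a rotation: \<open>T\<close> is a linear isometry of
  \<open>\<real>\<^sup>2 \<times> \<real>\<^sup>n\<^sup>-\<^sup>1\<close> onto \<open>\<real>\<^sup>n\<^sup>+\<^sup>1\<close> (onto by dimension), i.e. the standard identification
  followed by an orthogonal map. An orthogonal map of determinant \<open>-1\<close> becomes a rotation after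
  reflecting \<open>\<Gamma>\<close> in a line of \<open>\<real>\<^sup>2\<close> through the origin.\<close>

definition is_product_with_curve ::
  "'n::finite \<Rightarrow> 'p topology \<Rightarrow> ('n, 'p) atlas \<Rightarrow> ('p \<Rightarrow> real^'m::finite) \<Rightarrow>
   'q topology \<Rightarrow> (1, 'q) atlas \<Rightarrow> ('q \<Rightarrow> real^2) \<Rightarrow> bool" where
  "is_product_with_curve k M \<A> F C \<G> \<gamma> \<longleftrightarrow>
     (\<exists>(T :: (real^2) \<times> (real^'n) \<Rightarrow> real^'m) \<Phi>.
        linear T \<and> (\<forall>z. \<forall>y\<in>coord_hyperplane k. norm (T (z, y)) = norm (z, y)) \<and>
        diffeomorphism (prod_space k C) (prod_atlas k \<G>) M \<A> \<Phi> \<and>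
        (\<forall>p\<in>topspace C. \<forall>y\<in>coord_hyperplane k. F (\<Phi> (p, y)) = T (\<gamma> p, y)) \<and>
        (\<forall>(D,\<psi>)\<in>\<G>. \<forall>u v w. vec (u $ k) \<in> D \<longrightarrow>
           induced_metric (F \<circ> \<Phi> \<circ> prod_param k \<psi>) u v w = prod_metric_form k (\<gamma> \<circ> \<psi>) u v w))"

end

theory Submission
  imports Defs
begin

text \<open>
  Write the hypersurface locally as a graph over a tangent hyperplane and differentiate the two
  equations \<open>\<^bold>H = x\<^sup>\<bottom>/2\<close> and \<open>H\<^sup>2 - |A|\<^sup>2 = s\<close> at the base point. The first derivative of the second one
  is \<open>H \<nabla>H = \<langle>A, \<nabla>A\<rangle>\<close>; its trace of second derivatives, a Simons identity, is
  \<open>|\<nabla>H|\<^sup>2 - |\<nabla>A|\<^sup>2 = s (|A|\<^sup>2 + 1/2)\<close>. With \<open>s \<ge> 0\<close>, the Cauchy-Schwarz inequality forces \<open>s = 0\<close> and, where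
  \<open>H \<noteq> 0\<close>, \<open>\<nabla>A = (\<nabla>H / H) A\<close>. The Codazzi symmetry of \<open>\<nabla>A\<close> then makes \<open>A\<close> of rank one. Either \<open>H\<close> vanishes
  nowhere, and the plane spanned by the normal and the nonzero direction of \<open>A\<close> is constant; or \<open>H\<close>
  vanishes identically, because \<open>|\<nabla>H\<^sup>2| \<le> |x| H\<^sup>2\<close>, and the normal itself is constant. In both cases
  all tangent spaces contain one subspace of dimension \<open>n - 1\<close>. By completeness, the straight segments in its
  directions lift to the hypersurface for all times; these lifts define an action of \<open>\<real>\<^sup>n\<^sup>-\<^sup>1\<close> by translations,
  which splits the hypersurface off the curve of points at height \<open>0\<close>.
\<close>

section \<open>Smooth maps\<close>

text \<open>The curvature argument is pointwise. For each direction k, Cauchy-Schwarz gives (H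
  dH_k)^2 \<le> |A|^2 |dA_k|^2; after summing over k, H^2 = |A|^2 + s and |dH|^2 = |dA|^2 + s (|A|^2
  + 1/2) leave s |dA|^2 + (|A|^2 + s) s (|A|^2 + 1/2) \<le> 0. So no maximum principle enters. A
  graph over its own tangent plane has the Euclidean metric up to first order at the base point, and
  partial derivatives replace covariant ones there. The price is that each identity holds at one
  point of one graph; hence all quantities are shown to be independent of the parametrization, and
  the graph is centred anew at each point. The obstacle to constancy is that \<open>H\<close> has a
  sign only locally and the direction of \<open>A\<close> comes with no smooth choice. It is avoided
  by fixing an ambient vector \<open>x\<close> and following the function \<open>psi\<close>, the
  squared length of the projection of \<open>x\<close> to the plane of the normal and that
  direction. Its derivative is zero, and where it vanishes \<open>x\<close> is tangent; so a
  subspace found at one point serves at all points, by connectedness.\<close>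

abbreviation fd :: "('a::real_normed_vector \<Rightarrow> 'b::real_normed_vector) \<Rightarrow> 'a \<Rightarrow> 'a \<Rightarrow> 'b" where
  "fd f x \<equiv> frechet_derivative f (at x)"

lemma fd_eq: "(f has_derivative f') (at x) \<Longrightarrow> fd f x = f'"
  using frechet_derivative_at by metis

lemma fd_works: "f differentiable (at x) \<Longrightarrow> (f has_derivative fd f x) (at x)"
  using frechet_derivative_works by blast

lemma fd_cong:
  assumes "open S" "x \<in> S" "\<And>y. y \<in> S \<Longrightarrow> f y = g y"
  shows "fd f x = fd g x"
proof -
  have "(f has_derivative d) (at x) \<longleftrightarrow> (g has_derivative d) (at x)" for d
    using has_derivative_transform_within_open[of _ d x UNIV S] assms by metis
  then show ?thesis unfolding frechet_derivative_def by simp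
qed

lemma differentiable_cong_open:
  assumes "open S" "x \<in> S" "\<And>y. y \<in> S \<Longrightarrow> f y = g y"
  shows "f differentiable (at x) \<longleftrightarrow> g differentiable (at x)"
  using has_derivative_transform_within_open[of _ _ x UNIV S] assms unfolding differentiable_def by metis

section \<open>Closure properties of C^k maps\<close>

lemma Ck_on_cong:
  assumes "open S" "\<And>x. x \<in> S \<Longrightarrow> f x = g x"
  shows "Ck_on k S f \<longleftrightarrow> Ck_on k S g"
  using assms(2)
proof (induction k arbitrary: f g)
  case 0
  then show ?case by (auto intro: continuous_on_cong)
next
  case (Suc k)
  have "Ck_on k S (\<lambda>x. fd f x v) \<longleftrightarrow> Ck_on k S (\<lambda>x. fd g x v)" for v
    by (rule Suc.IH) (use fd_cong[OF assms(1)] Suc.prems in metis)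
  moreover have "f differentiable (at x) \<longleftrightarrow> g differentiable (at x)" if "x \<in> S" for x
    by (rule differentiable_cong_open[OF assms(1) that Suc.prems])
  ultimately show ?case by simp
qed

lemma Ck_on_subset: "Ck_on k S f \<Longrightarrow> T \<subseteq> S \<Longrightarrow> Ck_on k T f"
proof (induction k arbitrary: f)
  case 0
  then show ?case using continuous_on_subset by auto
next
  case (Suc k)
  then show ?case by (simp add: subset_iff)
qed

lemma Ck_on_local:
  assumes "\<And>x. x \<in> S \<Longrightarrow> \<exists>T. open T \<and> x \<in> T \<and> Ck_on k T f"
  shows "Ck_on k S f"
  using assms
proof (induction k arbitrary: f)
  case 0
  then have "isCont f x" if "x \<in> S" for x
    using that continuous_on_eq_continuous_at by (metis Ck_on.simps(1))
  then show ?case by (simp add: continuous_at_imp_continuous_on)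
next
  case (Suc k)
  have "Ck_on k S (\<lambda>x. fd f x v)" for v
    by (rule Suc.IH) (use Suc.prems in fastforce)
  then show ?case using Suc.prems by fastforce
qed

lemma Ck_on_Suc_imp: "Ck_on (Suc k) S f \<Longrightarrow> Ck_on k S f"
proof (induction k arbitrary: f)
  case 0
  then show ?case
    by (auto simp: continuous_at_imp_continuous_on differentiable_imp_continuous_within)
next
  case (Suc k)
  have "Ck_on k S (\<lambda>x. fd f x v)" for v
    by (rule Suc.IH) (use Suc.prems Ck_on.simps(2)[of "Suc k" S f] in blast)
  then show ?case using Suc.prems by simp
qed

lemma smooth_on_fd: "smooth_on S f \<Longrightarrow> smooth_on S (\<lambda>x. fd f x v)"
  unfolding smooth_on_def using Ck_on.simps(2) by blast

lemma smooth_on_differentiable: "smooth_on S f \<Longrightarrow> x \<in> S \<Longrightarrow> f differentiable (at x)"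
  unfolding smooth_on_def using Ck_on.simps(2) by blast

lemma smooth_on_has_derivative: "smooth_on S f \<Longrightarrow> x \<in> S \<Longrightarrow> (f has_derivative fd f x) (at x)"
  using smooth_on_differentiable fd_works by blast

lemma smooth_on_continuous: "smooth_on S f \<Longrightarrow> continuous_on S f"
  unfolding smooth_on_def using Ck_on.simps(1) by blast

lemma smooth_on_cong: "open S \<Longrightarrow> (\<And>x. x \<in> S \<Longrightarrow> f x = g x) \<Longrightarrow> smooth_on S f \<longleftrightarrow> smooth_on S g"
  unfolding smooth_on_def using Ck_on_cong by metis

lemma smooth_on_subset: "smooth_on S f \<Longrightarrow> T \<subseteq> S \<Longrightarrow> smooth_on T f"
  unfolding smooth_on_def using Ck_on_subset by metis

lemma smooth_on_local:
  assumes "\<And>x. x \<in> S \<Longrightarrow> \<exists>T. open T \<and> x \<in> T \<and> smooth_on T f"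
  shows "smooth_on S f"
  unfolding smooth_on_def using Ck_on_local assms unfolding smooth_on_def by metis

lemma Ck_on_const: "Ck_on k S (\<lambda>x. c)"
proof (induction k arbitrary: c)
  case (Suc k)
  have "fd (\<lambda>x. c) x v = 0" for x :: 'a and v by (simp add: fd_eq[OF has_derivative_const])
  then show ?case using Suc by simp
qed simp

lemma Ck_on_linear:
  assumes "bounded_linear L"
  shows "Ck_on k S L"
proof (cases k)
  case 0
  then show ?thesis by (simp add: assms linear_continuous_on)
next
  case (Suc j)
  have "fd L x = L" for x by (rule fd_eq) (rule bounded_linear_imp_has_derivative[OF assms])
  then show ?thesis
    using Suc bounded_linear_imp_differentiable[OF assms] by (simp add: Ck_on_const)
qed

lemma Ck_on_linear_compose:
  assumes "bounded_linear L" "open S"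
  shows "Ck_on k S f \<Longrightarrow> Ck_on k S (\<lambda>x. L (f x))"
proof (induction k arbitrary: f)
  case 0
  then show ?case using assms
    by (simp add: bounded_linear.continuous_on)
next
  case (Suc k)
  have d: "((\<lambda>x. L (f x)) has_derivative (\<lambda>v. L (fd f x v))) (at x)" if "x \<in> S" for x
    using Suc.prems that by (intro bounded_linear.has_derivative[OF assms(1)] fd_works) simp
  have "Ck_on k S (\<lambda>x. fd (\<lambda>x. L (f x)) x v)" for v
  proof (subst Ck_on_cong[OF assms(2)])
    show "fd (\<lambda>x. L (f x)) x v = L (fd f x v)" if "x \<in> S" for x
      using d[OF that] fd_eq by metis
    show "Ck_on k S (\<lambda>x. L (fd f x v))" using Suc by simp
  qed
  then show ?case using d by (auto simp: differentiable_def)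
qed

lemma Ck_on_add:
  assumes "open S"
  shows "Ck_on k S f \<Longrightarrow> Ck_on k S g \<Longrightarrow> Ck_on k S (\<lambda>x. f x + g x)"
proof (induction k arbitrary: f g)
  case 0
  then show ?case by (simp add: continuous_on_add)
next
  case (Suc k)
  have d: "((\<lambda>x. f x + g x) has_derivative (\<lambda>v. fd f x v + fd g x v)) (at x)" if "x \<in> S" for x
    using Suc.prems that by (intro has_derivative_add fd_works) simp_all
  have "Ck_on k S (\<lambda>x. fd (\<lambda>x. f x + g x) x v)" for v
  proof (subst Ck_on_cong[OF assms])
    show "fd (\<lambda>x. f x + g x) x v = fd f x v + fd g x v" if "x \<in> S" for x
      using d[OF that] fd_eq by metis
    show "Ck_on k S (\<lambda>x. fd f x v + fd g x v)" using Suc by simp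
  qed
  then show ?case using d by (auto simp: differentiable_def)
qed

lemma Ck_on_sum:
  assumes "open S" "\<And>i. i \<in> I \<Longrightarrow> Ck_on k S (f i)"
  shows "Ck_on k S (\<lambda>x. \<Sum>i\<in>I. f i x)"
proof (cases "finite I")
  case True
  then show ?thesis using assms(2)
    by (induction I rule: finite_induct) (auto simp: Ck_on_const intro!: Ck_on_add assms(1))
qed (simp add: Ck_on_const)

lemma Ck_on_bilinear:
  assumes "bounded_bilinear B" "open S"
  shows "Ck_on k S f \<Longrightarrow> Ck_on k S g \<Longrightarrow> Ck_on k S (\<lambda>x. B (f x) (g x))"
proof (induction k arbitrary: f g)
  case 0
  then show ?case using bounded_bilinear.continuous_on[OF assms(1)] by simp
next
  case (Suc k)
  have d: "((\<lambda>x. B (f x) (g x)) has_derivative (\<lambda>v. B (f x) (fd g x v) + B (fd f x v) (g x))) (at x)"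
    if "x \<in> S" for x
    using Suc.prems that by (intro bounded_bilinear.FDERIV[OF assms(1)] fd_works) simp_all
  have "Ck_on k S (\<lambda>x. fd (\<lambda>x. B (f x) (g x)) x v)" for v
  proof (subst Ck_on_cong[OF assms(2)])
    show "fd (\<lambda>x. B (f x) (g x)) x v = B (f x) (fd g x v) + B (fd f x v) (g x)" if "x \<in> S" for x
      using d[OF that] fd_eq by metis
    have "Ck_on k S f" "Ck_on k S g" using Suc.prems Ck_on_Suc_imp by blast+
    then show "Ck_on k S (\<lambda>x. B (f x) (fd g x v) + B (fd f x v) (g x))"
      using Suc by (intro Ck_on_add[OF assms(2)] Suc.IH) simp_all
  qed
  then show ?case using d by (auto simp: differentiable_def)
qed

text \<open>\<open>Ck_on\<close> differentiates in a fixed direction, whereas the chain rule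
  evaluates \<open>fd f (g x)\<close> at the moving vector \<open>fd g x v\<close>. Expanding that
  vector in \<open>Basis\<close> gives a sum of products to whose factors the induction hypothesis
  applies.\<close>

lemma Ck_on_compose:
  fixes f :: "'b::euclidean_space \<Rightarrow> 'c::real_normed_vector" and g :: "'a::euclidean_space \<Rightarrow> 'b"
  assumes "open S" "open T" "g ` S \<subseteq> T"
  shows "Ck_on k S g \<Longrightarrow> Ck_on k T f \<Longrightarrow> Ck_on k S (\<lambda>x. f (g x))"
proof (induction k arbitrary: f)
  case 0
  then show ?case using assms continuous_on_compose2 by auto
next
  case (Suc k)
  have gT: "g x \<in> T" if "x \<in> S" for x using assms(3) that by auto
  have d: "((\<lambda>x. f (g x)) has_derivative (\<lambda>v. fd f (g x) (fd g x v))) (at x)" if "x \<in> S" for x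
    by (rule has_derivative_compose[of g "fd g x" x UNIV])
       (use Suc.prems that gT[OF that] in \<open>auto simp: has_derivative_at_withinI fd_works\<close>)
  have lin: "fd f y v = (\<Sum>b\<in>Basis. (v \<bullet> b) *\<^sub>R fd f y b)" if "y \<in> T" for y v
  proof -
    have "linear (fd f y)"
      using Suc.prems that by (intro linear_frechet_derivative) simp
    then have "fd f y (\<Sum>b\<in>Basis. (v \<bullet> b) *\<^sub>R b) = (\<Sum>b\<in>Basis. (v \<bullet> b) *\<^sub>R fd f y b)"
      by (simp add: linear_sum linear_scale)
    then show ?thesis by (simp add: euclidean_representation)
  qed
  have "Ck_on k S (\<lambda>x. fd (\<lambda>x. f (g x)) x v)" for v
  proof (subst Ck_on_cong[OF assms(1)])
    show "fd (\<lambda>x. f (g x)) x v = (\<Sum>b\<in>Basis. (fd g x v \<bullet> b) *\<^sub>R fd f (g x) b)" if "x \<in> S" for x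
      using d[OF that] fd_eq lin gT[OF that] by metis
    have g: "Ck_on k S g" using Suc.prems Ck_on_Suc_imp by blast
    show "Ck_on k S (\<lambda>x. \<Sum>b\<in>Basis. (fd g x v \<bullet> b) *\<^sub>R fd f (g x) b)"
    proof (intro Ck_on_sum assms(1) Ck_on_bilinear[OF bounded_bilinear_scaleR])
      fix b :: 'b
      show "Ck_on k S (\<lambda>x. fd g x v \<bullet> b)"
        using Suc.prems by (intro Ck_on_linear_compose[OF bounded_linear_inner_left assms(1)]) simp
      show "Ck_on k S (\<lambda>x. fd f (g x) b)"
        using Suc.prems g by (intro Suc.IH) simp_all
    qed
  qed
  then show ?case using d by (auto simp: differentiable_def)
qed

lemma Ck_on_inverse:
  fixes f :: "'a::euclidean_space \<Rightarrow> real"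
  assumes "open S" "\<And>x. x \<in> S \<Longrightarrow> f x \<noteq> 0"
  shows "Ck_on k S f \<Longrightarrow> Ck_on k S (\<lambda>x. inverse (f x))"
proof (induction k)
  case 0
  then show ?case using assms by (auto intro: continuous_on_inverse)
next
  case (Suc k)
  have d: "((\<lambda>x. inverse (f x)) has_derivative (\<lambda>v. - (inverse (f x) * fd f x v * inverse (f x)))) (at x)"
    if "x \<in> S" for x
    using Suc.prems that assms by (intro Deriv.has_derivative_inverse fd_works) simp_all
  have "Ck_on k S (\<lambda>x. fd (\<lambda>x. inverse (f x)) x v)" for v
  proof (subst Ck_on_cong[OF assms(1)])
    show "fd (\<lambda>x. inverse (f x)) x v = - (inverse (f x) * fd f x v * inverse (f x))" if "x \<in> S" for x
      using d[OF that] fd_eq by metis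
    have i: "Ck_on k S (\<lambda>x. inverse (f x))" using Suc Ck_on_Suc_imp by blast
    show "Ck_on k S (\<lambda>x. - (inverse (f x) * fd f x v * inverse (f x)))"
      using Suc.prems
      by (intro Ck_on_linear_compose[OF bounded_linear_minus[OF bounded_linear_ident] assms(1)]
         Ck_on_bilinear[OF bounded_bilinear_mult assms(1)] i) simp
  qed
  then show ?case using d by (auto simp: differentiable_def)
qed

lemma Ck_on_componentwise:
  fixes f :: "'a::euclidean_space \<Rightarrow> 'b::euclidean_space"
  assumes "open S" "\<And>b. b \<in> Basis \<Longrightarrow> Ck_on k S (\<lambda>x. f x \<bullet> b)"
  shows "Ck_on k S f"
proof -
  have "Ck_on k S (\<lambda>x. \<Sum>b\<in>Basis. (f x \<bullet> b) *\<^sub>R b)"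
    using assms by (intro Ck_on_sum Ck_on_linear_compose[OF bounded_linear_scaleR_left]) auto
  then show ?thesis by (simp add: euclidean_representation)
qed

lemma Ck_on_prod:
  fixes f :: "'i \<Rightarrow> 'a::euclidean_space \<Rightarrow> real"
  assumes "open S" "\<And>i. i \<in> I \<Longrightarrow> Ck_on k S (f i)"
  shows "Ck_on k S (\<lambda>x. \<Prod>i\<in>I. f i x)"
proof (cases "finite I")
  case True
  then show ?thesis using assms(2)
    by (induction I rule: finite_induct)
       (auto simp: Ck_on_const intro!: Ck_on_bilinear[OF bounded_bilinear_mult] assms(1))
qed (simp add: Ck_on_const)

lemma Ck_on_det:
  fixes m :: "'a::euclidean_space \<Rightarrow> real^'n^'n::finite"
  assumes "open S" "\<And>i j. Ck_on k S (\<lambda>x. m x $ i $ j)"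
  shows "Ck_on k S (\<lambda>x. det (m x))"
  unfolding det_def
  by (intro Ck_on_sum Ck_on_bilinear[OF bounded_bilinear_mult] Ck_on_prod Ck_on_const assms)

text \<open>By Cramer's rule each component of \<open>inv (L x) v\<close> is a quotient of
  determinants in the entries of \<open>L x\<close> and \<open>v\<close>, and the denominator is
  nonzero because \<open>L x\<close> is bijective.\<close>

lemma Ck_on_inverse_linear:
  fixes L :: "'a::euclidean_space \<Rightarrow> real^'n::finite \<Rightarrow> real^'n"
  assumes S: "open S" and lin: "\<And>x. x \<in> S \<Longrightarrow> linear (L x)"
    and bij: "\<And>x. x \<in> S \<Longrightarrow> bij (L x)" and C: "\<And>v. Ck_on k S (\<lambda>x. L x v)"
  shows "Ck_on k S (\<lambda>x. inv (L x) v)"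
proof -
  have det: "det (matrix (L x)) \<noteq> 0" if "x \<in> S" for x
    using det_nz_iff_inj[OF lin[OF that]] bij[OF that] by (simp add: bij_is_inj)
  let ?c = "\<lambda>x. (\<chi> k. det(\<chi> i j. if j = k then v $ i else matrix (L x) $ i $ j) / det (matrix (L x)))"
  have eq: "inv (L x) v = ?c x" if "x \<in> S" for x
  proof -
    have "matrix (L x) *v inv (L x) v = v"
      using bij[OF that] lin[OF that] by (simp add: matrix_works bij_inv_eq_iff[symmetric] bij_is_surj surj_f_inv_f)
    then show ?thesis using cramer[OF det[OF that]] by blast
  qed
  have ent: "Ck_on k S (\<lambda>x. matrix (L x) $ i $ j)" for i j
    unfolding matrix_def using Ck_on_linear_compose[OF bounded_linear_vec_nth S C] by simp
  have "Ck_on k S ?c"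
  proof (rule Ck_on_componentwise[OF S])
    fix b :: "real^'n" assume "b \<in> Basis"
    then obtain k' where b: "b = axis k' 1" by (auto simp: Basis_vec_def)
    have "Ck_on k S (\<lambda>x. det(\<chi> i j. if j = k' then v $ i else matrix (L x) $ i $ j) * inverse (det (matrix (L x))))"
    proof (intro Ck_on_bilinear[OF bounded_bilinear_mult S] Ck_on_inverse S Ck_on_det det ent)
      show "Ck_on k S (\<lambda>x. (\<chi> i j. if j = k' then v $ i else matrix (L x) $ i $ j) $ i $ j)" for i j
        by (cases "j = k'") (simp_all add: Ck_on_const ent)
    qed
    then show "Ck_on k S (\<lambda>x. ?c x \<bullet> b)" by (simp add: b inner_axis divide_inverse)
  qed
  then show ?thesis using eq Ck_on_cong[OF S, of "\<lambda>x. inv (L x) v" ?c] by simp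
qed

lemma smooth_onD: "smooth_on S f \<Longrightarrow> Ck_on k S f" by (simp add: smooth_on_def)

lemma smooth_on_const: "smooth_on S (\<lambda>x. c)"
  by (simp add: smooth_on_def Ck_on_const)

lemma smooth_on_linear: "bounded_linear L \<Longrightarrow> smooth_on S L"
  by (simp add: smooth_on_def Ck_on_linear)

lemma smooth_on_linear_compose:
  "bounded_linear L \<Longrightarrow> open S \<Longrightarrow> smooth_on S f \<Longrightarrow> smooth_on S (\<lambda>x. L (f x))"
  by (simp add: smooth_on_def Ck_on_linear_compose)

lemma smooth_on_add: "open S \<Longrightarrow> smooth_on S f \<Longrightarrow> smooth_on S g \<Longrightarrow> smooth_on S (\<lambda>x. f x + g x)"
  by (simp add: smooth_on_def Ck_on_add)

lemma smooth_on_compose: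
  fixes f :: "'b::euclidean_space \<Rightarrow> 'c::real_normed_vector" and g :: "'a::euclidean_space \<Rightarrow> 'b"
  shows "open S \<Longrightarrow> open T \<Longrightarrow> g ` S \<subseteq> T \<Longrightarrow> smooth_on S g \<Longrightarrow> smooth_on T f \<Longrightarrow> smooth_on S (\<lambda>x. f (g x))"
  by (simp add: smooth_on_def Ck_on_compose)

text \<open>Bootstrapping: the local inverse satisfies \<open>fd g y = inv (fd f (g y))\<close>, so
  if \<open>g\<close> is C^k then so is its derivative, by composition and
  \<open>Ck_on_inverse_linear\<close>.\<close>

theorem smooth_inverse_function:
  fixes f :: "real^'n::finite \<Rightarrow> real^'n"
  assumes "open S" "smooth_on S f" "x0 \<in> S" "inj (fd f x0)"
  obtains U V g where "open U" "U \<subseteq> S" "x0 \<in> U" "open V" "f x0 \<in> V" "homeomorphism U V f g"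
    "smooth_on V g" "\<And>y. y \<in> V \<Longrightarrow> bij (fd f (g y)) \<and> (g has_derivative inv (fd f (g y))) (at y)"
proof -
  have lin: "bounded_linear (fd f x)" if "x \<in> S" for x
    using smooth_on_has_derivative[OF assms(2) that] has_derivative_bounded_linear by blast
  define f' where "f' x = (if x \<in> S then Blinfun (fd f x) else 0)" for x
  have f': "blinfun_apply (f' x) = fd f x" if "x \<in> S" for x
    using that lin by (simp add: f'_def bounded_linear_Blinfun_apply)
  have derf: "(f has_derivative blinfun_apply (f' x)) (at x)" if "x \<in> S" for x
    using that smooth_on_has_derivative[OF assms(2)] f' by simp
  have cf: "continuous_on S f'"
  proof (rule continuous_on_blinfun_componentwise)
    fix i :: "real^'n"
    have "continuous_on S (\<lambda>x. fd f x i)"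
      using smooth_on_continuous[OF smooth_on_fd[OF assms(2)]] .
    then show "continuous_on S (\<lambda>x. blinfun_apply (f' x) i)"
      using f' by (simp cong: continuous_on_cong)
  qed
  obtain g0 where g0: "linear g0" "g0 \<circ> fd f x0 = id"
    using linear_injective_left_inverse[OF bounded_linear.linear[OF lin[OF assms(3)]] assms(4)] by blast
  have inv: "Blinfun g0 o\<^sub>L f' x0 = id_blinfun"
    using g0 f'[OF assms(3)] by (intro blinfun_eqI)
      (simp add: bounded_linear_Blinfun_apply linear_conv_bounded_linear pointfree_idE)
  obtain U V g g' where *: "open U" "U \<subseteq> S" "x0 \<in> U" "open V" "f x0 \<in> V" "homeomorphism U V f g"
    "\<And>y. y \<in> V \<Longrightarrow> (g has_derivative (g' y)) (at y)"
    "\<And>y. y \<in> V \<Longrightarrow> g' y = inv (blinfun_apply (f'(g y)))"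
    "\<And>y. y \<in> V \<Longrightarrow> bij (blinfun_apply (f'(g y)))"
    using inverse_function_theorem[OF assms(1) derf cf assms(3) inv] by metis
  have gS: "g y \<in> U" "g y \<in> S" if "y \<in> V" for y
    using *(6) that *(2) unfolding homeomorphism_def by auto
  have dg: "bij (fd f (g y)) \<and> (g has_derivative inv (fd f (g y))) (at y)" if "y \<in> V" for y
    using *(7-9)[OF that] f'[OF gS(2)[OF that]] by simp
  have "Ck_on k V g" for k
  proof (induction k)
    case 0
    then show ?case using *(6) by (simp add: homeomorphism_def)
  next
    case (Suc k)
    have "Ck_on k V (\<lambda>y. fd g y v)" for v
    proof (subst Ck_on_cong[OF *(4)])
      show "fd g y v = inv (fd f (g y)) v" if "y \<in> V" for y using dg[OF that] fd_eq by metis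
      show "Ck_on k V (\<lambda>y. inv (fd f (g y)) v)"
      proof (rule Ck_on_inverse_linear[OF *(4)])
        show "linear (fd f (g y))" if "y \<in> V" for y
          using gS[OF that] lin bounded_linear.linear by blast
        show "Ck_on k V (\<lambda>y. fd f (g y) v)" for v
          by (rule Ck_on_compose[OF *(4) assms(1) _ Suc smooth_onD[OF smooth_on_fd[OF assms(2)]]])
             (use gS in auto)
      qed (use dg in auto)
    qed
    then show ?case using dg by (auto simp: differentiable_def)
  qed
  then have "smooth_on V g" by (simp add: smooth_on_def)
  then show thesis using that * dg by blast
qed

text \<open>The inverse function theorem is applied to \<open>L \<circ> f\<close>, where \<open>L\<close> is a linear left inverse of
  the derivative of \<open>f\<close> at \<open>u0\<close>.\<close>

lemma immersion_left_inverse: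
  fixes f :: "real^'n::finite \<Rightarrow> 'm::euclidean_space"
  assumes "open S" "smooth_on S f" "u0 \<in> S" "inj (fd f u0)"
  obtains U V r where "open U" "U \<subseteq> S" "u0 \<in> U" "open V" "f ` U \<subseteq> V" "smooth_on V r"
    "r ` V \<subseteq> U" "\<And>u. u \<in> U \<Longrightarrow> r (f u) = u"
proof -
  have der: "(f has_derivative fd f u0) (at u0)" using smooth_on_has_derivative assms by blast
  obtain L where L: "linear L" "L \<circ> fd f u0 = id"
    using linear_injective_left_inverse[OF has_derivative_linear[OF der] assms(4)] by blast
  have bl: "bounded_linear L" using L linear_conv_bounded_linear by blast
  have "((\<lambda>u. L (f u)) has_derivative (\<lambda>v. L (fd f u0 v))) (at u0)"
    by (rule bounded_linear.has_derivative[OF bl der])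
  then have "fd (\<lambda>u. L (f u)) u0 = id" using L(2) fd_eq by (metis comp_def eq_id_iff id_apply)
  then have inj: "inj (fd (\<lambda>u. L (f u)) u0)" by simp
  obtain U V g where *: "open U" "U \<subseteq> S" "u0 \<in> U" "open V" "homeomorphism U V (\<lambda>u. L (f u)) g"
    "smooth_on V g"
    using smooth_inverse_function[OF assms(1) smooth_on_linear_compose[OF bl assms(1,2)] assms(3) inj] by metis
  show thesis
  proof
    show "open (L -` V)" using *(4) bl continuous_open_vimage linear_continuous_at by blast
    show "f ` U \<subseteq> L -` V" using *(5) by (auto simp: homeomorphism_def)
    show "smooth_on (L -` V) (\<lambda>x. g (L x))"
      by (rule smooth_on_compose[OF \<open>open (L -` V)\<close> *(4)]) (auto simp: * smooth_on_linear[OF bl])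
    show "(\<lambda>x. g (L x)) ` (L -` V) \<subseteq> U" using *(5) by (auto simp: homeomorphism_def)
    show "g (L (f u)) = u" if "u \<in> U" for u using *(5) that by (auto simp: homeomorphism_def)
  qed (use * in auto)
qed

text \<open>Near each point \<open>g\<close> is \<open>r\<close> after \<open>f\<close> after
  \<open>g\<close>, with \<open>r\<close> a smooth left inverse of \<open>f\<close>; continuity of
  \<open>g\<close> keeps its values in the neighbourhood where \<open>r\<close> inverts
  \<open>f\<close>.\<close>

lemma smooth_on_lift_immersion:
  fixes f :: "real^'n::finite \<Rightarrow> 'm::euclidean_space" and g :: "'a::euclidean_space \<Rightarrow> real^'n"
  assumes "open E" "smooth_on E f" "\<And>u. u \<in> E \<Longrightarrow> inj (fd f u)"
    and "open S" "g ` S \<subseteq> E" "continuous_on S g" "smooth_on S (\<lambda>x. f (g x))"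
  shows "smooth_on S g"
proof (rule smooth_on_local)
  fix x assume x: "x \<in> S"
  then have gx: "g x \<in> E" using assms by auto
  obtain U V r where *: "open U" "U \<subseteq> E" "g x \<in> U" "open V" "f ` U \<subseteq> V" "smooth_on V r"
    "\<And>u. u \<in> U \<Longrightarrow> r (f u) = u"
    using immersion_left_inverse[OF assms(1,2) gx assms(3)[OF gx]] by metis
  define T where "T = S \<inter> g -` U"
  have T: "open T" "x \<in> T" "T \<subseteq> S"
    using continuous_open_preimage[OF assms(6,4) *(1)] x * by (auto simp: T_def)
  have "smooth_on T (\<lambda>x. r (f (g x)))"
    by (rule smooth_on_compose[OF T(1) *(4) _ smooth_on_subset[OF assms(7) T(3)] *(6)])
      (use *(5) in \<open>auto simp: T_def\<close>)
  then have "smooth_on T g"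
    by (subst smooth_on_cong[OF T(1), of g "\<lambda>x. r (f (g x))"]) (auto simp: T_def *)
  then show "\<exists>T. open T \<and> x \<in> T \<and> smooth_on T g" using T by blast
qed

text \<open>Schwarz: the second difference of \<open>g\<close> over a square of side \<open>t\<close> equals \<open>t\<^sup>2\<close> times a value of
  \<open>g\<^sub>s\<^sub>t\<close> and also of \<open>g\<^sub>t\<^sub>s\<close>, by applying the mean value theorem twice.\<close>

lemma second_difference_mvt:
  fixes f :: "'a::euclidean_space \<Rightarrow> real"
  assumes B: "\<And>s t. 0 \<le> s \<Longrightarrow> s \<le> h \<Longrightarrow> 0 \<le> t \<Longrightarrow> t \<le> h \<Longrightarrow> x + s *\<^sub>R v + t *\<^sub>R w \<in> S"
    and f: "\<And>y. y \<in> S \<Longrightarrow> f differentiable (at y)"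
    and f': "\<And>y. y \<in> S \<Longrightarrow> (\<lambda>z. fd f z v) differentiable (at y)" and h: "0 < h"
  obtains s t where "0 < s" "s < h" "0 < t" "t < h"
    "f (x + h *\<^sub>R v + h *\<^sub>R w) - f (x + h *\<^sub>R v) - f (x + h *\<^sub>R w) + f x
       = h * h * fd (\<lambda>z. fd f z v) (x + s *\<^sub>R v + t *\<^sub>R w) w"
proof -
  define q where "q s = f (x + s *\<^sub>R v + h *\<^sub>R w) - f (x + s *\<^sub>R v)" for s
  have dq: "(q has_real_derivative (fd f (x + s *\<^sub>R v + h *\<^sub>R w) v - fd f (x + s *\<^sub>R v) v)) (at s)"
    if "0 \<le> s" "s \<le> h" for s
  proof -
    have D: "((\<lambda>s. f (x + s *\<^sub>R v + c)) has_derivative (\<lambda>r. fd f (x + s *\<^sub>R v + c) (r *\<^sub>R v))) (at s)"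
      if "x + s *\<^sub>R v + c \<in> S" for c
      by (rule has_derivative_compose[of "\<lambda>s. x + s *\<^sub>R v + c" "\<lambda>r. r *\<^sub>R v" s UNIV, OF _ fd_works[OF f[OF that]]])
         (auto intro!: derivative_eq_intros)
    have l: "fd f y (r *\<^sub>R v) = r * fd f y v" if "y \<in> S" for y r
      using linear_scale[OF linear_frechet_derivative[OF f[OF that]]] by simp
    have "x + s *\<^sub>R v + h *\<^sub>R w \<in> S" "x + s *\<^sub>R v \<in> S" using B[of s h] B[of s 0] that h by auto
    then have "(q has_derivative (\<lambda>r. r * (fd f (x + s *\<^sub>R v + h *\<^sub>R w) v - fd f (x + s *\<^sub>R v) v))) (at s)"
      unfolding q_def
      using has_derivative_diff[OF D[of "h *\<^sub>R w"] D[of 0]] by (simp add: l right_diff_distrib)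
    then show ?thesis by (simp add: has_field_derivative_def mult.commute[of _ "_ - _"])
  qed
  obtain s where s: "0 < s" "s < h"
    "q h - q 0 = (h - 0) * (fd f (x + s *\<^sub>R v + h *\<^sub>R w) v - fd f (x + s *\<^sub>R v) v)"
    using MVT2[OF h, of q "\<lambda>s. fd f (x + s *\<^sub>R v + h *\<^sub>R w) v - fd f (x + s *\<^sub>R v) v"] dq by metis
  define p where "p t = fd f (x + s *\<^sub>R v + t *\<^sub>R w) v" for t
  have dp: "(p has_real_derivative fd (\<lambda>z. fd f z v) (x + s *\<^sub>R v + t *\<^sub>R w) w) (at t)"
    if "0 \<le> t" "t \<le> h" for t
  proof -
    have y: "x + s *\<^sub>R v + t *\<^sub>R w \<in> S" using B s that by simp
    have "(p has_derivative (\<lambda>r. fd (\<lambda>z. fd f z v) (x + s *\<^sub>R v + t *\<^sub>R w) (r *\<^sub>R w))) (at t)"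
      unfolding p_def
      by (rule has_derivative_compose[of "\<lambda>t. x + s *\<^sub>R v + t *\<^sub>R w" "\<lambda>r. r *\<^sub>R w" t UNIV, OF _ fd_works[OF f'[OF y]]])
         (auto intro!: derivative_eq_intros)
    then show ?thesis
      using linear_scale[OF linear_frechet_derivative[OF f'[OF y]]]
      by (simp add: has_field_derivative_def mult.commute[of _ "fd _ _ _"])
  qed
  obtain t where t: "0 < t" "t < h" "p h - p 0 = (h - 0) * fd (\<lambda>z. fd f z v) (x + s *\<^sub>R v + t *\<^sub>R w) w"
    using MVT2[OF h, of p "\<lambda>t. fd (\<lambda>z. fd f z v) (x + s *\<^sub>R v + t *\<^sub>R w) w"] dp by metis
  show thesis
    by (rule that[OF s(1,2) t(1,2)]) (use s(3) t(3) in \<open>simp add: q_def p_def\<close>)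
qed

lemma fd_commute_real:
  fixes f :: "'a::euclidean_space \<Rightarrow> real"
  assumes "open S" "x \<in> S" "Ck_on 2 S f"
  shows "fd (\<lambda>y. fd f y v) x w = fd (\<lambda>y. fd f y w) x v"
proof (rule ccontr)
  assume ne: "fd (\<lambda>y. fd f y v) x w \<noteq> fd (\<lambda>y. fd f y w) x v"
  \<comment> \<open>Half the gap: two numbers within \<open>e\<close> of the two sides cannot
    coincide, yet both second differences are the same.\<close>
  define e where "e = \<bar>fd (\<lambda>y. fd f y v) x w - fd (\<lambda>y. fd f y w) x v\<bar> / 2"
  have e: "e > 0" using ne by (simp add: e_def)
  have C: "Ck_on (Suc (Suc 0)) S f" using assms(3) by (simp add: numeral_2_eq_2)
  have d: "f differentiable (at y)" "(\<lambda>z. fd f z u) differentiable (at y)" if "y \<in> S" for y u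
    using C that by auto
  have cont: "continuous (at x) (\<lambda>y. fd (\<lambda>z. fd f z u) y u')" for u u'
    using C assms by (auto simp: continuous_on_eq_continuous_at)
  obtain d1 where d1: "d1 > 0" "\<And>y. dist y x < d1 \<Longrightarrow> dist (fd (\<lambda>z. fd f z v) y w) (fd (\<lambda>z. fd f z v) x w) < e"
    using cont[of v w] e unfolding continuous_at_eps_delta by blast
  obtain d2 where d2: "d2 > 0" "\<And>y. dist y x < d2 \<Longrightarrow> dist (fd (\<lambda>z. fd f z w) y v) (fd (\<lambda>z. fd f z w) x v) < e"
    using cont[of w v] e unfolding continuous_at_eps_delta by blast
  obtain d3 where d3: "d3 > 0" "ball x d3 \<subseteq> S" using assms openE by blast
  define r where "r = min d1 (min d2 d3)"
  \<comment> \<open>With \<open>h = r / (2 * X)\<close> the whole square stays within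
    \<open>r / 2\<close> of \<open>x\<close>; the summand \<open>1\<close> keeps \<open>X\<close>
    positive when \<open>v\<close> and \<open>w\<close> are zero.\<close>
  define X where "X = norm v + norm w + 1"
  have X: "X > 0" by (simp add: X_def add_nonneg_pos)
  define h where "h = r / (2 * X)"
  have r: "r > 0" using d1 d2 d3 by (simp add: r_def)
  have h: "h > 0" using r X by (simp add: h_def)
  have bd: "dist (x + s *\<^sub>R v + t *\<^sub>R w) x < r" if "0 \<le> s" "s \<le> h" "0 \<le> t" "t \<le> h" for s t
  proof -
    have "norm (s *\<^sub>R v + t *\<^sub>R w) \<le> s * norm v + t * norm w"
      using that by (metis abs_of_nonneg norm_scaleR norm_triangle_ineq)
    also have "\<dots> \<le> h * norm v + h * norm w"
      using that by (intro add_mono mult_right_mono) auto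
    also have "\<dots> \<le> h * X" using h by (simp add: X_def distrib_left)
    also have "\<dots> = r / 2" using X by (simp add: h_def)
    also have "\<dots> < r" using r by simp
    finally show ?thesis by (simp add: dist_norm add.assoc)
  qed
  have S: "x + s *\<^sub>R v + t *\<^sub>R w \<in> S" if "0 \<le> s" "s \<le> h" "0 \<le> t" "t \<le> h" for s t
    using bd[OF that] d3(2) by (auto simp: r_def dist_commute subset_iff)
  have S': "x + s *\<^sub>R w + t *\<^sub>R v \<in> S" if "0 \<le> s" "s \<le> h" "0 \<le> t" "t \<le> h" for s t
    using S[OF that(3,4,1,2)] by (simp add: add.assoc add.commute[of "s *\<^sub>R w"])
  obtain s t where st: "0 < s" "s < h" "0 < t" "t < h"
    "f (x + h *\<^sub>R v + h *\<^sub>R w) - f (x + h *\<^sub>R v) - f (x + h *\<^sub>R w) + f x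
       = h * h * fd (\<lambda>z. fd f z v) (x + s *\<^sub>R v + t *\<^sub>R w) w"
    by (rule second_difference_mvt[OF S d h]) auto
  obtain s' t' where st': "0 < s'" "s' < h" "0 < t'" "t' < h"
    "f (x + h *\<^sub>R w + h *\<^sub>R v) - f (x + h *\<^sub>R w) - f (x + h *\<^sub>R v) + f x
       = h * h * fd (\<lambda>z. fd f z w) (x + s' *\<^sub>R w + t' *\<^sub>R v) v"
    by (rule second_difference_mvt[OF S' d h]) auto
  have sw: "x + h *\<^sub>R w + h *\<^sub>R v = x + h *\<^sub>R v + h *\<^sub>R w" by simp
  have "h * h * fd (\<lambda>z. fd f z w) (x + s' *\<^sub>R w + t' *\<^sub>R v) v = h * h * fd (\<lambda>z. fd f z v) (x + s *\<^sub>R v + t *\<^sub>R w) w"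
    using st(5) st'(5)[unfolded sw] by linarith
  then have eq: "fd (\<lambda>z. fd f z w) (x + s' *\<^sub>R w + t' *\<^sub>R v) v = fd (\<lambda>z. fd f z v) (x + s *\<^sub>R v + t *\<^sub>R w) w"
    using h by simp
  have "dist (x + s *\<^sub>R v + t *\<^sub>R w) x < r" "dist (x + t' *\<^sub>R v + s' *\<^sub>R w) x < r"
    using bd[of s t] bd[of t' s'] st st' by auto
  moreover have "x + t' *\<^sub>R v + s' *\<^sub>R w = x + s' *\<^sub>R w + t' *\<^sub>R v" by simp
  ultimately have "dist (fd (\<lambda>z. fd f z v) (x + s *\<^sub>R v + t *\<^sub>R w) w) (fd (\<lambda>z. fd f z v) x w) < e"
    "dist (fd (\<lambda>z. fd f z w) (x + s' *\<^sub>R w + t' *\<^sub>R v) v) (fd (\<lambda>z. fd f z w) x v) < e"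
    using d1(2) d2(2) by (auto simp: r_def)
  then show False using eq unfolding e_def dist_real_def by argo
qed

lemma fd_inner:
  assumes "f differentiable (at x)"
  shows "fd (\<lambda>y. f y \<bullet> b) x v = fd f x v \<bullet> b"
  using fd_eq[OF bounded_linear.has_derivative[OF bounded_linear_inner_left fd_works[OF assms]]] by metis

lemma fd_commute:
  fixes f :: "'a::euclidean_space \<Rightarrow> 'b::euclidean_space"
  assumes "open S" "x \<in> S" "Ck_on 2 S f"
  shows "fd (\<lambda>y. fd f y v) x w = fd (\<lambda>y. fd f y w) x v"
proof (rule euclidean_eqI)
  fix b :: 'b
  have C: "Ck_on (Suc (Suc 0)) S f" using assms(3) by (simp add: numeral_2_eq_2)
  have d: "f differentiable (at y)" "(\<lambda>z. fd f z u) differentiable (at y)" if "y \<in> S" for y u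
    using C that by auto
  have eq: "fd (\<lambda>y. fd f y u) x u' \<bullet> b = fd (\<lambda>y. fd (\<lambda>z. f z \<bullet> b) y u) x u'" for u u'
  proof -
    have "fd (\<lambda>y. fd f y u) x u' \<bullet> b = fd (\<lambda>y. fd f y u \<bullet> b) x u'"
      using fd_inner[OF d(2)[OF assms(2)]] by metis
    also have "fd (\<lambda>y. fd f y u \<bullet> b) x = fd (\<lambda>y. fd (\<lambda>z. f z \<bullet> b) y u) x"
      by (rule fd_cong[OF assms(1,2)]) (metis d(1) fd_inner)
    finally show ?thesis .
  qed
  show "fd (\<lambda>y. fd f y v) x w \<bullet> b = fd (\<lambda>y. fd f y w) x v \<bullet> b"
    unfolding eq
    by (rule fd_commute_real[OF assms(1,2) Ck_on_linear_compose[OF bounded_linear_inner_left assms(1,3)]])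
qed

section \<open>Frames and changes of parametrization\<close>

abbreviation ax :: "'n::finite \<Rightarrow> real^'n" where "ax i \<equiv> axis i 1"

lemma sum_ax: "(\<Sum>i\<in>UNIV. (x $ i) *\<^sub>R ax i) = (x :: real^'n::finite)"
  by (simp add: vec_eq_iff axis_def if_distrib[of "\<lambda>x. _ * x"] cong: if_cong)

lemma linear_ax:
  assumes "linear L" shows "L v = (\<Sum>i\<in>UNIV. (v $ i) *\<^sub>R L (ax i))"
  by (subst sum_ax[of v, symmetric]) (simp add: linear_sum[OF assms] linear_scale[OF assms])

definition immersion_on :: "(real^'n::finite) set \<Rightarrow> (real^'n \<Rightarrow> real^'m::finite) \<Rightarrow> bool" where
  "immersion_on D f \<longleftrightarrow> open D \<and> smooth_on D f \<and> (\<forall>u\<in>D. inj (fd f u))"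

lemma immersion_onD:
  assumes "immersion_on D f"
  shows "open D" "smooth_on D f" "u \<in> D \<Longrightarrow> inj (fd f u)" "u \<in> D \<Longrightarrow> linear (fd f u)"
    "u \<in> D \<Longrightarrow> (f has_derivative fd f u) (at u)"
    "u \<in> D \<Longrightarrow> (\<lambda>x. fd f x w) differentiable (at u)"
    "u \<in> D \<Longrightarrow> ((\<lambda>x. fd f x w) has_derivative fd (\<lambda>x. fd f x w) u) (at u)"
  using assms smooth_on_has_derivative[of D f u] smooth_on_has_derivative[OF smooth_on_fd[of D f w], of u]
  unfolding immersion_on_def
  by (auto intro: linear_frechet_derivative smooth_on_differentiable smooth_on_fd)

text \<open>The tangent space is a hyperplane, so the definite description is the projection to the
  line of \<open>N\<close>. This is the form in which \<open>normal_part\<close> is evaluated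
  later.\<close>

lemma normal_part_eq:
  assumes "tangent_space f u = {w. w \<bullet> N = 0}" "norm N = 1"
  shows "normal_part f u x = (x \<bullet> N) *\<^sub>R N"
  unfolding normal_part_def
proof (rule the_equality)
  have NN: "N \<bullet> N = 1" using assms(2) by (simp add: norm_eq_1)
  show "(x \<bullet> N) *\<^sub>R N \<in> (tangent_space f u)\<^sup>\<bottom> \<and> x - (x \<bullet> N) *\<^sub>R N \<in> tangent_space f u"
    using NN by (auto simp: orthogonal_comp_def orthogonal_def assms inner_diff_left inner_diff_right inner_commute)
  fix y assume y: "y \<in> (tangent_space f u)\<^sup>\<bottom> \<and> x - y \<in> tangent_space f u"
  have xy: "y \<bullet> N = x \<bullet> N" using y by (simp add: assms inner_diff_left)
  have "y - (y \<bullet> N) *\<^sub>R N \<in> tangent_space f u" using NN by (simp add: assms inner_diff_left)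
  then have "(y - (y \<bullet> N) *\<^sub>R N) \<bullet> y = 0"
    using y by (auto simp: orthogonal_comp_def orthogonal_def)
  moreover have "(y - (y \<bullet> N) *\<^sub>R N) \<bullet> N = 0" using NN by (simp add: inner_diff_left)
  ultimately have "(y - (y \<bullet> N) *\<^sub>R N) \<bullet> (y - (y \<bullet> N) *\<^sub>R N) = 0"
    by (metis inner_diff_right inner_scaleR_right mult_zero_right diff_zero)
  then show "y = (x \<bullet> N) *\<^sub>R N" using xy by simp
qed

lemma unit_normal_exists:
  fixes f :: "real^'n::finite \<Rightarrow> real^'m::finite"
  assumes "linear (fd f u)" "inj (fd f u)" "CARD('m) = CARD('n) + 1"
  obtains N where "norm N = 1" "tangent_space f u = {w. w \<bullet> N = 0}"
proof -
  have s: "subspace (tangent_space f u)"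
    unfolding tangent_space_def using assms(1) linear_subspace_image subspace_UNIV by blast
  have d: "dim (tangent_space f u) = CARD('n)"
    unfolding tangent_space_def using dim_image_eq[OF assms(1), of UNIV] assms(2) by simp
  have "dim (tangent_space f u) < DIM(real^'m)" using d assms(3) by simp
  then obtain x where x: "x \<noteq> 0" "\<And>y. y \<in> span (tangent_space f u) \<Longrightarrow> orthogonal x y"
    using orthogonal_to_subspace_exists by blast
  define N where "N = x /\<^sub>R norm x"
  have N: "norm N = 1" using x by (simp add: N_def)
  have "tangent_space f u \<subseteq> {w. w \<bullet> N = 0}"
    using x(2) by (auto simp: N_def orthogonal_def inner_commute span_base)
  moreover have "dim {w. w \<bullet> N = 0} = CARD('m) - 1"
    using dim_hyperplane[of N] N by (simp add: inner_commute flip: zero_less_norm_iff)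
  ultimately have "tangent_space f u = {w. w \<bullet> N = 0}"
    using d assms(3) s by (intro subspace_dim_equal subspace_hyperplane2) auto
  then show thesis using N that by blast
qed

text \<open>The vector \<open>w\<close> is extended by constant coordinates, so linearity in
  \<open>w\<close> is that of \<open>fd f x\<close>, differentiated in \<open>x\<close>. Bilinearity
  is what allows traces to be taken over an arbitrary frame.\<close>

lemma second_ff_bilinear:
  fixes f :: "real^'n::finite \<Rightarrow> real^'m::finite"
  assumes "immersion_on D f" "u \<in> D" "CARD('m) = CARD('n) + 1"
  shows "bilinear (second_ff f u)"
proof -
  note I = immersion_onD[OF assms(1)]
  obtain N where N: "norm N = 1" "tangent_space f u = {w. w \<bullet> N = 0}"
    using unit_normal_exists[OF I(4,3)] assms by blast
  have eq: "second_ff f u v w = (fd (\<lambda>x. fd f x w) u v \<bullet> N) *\<^sub>R N" for v w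
    unfolding second_ff_def normal_part_eq[OF N(2,1)] ..
  have lin: "linear (fd (\<lambda>x. fd f x w) u)" for w
    using I(6)[OF assms(2)] linear_frechet_derivative by blast
  have add: "fd (\<lambda>x. fd f x (a + b)) u = (\<lambda>v. fd (\<lambda>x. fd f x a) u v + fd (\<lambda>x. fd f x b) u v)" for a b
  proof -
    have "fd (\<lambda>x. fd f x (a + b)) u = fd (\<lambda>x. fd f x a + fd f x b) u"
      by (rule fd_cong[OF I(1) assms(2)]) (simp add: linear_add[OF I(4)])
    also have "\<dots> = (\<lambda>v. fd (\<lambda>x. fd f x a) u v + fd (\<lambda>x. fd f x b) u v)"
      by (intro fd_eq has_derivative_add I(7) assms)
    finally show ?thesis .
  qed
  have scale: "fd (\<lambda>x. fd f x (c *\<^sub>R a)) u = (\<lambda>v. c *\<^sub>R fd (\<lambda>x. fd f x a) u v)" for c a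
  proof -
    have "fd (\<lambda>x. fd f x (c *\<^sub>R a)) u = fd (\<lambda>x. c *\<^sub>R fd f x a) u"
      by (rule fd_cong[OF I(1) assms(2)]) (simp add: linear_scale[OF I(4)])
    also have "\<dots> = (\<lambda>v. c *\<^sub>R fd (\<lambda>x. fd f x a) u v)"
      by (intro fd_eq has_derivative_scaleR_right I(7) assms)
    finally show ?thesis .
  qed
  show ?thesis
    unfolding bilinear_def eq
    by (auto intro!: linearI simp: add scale linear_add[OF lin] linear_scale[OF lin] inner_add_left scaleR_add_left)
qed

lemma bilinear_ax:
  assumes "bilinear B"
  shows "B v w = (\<Sum>i\<in>UNIV. \<Sum>j\<in>UNIV. (v $ i * w $ j) *\<^sub>R B (ax i) (ax j))"
proof -
  have "B v w = (\<Sum>i\<in>UNIV. (v $ i) *\<^sub>R B (ax i) w)"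
    using linear_ax[of "\<lambda>v. B v w" v] assms by (simp add: bilinear_def)
  also have "\<dots> = (\<Sum>i\<in>UNIV. (v $ i) *\<^sub>R (\<Sum>j\<in>UNIV. (w $ j) *\<^sub>R B (ax i) (ax j)))"
    using linear_ax[of "B _" w] assms by (simp add: bilinear_def)
  finally show ?thesis by (simp add: scaleR_sum_right)
qed

text \<open>If \<open>E\<close> maps the standard basis to a \<open>g\<close>-orthonormal frame, then \<open>g\<^sup>-\<^sup>1 = E E\<^sup>T\<close>. This turns the
  traces in the definitions of the curvatures into sums over the frame, and thereby makes them
  independent of the parametrization.\<close>

definition orthonormal_frame :: "(real^'n::finite \<Rightarrow> real^'m::finite) \<Rightarrow> real^'n \<Rightarrow> (real^'n \<Rightarrow> real^'n) \<Rightarrow> bool" where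
  "orthonormal_frame f u E \<longleftrightarrow> linear E \<and> (\<forall>v w. fd f u (E v) \<bullet> fd f u (E w) = v \<bullet> w)"

lemma matrix_inv_eq:
  fixes A :: "real^'n^'n::finite"
  assumes "A ** B = mat 1"
  shows "matrix_inv A = B"
proof -
  have BA: "B ** A = mat 1" using assms matrix_left_right_inverse by blast
  have "A ** matrix_inv A = mat 1 \<and> matrix_inv A ** A = mat 1"
    unfolding matrix_inv_def by (rule someI[of _ B]) (use assms BA in simp)
  then show ?thesis by (metis BA matrix_mul_assoc matrix_mul_lid matrix_mul_rid)
qed

text \<open>Orthonormality reads \<open>E^T (G E) = 1\<close> for the Gram matrix \<open>G\<close>.
  A left inverse of a square matrix is also a right inverse, so
  \<open>G (E E^T) = 1\<close>.\<close>

lemma inverse_metric_frame: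
  fixes f :: "real^'n::finite \<Rightarrow> real^'m::finite"
  assumes lin: "linear (fd f u)" and E: "orthonormal_frame f u E"
  shows "inverse_metric f u $ i $ j = (\<Sum>a\<in>UNIV. E (ax a) $ i * E (ax a) $ j)"
proof -
  let ?G = "\<chi> i j. induced_metric f u (ax i) (ax j)"
  let ?E = "matrix E"
  have Ecol: "?E $ i $ a = E (ax a) $ i" for i a by (simp add: matrix_def)
  have "(transpose ?E ** (?G ** ?E)) $ a $ b = (mat 1 :: real^'n^'n) $ a $ b" for a b
  proof -
    have b: "bilinear (\<lambda>v w. fd f u v \<bullet> fd f u w)"
      by (auto simp: bilinear_def inner_add_left inner_add_right linear_add[OF lin] linear_scale[OF lin] intro!: linearI)
    have "(transpose ?E ** (?G ** ?E)) $ a $ b =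
      (\<Sum>i\<in>UNIV. \<Sum>j\<in>UNIV. (E (ax a) $ i * E (ax b) $ j) *\<^sub>R (fd f u (ax i) \<bullet> fd f u (ax j)))"
      by (simp add: matrix_matrix_mult_def transpose_def Ecol induced_metric_def sum_distrib_left mult_ac)
    also have "\<dots> = fd f u (E (ax a)) \<bullet> fd f u (E (ax b))" using bilinear_ax[OF b, of "E (ax a)" "E (ax b)"] by simp
    also have "\<dots> = ax a \<bullet> ax b" using E by (simp add: orthonormal_frame_def)
    also have "\<dots> = (mat 1 :: real^'n^'n) $ a $ b" by (auto simp: mat_def inner_axis) (simp_all add: axis_def)
    finally show ?thesis .
  qed
  then have "transpose ?E ** (?G ** ?E) = mat 1" by (simp add: vec_eq_iff)
  then have "(?G ** ?E) ** transpose ?E = mat 1" using matrix_left_right_inverse by blast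
  then have "?G ** (?E ** transpose ?E) = mat 1" by (simp add: matrix_mul_assoc)
  then have "inverse_metric f u = ?E ** transpose ?E"
    unfolding inverse_metric_def by (rule matrix_inv_eq)
  then show ?thesis by (simp add: matrix_matrix_mult_def transpose_def Ecol)
qed

lemma trace_frame:
  fixes f :: "real^'n::finite \<Rightarrow> real^'m::finite"
  assumes "linear (fd f u)" "orthonormal_frame f u E" and B: "bilinear B"
  shows "(\<Sum>i\<in>UNIV. \<Sum>j\<in>UNIV. inverse_metric f u $ i $ j *\<^sub>R B (ax i) (ax j)) = (\<Sum>a\<in>UNIV. B (E (ax a)) (E (ax a)))"
proof -
  have "(\<Sum>i\<in>UNIV. \<Sum>j\<in>UNIV. inverse_metric f u $ i $ j *\<^sub>R B (ax i) (ax j)) =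
    (\<Sum>i\<in>UNIV. \<Sum>j\<in>UNIV. \<Sum>a\<in>UNIV. (E (ax a) $ i * E (ax a) $ j) *\<^sub>R B (ax i) (ax j))"
    by (simp add: inverse_metric_frame[OF assms(1,2)] scaleR_sum_left)
  also have "\<dots> = (\<Sum>i\<in>UNIV. \<Sum>a\<in>UNIV. \<Sum>j\<in>UNIV. (E (ax a) $ i * E (ax a) $ j) *\<^sub>R B (ax i) (ax j))"
    by (intro sum.cong refl sum.swap)
  also have "\<dots> = (\<Sum>a\<in>UNIV. \<Sum>i\<in>UNIV. \<Sum>j\<in>UNIV. (E (ax a) $ i * E (ax a) $ j) *\<^sub>R B (ax i) (ax j))"
    by (rule sum.swap)
  also have "\<dots> = (\<Sum>a\<in>UNIV. B (E (ax a)) (E (ax a)))"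
    by (intro sum.cong refl bilinear_ax[OF B, symmetric])
  finally show ?thesis .
qed

text \<open>A linear isometry \<open>J\<close> of R^n onto the tangent space, pulled back by a left
  inverse \<open>L\<close> of the derivative, takes the place of Gram-Schmidt.\<close>

lemma orthonormal_frame_exists:
  fixes f :: "real^'n::finite \<Rightarrow> real^'m::finite"
  assumes lin: "linear (fd f u)" and inj: "inj (fd f u)"
  obtains E where "orthonormal_frame f u E"
proof -
  have s: "subspace (tangent_space f u)"
    unfolding tangent_space_def using lin linear_subspace_image subspace_UNIV by blast
  have d: "dim (tangent_space f u) = CARD('n)"
    unfolding tangent_space_def using dim_image_eq[OF lin, of UNIV] inj by simp
  obtain J :: "real^'n \<Rightarrow> real^'m" where J: "linear J" "J ` UNIV = tangent_space f u" "\<And>x. norm (J x) = norm x"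
    using isometry_subspaces[of "UNIV :: (real^'n) set", OF subspace_UNIV s] d by auto
  obtain L where L: "linear L" "L \<circ> fd f u = id" using linear_injective_left_inverse[OF lin inj] by blast
  have DE: "fd f u (L (J v)) = J v" for v
  proof -
    have "J v \<in> range (fd f u)" using J(2) by (auto simp: tangent_space_def)
    then obtain x where "J v = fd f u x" by blast
    then show ?thesis using L(2) by (metis comp_apply id_apply)
  qed
  have "J v \<bullet> J w = v \<bullet> w" for v w
    using J(1,3) by (simp add: dot_norm linear_add[symmetric])
  then have "orthonormal_frame f u (L \<circ> J)"
    unfolding orthonormal_frame_def using L J DE by (auto intro: linear_compose)
  then show thesis by (rule that)
qed

lemma mean_curvature_frame:
  fixes f :: "real^'n::finite \<Rightarrow> real^'m::finite"
  assumes "immersion_on D f" "u \<in> D" "CARD('m) = CARD('n) + 1" "orthonormal_frame f u E"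
  shows "mean_curvature_vector f u = (\<Sum>a\<in>UNIV. second_ff f u (E (ax a)) (E (ax a)))"
  unfolding mean_curvature_vector_def
  using trace_frame[OF immersion_onD(4)[OF assms(1,2)] assms(4) second_ff_bilinear[OF assms(1-3)]] .

lemma second_ff_norm_sq_frame:
  fixes f :: "real^'n::finite \<Rightarrow> real^'m::finite"
  assumes "immersion_on D f" "u \<in> D" "CARD('m) = CARD('n) + 1" "orthonormal_frame f u E"
  shows "second_ff_norm_sq f u =
    (\<Sum>a\<in>UNIV. \<Sum>b\<in>UNIV. second_ff f u (E (ax a)) (E (ax b)) \<bullet> second_ff f u (E (ax a)) (E (ax b)))"
proof -
  let ?A = "second_ff f u"
  let ?g = "inverse_metric f u"
  note A = second_ff_bilinear[OF assms(1-3)] and lin = immersion_onD(4)[OF assms(1,2)]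
  have l: "linear (\<lambda>v. ?A v w)" "linear (?A w)" for w using A by (auto simp: bilinear_def)
  have B1: "bilinear (\<lambda>x y. ?A x p \<bullet> ?A y q)" for p q
    by (auto simp: bilinear_def inner_add_left inner_add_right linear_add[OF l(1)] linear_scale[OF l(1)] intro!: linearI)
  have B2: "bilinear (\<lambda>x y. \<Sum>a\<in>UNIV. ?A (E (ax a)) x \<bullet> ?A (E (ax a)) y)"
    by (auto simp: bilinear_def inner_add_left inner_add_right linear_add[OF l(2)] linear_scale[OF l(2)] sum.distrib
        sum_distrib_left intro!: linearI)
  have "second_ff_norm_sq f u = (\<Sum>i\<in>UNIV. \<Sum>j\<in>UNIV. \<Sum>k\<in>UNIV. \<Sum>l\<in>UNIV.
        ?g $ j $ l * (?g $ i $ k * (?A (ax i) (ax j) \<bullet> ?A (ax k) (ax l))))"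
    unfolding second_ff_norm_sq_def by (simp add: mult_ac)
  also have "\<dots> = (\<Sum>j\<in>UNIV. \<Sum>l\<in>UNIV. ?g $ j $ l * (\<Sum>i\<in>UNIV. \<Sum>k\<in>UNIV. ?g $ i $ k * (?A (ax i) (ax j) \<bullet> ?A (ax k) (ax l))))"
  proof -
    have "(\<Sum>i\<in>UNIV. \<Sum>j\<in>UNIV. \<Sum>k\<in>UNIV. \<Sum>l\<in>UNIV. ?g $ j $ l * (?g $ i $ k * (?A (ax i) (ax j) \<bullet> ?A (ax k) (ax l)))) =
      (\<Sum>j\<in>UNIV. \<Sum>i\<in>UNIV. \<Sum>k\<in>UNIV. \<Sum>l\<in>UNIV. ?g $ j $ l * (?g $ i $ k * (?A (ax i) (ax j) \<bullet> ?A (ax k) (ax l))))"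
      by (rule sum.swap)
    also have "\<dots> = (\<Sum>j\<in>UNIV. \<Sum>i\<in>UNIV. \<Sum>l\<in>UNIV. \<Sum>k\<in>UNIV. ?g $ j $ l * (?g $ i $ k * (?A (ax i) (ax j) \<bullet> ?A (ax k) (ax l))))"
      by (intro sum.cong refl sum.swap)
    also have "\<dots> = (\<Sum>j\<in>UNIV. \<Sum>l\<in>UNIV. \<Sum>i\<in>UNIV. \<Sum>k\<in>UNIV. ?g $ j $ l * (?g $ i $ k * (?A (ax i) (ax j) \<bullet> ?A (ax k) (ax l))))"
      by (intro sum.cong refl sum.swap)
    finally show ?thesis by (simp add: sum_distrib_left)
  qed
  also have "\<dots> = (\<Sum>j\<in>UNIV. \<Sum>l\<in>UNIV. ?g $ j $ l * (\<Sum>a\<in>UNIV. ?A (E (ax a)) (ax j) \<bullet> ?A (E (ax a)) (ax l)))"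
    using trace_frame[OF lin assms(4) B1] by simp
  also have "\<dots> = (\<Sum>b\<in>UNIV. \<Sum>a\<in>UNIV. ?A (E (ax a)) (E (ax b)) \<bullet> ?A (E (ax a)) (E (ax b)))"
    using trace_frame[OF lin assms(4) B2] by simp
  finally show ?thesis by (subst sum.swap) simp
qed

section \<open>Independence of the parametrization\<close>

definition reparam :: "(real^'n::finite) set \<Rightarrow> (real^'n \<Rightarrow> real^'n) \<Rightarrow> (real^'n) set \<Rightarrow> bool" where
  "reparam V g D \<longleftrightarrow> open V \<and> smooth_on V g \<and> g ` V \<subseteq> D \<and> (\<forall>y\<in>V. bij (fd g y))"

lemma fd_compose:
  assumes "g differentiable (at y)" "f differentiable (at (g y))"
  shows "fd (\<lambda>x. f (g x)) y = (\<lambda>v. fd f (g y) (fd g y v))"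
  by (intro fd_eq has_derivative_compose[OF fd_works[OF assms(1)] fd_works[OF assms(2)]])

context
  fixes f :: "real^'n::finite \<Rightarrow> real^'m::finite" and D V g
  assumes I: "immersion_on D f" and R: "reparam V g D"
begin

lemma reparam_props:
  assumes "y \<in> V"
  shows "g y \<in> D" "g differentiable (at y)" "f differentiable (at (g y))" "bij (fd g y)" "linear (fd g y)" "open V"
  using R I assms unfolding reparam_def immersion_on_def
  by (auto intro: smooth_on_differentiable linear_frechet_derivative)

lemma fd_reparam: "y \<in> V \<Longrightarrow> fd (f \<circ> g) y = (\<lambda>v. fd f (g y) (fd g y v))"
  unfolding comp_def using fd_compose reparam_props by blast

lemma immersion_reparam: "immersion_on V (f \<circ> g)"
proof -
  have "smooth_on V (f \<circ> g)"
    unfolding comp_def using I R unfolding immersion_on_def reparam_def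
    by (intro smooth_on_compose[of V D g f]) auto
  moreover have "inj (fd (f \<circ> g) y)" if "y \<in> V" for y
    using fd_reparam[OF that] immersion_onD(3)[OF I reparam_props(1)[OF that]] reparam_props(4)[OF that]
    by (auto simp: inj_def bij_def)
  ultimately show ?thesis using R unfolding immersion_on_def reparam_def by blast
qed

lemma tangent_space_reparam: "y \<in> V \<Longrightarrow> tangent_space (f \<circ> g) y = tangent_space f (g y)"
  unfolding tangent_space_def fd_reparam using reparam_props(4)[of y]
  by (metis bij_is_surj image_image)

lemma normal_part_reparam: "y \<in> V \<Longrightarrow> normal_part (f \<circ> g) y = normal_part f (g y)"
  unfolding normal_part_def tangent_space_reparam ..

text \<open>The chain rule gives the second derivative of \<open>f\<close> on
  \<open>fd g y v\<close> and \<open>fd g y w\<close>, plus the first derivative of \<open>f\<close>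
  applied to a second derivative of \<open>g\<close>. The latter is tangent, and the normal part
  removes it.\<close>

lemma second_ff_reparam:
  assumes y: "y \<in> V" and card: "CARD('m) = CARD('n) + 1"
  shows "second_ff (f \<circ> g) y v w = second_ff f (g y) (fd g y v) (fd g y w)"
proof -
  note P = reparam_props[OF y]
  obtain N where N: "norm N = 1" "tangent_space f (g y) = {w. w \<bullet> N = 0}"
    using unit_normal_exists[OF immersion_onD(4,3)[OF I P(1)] card] by blast
  have Vo: "open V" using R by (simp add: reparam_def)
  have "fd (\<lambda>x. fd (f \<circ> g) x w) y = fd (\<lambda>x. \<Sum>i\<in>UNIV. (fd g x w $ i) *\<^sub>R fd f (g x) (ax i)) y"
  proof (rule fd_cong[OF Vo y])
    fix x assume x: "x \<in> V"
    show "fd (f \<circ> g) x w = (\<Sum>i\<in>UNIV. (fd g x w $ i) *\<^sub>R fd f (g x) (ax i))"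
      unfolding fd_reparam[OF x]
      by (rule linear_ax[OF immersion_onD(4)[OF I reparam_props(1)[OF x]]])
  qed
  also have "\<dots> = (\<lambda>v. \<Sum>i\<in>UNIV. (fd g y w $ i) *\<^sub>R fd (\<lambda>z. fd f z (ax i)) (g y) (fd g y v)
       + (fd (\<lambda>x. fd g x w) y v $ i) *\<^sub>R fd f (g y) (ax i))"
  proof (intro fd_eq has_derivative_sum has_derivative_scaleR)
    fix i :: 'n
    have "smooth_on V (\<lambda>x. fd g x w)" using R smooth_on_fd unfolding reparam_def by blast
    then have "((\<lambda>x. fd g x w) has_derivative fd (\<lambda>x. fd g x w) y) (at y)"
      using smooth_on_has_derivative y by blast
    then show "((\<lambda>x. fd g x w $ i) has_derivative (\<lambda>v. fd (\<lambda>x. fd g x w) y v $ i)) (at y)"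
      by (rule bounded_linear.has_derivative[OF bounded_linear_vec_nth])
    show "((\<lambda>x. fd f (g x) (ax i)) has_derivative (\<lambda>v. fd (\<lambda>z. fd f z (ax i)) (g y) (fd g y v))) (at y)"
      by (rule has_derivative_compose[OF fd_works[OF P(2)] immersion_onD(7)[OF I P(1)]])
  qed
  finally have e: "fd (\<lambda>x. fd (f \<circ> g) x w) y v =
     (\<Sum>i\<in>UNIV. (fd g y w $ i) *\<^sub>R fd (\<lambda>z. fd f z (ax i)) (g y) (fd g y v)
       + (fd (\<lambda>x. fd g x w) y v $ i) *\<^sub>R fd f (g y) (ax i))" by metis
  have t: "fd f (g y) x \<bullet> N = 0" for x using N(2) by (auto simp: tangent_space_def)
  have s: "second_ff f (g y) a b = (fd (\<lambda>x. fd f x b) (g y) a \<bullet> N) *\<^sub>R N" for a b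
    unfolding second_ff_def normal_part_eq[OF N(2,1)] ..
  have "second_ff (f \<circ> g) y v w = (fd (\<lambda>x. fd (f \<circ> g) x w) y v \<bullet> N) *\<^sub>R N"
    unfolding second_ff_def normal_part_reparam[OF y] normal_part_eq[OF N(2,1)] ..
  also have "\<dots> = (\<Sum>i\<in>UNIV. (fd g y w $ i) *\<^sub>R second_ff f (g y) (fd g y v) (ax i))"
    unfolding e by (simp add: inner_sum_left inner_add_left t s scaleR_sum_left)
  also have "\<dots> = second_ff f (g y) (fd g y v) (fd g y w)"
    using linear_ax[of "second_ff f (g y) (fd g y v)" "fd g y w"] second_ff_bilinear[OF I P(1) card]
    by (simp add: bilinear_def)
  finally show ?thesis .
qed

lemma orthonormal_frame_reparam:
  assumes "y \<in> V" "orthonormal_frame (f \<circ> g) y E"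
  shows "orthonormal_frame f (g y) (\<lambda>v. fd g y (E v))"
  using assms reparam_props(5)[OF assms(1)] unfolding orthonormal_frame_def fd_reparam[OF assms(1)]
  by (auto intro: linear_compose[unfolded comp_def])

text \<open>\<open>fd g y\<close> carries an orthonormal frame of \<open>f \<circ> g\<close> to one
  of \<open>f\<close>, so both traces become equal sums over frames.\<close>

lemma mean_curvature_reparam:
  assumes y: "y \<in> V" and card: "CARD('m) = CARD('n) + 1"
  shows "mean_curvature_vector (f \<circ> g) y = mean_curvature_vector f (g y)"
    and "second_ff_norm_sq (f \<circ> g) y = second_ff_norm_sq f (g y)"
proof -
  note I' = immersion_onD[OF immersion_reparam]
  obtain E where E: "orthonormal_frame (f \<circ> g) y E"
    using orthonormal_frame_exists[OF I'(4,3)[OF y]] by blast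
  note E' = orthonormal_frame_reparam[OF y E]
  show "mean_curvature_vector (f \<circ> g) y = mean_curvature_vector f (g y)"
    unfolding mean_curvature_frame[OF immersion_reparam y card E]
      mean_curvature_frame[OF I reparam_props(1)[OF y] card E'] second_ff_reparam[OF y card] ..
  show "second_ff_norm_sq (f \<circ> g) y = second_ff_norm_sq f (g y)"
    unfolding second_ff_norm_sq_frame[OF immersion_reparam y card E]
      second_ff_norm_sq_frame[OF I reparam_props(1)[OF y] card E'] second_ff_reparam[OF y card] ..
qed

end

section \<open>Graphs over a tangent hyperplane\<close>

definition pd :: "'n::finite \<Rightarrow> (real^'n \<Rightarrow> real) \<Rightarrow> real^'n \<Rightarrow> real" where
  "pd i F y = fd F y (ax i)"

text \<open>Differentiation rules for real functions on one open set, stated for \<open>pd\<close>,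
  so that jets of polynomial expressions in the derivatives of a function can be computed by
  simplification.\<close>

locale open_domain =
  fixes V :: "(real^'n::finite) set"
  assumes V: "open V"
begin

lemma smooth_pd [intro]: "smooth_on V F \<Longrightarrow> smooth_on V (pd i F)"
  unfolding pd_def[abs_def] by (rule smooth_on_fd)

lemma smooth_add [intro]:
  fixes F G :: "real^'n \<Rightarrow> real"
  shows "smooth_on V F \<Longrightarrow> smooth_on V G \<Longrightarrow> smooth_on V (\<lambda>y. F y + G y)"
  by (rule smooth_on_add[OF V])

lemma smooth_mult [intro]:
  fixes F G :: "real^'n \<Rightarrow> real"
  shows "smooth_on V F \<Longrightarrow> smooth_on V G \<Longrightarrow> smooth_on V (\<lambda>y. F y * G y)"
  by (simp add: smooth_on_def Ck_on_bilinear[OF bounded_bilinear_mult V])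

lemma smooth_const [intro]: "smooth_on V (\<lambda>y. c :: real)"
  by (rule smooth_on_const)

lemma smooth_cmult [intro]:
  fixes F :: "real^'n \<Rightarrow> real"
  shows "smooth_on V F \<Longrightarrow> smooth_on V (\<lambda>y. c * F y)"
  by (intro smooth_mult smooth_const)

lemma smooth_diff [intro]:
  fixes F G :: "real^'n \<Rightarrow> real"
  shows "smooth_on V F \<Longrightarrow> smooth_on V G \<Longrightarrow> smooth_on V (\<lambda>y. F y - G y)"
  using smooth_add[of F "\<lambda>y. (-1) * G y"] smooth_cmult[of G "-1"] by simp

lemma smooth_sum [intro]:
  fixes F :: "'i \<Rightarrow> real^'n \<Rightarrow> real"
  shows "(\<And>i. smooth_on V (F i)) \<Longrightarrow> smooth_on V (\<lambda>y. \<Sum>i\<in>I. F i y)"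
  by (simp add: smooth_on_def Ck_on_sum[OF V])

lemma smooth_nth [intro]: "smooth_on V (\<lambda>y. y $ i)"
  by (intro smooth_on_linear bounded_linear_vec_nth)

lemma pd_cong: "y \<in> V \<Longrightarrow> (\<And>z. z \<in> V \<Longrightarrow> F z = G z) \<Longrightarrow> pd i F y = pd i G y"
  unfolding pd_def by (metis V fd_cong)

lemma pd_const: "pd i (\<lambda>y. c) y = 0"
  unfolding pd_def by (simp add: fd_eq[OF has_derivative_const])

lemma pd_nth: "pd i (\<lambda>y. y $ j) y = (if i = j then 1 else 0)"
  unfolding pd_def by (simp add: fd_eq[OF bounded_linear_imp_has_derivative[OF bounded_linear_vec_nth]] axis_def)

lemma pd_add:
  "smooth_on V F \<Longrightarrow> smooth_on V G \<Longrightarrow> y \<in> V \<Longrightarrow> pd i (\<lambda>y. F y + G y) y = pd i F y + pd i G y"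
  unfolding pd_def
  by (subst fd_eq[OF has_derivative_add[OF smooth_on_has_derivative smooth_on_has_derivative]]) auto

lemma pd_diff:
  "smooth_on V F \<Longrightarrow> smooth_on V G \<Longrightarrow> y \<in> V \<Longrightarrow> pd i (\<lambda>y. F y - G y) y = pd i F y - pd i G y"
  unfolding pd_def
  by (subst fd_eq[OF has_derivative_diff[OF smooth_on_has_derivative smooth_on_has_derivative]]) auto

lemma pd_mult:
  "smooth_on V F \<Longrightarrow> smooth_on V G \<Longrightarrow> y \<in> V \<Longrightarrow> pd i (\<lambda>y. F y * G y) y = pd i F y * G y + F y * pd i G y"
  unfolding pd_def
  by (subst fd_eq[OF has_derivative_mult[OF smooth_on_has_derivative smooth_on_has_derivative]]) auto

lemma pd_cmult: "smooth_on V F \<Longrightarrow> y \<in> V \<Longrightarrow> pd i (\<lambda>y. c * F y) y = c * pd i F y"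
  by (simp add: pd_mult smooth_const pd_const)

lemma pd_sum:
  "(\<And>j. smooth_on V (F j)) \<Longrightarrow> y \<in> V \<Longrightarrow> pd i (\<lambda>y. \<Sum>j\<in>I. F j y) y = (\<Sum>j\<in>I. pd i (F j) y)"
  unfolding pd_def
  by (subst fd_eq[OF has_derivative_sum[OF smooth_on_has_derivative]]) auto

lemma pd_commute: "smooth_on V F \<Longrightarrow> y \<in> V \<Longrightarrow> pd i (pd j F) y = pd j (pd i F) y"
  unfolding pd_def[abs_def] by (rule fd_commute[OF V]) (auto simp: smooth_on_def)

lemma pd2_mult:
  assumes "smooth_on V F" "smooth_on V G" "y \<in> V"
  shows "pd i (pd j (\<lambda>y. F y * G y)) y =
    pd i (pd j F) y * G y + pd j F y * pd i G y + pd i F y * pd j G y + F y * pd i (pd j G) y"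
proof -
  have "pd i (pd j (\<lambda>y. F y * G y)) y = pd i (\<lambda>y. pd j F y * G y + F y * pd j G y) y"
    by (rule pd_cong[OF assms(3)]) (simp add: pd_mult assms)
  then show ?thesis using assms by (simp add: pd_add pd_mult smooth_pd smooth_mult)
qed

lemma pd2_sum:
  assumes "\<And>j. smooth_on V (F j)" "y \<in> V"
  shows "pd i (pd k (\<lambda>y. \<Sum>j\<in>I. F j y)) y = (\<Sum>j\<in>I. pd i (pd k (F j)) y)"
proof -
  have "pd i (pd k (\<lambda>y. \<Sum>j\<in>I. F j y)) y = pd i (\<lambda>y. \<Sum>j\<in>I. pd k (F j) y) y"
    by (rule pd_cong[OF assms(2)]) (simp add: pd_sum assms)
  then show ?thesis using assms by (simp add: pd_sum smooth_pd)
qed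

lemma pd2_diff:
  assumes "smooth_on V F" "smooth_on V G" "y \<in> V"
  shows "pd i (pd k (\<lambda>y. F y - G y)) y = pd i (pd k F) y - pd i (pd k G) y"
proof -
  have "pd i (pd k (\<lambda>y. F y - G y)) y = pd i (\<lambda>y. pd k F y - pd k G y) y"
    by (rule pd_cong[OF assms(3)]) (simp add: pd_diff assms)
  then show ?thesis using assms by (simp add: pd_diff smooth_pd)
qed

lemma pd2_add:
  assumes "smooth_on V F" "smooth_on V G" "y \<in> V"
  shows "pd i (pd k (\<lambda>y. F y + G y)) y = pd i (pd k F) y + pd i (pd k G) y"
proof -
  have "pd i (pd k (\<lambda>y. F y + G y)) y = pd i (\<lambda>y. pd k F y + pd k G y) y"
    by (rule pd_cong[OF assms(3)]) (simp add: pd_add assms)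
  then show ?thesis using assms by (simp add: pd_add smooth_pd)
qed

lemma pd2_const: "pd i (pd k (\<lambda>y. c)) y = 0"
proof -
  have "pd k (\<lambda>y. c) = (\<lambda>y. 0)" by (simp add: pd_const fun_eq_iff)
  then show ?thesis by (simp add: pd_const)
qed

lemma pd2_cmult:
  assumes "smooth_on V F" "y \<in> V"
  shows "pd i (pd k (\<lambda>y. c * F y)) y = c * pd i (pd k F) y"
  using pd2_mult[OF smooth_const[of c] assms(1,2), of i k] by (simp add: pd_const pd2_const)

lemma pd3_cyc:
  assumes "smooth_on V F" "y \<in> V"
  shows "pd i (pd j (pd k F)) y = pd i (pd k (pd j F)) y" "pd i (pd j (pd k F)) y = pd j (pd i (pd k F)) y"
  using assms by (auto intro!: pd_cong pd_commute)

end

text \<open>For \<open>w = 1 + |a|^2\<close> the matrix \<open>g\<close> is the inverse of the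
  metric \<open>1 + a a^T\<close> of a graph with gradient \<open>a\<close>. The two contractions
  behind the mean curvature and \<open>|A|^2\<close> are expressed by the vector
  \<open>b = h a\<close> and the number \<open>R = a^T h a\<close>.\<close>

lemma frame_sums:
  fixes h :: "'n::finite \<Rightarrow> 'n \<Rightarrow> real" and a :: "'n \<Rightarrow> real" and w :: real
  assumes sym: "\<And>i j. h i j = h j i"
  defines "g \<equiv> \<lambda>i j. (if i = j then 1 else 0) - a i * a j / w"
    and "b \<equiv> \<lambda>j. \<Sum>k\<in>UNIV. a k * h k j"
  defines "R \<equiv> \<Sum>j\<in>UNIV. a j * b j"
  shows "(\<Sum>i\<in>UNIV. \<Sum>j\<in>UNIV. g i j * h i j) = (\<Sum>i\<in>UNIV. h i i) - R / w"
    and "(\<Sum>i\<in>UNIV. \<Sum>j\<in>UNIV. \<Sum>k\<in>UNIV. \<Sum>l\<in>UNIV. g i k * g j l * (h i j * h k l)) =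
      (\<Sum>i\<in>UNIV. \<Sum>j\<in>UNIV. (h i j)\<^sup>2) - 2 * (\<Sum>j\<in>UNIV. (b j)\<^sup>2) / w + R\<^sup>2 / w\<^sup>2"
proof -
  have g1: "(\<Sum>k\<in>UNIV. g i k * x k) = x i - a i * (\<Sum>k\<in>UNIV. a k * x k) / w" for i x
  proof -
    have "(\<Sum>k\<in>UNIV. g i k * x k) = (\<Sum>k\<in>UNIV. (if i = k then x k else 0) - a i / w * (a k * x k))"
      unfolding g_def by (intro sum.cong) (auto simp: left_diff_distrib)
    also have "\<dots> = x i - a i / w * (\<Sum>k\<in>UNIV. a k * x k)"
      by (simp add: sum_subtractf sum_distrib_left)
    finally show ?thesis by simp
  qed
  have bb: "(\<Sum>k\<in>UNIV. a k * h i k) = b i" for i unfolding b_def by (simp add: sym[of i])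
  have "(\<Sum>i\<in>UNIV. \<Sum>j\<in>UNIV. g i j * h i j) = (\<Sum>i\<in>UNIV. h i i - a i * b i / w)"
    by (simp add: g1 bb)
  then show "(\<Sum>i\<in>UNIV. \<Sum>j\<in>UNIV. g i j * h i j) = (\<Sum>i\<in>UNIV. h i i) - R / w"
    by (simp add: sum_subtractf R_def sum_divide_distrib)
  have in1: "(\<Sum>l\<in>UNIV. g j l * h k l) = h k j - a j * b k / w" for j k by (simp add: g1 bb)
  have in2: "(\<Sum>k\<in>UNIV. g i k * (h k j - a j * b k / w)) = h i j - a j * b i / w - a i * b j / w + a i * a j * R / w\<^sup>2" for i j
  proof -
    have e: "(\<Sum>k\<in>UNIV. a k * (h k j - a j * b k / w)) = b j - a j * R / w"
      by (simp add: right_diff_distrib sum_subtractf b_def R_def sum_distrib_left sum_divide_distrib mult_ac)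
    then show ?thesis unfolding g1 e by (simp add: diff_divide_distrib right_diff_distrib power2_eq_square mult_ac)
  qed
  have key: "(\<Sum>k\<in>UNIV. \<Sum>l\<in>UNIV. g i k * g j l * (h i j * h k l)) = h i j * (h i j - a j * b i / w - a i * b j / w + a i * a j * R / w\<^sup>2)" for i j
  proof -
    have "(\<Sum>k\<in>UNIV. \<Sum>l\<in>UNIV. g i k * g j l * (h i j * h k l)) = h i j * (\<Sum>k\<in>UNIV. g i k * (\<Sum>l\<in>UNIV. g j l * h k l))"
      unfolding sum_distrib_left by (intro sum.cong refl) (simp only: mult_ac)
    then show ?thesis unfolding in1 in2 .
  qed
  have "(\<Sum>i\<in>UNIV. \<Sum>j\<in>UNIV. \<Sum>k\<in>UNIV. \<Sum>l\<in>UNIV. g i k * g j l * (h i j * h k l)) =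
     (\<Sum>i\<in>UNIV. \<Sum>j\<in>UNIV. (h i j)\<^sup>2 - b i / w * (a j * h i j) - a i / w * (b j * h i j) + R / w\<^sup>2 * a i * (a j * h i j))"
    unfolding key by (intro sum.cong refl) (simp add: algebra_simps power2_eq_square)
  also have "\<dots> = (\<Sum>i\<in>UNIV. \<Sum>j\<in>UNIV. (h i j)\<^sup>2) - (\<Sum>i\<in>UNIV. b i / w * b i) - (\<Sum>i\<in>UNIV. \<Sum>j\<in>UNIV. a i / w * (b j * h i j)) + (\<Sum>i\<in>UNIV. R / w\<^sup>2 * a i * b i)"
    unfolding sum.distrib sum_subtractf sum_distrib_left[symmetric] bb ..
  also have "(\<Sum>i\<in>UNIV. \<Sum>j\<in>UNIV. a i / w * (b j * h i j)) = (\<Sum>j\<in>UNIV. b j / w * b j)"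
    by (subst sum.swap) (simp add: b_def sum_distrib_left sum_divide_distrib mult_ac)
  finally show "(\<Sum>i\<in>UNIV. \<Sum>j\<in>UNIV. \<Sum>k\<in>UNIV. \<Sum>l\<in>UNIV. g i k * g j l * (h i j * h k l)) =
      (\<Sum>i\<in>UNIV. \<Sum>j\<in>UNIV. (h i j)\<^sup>2) - 2 * (\<Sum>j\<in>UNIV. (b j)\<^sup>2) / w + R\<^sup>2 / w\<^sup>2"
    by (simp add: R_def power2_eq_square sum_distrib_left sum_divide_distrib sum_negf mult_ac)
qed

text \<open>The part of \<open>N\<close> orthogonal to the unit normal \<open>N'\<close> of
  \<open>unit_normal_exists\<close> is tangent, hence orthogonal to \<open>N\<close> and so to
  itself. Thus \<open>N\<close> is a multiple of \<open>N'\<close>.\<close>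

lemma tangent_space_unit_normal:
  fixes f :: "real^'n::finite \<Rightarrow> real^'m::finite"
  assumes "linear (fd f u)" "inj (fd f u)" "CARD('m) = CARD('n) + 1"
    and N: "norm N = 1" "\<And>v. fd f u v \<bullet> N = 0"
  shows "tangent_space f u = {w. w \<bullet> N = 0}"
proof -
  obtain N' where N': "norm N' = 1" "tangent_space f u = {w. w \<bullet> N' = 0}"
    using unit_normal_exists[OF assms(1-3)] by blast
  have NN: "N' \<bullet> N' = 1" "N \<bullet> N = 1" using N'(1) N(1) by (simp_all add: norm_eq_1)
  have "N - (N \<bullet> N') *\<^sub>R N' \<in> tangent_space f u" using NN by (simp add: N' inner_diff_left)
  then have "(N - (N \<bullet> N') *\<^sub>R N') \<bullet> N = 0" using N(2) by (auto simp: tangent_space_def)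
  moreover have "(N - (N \<bullet> N') *\<^sub>R N') \<bullet> N' = 0" using NN by (simp add: inner_diff_left)
  ultimately have "(N - (N \<bullet> N') *\<^sub>R N') \<bullet> (N - (N \<bullet> N') *\<^sub>R N') = 0"
    by (metis inner_diff_right inner_scaleR_right mult_zero_right diff_zero)
  then have eq: "N = (N \<bullet> N') *\<^sub>R N'" by simp
  then have "N \<bullet> N' \<noteq> 0" using N(1) by auto
  then show ?thesis unfolding N'(2) using eq by (metis inner_scaleR_right mult_eq_0_iff)
qed

text \<open>The graph of \<open>\<phi>\<close> over the affine tangent plane at \<open>x0\<close>,
  with orthonormal coordinates given by \<open>J\<close>. As \<open>\<phi>\<close> and its gradient
  vanish at \<open>0\<close>, the metric is Euclidean up to first order there, and first covariant
  derivatives at \<open>0\<close> are partial derivatives.\<close>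

locale graph = open_domain V for V :: "(real^'n::finite) set" +
  fixes J :: "real^'n \<Rightarrow> real^'m::finite" and x0 N0 :: "real^'m" and \<phi> :: "real^'n \<Rightarrow> real"
  assumes zero: "0 \<in> V" and sm: "smooth_on V \<phi>" and J: "linear J"
    and JJ: "\<And>v w. J v \<bullet> J w = v \<bullet> w" and JN: "\<And>v. J v \<bullet> N0 = 0" and NN: "N0 \<bullet> N0 = 1"
    and phi0: "\<phi> 0 = 0" and dphi0: "\<And>v. fd \<phi> 0 v = 0"
    and card: "CARD('m) = CARD('n) + 1"
begin

definition F :: "real^'n \<Rightarrow> real^'m" where "F y = x0 + J y + \<phi> y *\<^sub>R N0"

definition grad :: "real^'n \<Rightarrow> real^'n" where "grad y = (\<chi> i. pd i \<phi> y)"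

definition w :: "real^'n \<Rightarrow> real" where "w y = 1 + (\<Sum>i\<in>UNIV. pd i \<phi> y * pd i \<phi> y)"

definition N :: "real^'n \<Rightarrow> real^'m" where "N y = (N0 - J (grad y)) /\<^sub>R sqrt (w y)"

definition hess :: "real^'n \<Rightarrow> 'n \<Rightarrow> 'n \<Rightarrow> real" where "hess y i j = pd i (pd j \<phi>) y"

definition hf :: "real^'n \<Rightarrow> real^'n \<Rightarrow> real^'n \<Rightarrow> real" where
  "hf y v v' = (\<Sum>i\<in>UNIV. \<Sum>j\<in>UNIV. v $ i * v' $ j * hess y i j)"

text \<open>\<open>bb\<close> is the Hessian of \<open>\<phi>\<close> applied to its gradient, and
  \<open>RR\<close> the Hessian evaluated twice on the gradient. They are the corrections produced
  by the inverse metric, of first and second order in the gradient.\<close>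

definition bb :: "'n \<Rightarrow> real^'n \<Rightarrow> real" where "bb j y = (\<Sum>k\<in>UNIV. pd k \<phi> y * pd k (pd j \<phi>) y)"

definition RR :: "real^'n \<Rightarrow> real" where "RR y = (\<Sum>j\<in>UNIV. pd j \<phi> y * bb j y)"

definition Lap :: "real^'n \<Rightarrow> real" where "Lap y = (\<Sum>i\<in>UNIV. pd i (pd i \<phi>) y)"

text \<open>Half of \<open>F y \<bullet> N y\<close>, multiplied by \<open>sqrt (w y)\<close> to be
  free of roots: the right-hand side of the expander equation in terms of
  \<open>\<phi>\<close>.\<close>

definition Q :: "real^'n \<Rightarrow> real" where
  "Q y = 1/2 * ((x0 \<bullet> N0 + \<phi> y) - (\<Sum>j\<in>UNIV. (x0 \<bullet> J (ax j) + y $ j) * pd j \<phi> y))"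

lemma smooths: "smooth_on V w" "smooth_on V (bb j)" "smooth_on V RR" "smooth_on V Lap" "smooth_on V Q"
  "smooth_on V (pd i \<phi>)" "smooth_on V (pd i (pd j \<phi>))"
proof -
  show p: "smooth_on V (pd i \<phi>)" "smooth_on V (pd i (pd j \<phi>))" for i j using sm by auto
  show "smooth_on V w" unfolding w_def[abs_def] by (intro smooth_add smooth_const smooth_sum smooth_mult p)
  show b: "smooth_on V (bb j)" for j unfolding bb_def[abs_def] by (intro smooth_sum smooth_mult p)
  show "smooth_on V RR" unfolding RR_def[abs_def] by (intro smooth_sum smooth_mult p b)
  show "smooth_on V Lap" unfolding Lap_def[abs_def] by (intro smooth_sum p)
  show "smooth_on V Q" unfolding Q_def[abs_def]
    by (intro smooth_cmult smooth_diff smooth_add smooth_const smooth_sum smooth_mult p sm smooth_nth)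
qed

lemma NJ: "N0 \<bullet> J v = 0"
  using JN[of v] inner_commute by metis

lemma w_pos: "w y > 0" "w y \<noteq> 0" "sqrt (w y) > 0" "sqrt (w y) * sqrt (w y) = w y"
proof -
  show "w y > 0" unfolding w_def by (intro add_pos_nonneg sum_nonneg) auto
  then show "w y \<noteq> 0" "sqrt (w y) > 0" "sqrt (w y) * sqrt (w y) = w y" by auto
qed

lemma w_grad: "w y = 1 + grad y \<bullet> grad y"
  by (simp add: w_def grad_def inner_vec_def)

lemma fd_phi: "y \<in> V \<Longrightarrow> fd \<phi> y v = grad y \<bullet> v"
proof -
  assume "y \<in> V"
  then have "linear (fd \<phi> y)" using smooth_on_differentiable[OF sm] linear_frechet_derivative by blast
  from linear_ax[OF this, of v] show ?thesis by (simp add: grad_def inner_vec_def pd_def mult.commute)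
qed

lemma F_deriv: "y \<in> V \<Longrightarrow> (F has_derivative (\<lambda>v. J v + (grad y \<bullet> v) *\<^sub>R N0)) (at y)"
proof -
  assume y: "y \<in> V"
  have bl: "bounded_linear J" using J linear_conv_bounded_linear by blast
  have "fd \<phi> y = (\<lambda>v. grad y \<bullet> v)" using fd_phi[OF y] by blast
  then have "(\<phi> has_derivative (\<lambda>v. grad y \<bullet> v)) (at y)"
    using smooth_on_has_derivative[OF sm y] by simp
  then show ?thesis unfolding F_def[abs_def]
    by (auto intro!: derivative_eq_intros bounded_linear.has_derivative[OF bl])
qed

lemma fd_F: "y \<in> V \<Longrightarrow> fd F y v = J v + (grad y \<bullet> v) *\<^sub>R N0"
  using fd_eq[OF F_deriv] by simp

lemma inner_fd_F: "y \<in> V \<Longrightarrow> fd F y v \<bullet> fd F y v' = v \<bullet> v' + (grad y \<bullet> v) * (grad y \<bullet> v')"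
  by (simp add: fd_F inner_add_left inner_add_right JJ JN NN NJ)

lemma immersion_F: "immersion_on V F"
  unfolding immersion_on_def
proof (intro conjI ballI V)
  have bl: "bounded_linear J" using J linear_conv_bounded_linear by blast
  show "smooth_on V F" unfolding F_def[abs_def]
    by (intro smooth_on_add V smooth_on_const smooth_on_linear bl
        smooth_on_linear_compose[OF bounded_linear_scaleR_left V sm])
  fix y assume y: "y \<in> V"
  have "v = 0" if "fd F y v = 0" for v
  proof -
    have "v \<bullet> v + (grad y \<bullet> v)\<^sup>2 = 0" using inner_fd_F[OF y, of v v] that by (simp add: power2_eq_square)
    then have "v \<bullet> v = 0" by (metis add_nonneg_eq_0_iff inner_ge_zero zero_le_power2)
    then show ?thesis by simp
  qed
  moreover have "linear (fd F y)" using has_derivative_linear[OF F_deriv[OF y]] fd_eq[OF F_deriv[OF y]] by simp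
  ultimately show "inj (fd F y)" using linear_injective_0 by blast
qed

lemma N_unit: "N y \<bullet> N y = 1"
proof -
  have "(N0 - J (grad y)) \<bullet> (N0 - J (grad y)) = w y"
    by (simp add: inner_diff_left inner_diff_right NN JN JJ NJ w_grad)
  then show ?thesis using w_pos(1,3,4)[of y]
    unfolding N_def inner_scaleR_left inner_scaleR_right by (simp add: field_simps)
qed

lemma fd_F_N: "y \<in> V \<Longrightarrow> fd F y v \<bullet> N y = 0"
  by (simp add: fd_F N_def inner_add_left inner_add_right inner_diff_left inner_diff_right JN NN JJ NJ inner_commute[of v "grad y"])

lemma tangent_space_F: "y \<in> V \<Longrightarrow> tangent_space F y = {x. x \<bullet> N y = 0}"
  using tangent_space_unit_normal[OF immersion_onD(4,3)[OF immersion_F] card, of y "N y"] fd_F_N N_unit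
  by (simp add: norm_eq_1)

lemma normal_part_F: "y \<in> V \<Longrightarrow> normal_part F y x = (x \<bullet> N y) *\<^sub>R N y"
  using normal_part_eq tangent_space_F N_unit norm_eq_1 by blast

text \<open>The second derivative of the graph is the Hessian of \<open>\<phi>\<close> times
  \<open>N0\<close>, and \<open>N0\<close> has normal component
  \<open>1 / sqrt (w y)\<close>.\<close>

lemma second_ff_F:
  assumes "y \<in> V" shows "second_ff F y v v' = (hf y v v' / sqrt (w y)) *\<^sub>R N y"
proof -
  have d: "((\<lambda>x. grad x \<bullet> v') has_derivative (\<lambda>v. hf y v v')) (at y)"
  proof -
    have eq: "grad x \<bullet> v' = (\<Sum>j\<in>UNIV. pd j \<phi> x * v' $ j)" for x by (simp add: grad_def inner_vec_def)
    have "fd (pd j \<phi>) y v = (\<Sum>i\<in>UNIV. v $ i * hess y i j)" for j v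
    proof -
      have "linear (fd (pd j \<phi>) y)"
        using smooth_on_differentiable[OF smooths(6) assms] linear_frechet_derivative by blast
      from linear_ax[OF this, of v] show ?thesis by (simp add: hess_def pd_def)
    qed
    then have "hf y v v' = (\<Sum>j\<in>UNIV. fd (pd j \<phi>) y v * v' $ j)" for v
      unfolding hf_def by (subst sum.swap) (simp add: sum_distrib_right sum_distrib_left mult_ac)
    moreover have "((\<lambda>x. \<Sum>j\<in>UNIV. pd j \<phi> x * v' $ j) has_derivative (\<lambda>v. \<Sum>j\<in>UNIV. fd (pd j \<phi>) y v * v' $ j)) (at y)"
      by (intro has_derivative_sum has_derivative_mult_left smooth_on_has_derivative[OF smooths(6) assms])
    ultimately show ?thesis unfolding eq by presburger
  qed
  have "fd (\<lambda>x. fd F x v') y = fd (\<lambda>x. J v' + (grad x \<bullet> v') *\<^sub>R N0) y"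
    by (rule fd_cong[OF V assms]) (simp add: fd_F)
  also have "\<dots> = (\<lambda>v. hf y v v' *\<^sub>R N0)"
    using has_derivative_add[OF has_derivative_const has_derivative_scaleR_left[OF d]] by (intro fd_eq) simp
  finally have "fd (\<lambda>x. fd F x v') y v = hf y v v' *\<^sub>R N0" by metis
  moreover have "N0 \<bullet> N y = 1 / sqrt (w y)"
    by (simp add: N_def inner_diff_right NN NJ JN field_simps)
  ultimately show ?thesis unfolding second_ff_def normal_part_F[OF assms] by simp
qed

lemma second_ff_F_ax: "y \<in> V \<Longrightarrow> second_ff F y (ax i) (ax j) = (hess y i j / sqrt (w y)) *\<^sub>R N y"
proof -
  assume y: "y \<in> V"
  have "hf y (ax i) (ax j) = hess y i j"
    by (simp add: hf_def axis_def if_distrib[of "\<lambda>x. x * _"] if_distrib[of "\<lambda>x. _ * x"] cong: if_cong)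
  then show ?thesis by (simp add: second_ff_F[OF y])
qed

text \<open>The metric is a rank-one perturbation \<open>1 + a a^T\<close> of the identity, with
  inverse \<open>1 - a a^T / w\<close> (Sherman-Morrison).\<close>

lemma inverse_metric_F:
  assumes "y \<in> V"
  shows "inverse_metric F y $ i $ j = (if i = j then 1 else 0) - pd i \<phi> y * pd j \<phi> y / w y"
proof -
  let ?a = "\<lambda>i. pd i \<phi> y"
  let ?G = "(\<chi> i j. induced_metric F y (ax i) (ax j)) :: real^'n^'n"
  let ?H = "(\<chi> i j. (if i = j then 1 else 0) - ?a i * ?a j / w y) :: real^'n^'n"
  have G: "?G $ i $ j = (if i = j then 1 else 0) + ?a i * ?a j" for i j
    by (simp add: induced_metric_def inner_fd_F[OF assms] grad_def inner_axis) (simp add: axis_def)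
  have "(?G ** ?H) $ i $ j = (mat 1 :: real^'n^'n) $ i $ j" for i j
  proof -
    have "(?G ** ?H) $ i $ j = (\<Sum>k\<in>UNIV. ((if i = k then 1 else 0) + ?a i * ?a k) * ((if k = j then 1 else 0) - ?a k * ?a j / w y))"
      by (simp add: matrix_matrix_mult_def G del: vec_lambda_beta) simp
    also have "\<dots> = (\<Sum>k\<in>UNIV. (if i = k then (if k = j then 1 else 0) - ?a k * ?a j / w y else 0)
       + (if k = j then ?a i * ?a k else 0) - ?a i * ?a j / w y * (?a k * ?a k))"
      by (intro sum.cong) (auto simp: algebra_simps)
    also have "\<dots> = (if i = j then 1 else 0) - ?a i * ?a j / w y + ?a i * ?a j - ?a i * ?a j / w y * (w y - 1)"
      unfolding sum.distrib sum_subtractf sum_distrib_left[symmetric] by (simp add: w_def)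
    also have "\<dots> = (mat 1 :: real^'n^'n) $ i $ j"
      using w_pos[of y] by (simp add: mat_def right_diff_distrib)
    finally show ?thesis .
  qed
  then have "?G ** ?H = mat 1" by (simp add: vec_eq_iff)
  then have "inverse_metric F y = ?H" unfolding inverse_metric_def by (rule matrix_inv_eq)
  then show ?thesis by simp
qed

lemma hess_sym: "y \<in> V \<Longrightarrow> hess y i j = hess y j i"
  unfolding hess_def by (rule pd_commute[OF sm])

lemma mean_curvature_F:
  assumes y: "y \<in> V"
  shows "mean_curvature_vector F y = ((Lap y - RR y / w y) / sqrt (w y)) *\<^sub>R N y"
proof -
  have "mean_curvature_vector F y = ((\<Sum>i\<in>UNIV. \<Sum>j\<in>UNIV. ((if i = j then 1 else 0) - pd i \<phi> y * pd j \<phi> y / w y) * hess y i j) / sqrt (w y)) *\<^sub>R N y"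
    unfolding mean_curvature_vector_def
    by (simp add: inverse_metric_F[OF y] second_ff_F_ax[OF y] scaleR_sum_left sum_divide_distrib)
  then show ?thesis
    unfolding frame_sums(1)[of "hess y", OF hess_sym[OF y]]
    by (simp add: Lap_def RR_def bb_def hess_def)
qed

lemma second_ff_norm_sq_F:
  assumes y: "y \<in> V"
  shows "second_ff_norm_sq F y = ((\<Sum>i\<in>UNIV. \<Sum>j\<in>UNIV. hess y i j * hess y i j) - 2 * (\<Sum>j\<in>UNIV. bb j y * bb j y) / w y + (RR y / w y)\<^sup>2) / w y"
proof -
  have nn: "((a / sqrt (w y)) *\<^sub>R N y) \<bullet> ((b / sqrt (w y)) *\<^sub>R N y) = a * b / w y" for a b
    using w_pos(1)[of y] by (simp add: N_unit)
  have "second_ff_norm_sq F y = (\<Sum>i\<in>UNIV. \<Sum>j\<in>UNIV. \<Sum>k\<in>UNIV. \<Sum>l\<in>UNIV.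
     ((if i = k then 1 else 0) - pd i \<phi> y * pd k \<phi> y / w y) * ((if j = l then 1 else 0) - pd j \<phi> y * pd l \<phi> y / w y) * (hess y i j * hess y k l)) / w y"
    unfolding second_ff_norm_sq_def inverse_metric_F[OF y] second_ff_F_ax[OF y] sum_divide_distrib
    by (intro sum.cong refl) (simp only: nn times_divide_eq_right)
  then show ?thesis
    unfolding frame_sums(2)[of "hess y", OF hess_sym[OF y]]
    by (simp add: power2_eq_square RR_def bb_def hess_def)
qed

end

section \<open>Simons' identity\<close>

locale expander_graph = graph V J x0 N0 \<phi> for V :: "(real^'n::finite) set"
    and J :: "real^'n \<Rightarrow> real^'m::finite" and x0 N0 \<phi> +
  fixes s :: real
  assumes expander: "\<And>y. y \<in> V \<Longrightarrow> mean_curvature_vector F y = (1/2) *\<^sub>R normal_part F y (F y)"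
    and scal: "\<And>y. y \<in> V \<Longrightarrow> scalar_curvature F y = s"
begin

abbreviation xJ :: "'n \<Rightarrow> real" where "xJ j \<equiv> x0 \<bullet> J (ax j)"

lemma F_N: "F y \<bullet> N y = 2 * Q y / sqrt (w y)"
proof -
  have "x0 \<bullet> J (grad y) = (\<Sum>j\<in>UNIV. xJ j * pd j \<phi> y)"
    by (subst linear_ax[OF J]) (simp add: inner_sum_right grad_def mult.commute)
  moreover have "y \<bullet> grad y = (\<Sum>j\<in>UNIV. y $ j * pd j \<phi> y)" by (simp add: inner_vec_def grad_def)
  ultimately have "F y \<bullet> (N0 - J (grad y)) = 2 * Q y"
    by (simp add: F_def Q_def inner_add_left inner_diff_right JN NN JJ NJ distrib_right sum.distrib)
  then show ?thesis by (simp add: N_def divide_inverse)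
qed

lemma mean_curvature_Q: "y \<in> V \<Longrightarrow> mean_curvature_vector F y = (Q y / sqrt (w y)) *\<^sub>R N y"
  using expander normal_part_F F_N by simp

lemma N_nonzero: "N y \<noteq> 0" using N_unit[of y] by auto

text \<open>The expander equation cleared of roots and denominators: an identity of smooth functions
  on \<open>V\<close> that can be differentiated twice at \<open>0\<close> by the product
  rule.\<close>

lemma E_eq:
  assumes y: "y \<in> V" shows "(Lap y - Q y) * w y = RR y"
proof -
  have "(Lap y - RR y / w y) / sqrt (w y) = Q y / sqrt (w y)"
    using mean_curvature_Q[OF y] mean_curvature_F[OF y] N_nonzero[of y] by simp
  then have "Lap y - RR y / w y = Q y" using w_pos(1)[of y] by simp
  then have "RR y / w y = Lap y - Q y" by linarith
  then show ?thesis using w_pos(1)[of y] by (simp add: field_simps)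
qed

lemma eta_eq: "y \<in> V \<Longrightarrow> (norm (mean_curvature_vector F y))\<^sup>2 = Q y * Q y / w y"
  using N_unit[of y] w_pos(1)[of y]
  by (simp add: mean_curvature_Q power_mult_distrib power_divide norm_eq_1[symmetric] power2_eq_square)

text \<open>By \<open>E_eq\<close>, \<open>cc\<close> equals \<open>RR / w\<close>, written without
  a division. In these terms the scalar curvature equation, multiplied by \<open>w\<close> squared,
  takes the polynomial form \<open>S_eq\<close>.\<close>

definition H2 :: "real^'n \<Rightarrow> real" where
  "H2 y = (\<Sum>i\<in>UNIV. \<Sum>j\<in>UNIV. pd i (pd j \<phi>) y * pd i (pd j \<phi>) y)"
definition BB :: "real^'n \<Rightarrow> real" where "BB y = (\<Sum>j\<in>UNIV. bb j y * bb j y)"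
definition cc :: "real^'n \<Rightarrow> real" where "cc y = Lap y - Q y"
definition XX :: "real^'n \<Rightarrow> real" where "XX y = Q y * Q y - H2 y - cc y * cc y"

lemma smooths': "smooth_on V H2" "smooth_on V BB" "smooth_on V cc" "smooth_on V XX"
proof -
  show h: "smooth_on V H2" unfolding H2_def[abs_def] by (intro smooth_sum smooth_mult smooths)
  show "smooth_on V BB" unfolding BB_def[abs_def] by (intro smooth_sum smooth_mult smooths)
  show c: "smooth_on V cc" unfolding cc_def[abs_def] by (intro smooth_diff smooths)
  show "smooth_on V XX" unfolding XX_def[abs_def] by (intro smooth_diff smooth_mult smooths h c)
qed

lemma S_eq:
  assumes y: "y \<in> V" shows "XX y * w y + 2 * BB y = s * (w y * w y)"
proof -
  have w: "w y > 0" by (rule w_pos)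
  have "RR y / w y = cc y" using E_eq[OF y] w by (simp add: cc_def field_simps)
  then have "second_ff_norm_sq F y = (H2 y - 2 * BB y / w y + cc y * cc y) / w y"
    using second_ff_norm_sq_F[OF y] by (simp add: H2_def BB_def hess_def power2_eq_square)
  then have "Q y * Q y / w y - (H2 y - 2 * BB y / w y + cc y * cc y) / w y = s"
    using scal[OF y] eta_eq[OF y] by (simp add: scalar_curvature_def)
  then have "Q y * Q y - (H2 y - 2 * BB y / w y + cc y * cc y) = s * w y"
    using w by (simp add: field_simps)
  then have "(XX y + 2 * BB y / w y) * w y = s * w y * w y" by (simp add: XX_def)
  then show ?thesis using w by (simp add: distrib_right)
qed

section \<open>Jets at the base point\<close>

abbreviation h :: "'n \<Rightarrow> 'n \<Rightarrow> real" where "h i j \<equiv> pd i (pd j \<phi>) 0"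
abbreviation t :: "'n \<Rightarrow> 'n \<Rightarrow> 'n \<Rightarrow> real" where "t i j k \<equiv> pd i (pd j (pd k \<phi>)) 0"
abbreviation f4 :: "'n \<Rightarrow> 'n \<Rightarrow> 'n \<Rightarrow> 'n \<Rightarrow> real" where "f4 i j k l \<equiv> pd i (pd j (pd k (pd l \<phi>))) 0"
definition M :: "'n \<Rightarrow> 'n \<Rightarrow> real" where "M i j = (\<Sum>k\<in>UNIV. h i k * h k j)"

lemma h_sym: "h i j = h j i" by (rule pd_commute[OF sm zero])
lemma t_sym: "t i j k = t i k j" "t i j k = t j i k"
  using pd3_cyc[OF sm zero] by blast+
text \<open>Only neighbouring derivatives commute directly, so the two pairs of indices are
  exchanged one transposition at a time.\<close>

lemma f4_sym: "f4 k l i j = f4 i j k l"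
proof -
  have "f4 k l i j = f4 k i l j" by (intro pd_cong[OF zero] pd_commute[OF smooths(6)])
  also have "\<dots> = f4 i k l j" by (intro pd_commute[OF smooths(7)] zero)
  also have "\<dots> = f4 i k j l" by (rule pd_cong[OF zero pd_cong[OF _ pd_commute[OF sm]]])
  also have "\<dots> = f4 i j k l" by (intro pd_cong[OF zero] pd_commute[OF smooths(6)])
  finally show ?thesis .
qed

lemma jet_phi: "pd i \<phi> 0 = 0" by (simp add: pd_def dphi0)

lemma jet_w: "w 0 = 1" "pd k w 0 = 0" "pd l (pd k w) 0 = 2 * (\<Sum>i\<in>UNIV. h l i * h k i)"
proof -
  show "w 0 = 1" by (simp add: w_def jet_phi)
  note p = smooths(6)
  show "pd k w 0 = 0" unfolding w_def[abs_def]
    by (simp add: pd_add pd_const pd_sum pd_mult zero smooth_sum smooth_mult smooth_const p jet_phi)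
  show "pd l (pd k w) 0 = 2 * (\<Sum>i\<in>UNIV. h l i * h k i)" unfolding w_def[abs_def]
    by (simp add: pd2_add pd2_const pd2_sum pd2_mult zero smooth_sum smooth_mult smooth_const p jet_phi
       sum_distrib_left mult.commute[of "h k _"])
qed

lemma jet_bb: "bb j 0 = 0" "pd l (bb j) 0 = M l j"
  unfolding bb_def[abs_def] M_def
  by (simp_all add: pd_sum pd_mult zero smooth_mult smooths jet_phi)

lemma jet_RR: "RR 0 = 0" "pd k RR 0 = 0" "pd l (pd k RR) 0 = (\<Sum>j\<in>UNIV. h k j * M l j + h l j * M k j)"
  unfolding RR_def[abs_def]
  by (simp_all add: pd_sum pd_mult pd2_sum pd2_mult zero smooth_mult smooths jet_phi jet_bb)

lemma jet_BB: "BB 0 = 0" "pd k BB 0 = 0" "pd l (pd k BB) 0 = 2 * (\<Sum>j\<in>UNIV. M l j * M k j)"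
  unfolding BB_def[abs_def]
  by (simp_all add: pd_sum pd_mult pd2_sum pd2_mult zero smooth_mult smooths jet_bb
     sum_distrib_left mult.commute[of "M k _"])

text \<open>Differentiating \<open>cc * w = RR\<close> avoids the quotient rule: \<open>w\<close> is
  \<open>1\<close> and \<open>cc\<close> is \<open>0\<close> up to first order, so the second
  derivatives of \<open>cc\<close> and \<open>RR\<close> agree.\<close>

lemma jet_cc: "cc 0 = 0" "pd k cc 0 = 0" "pd l (pd k cc) 0 = pd l (pd k RR) 0"
proof -
  have eq: "cc y * w y = RR y" if "y \<in> V" for y using E_eq[OF that] by (simp add: cc_def)
  show c0: "cc 0 = 0" using eq[OF zero] by (simp add: jet_RR jet_w)
  have e: "pd k (\<lambda>y. cc y * w y) y = pd k RR y" if "y \<in> V" for y k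
    by (rule pd_cong[OF that]) (rule eq)
  show c1: "pd k cc 0 = 0" for k
    using e[OF zero, of k] by (simp add: pd_mult smooths smooths' zero jet_w jet_RR c0)
  have "pd l (pd k (\<lambda>y. cc y * w y)) 0 = pd l (pd k RR) 0" by (rule pd_cong[OF zero e])
  then show "pd l (pd k cc) 0 = pd l (pd k RR) 0"
    by (simp add: pd2_mult smooths smooths' zero jet_w c0 c1)
qed

text \<open>The derivative of the summand \<open>\<phi>\<close> cancels against the one that hits
  the coordinate \<open>y $ k\<close>, so no first derivative of \<open>\<phi>\<close> survives. At
  \<open>0\<close> this is the expander identity that expresses dH by the second fundamental form on
  the tangential part of the position.\<close>

lemma pd_Q: "y \<in> V \<Longrightarrow> pd k Q y = - (1/2) * (\<Sum>j\<in>UNIV. (xJ j + y $ j) * pd k (pd j \<phi>) y)"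
proof -
  assume y: "y \<in> V"
  have a: "smooth_on V (\<lambda>y. xJ j + y $ j)" for j by (intro smooth_add smooth_const smooth_nth)
  have b: "smooth_on V (\<lambda>y. (xJ j + y $ j) * pd j \<phi> y)" for j by (intro smooth_mult a smooths)
  have c: "pd k (\<lambda>y. xJ j + y $ j) y = (if k = j then 1 else 0)" for j
    by (simp add: pd_add[OF smooth_const smooth_nth y] pd_const pd_nth)
  have "pd k Q y = 1/2 * (pd k \<phi> y - (\<Sum>j\<in>UNIV. (if k = j then 1 else 0) * pd j \<phi> y + (xJ j + y $ j) * pd k (pd j \<phi>) y))"
    unfolding Q_def[abs_def]
    apply (subst pd_cmult[OF _ y]) subgoal by (intro smooth_diff smooth_add smooth_const sm smooth_sum b)
    apply (subst pd_diff[OF _ _ y]) subgoal by (intro smooth_add smooth_const sm) subgoal by (intro smooth_sum b)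
    apply (subst pd_add[OF smooth_const sm y]) apply (subst pd_sum[OF b y])
    by (simp add: pd_const pd_mult[OF a smooths(6) y] c)
  also have "\<dots> = - (1/2) * (\<Sum>j\<in>UNIV. (xJ j + y $ j) * pd k (pd j \<phi>) y)"
    by (simp add: sum.distrib if_distrib[of "\<lambda>x. x * _"] cong: if_cong)
  finally show ?thesis .
qed

lemma jet_Q: "pd k Q 0 = - (1/2) * (\<Sum>j\<in>UNIV. xJ j * h k j)"
  "pd l (pd k Q) 0 = - (1/2) * (h k l + (\<Sum>j\<in>UNIV. xJ j * t l k j))"
proof -
  show "pd k Q 0 = - (1/2) * (\<Sum>j\<in>UNIV. xJ j * h k j)" using pd_Q[OF zero] by simp
  have a: "smooth_on V (\<lambda>y. xJ j + y $ j)" for j by (intro smooth_add smooth_const smooth_nth)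
  have b: "smooth_on V (\<lambda>y. (xJ j + y $ j) * pd k (pd j \<phi>) y)" for j by (intro smooth_mult a smooths)
  have c: "pd l (\<lambda>y. xJ j + y $ j) 0 = (if l = j then 1 else 0)" for j
    by (simp add: pd_add[OF smooth_const smooth_nth zero] pd_const pd_nth)
  have "pd l (pd k Q) 0 = pd l (\<lambda>y. - (1/2) * (\<Sum>j\<in>UNIV. (xJ j + y $ j) * pd k (pd j \<phi>) y)) 0"
    by (rule pd_cong[OF zero pd_Q])
  also have "\<dots> = - (1/2) * (\<Sum>j\<in>UNIV. (if l = j then 1 else 0) * h k j + xJ j * t l k j)"
    apply (subst pd_cmult[OF _ zero]) subgoal by (intro smooth_sum b)
    apply (subst pd_sum[OF b zero])
    by (simp add: pd_mult[OF a smooths(7) zero] c)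
  finally show "pd l (pd k Q) 0 = - (1/2) * (h k l + (\<Sum>j\<in>UNIV. xJ j * t l k j))"
    by (simp add: sum.distrib if_distrib[of "\<lambda>x. x * _"] cong: if_cong)
qed

text \<open>\<open>Q = Lap - cc\<close>, and \<open>cc\<close> vanishes up to first order; only the
  second derivatives feel that the metric is not flat, through \<open>jet_RR\<close>.\<close>

lemma Q_trace: "Q 0 = (\<Sum>i\<in>UNIV. h i i)" "pd k Q 0 = (\<Sum>i\<in>UNIV. t k i i)"
  "pd l (pd k Q) 0 = (\<Sum>i\<in>UNIV. f4 l k i i) - (\<Sum>j\<in>UNIV. h k j * M l j + h l j * M k j)"
proof -
  show "Q 0 = (\<Sum>i\<in>UNIV. h i i)" using jet_cc(1) by (simp add: cc_def Lap_def)
  have "pd k Lap 0 = (\<Sum>i\<in>UNIV. t k i i)" unfolding Lap_def[abs_def] by (simp add: pd_sum smooths zero)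
  then show "pd k Q 0 = (\<Sum>i\<in>UNIV. t k i i)" using jet_cc(2)[of k]
    unfolding cc_def[abs_def] by (simp add: pd_diff smooths zero)
  have "pd l (pd k Lap) 0 = (\<Sum>i\<in>UNIV. f4 l k i i)" unfolding Lap_def[abs_def] by (simp add: pd2_sum smooths zero)
  then show "pd l (pd k Q) 0 = (\<Sum>i\<in>UNIV. f4 l k i i) - (\<Sum>j\<in>UNIV. h k j * M l j + h l j * M k j)"
    using jet_cc(3)[of l k] unfolding cc_def[abs_def] jet_RR(3) by (simp add: pd2_diff smooths zero)
qed

lemma jet_XX: "XX 0 = s" "pd k XX 0 = 0" "pd k (pd k XX) 0 = 2 * s * (\<Sum>i\<in>UNIV. h k i * h k i) - 4 * (\<Sum>j\<in>UNIV. M k j * M k j)"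
proof -
  show x0: "XX 0 = s" using S_eq[OF zero] by (simp add: jet_w jet_BB)
  have sL: "smooth_on V (\<lambda>y. XX y * w y)" "smooth_on V (\<lambda>y. 2 * BB y)" "smooth_on V (\<lambda>y. w y * w y)"
    by (intro smooth_mult smooth_cmult smooths smooths')+
  have e: "pd k (\<lambda>y. XX y * w y + 2 * BB y) y = pd k (\<lambda>y. s * (w y * w y)) y" if "y \<in> V" for y k
    by (rule pd_cong[OF that]) (rule S_eq)
  show x1: "pd k XX 0 = 0" for k using e[OF zero, of k]
    by (simp add: pd_add pd_cmult sL pd_mult smooths smooths' zero jet_w jet_BB)
  have "pd k (pd k (\<lambda>y. XX y * w y + 2 * BB y)) 0 = pd k (pd k (\<lambda>y. s * (w y * w y))) 0" by (rule pd_cong[OF zero e])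
  then show "pd k (pd k XX) 0 = 2 * s * (\<Sum>i\<in>UNIV. h k i * h k i) - 4 * (\<Sum>j\<in>UNIV. M k j * M k j)"
    by (simp add: pd2_add pd2_cmult sL pd2_mult smooths smooths' zero jet_w jet_BB x0 x1)
qed

lemma pd_XX: "y \<in> V \<Longrightarrow> pd k XX y = 2 * (Q y * pd k Q y) - 2 * (\<Sum>i\<in>UNIV. \<Sum>j\<in>UNIV. pd i (pd j \<phi>) y * pd k (pd i (pd j \<phi>)) y)
     - 2 * (cc y * pd k cc y)"
  unfolding XX_def[abs_def] H2_def[abs_def]
  by (simp add: pd_diff smooth_diff smooth_mult smooth_sum smooths smooths' pd_mult pd_sum sum_distrib_left)

lemma S_first: "Q 0 * pd k Q 0 = (\<Sum>i\<in>UNIV. \<Sum>j\<in>UNIV. h i j * t k i j)"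
  using pd_XX[OF zero, of k] jet_XX(2)[of k] by (simp add: jet_cc)

lemma S_zero: "Q 0 * Q 0 = (\<Sum>i\<in>UNIV. \<Sum>j\<in>UNIV. h i j * h i j) + s"
  using jet_XX(1) by (simp add: XX_def H2_def jet_cc)

text \<open>The direct expansion of a derivative that \<open>jet_XX\<close> obtains from the
  constancy of the scalar curvature. Comparing the traces of the two gives
  \<open>simons\<close>.\<close>

lemma S_second: "pd k (pd k XX) 0 = 2 * (pd k Q 0 * pd k Q 0) + 2 * (Q 0 * pd k (pd k Q) 0)
   - 2 * (\<Sum>i\<in>UNIV. \<Sum>j\<in>UNIV. t k i j * t k i j) - 2 * (\<Sum>i\<in>UNIV. \<Sum>j\<in>UNIV. h i j * f4 k k i j)"
proof -
  have s1: "smooth_on V (\<lambda>y. \<Sum>j\<in>UNIV. pd i (pd j \<phi>) y * pd i (pd j \<phi>) y)" for i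
    by (intro smooth_sum smooth_mult smooths)
  have "pd k (pd k XX) 0 = pd k (pd k (\<lambda>y. Q y * Q y)) 0 - pd k (pd k H2) 0 - pd k (pd k (\<lambda>y. cc y * cc y)) 0"
    unfolding XX_def[abs_def] by (simp add: pd2_diff smooth_diff smooth_mult smooths smooths' zero)
  moreover have "pd k (pd k (\<lambda>y. Q y * Q y)) 0 = 2 * (pd k Q 0 * pd k Q 0) + 2 * (Q 0 * pd k (pd k Q) 0)"
    by (simp add: pd2_mult smooths zero)
  moreover have "pd k (pd k (\<lambda>y. cc y * cc y)) 0 = 0"
    by (simp add: pd2_mult smooths' zero jet_cc(1,2))
  moreover have "pd k (pd k H2) 0 = 2 * (\<Sum>i\<in>UNIV. \<Sum>j\<in>UNIV. t k i j * t k i j) + 2 * (\<Sum>i\<in>UNIV. \<Sum>j\<in>UNIV. h i j * f4 k k i j)"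
    unfolding H2_def[abs_def]
    by (simp add: pd2_sum s1 smooth_mult smooths pd2_mult zero sum.distrib sum_distrib_left)
  ultimately show ?thesis by simp
qed

abbreviation h2 :: real where "h2 \<equiv> \<Sum>i\<in>UNIV. \<Sum>j\<in>UNIV. h i j * h i j"
abbreviation G2 :: real where "G2 \<equiv> \<Sum>k\<in>UNIV. pd k Q 0 * pd k Q 0"
abbreviation T2 :: real where "T2 \<equiv> \<Sum>k\<in>UNIV. \<Sum>i\<in>UNIV. \<Sum>j\<in>UNIV. t k i j * t k i j"

text \<open>This identity is the trace of Simons' identity for the drift Laplacian applied to the constant
  function \<open>H\<^sup>2 - |A|\<^sup>2\<close>; the quadratic terms in \<open>M = h\<^sup>2\<close> cancel.\<close>

lemma simons: "G2 - T2 = s * (h2 + 1/2)"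
proof -
  define xQ where "xQ = (\<Sum>j\<in>UNIV. xJ j * pd j Q 0)"
  define M2 where "M2 = (\<Sum>k\<in>UNIV. \<Sum>j\<in>UNIV. M k j * M k j)"
  have hf4: "(\<Sum>k\<in>UNIV. \<Sum>i\<in>UNIV. \<Sum>j\<in>UNIV. h i j * f4 k k i j) = - (1/2) * (h2 + Q 0 * xQ) + 2 * M2"
  proof -
    have "(\<Sum>k\<in>UNIV. \<Sum>i\<in>UNIV. \<Sum>j\<in>UNIV. h i j * f4 k k i j) = (\<Sum>i\<in>UNIV. \<Sum>j\<in>UNIV. \<Sum>k\<in>UNIV. h i j * f4 k k i j)"
      by (subst sum.swap) (intro sum.cong refl sum.swap)
    \<comment> \<open>Commuting derivatives turns the Laplacian of the Hessian into the Hessian of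
      the Laplacian, which \<open>Q_trace\<close> expresses by \<open>Q\<close>. The curvature terms
      of Simons' identity enter here, as the products with \<open>M\<close>.\<close>
    also have "\<dots> = (\<Sum>i\<in>UNIV. \<Sum>j\<in>UNIV. h i j * (\<Sum>k\<in>UNIV. f4 i j k k))"
      using f4_sym by (simp add: sum_distrib_left)
    also have "\<dots> = (\<Sum>i\<in>UNIV. \<Sum>j\<in>UNIV. h i j * (pd i (pd j Q) 0 + (\<Sum>m\<in>UNIV. h j m * M i m + h i m * M j m)))"
      by (simp add: Q_trace(3))
    also have "\<dots> = (\<Sum>i\<in>UNIV. \<Sum>j\<in>UNIV. h i j * pd i (pd j Q) 0)
       + (\<Sum>i\<in>UNIV. \<Sum>j\<in>UNIV. \<Sum>m\<in>UNIV. h i j * h j m * M i m) + (\<Sum>i\<in>UNIV. \<Sum>j\<in>UNIV. \<Sum>m\<in>UNIV. h i j * h i m * M j m)"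
      by (simp add: distrib_left sum.distrib sum_distrib_left mult.assoc)
    also have "(\<Sum>i\<in>UNIV. \<Sum>j\<in>UNIV. \<Sum>m\<in>UNIV. h i j * h j m * M i m) = M2"
    proof -
      have "(\<Sum>i\<in>UNIV. \<Sum>j\<in>UNIV. \<Sum>m\<in>UNIV. h i j * h j m * M i m) = (\<Sum>i\<in>UNIV. \<Sum>m\<in>UNIV. \<Sum>j\<in>UNIV. h i j * h j m * M i m)"
        by (intro sum.cong refl sum.swap)
      then show ?thesis by (simp add: M2_def M_def sum_distrib_right)
    qed
    also have "(\<Sum>i\<in>UNIV. \<Sum>j\<in>UNIV. \<Sum>m\<in>UNIV. h i j * h i m * M j m) = M2"
    proof -
      have "(\<Sum>i\<in>UNIV. \<Sum>j\<in>UNIV. \<Sum>m\<in>UNIV. h i j * h i m * M j m) = (\<Sum>j\<in>UNIV. \<Sum>m\<in>UNIV. \<Sum>i\<in>UNIV. h i j * h i m * M j m)"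
        by (subst sum.swap) (intro sum.cong refl sum.swap)
      also have "\<dots> = (\<Sum>j\<in>UNIV. \<Sum>m\<in>UNIV. \<Sum>i\<in>UNIV. h j i * h i m * M j m)"
        by (intro sum.cong refl arg_cong2[of _ _ _ _ times] h_sym)
      finally show ?thesis by (simp add: M2_def M_def sum_distrib_right)
    qed
    \<comment> \<open>The position terms become the drift term \<open>Q 0 * xQ\<close> by
      \<open>S_first\<close>; the same term arises in \<open>QQ\<close> and cancels against this one
      at the end.\<close>
    also have "(\<Sum>i\<in>UNIV. \<Sum>j\<in>UNIV. h i j * pd i (pd j Q) 0) = - (1/2) * (h2 + Q 0 * xQ)"
    proof -
      have "(\<Sum>i\<in>UNIV. \<Sum>j\<in>UNIV. h i j * pd i (pd j Q) 0) =
        (\<Sum>i\<in>UNIV. \<Sum>j\<in>UNIV. - (1/2) * (h i j * h i j) + - (1/2) * (\<Sum>l\<in>UNIV. xJ l * (h i j * t l i j)))"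
      proof (intro sum.cong refl)
        fix i j
        have "(\<Sum>l\<in>UNIV. xJ l * t i j l) = (\<Sum>l\<in>UNIV. xJ l * t l i j)" using t_sym by metis
        then show "h i j * pd i (pd j Q) 0 = - (1/2) * (h i j * h i j) + - (1/2) * (\<Sum>l\<in>UNIV. xJ l * (h i j * t l i j))"
          unfolding jet_Q(2) using h_sym[of i j] by (simp add: algebra_simps sum_distrib_left)
      qed
      also have "\<dots> = - (1/2) * h2 + - (1/2) * (\<Sum>i\<in>UNIV. \<Sum>j\<in>UNIV. \<Sum>l\<in>UNIV. xJ l * (h i j * t l i j))"
        unfolding sum.distrib sum_distrib_left[symmetric] ..
      also have "(\<Sum>i\<in>UNIV. \<Sum>j\<in>UNIV. \<Sum>l\<in>UNIV. xJ l * (h i j * t l i j)) = (\<Sum>i\<in>UNIV. \<Sum>l\<in>UNIV. \<Sum>j\<in>UNIV. xJ l * (h i j * t l i j))"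
        by (intro sum.cong refl sum.swap)
      also have "\<dots> = (\<Sum>l\<in>UNIV. \<Sum>i\<in>UNIV. \<Sum>j\<in>UNIV. xJ l * (h i j * t l i j))" by (rule sum.swap)
      also have "\<dots> = (\<Sum>l\<in>UNIV. xJ l * (Q 0 * pd l Q 0))" unfolding S_first sum_distrib_left ..
      also have "\<dots> = Q 0 * xQ" by (simp add: xQ_def sum_distrib_left mult_ac)
      finally show ?thesis by (simp add: algebra_simps)
    qed
    finally show ?thesis by simp
  qed
  have QQ: "Q 0 * (\<Sum>k\<in>UNIV. pd k (pd k Q) 0) = - (1/2) * (Q 0 * Q 0) - (1/2) * (Q 0 * xQ)"
  proof -
    have "(\<Sum>k\<in>UNIV. pd k (pd k Q) 0) = (\<Sum>k\<in>UNIV. - (1/2) * h k k + - (1/2) * (\<Sum>j\<in>UNIV. xJ j * t j k k))"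
    proof (intro sum.cong refl)
      fix k
      have "(\<Sum>l\<in>UNIV. xJ l * t k k l) = (\<Sum>l\<in>UNIV. xJ l * t l k k)" using t_sym by metis
      then show "pd k (pd k Q) 0 = - (1/2) * h k k + - (1/2) * (\<Sum>j\<in>UNIV. xJ j * t j k k)"
        unfolding jet_Q(2) by (simp add: algebra_simps)
    qed
    also have "\<dots> = - (1/2) * Q 0 + - (1/2) * (\<Sum>k\<in>UNIV. \<Sum>j\<in>UNIV. xJ j * t j k k)"
      unfolding sum.distrib sum_distrib_left[symmetric] Q_trace(1) ..
    also have "(\<Sum>k\<in>UNIV. \<Sum>j\<in>UNIV. xJ j * t j k k) = (\<Sum>j\<in>UNIV. xJ j * pd j Q 0)"
      unfolding Q_trace(2) sum_distrib_left by (rule sum.swap)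
    finally have e: "(\<Sum>k\<in>UNIV. pd k (pd k Q) 0) = - (1/2) * Q 0 + - (1/2) * xQ" by (simp only: xQ_def)
    show ?thesis unfolding e by (simp add: algebra_simps)
  qed
  have "(\<Sum>k\<in>UNIV. pd k (pd k XX) 0) = 2 * s * h2 - 4 * M2"
    unfolding jet_XX(3) M2_def sum_subtractf sum_distrib_left[symmetric] ..
  moreover have "(\<Sum>k\<in>UNIV. pd k (pd k XX) 0) = 2 * G2 + 2 * (Q 0 * (\<Sum>k\<in>UNIV. pd k (pd k Q) 0)) - 2 * T2
     - 2 * (\<Sum>k\<in>UNIV. \<Sum>i\<in>UNIV. \<Sum>j\<in>UNIV. h i j * f4 k k i j)"
    unfolding S_second sum_subtractf sum.distrib sum_distrib_left[symmetric] ..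
  ultimately have "2 * s * h2 - 4 * M2 = 2 * G2 - (Q 0 * Q 0) - Q 0 * xQ - 2 * T2 + h2 + Q 0 * xQ - 4 * M2"
    unfolding hf4 QQ by (simp add: algebra_simps)
  \<comment> \<open>By \<open>S_zero\<close> the remaining difference \<open>h2 - Q 0 * Q 0\<close>
    is \<open>- s\<close>; this is where the summand 1/2 comes from.\<close>
  then have "2 * s * h2 = 2 * G2 - 2 * T2 - s" unfolding S_zero by simp
  then show ?thesis by (simp add: algebra_simps)
qed

end

section \<open>Rank one\<close>

text \<open>The square of \<open>H\<close> requires no choice of a unit normal, so it is a function
  on the whole hypersurface, and for an expander it is differentiable also at its zeros.\<close>

definition eta :: "(real^'n::finite \<Rightarrow> real^'m::finite) \<Rightarrow> real^'n \<Rightarrow> real" where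
  "eta f u = (norm (mean_curvature_vector f u))\<^sup>2"

text \<open>Coordinates of the tangential projection of an ambient vector. They are characterized by
  orthogonality instead of the inverse metric, so that they visibly transform by
  \<open>fd g y\<close>.\<close>

definition tangent_coord :: "(real^'n::finite \<Rightarrow> real^'m::finite) \<Rightarrow> real^'n \<Rightarrow> real^'m \<Rightarrow> real^'n" where
  "tangent_coord f u x = (THE X. \<forall>v. (x - fd f u X) \<bullet> fd f u v = 0)"

text \<open>Where the second fundamental form is \<open>H e \<otimes> e\<close> with \<open>H \<noteq> 0\<close>, this is the squared length of the
  projection of \<open>x\<close> to the plane spanned by the normal and \<open>e\<close>. Where \<open>H = 0\<close>, the quotient is \<open>0\<close>
  and only the normal component remains.\<close>

definition psi :: "(real^'n::finite \<Rightarrow> real^'m::finite) \<Rightarrow> real^'m \<Rightarrow> real^'n \<Rightarrow> real" where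
  "psi f x u = (norm (normal_part f u x))\<^sup>2
     + (second_ff f u (tangent_coord f u x) (tangent_coord f u x) \<bullet> mean_curvature_vector f u) / eta f u"

lemma tangent_coord_eq:
  assumes "linear (fd f u)" "inj (fd f u)" "\<And>v. (x - fd f u X) \<bullet> fd f u v = 0"
  shows "tangent_coord f u x = X"
  unfolding tangent_coord_def
proof (rule the_equality)
  fix Y assume Y: "\<forall>v. (x - fd f u Y) \<bullet> fd f u v = 0"
  have "fd f u (X - Y) \<bullet> fd f u (X - Y) = (x - fd f u Y) \<bullet> fd f u (X - Y) - (x - fd f u X) \<bullet> fd f u (X - Y)"
    by (simp add: linear_diff[OF assms(1)] inner_diff_left)
  also have "\<dots> = 0" using Y assms(3) by simp
  finally have "fd f u (X - Y) = fd f u 0" using linear_0[OF assms(1)] by simp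
  then show "Y = X" using injD[OF assms(2)] by fastforce
qed (use assms(3) in blast)

text \<open>The tangential coordinates transform by \<open>fd g y\<close>, which is just what
  \<open>second_ff\<close> absorbs; the other ingredients are invariant already.\<close>

lemma psi_reparam:
  fixes f :: "real^'n::finite \<Rightarrow> real^'m::finite"
  assumes I: "immersion_on D f" and R: "reparam V g D" and y: "y \<in> V" and card: "CARD('m) = CARD('n) + 1"
  shows "psi (f \<circ> g) x y = psi f x (g y)"
proof -
  note P = reparam_props[OF I R y] and I' = immersion_onD[OF immersion_reparam[OF I R]]
  obtain N where N: "norm N = 1" "tangent_space (f \<circ> g) y = {w. w \<bullet> N = 0}"
    using unit_normal_exists[OF I'(4,3)[OF y] card] by blast
  have "x - (x \<bullet> N) *\<^sub>R N \<in> tangent_space (f \<circ> g) y"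
    using N by (simp add: inner_diff_left norm_eq_1)
  then obtain X where X: "x - (x \<bullet> N) *\<^sub>R N = fd (f \<circ> g) y X" by (auto simp: tangent_space_def)
  have o: "N \<bullet> fd (f \<circ> g) y v = 0" for v
    using N(2) by (metis (mono_tags) inner_commute mem_Collect_eq rangeI tangent_space_def)
  have "(x - fd (f \<circ> g) y X) \<bullet> fd (f \<circ> g) y v = 0" for v
    using o by (simp add: X[symmetric])
  note X1 = this
  have t1: "tangent_coord (f \<circ> g) y x = X" by (rule tangent_coord_eq[OF I'(4,3)[OF y] X1])
  have "tangent_coord f (g y) x = fd g y X"
  proof (rule tangent_coord_eq[OF immersion_onD(4,3)[OF I P(1)]])
    fix v
    obtain v' where "v = fd g y v'" using P(4) by (metis bij_pointE)
    then show "(x - fd f (g y) (fd g y X)) \<bullet> fd f (g y) v = 0"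
      using X1[of v'] fd_reparam[OF I R y] by simp
  qed
  then show ?thesis
    unfolding psi_def eta_def normal_part_reparam[OF I R y] mean_curvature_reparam[OF I R y card] t1
      second_ff_reparam[OF I R y card] by simp
qed

lemma double_sum_Cauchy_Schwarz:
  fixes a b :: "'n::finite \<Rightarrow> 'n \<Rightarrow> real"
  shows "(\<Sum>i\<in>UNIV. \<Sum>j\<in>UNIV. a i j * b i j)\<^sup>2 \<le> (\<Sum>i\<in>UNIV. \<Sum>j\<in>UNIV. a i j * a i j) * (\<Sum>i\<in>UNIV. \<Sum>j\<in>UNIV. b i j * b i j)"
  using Cauchy_Schwarz_ineq[of "(\<chi> i j. a i j) :: real^'n^'n" "(\<chi> i j. b i j)"] by (simp add: inner_vec_def)

text \<open>\<open>h i j = (c i / c k) * h k j\<close> is a function of \<open>i\<close> times a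
  function of \<open>j\<close>, so all 2 by 2 minors vanish. Rank one is expressed by minors
  throughout, which spares the choice of an eigenvector.\<close>

lemma rank_one_if_proportional:
  fixes h :: "'n \<Rightarrow> 'n \<Rightarrow> real"
  assumes sym: "\<And>i j. h i j = h j i" and "c k \<noteq> 0" and c: "\<And>i k j. c k * h i j = c i * h k j"
  shows "h i j * h p l = h i l * h p j"
proof -
  have e: "h i j = c i * h k j / c k" for i j using c[of k i j] assms(2) by (simp add: field_simps)
  show ?thesis by (subst (1 2) e, subst (3 4) e) simp
qed

context expander_graph
begin

lemma hf_zero_bound: "(hf 0 v v')\<^sup>2 \<le> h2 * ((v \<bullet> v) * (v' \<bullet> v'))"
proof -
  have "(hf 0 v v')\<^sup>2 \<le> (\<Sum>i\<in>UNIV. \<Sum>j\<in>UNIV. (v $ i * v' $ j) * (v $ i * v' $ j)) * h2"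
    using double_sum_Cauchy_Schwarz[of "\<lambda>i j. v $ i * v' $ j" h] by (simp add: hf_def hess_def)
  also have "(\<Sum>i\<in>UNIV. \<Sum>j\<in>UNIV. (v $ i * v' $ j) * (v $ i * v' $ j)) = (v \<bullet> v) * (v' \<bullet> v')"
    by (simp add: inner_vec_def sum_product mult_ac)
  finally show ?thesis by (simp add: mult.commute)
qed

lemma QG_le: "Q 0 * Q 0 * G2 \<le> h2 * T2"
proof -
  have "Q 0 * Q 0 * G2 = (\<Sum>k\<in>UNIV. (Q 0 * pd k Q 0)\<^sup>2)"
    by (simp add: sum_distrib_left power2_eq_square mult_ac)
  also have "\<dots> \<le> (\<Sum>k\<in>UNIV. h2 * (\<Sum>i\<in>UNIV. \<Sum>j\<in>UNIV. t k i j * t k i j))"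
    unfolding S_first by (intro sum_mono double_sum_Cauchy_Schwarz)
  finally show ?thesis by (simp add: sum_distrib_left)
qed

lemma scal_zero:
  assumes "s \<ge> 0" shows "s = 0"
proof (rule ccontr)
  assume "s \<noteq> 0"
  then have s: "s > 0" using assms by simp
  have h2: "h2 \<ge> 0" and T2: "T2 \<ge> 0" by (intro sum_nonneg; simp)+
  have "(h2 + s) * (T2 + s * (h2 + 1/2)) \<le> h2 * T2"
    using QG_le simons S_zero by (simp add: algebra_simps)
  then have "s * T2 + (h2 + s) * (s * (h2 + 1/2)) \<le> 0" by (simp add: algebra_simps)
  moreover have "s * T2 \<ge> 0" "(h2 + s) * (s * (h2 + 1/2)) > 0"
    using s h2 T2 by (simp_all add: add_nonneg_pos)
  ultimately show False by linarith
qed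

text \<open>\<open>et\<close> is \<open>eta F\<close> as a visibly smooth expression in
  \<open>\<phi>\<close>; its jet is read off from \<open>et * w = Q * Q\<close>.\<close>

definition et :: "real^'n \<Rightarrow> real" where "et y = Q y * Q y * inverse (w y)"
definition iw :: "real^'n \<Rightarrow> real" where "iw y = inverse (w y)"

lemma smooth_iw: "smooth_on V iw" and smooth_et: "smooth_on V et"
proof -
  show i: "smooth_on V iw" unfolding iw_def[abs_def] smooth_on_def
    using Ck_on_inverse[OF V w_pos(2)] smooths(1) by (simp add: smooth_on_def)
  then show "smooth_on V et" unfolding et_def[abs_def]
    using smooths(5) by (auto simp: iw_def[abs_def])
qed

lemma jet_iw: "iw 0 = 1" "pd k iw 0 = 0"
proof -
  show i: "iw 0 = 1" by (simp add: iw_def jet_w)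
  have "pd k (\<lambda>y. iw y * w y) 0 = pd k (\<lambda>y. 1) 0"
    by (rule pd_cong[OF zero]) (simp add: iw_def w_pos)
  then show "pd k iw 0 = 0" by (simp add: pd_mult smooth_iw smooths zero pd_const jet_w i)
qed

lemma eta_et: "y \<in> V \<Longrightarrow> eta F y = et y"
  by (simp add: eta_def eta_eq et_def divide_inverse)

lemma jet_et: "et 0 = Q 0 * Q 0" "pd k et 0 = 2 * (Q 0 * pd k Q 0)"
  "pd l (pd k et) 0 + Q 0 * Q 0 * (2 * (\<Sum>i\<in>UNIV. h l i * h k i)) = pd l (pd k Q) 0 * Q 0 + pd k Q 0 * pd l Q 0 + pd l Q 0 * pd k Q 0 + Q 0 * pd l (pd k Q) 0"
proof -
  show e0: "et 0 = Q 0 * Q 0" by (simp add: et_def jet_w)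
  have e: "pd k (\<lambda>y. et y * w y) y = pd k (\<lambda>y. Q y * Q y) y" if "y \<in> V" for y k
    by (rule pd_cong[OF that]) (simp add: et_def w_pos)
  show "pd k et 0 = 2 * (Q 0 * pd k Q 0)"
    using e[OF zero, of k] by (simp add: pd_mult smooth_et smooths zero jet_w)
  have "pd l (pd k (\<lambda>y. et y * w y)) 0 = pd l (pd k (\<lambda>y. Q y * Q y)) 0" by (rule pd_cong[OF zero e])
  then show "pd l (pd k et) 0 + Q 0 * Q 0 * (2 * (\<Sum>i\<in>UNIV. h l i * h k i)) = pd l (pd k Q) 0 * Q 0 + pd k Q 0 * pd l Q 0 + pd l Q 0 * pd k Q 0 + Q 0 * pd l (pd k Q) 0"
    by (simp add: pd2_mult smooth_et smooths zero jet_w e0)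
qed

lemma eta_derivative: "y \<in> V \<Longrightarrow> (eta F has_derivative (\<lambda>v. \<Sum>k\<in>UNIV. v $ k * pd k et y)) (at y)"
proof -
  assume y: "y \<in> V"
  have d: "(et has_derivative fd et y) (at y)" by (rule smooth_on_has_derivative[OF smooth_et y])
  have "fd et y v = (\<Sum>k\<in>UNIV. v $ k * pd k et y)" for v
    using linear_ax[OF has_derivative_linear[OF d], of v] by (simp add: pd_def)
  then have "fd et y = (\<lambda>v. \<Sum>k\<in>UNIV. v $ k * pd k et y)" by blast
  then show ?thesis
    using has_derivative_transform_within_open[OF d V y, of "eta F"] eta_et by simp
qed

lemma fd_eta: "y \<in> V \<Longrightarrow> fd (eta F) y v = (\<Sum>k\<in>UNIV. v $ k * pd k et y)"
  using fd_eq[OF eta_derivative] by simp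

context
  assumes s0: "s = 0"
begin

text \<open>The equality case of Cauchy-Schwarz, as a sum of squares: for \<open>s = 0\<close> one
  has \<open>h2 = Q 0 * Q 0\<close> and \<open>G2 = T2\<close>, so the squared distance of
  \<open>t\<close> from the claimed multiple of \<open>h\<close> is
  \<open>T2 - 2 * G2 + G2 = 0\<close>.\<close>

lemma t_proportional:
  assumes "Q 0 \<noteq> 0"
  shows "t k i j = pd k Q 0 / Q 0 * h i j"
proof -
  let ?th = "\<lambda>k. pd k Q 0 / Q 0"
  have a: "?th k * (Q 0 * pd k Q 0) = pd k Q 0 * pd k Q 0" for k using assms by simp
  have b: "?th k * ?th k * (Q 0 * Q 0) = pd k Q 0 * pd k Q 0" for k using assms by simp
  have "(\<Sum>k\<in>UNIV. \<Sum>i\<in>UNIV. \<Sum>j\<in>UNIV. (t k i j - ?th k * h i j)\<^sup>2) =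
     (\<Sum>k\<in>UNIV. \<Sum>i\<in>UNIV. \<Sum>j\<in>UNIV. t k i j * t k i j - 2 * ?th k * (h i j * t k i j) + ?th k * ?th k * (h i j * h i j))"
    by (intro sum.cong refl) (simp add: power2_eq_square algebra_simps)
  also have "\<dots> = T2 - (\<Sum>k\<in>UNIV. 2 * ?th k * (Q 0 * pd k Q 0)) + (\<Sum>k\<in>UNIV. ?th k * ?th k * (Q 0 * Q 0))"
    unfolding S_first S_zero s0 sum.distrib sum_subtractf sum_distrib_left[symmetric] by simp
  also have "\<dots> = T2 - 2 * G2 + G2" unfolding mult.assoc[of 2] a b sum_distrib_left[symmetric] ..
  also have "\<dots> = 0" using simons by (simp add: s0)
  finally have "(\<Sum>k\<in>UNIV. \<Sum>i\<in>UNIV. \<Sum>j\<in>UNIV. (t k i j - ?th k * h i j)\<^sup>2) = 0" .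
  then have "(\<Sum>i\<in>UNIV. \<Sum>j\<in>UNIV. (t k i j - ?th k * h i j)\<^sup>2) = 0"
    by (subst (asm) sum_nonneg_eq_0_iff) (auto intro!: sum_nonneg)
  then have "(\<Sum>j\<in>UNIV. (t k i j - ?th k * h i j)\<^sup>2) = 0"
    by (subst (asm) sum_nonneg_eq_0_iff) (auto intro!: sum_nonneg)
  then have "(t k i j - ?th k * h i j)\<^sup>2 = 0"
    by (subst (asm) sum_nonneg_eq_0_iff) auto
  then show ?thesis by simp
qed

text \<open>The Codazzi symmetry of \<open>t\<close> inserted into \<open>t_proportional\<close>,
  multiplied by twice \<open>Q 0 * Q 0\<close> so that it remains meaningful where
  \<open>Q 0 = 0\<close>. Written with \<open>eta\<close> and \<open>second_ff\<close>, it can be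
  carried to other parametrizations.\<close>

lemma eta_second_ff_zero:
  "fd (eta F) 0 v *\<^sub>R second_ff F 0 v1 z = fd (eta F) 0 v1 *\<^sub>R second_ff F 0 v z"
proof -
  have k: "pd k et 0 * h i j = pd i et 0 * h k j" for k i j
  proof (cases "Q 0 = 0")
    case False
    have "pd k Q 0 / Q 0 * h i j = pd i Q 0 / Q 0 * h k j"
      using t_proportional[OF False] t_sym(2)[of k i j] by simp
    then show ?thesis using False by (simp add: jet_et field_simps)
  qed (simp add: jet_et)
  have e: "fd (eta F) 0 v * hf 0 v1 z = (\<Sum>k\<in>UNIV. \<Sum>i\<in>UNIV. \<Sum>j\<in>UNIV. v $ k * v1 $ i * z $ j * (pd k et 0 * h i j))" for v v1
    by (simp add: fd_eta[OF zero] hf_def hess_def sum_product) (simp add: sum_distrib_left mult_ac)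
  have "fd (eta F) 0 v * hf 0 v1 z = (\<Sum>k\<in>UNIV. \<Sum>i\<in>UNIV. \<Sum>j\<in>UNIV. v1 $ i * v $ k * z $ j * (pd i et 0 * h k j))"
    unfolding e by (intro sum.cong refl) (subst k, simp only: mult_ac)
  also have "\<dots> = (\<Sum>i\<in>UNIV. \<Sum>k\<in>UNIV. \<Sum>j\<in>UNIV. v1 $ i * v $ k * z $ j * (pd i et 0 * h k j))" by (rule sum.swap)
  also have "\<dots> = fd (eta F) 0 v1 * hf 0 v z" unfolding e ..
  finally show ?thesis by (simp add: second_ff_F[OF zero])
qed

lemma h2_Q: "h2 = Q 0 * Q 0" using S_zero s0 by simp

text \<open>By \<open>jet_Q\<close> the derivative of Q^2 at \<open>0\<close> is
  \<open>- Q 0\<close> times the Hessian evaluated on \<open>v\<close> and the tangential part of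
  \<open>x0\<close>, and \<open>s = 0\<close> makes the norm of the Hessian equal to
  \<open>\<bar>Q 0\<bar>\<close>. This differential inequality propagates the zeros of
  \<open>H\<close>.\<close>

lemma eta_log_derivative_bound: "\<bar>fd (eta F) 0 v\<bar> \<le> norm (F 0) * norm (fd F 0 v) * eta F 0"
proof -
  let ?x = "(\<chi> j. xJ j) :: real^'n"
  have "norm ?x * norm ?x = ?x \<bullet> ?x" by (simp add: dot_square_norm power2_eq_square)
  also have "\<dots> = (\<Sum>j\<in>UNIV. xJ j * xJ j)" by (subst inner_vec_def) simp
  also have "\<dots> = x0 \<bullet> J ?x" by (subst linear_ax[OF J]) (simp add: inner_sum_right)
  also have "\<dots> \<le> norm x0 * norm (J ?x)" using norm_cauchy_schwarz by blast
  also have "norm (J ?x) = norm ?x" by (simp add: norm_eq_sqrt_inner JJ)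
  finally have x: "norm ?x \<le> norm x0" by (cases "norm ?x = 0") (auto simp: mult_le_cancel_right)
  have "fd (eta F) 0 v = 2 * Q 0 * (\<Sum>k\<in>UNIV. v $ k * pd k Q 0)"
    by (simp add: fd_eta[OF zero] jet_et sum_distrib_left mult_ac)
  also have "(\<Sum>k\<in>UNIV. v $ k * pd k Q 0) = - (1/2) * hf 0 v ?x"
    by (simp add: jet_Q(1) hf_def hess_def sum_distrib_left sum_negf mult_ac)
  finally have 1: "\<bar>fd (eta F) 0 v\<bar> = \<bar>Q 0\<bar> * \<bar>hf 0 v ?x\<bar>" by (simp add: abs_mult)
  have "(hf 0 v ?x)\<^sup>2 \<le> (\<bar>Q 0\<bar> * (norm v * norm ?x))\<^sup>2"
    using hf_zero_bound[of v ?x] h2_Q by (simp add: power_mult_distrib power2_norm_eq_inner power2_eq_square[of "Q 0"])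
  then have "\<bar>hf 0 v ?x\<bar> \<le> \<bar>Q 0\<bar> * (norm v * norm ?x)"
    by (metis abs_le_square_iff abs_of_nonneg abs_ge_zero mult_nonneg_nonneg norm_ge_zero)
  also have "\<dots> \<le> \<bar>Q 0\<bar> * (norm v * norm x0)" using x by (intro mult_left_mono) auto
  finally have "\<bar>fd (eta F) 0 v\<bar> \<le> \<bar>Q 0\<bar> * (\<bar>Q 0\<bar> * (norm v * norm x0))"
    unfolding 1 by (intro mult_left_mono) auto
  moreover have "norm (fd F 0 v) = norm v"
    using inner_fd_F[OF zero, of v v] jet_phi by (simp add: norm_eq_sqrt_inner grad_def inner_vec_def)
  moreover have "F 0 = x0" by (simp add: F_def linear_0[OF J] phi0)
  moreover have "eta F 0 = \<bar>Q 0\<bar> * \<bar>Q 0\<bar>" using eta_et[OF zero] by (simp add: jet_et)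
  ultimately show ?thesis by (simp add: mult_ac)
qed

text \<open>If the gradient of \<open>H\<^sup>2\<close> vanishes at \<open>0\<close>, then its Hessian takes over its role, since its trace
  there is negative.\<close>

lemma rank_one:
  assumes Q0: "Q 0 \<noteq> 0"
    and prp: "\<And>y v v1 z. y \<in> V \<Longrightarrow> fd (eta F) y v *\<^sub>R second_ff F y v1 z = fd (eta F) y v1 *\<^sub>R second_ff F y v z"
  shows "h i j * h p l = h i l * h p j"
proof -
  have k: "pd k et y * pd i (pd j \<phi>) y = pd i et y * pd k (pd j \<phi>) y" if y: "y \<in> V" for y k i j
  proof -
    have "fd (eta F) y (ax i) = pd i et y" for i
      using fd_eta[OF y, of "ax i"] by (simp add: axis_def if_distrib[of "\<lambda>x. x * _"] cong: if_cong)
    then show ?thesis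
      using prp[OF y, of "ax k" "ax i" "ax j"] w_pos(3)[of y] N_nonzero[of y]
      by (simp add: second_ff_F_ax[OF y] hess_def)
  qed
  show ?thesis
  proof (cases "\<exists>k. pd k et 0 \<noteq> 0")
    case True
    then show ?thesis using rank_one_if_proportional[of h "\<lambda>k. pd k et 0", OF h_sym] k[OF zero] by blast
  next
    case False
    then have e0: "pd k et 0 = 0" for k by simp
    then have Q1: "pd k Q 0 = 0" for k using jet_et(2)[of k] Q0 by simp
    \<comment> \<open>At a critical point of \<open>et\<close> the differentiated proportionality
      loses the third derivatives of \<open>\<phi>\<close>. Each row of the Hessian of
      \<open>et\<close> then plays the role of the gradient; the row of a nonzero diagonal entry is
      taken at the end.\<close>
    have kk: "pd p (pd k et) 0 * h i j = pd p (pd i et) 0 * h k j" for p k i j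
    proof -
      have "pd p (\<lambda>y. pd k et y * pd i (pd j \<phi>) y) 0 = pd p (\<lambda>y. pd i et y * pd k (pd j \<phi>) y) 0"
        by (rule pd_cong[OF zero k])
      then show ?thesis by (simp add: pd_mult smooth_pd smooth_et smooths zero e0)
    qed
    have "(\<Sum>k\<in>UNIV. pd k (pd k Q) 0) = (\<Sum>k\<in>UNIV. - (1/2) * h k k + - (1/2) * (\<Sum>j\<in>UNIV. xJ j * t j k k))"
    proof (intro sum.cong refl)
      fix k
      have "(\<Sum>l\<in>UNIV. xJ l * t k k l) = (\<Sum>l\<in>UNIV. xJ l * t l k k)" using t_sym by metis
      then show "pd k (pd k Q) 0 = - (1/2) * h k k + - (1/2) * (\<Sum>j\<in>UNIV. xJ j * t j k k)"
        unfolding jet_Q(2) by (simp add: algebra_simps)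
    qed
    also have "\<dots> = - (1/2) * Q 0"
      using t_proportional[OF Q0] Q1 by (simp add: Q_trace(1) sum_distrib_left sum_negf)
    finally have translate: "(\<Sum>k\<in>UNIV. pd k (pd k Q) 0) = - (1/2) * Q 0" .
    have "pd k (pd k et) 0 + Q 0 * Q 0 * (2 * (\<Sum>i\<in>UNIV. h k i * h k i)) = 2 * Q 0 * pd k (pd k Q) 0" for k
      using jet_et(3)[of k k] by (simp add: Q1)
    then have "(\<Sum>k\<in>UNIV. pd k (pd k et) 0 + Q 0 * Q 0 * (2 * (\<Sum>i\<in>UNIV. h k i * h k i))) = 2 * Q 0 * (\<Sum>k\<in>UNIV. pd k (pd k Q) 0)"
      by (simp only: sum_distrib_left)
    then have "(\<Sum>k\<in>UNIV. pd k (pd k et) 0) + Q 0 * Q 0 * (2 * h2) = 2 * Q 0 * (- (1/2) * Q 0)"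
      unfolding translate sum.distrib sum_distrib_left[symmetric] .
    then have "(\<Sum>k\<in>UNIV. pd k (pd k et) 0) = - (Q 0 * Q 0) - 2 * (h2 * h2)" unfolding h2_Q by (simp add: algebra_simps)
    also have "\<dots> < 0" using Q0 by (smt (verit) not_real_square_gt_zero zero_le_square)
    finally have "(\<Sum>k\<in>UNIV. pd k (pd k et) 0) \<noteq> 0" by simp
    then obtain p where "pd p (pd p et) 0 \<noteq> 0" by (meson sum.neutral)
    then show ?thesis using rank_one_if_proportional[of h "\<lambda>k. pd p (pd k et) 0", OF h_sym] kk by blast
  qed
qed

end

section \<open>The function \<open>psi\<close> on a graph\<close>

definition om :: "real^'m \<Rightarrow> real^'n" where "om x = (\<chi> i. x \<bullet> J (ax i))"
text \<open>\<open>uu x\<close> is \<open>sqrt w\<close> times the normal component of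
  \<open>x\<close>, and \<open>Xc x\<close> gives the coordinates of the tangential part of
  \<open>x\<close> with respect to the graph; at \<open>0\<close> these are
  \<open>om x\<close>.\<close>

definition uu :: "real^'m \<Rightarrow> real^'n \<Rightarrow> real" where
  "uu x y = x \<bullet> N0 - (\<Sum>i\<in>UNIV. pd i \<phi> y * (x \<bullet> J (ax i)))"
definition Xc :: "real^'m \<Rightarrow> 'n \<Rightarrow> real^'n \<Rightarrow> real" where
  "Xc x i y = x \<bullet> J (ax i) + uu x y * iw y * pd i \<phi> y"

lemma om_inner: "om x \<bullet> v = (\<Sum>i\<in>UNIV. om x $ i * v $ i)"
  by (simp add: inner_vec_def)

lemma inner_J: "x \<bullet> J v = om x \<bullet> v"
  unfolding om_inner by (subst linear_ax[OF J]) (simp add: inner_sum_right om_def mult.commute)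

text \<open>The roots cancel: with respect to \<open>N\<close>, the second fundamental form is the
  Hessian over \<open>sqrt w\<close>, the mean curvature vector is \<open>Q / sqrt w\<close>, and
  \<open>eta\<close> is \<open>Q * Q / w\<close>. At zeros of \<open>Q\<close> both sides agree
  because a quotient by zero is zero.\<close>

lemma psi_F:
  assumes y: "y \<in> V"
  shows "psi F x y = uu x y * uu x y * iw y + (\<Sum>i\<in>UNIV. \<Sum>j\<in>UNIV. Xc x i y * Xc x j y * pd i (pd j \<phi>) y) * inverse (Q y)"
proof -
  let ?X = "(\<chi> i. Xc x i y) :: real^'n"
  have w: "w y > 0" by (rule w_pos)
  have uu: "uu x y = x \<bullet> N0 - om x \<bullet> grad y"
    by (simp add: uu_def om_def grad_def inner_vec_def mult.commute)
  have X: "?X = om x + (uu x y / w y) *\<^sub>R grad y"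
    by (simp add: vec_eq_iff Xc_def om_def grad_def iw_def divide_inverse)
  have "x \<bullet> N y = uu x y / sqrt (w y)"
    by (simp add: N_def inner_diff_right inner_J uu divide_inverse)
  moreover have "inverse (sqrt (w y)) * inverse (sqrt (w y)) = inverse (w y)"
    by (metis inverse_mult_distrib w_pos(4))
  ultimately have n: "(norm (normal_part F y x))\<^sup>2 = uu x y * uu x y * iw y"
    using N_unit[of y] w
    by (simp add: normal_part_F[OF y] norm_eq_1[symmetric] iw_def divide_inverse power2_eq_square)
  have tc: "tangent_coord F y x = ?X"
  proof (rule tangent_coord_eq[OF immersion_onD(4,3)[OF immersion_F y]])
    fix v
    have "x \<bullet> fd F y v = om x \<bullet> v + (grad y \<bullet> v) * (x \<bullet> N0)"
      by (simp add: fd_F[OF y] inner_add_right inner_J)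
    moreover have "fd F y ?X \<bullet> fd F y v = om x \<bullet> v + uu x y / w y * (grad y \<bullet> v) + (grad y \<bullet> om x + uu x y / w y * (w y - 1)) * (grad y \<bullet> v)"
      unfolding inner_fd_F[OF y] X by (simp add: inner_add_left inner_add_right w_grad)
    moreover have "\<dots> = om x \<bullet> v + (grad y \<bullet> om x + uu x y) * (grad y \<bullet> v)"
      using w by (simp add: field_simps)
    ultimately show "(x - fd F y ?X) \<bullet> fd F y v = 0"
      unfolding inner_diff_left by (simp add: uu inner_commute algebra_simps)
  qed
  have "second_ff F y ?X ?X \<bullet> mean_curvature_vector F y / eta F y = hf y ?X ?X * inverse (Q y)"
    using N_unit[of y] w eta_et[OF y]
    by (simp add: second_ff_F[OF y] mean_curvature_Q[OF y] et_def field_simps)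
  moreover have "hf y ?X ?X = (\<Sum>i\<in>UNIV. \<Sum>j\<in>UNIV. Xc x i y * Xc x j y * pd i (pd j \<phi>) y)"
    by (simp add: hf_def hess_def)
  ultimately show ?thesis unfolding psi_def n tc by simp
qed

lemma smooth_uu: "smooth_on V (uu x)" and smooth_Xc: "smooth_on V (Xc x i)"
proof -
  show u: "smooth_on V (uu x)" unfolding uu_def[abs_def]
    by (intro smooth_diff smooth_const smooth_sum smooth_mult smooths)
  show "smooth_on V (Xc x i)" unfolding Xc_def[abs_def]
    by (intro smooth_add smooth_const smooth_mult smooths u smooth_iw)
qed

lemma jet_uu: "uu x 0 = x \<bullet> N0" "pd k (uu x) 0 = - (\<Sum>i\<in>UNIV. h k i * (x \<bullet> J (ax i)))"
  unfolding uu_def[abs_def]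
  by (simp_all add: jet_phi pd_diff smooth_const smooth_sum smooth_mult smooths zero pd_const pd_sum pd_mult)

lemma jet_Xc: "Xc x i 0 = x \<bullet> J (ax i)" "pd k (Xc x i) 0 = (x \<bullet> N0) * h k i"
  unfolding Xc_def[abs_def]
  by (simp_all add: jet_phi pd_add smooth_const smooth_mult smooths smooth_uu smooth_iw zero pd_const pd_mult jet_uu jet_iw)

lemma psi_zero: "psi F x 0 = (x \<bullet> N0)\<^sup>2 + (\<Sum>i\<in>UNIV. \<Sum>j\<in>UNIV. om x $ i * om x $ j * h i j) / Q 0"
  by (simp add: psi_F[OF zero] jet_uu jet_iw jet_Xc om_def power2_eq_square divide_inverse)

text \<open>A symmetric matrix of rank one satisfies \<open>h^2 = tr(h) h\<close>, and its trace is
  \<open>Q 0\<close>.\<close>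

lemma rank_one_square:
  assumes "\<And>i j p l. h i j * h p l = h i l * h p j"
  shows "(\<Sum>i\<in>UNIV. h k i * h i j) = Q 0 * h k j"
proof -
  have "(\<Sum>i\<in>UNIV. h k i * h i j) = (\<Sum>i\<in>UNIV. h i i * h k j)"
    by (intro sum.cong refl) (metis assms h_sym)
  then show ?thesis by (simp add: Q_trace(1) sum_distrib_right)
qed

text \<open>Two cancellations. With \<open>b\<close> the normal component of \<open>x\<close>, the
  squared normal part contributes \<open>- 2 b h(e_k, x)\<close>, and the change of the tangential
  part contributes \<open>2 b h^2(e_k, x) / Q\<close>, which is its negative since
  \<open>h^2 = Q h\<close>. The derivative of the tensor \<open>h / Q\<close> vanishes by
  \<open>t_proportional\<close>. Geometrically, the plane of the normal and the direction of
  \<open>A\<close> is parallel.\<close>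

lemma psi_derivative_zero:
  assumes s0: "s = 0"
    and rk: "Q 0 \<noteq> 0 \<Longrightarrow> (\<And>i j p l. h i j * h p l = h i l * h p j)"
    and Q: "Q 0 = 0 \<Longrightarrow> (\<And>y. y \<in> V \<Longrightarrow> Q y = 0)"
  shows "(psi F x has_derivative (\<lambda>v. 0)) (at 0)"
proof -
  \<comment> \<open>If \<open>Q 0\<close> is nonzero, \<open>V\<close> is shrunk to where
    \<open>Q\<close> has an inverse. Otherwise \<open>Q\<close> vanishes on \<open>V\<close> by
    assumption, and its inverse there is the constant \<open>0\<close>.\<close>
  define V' where "V' = (if Q 0 = 0 then V else V \<inter> Q -` (- {0}))"
  define iQ where "iQ y = inverse (Q y)" for y
  have V': "open V'" "0 \<in> V'" "V' \<subseteq> V"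
    unfolding V'_def using zero V continuous_open_preimage[OF smooth_on_continuous[OF smooths(5)] V, of "- {0}"] by auto
  interpret V': open_domain V' by standard (rule V')
  have sub: "smooth_on V f \<Longrightarrow> smooth_on V' f" for f :: "real^'n \<Rightarrow> real" using smooth_on_subset V' by blast
  have iQ: "smooth_on V' iQ"
  proof (cases "Q 0 = 0")
    case True
    then have "iQ y = 0" if "y \<in> V'" for y using Q[OF True, of y] V' that by (auto simp: iQ_def)
    then show ?thesis using smooth_on_cong[OF V'(1), of iQ "\<lambda>y. 0"] smooth_on_const by metis
  next
    case False
    then have "Q y \<noteq> 0" if "y \<in> V'" for y using that by (simp add: V'_def)
    then show ?thesis unfolding iQ_def[abs_def] smooth_on_def
      using Ck_on_inverse[OF V'(1)] smooth_onD[OF sub[OF smooths(5)]] by blast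
  qed
  define S where "S y = (\<Sum>i\<in>UNIV. \<Sum>j\<in>UNIV. Xc x i y * Xc x j y * pd i (pd j \<phi>) y)" for y
  define P where "P y = uu x y * uu x y * iw y + S y * iQ y" for y
  have sS0: "smooth_on V (\<lambda>y. Xc x i y * Xc x j y * pd i (pd j \<phi>) y)" for i j
    by (intro smooth_mult smooth_Xc smooths)
  have sS: "smooth_on V S" unfolding S_def[abs_def] by (intro smooth_sum sS0)
  have sP: "smooth_on V' P" unfolding P_def[abs_def]
    by (intro V'.smooth_add V'.smooth_mult sub[OF smooth_uu] sub[OF smooth_iw] sub[OF sS] iQ)
  define om' where "om' i = x \<bullet> J (ax i)" for i
  define b where "b = x \<bullet> N0"
  have "pd k P 0 = 0" for k
  proof -
    have pS: "pd k S 0 = (\<Sum>i\<in>UNIV. \<Sum>j\<in>UNIV. (b * h k i * om' j + om' i * (b * h k j)) * h i j + om' i * om' j * t k i j)"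
      unfolding S_def[abs_def]
      by (simp add: pd_sum smooth_sum smooth_mult sS0 pd_mult smooth_Xc smooths zero jet_Xc om'_def b_def)
    have S0: "S 0 = (\<Sum>i\<in>UNIV. \<Sum>j\<in>UNIV. om' i * om' j * h i j)" by (simp add: S_def jet_Xc om'_def)
    have pP: "pd k P 0 = - 2 * b * (\<Sum>i\<in>UNIV. h k i * om' i) + pd k S 0 * iQ 0 + S 0 * pd k iQ 0"
      unfolding P_def[abs_def]
      by (simp add: V'.pd_add V'.pd_mult V'.smooth_add V'.smooth_mult V' sub smooth_uu smooth_iw sS iQ jet_uu jet_iw b_def om'_def)
    show ?thesis
    proof (cases "Q 0 = 0")
      case True
      \<comment> \<open>For \<open>s = 0\<close> the squared norm of the Hessian is
        \<open>Q 0 * Q 0\<close>, so at a zero of \<open>H\<close> the whole Hessian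
        vanishes.\<close>
      have "h2 = 0" using h2_Q[OF s0] True by simp
      then have "(\<Sum>j\<in>UNIV. h i j * h i j) = 0" for i
        by (subst (asm) sum_nonneg_eq_0_iff) (auto intro!: sum_nonneg)
      then have h0: "h i j = 0" for i j
        by (subst (asm) sum_nonneg_eq_0_iff) auto
      then show ?thesis unfolding pP S0 using True by (simp add: iQ_def)
    next
      case False
      note rk = rk[OF False]
      have "pd k (\<lambda>y. iQ y * Q y) 0 = pd k (\<lambda>y. 1) 0"
        by (rule V'.pd_cong[OF V'(2)]) (simp add: iQ_def V'_def False)
      then have piQ: "pd k iQ 0 = - (pd k Q 0 / Q 0) * iQ 0"
        unfolding V'.pd_mult[OF iQ sub[OF smooths(5)] V'(2)] pd_const using False by (simp add: iQ_def field_simps)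
      have "pd k S 0 = (\<Sum>i\<in>UNIV. \<Sum>j\<in>UNIV. b * (om' j * (h k i * h i j))) + (\<Sum>i\<in>UNIV. \<Sum>j\<in>UNIV. b * (om' i * (h k j * h j i)))
          + (\<Sum>i\<in>UNIV. \<Sum>j\<in>UNIV. pd k Q 0 / Q 0 * (om' i * om' j * h i j))"
        unfolding pS sum.distrib[symmetric]
        by (intro sum.cong refl) (subst t_proportional[OF s0 False], subst (8) h_sym, simp add: algebra_simps)
      also have "(\<Sum>i\<in>UNIV. \<Sum>j\<in>UNIV. b * (om' i * (h k j * h j i))) = (\<Sum>i\<in>UNIV. b * (om' i * (Q 0 * h k i)))"
        unfolding sum_distrib_left[symmetric] rank_one_square[OF rk] ..
      also have "(\<Sum>i\<in>UNIV. \<Sum>j\<in>UNIV. b * (om' j * (h k i * h i j))) = (\<Sum>j\<in>UNIV. \<Sum>i\<in>UNIV. b * (om' j * (h k i * h i j)))"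
        by (rule sum.swap)
      also have "\<dots> = (\<Sum>i\<in>UNIV. b * (om' i * (Q 0 * h k i)))"
        unfolding sum_distrib_left[symmetric] rank_one_square[OF rk] ..
      also have "(\<Sum>i\<in>UNIV. \<Sum>j\<in>UNIV. pd k Q 0 / Q 0 * (om' i * om' j * h i j)) = pd k Q 0 / Q 0 * S 0"
        unfolding S0 sum_distrib_left[symmetric] ..
      also have "(\<Sum>i\<in>UNIV. b * (om' i * (Q 0 * h k i))) = b * Q 0 * (\<Sum>i\<in>UNIV. h k i * om' i)"
        by (simp add: sum_distrib_left mult_ac)
      finally have "pd k S 0 = 2 * b * Q 0 * (\<Sum>i\<in>UNIV. h k i * om' i) + pd k Q 0 / Q 0 * S 0" by simp
      then show ?thesis unfolding pP piQ using False by (simp add: iQ_def field_simps)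
    qed
  qed
  then have "fd P 0 v = 0" for v
    using linear_ax[OF has_derivative_linear[OF smooth_on_has_derivative[OF sP V'(2)]], of v] by (simp add: pd_def)
  then have "fd P 0 = (\<lambda>v. 0)" by blast
  then have "(P has_derivative (\<lambda>v. 0)) (at 0)" using smooth_on_has_derivative[OF sP V'(2)] by simp
  moreover have "P y = psi F x y" if "y \<in> V" for y
    by (simp add: psi_F[OF that] P_def S_def iQ_def)
  ultimately show ?thesis using has_derivative_transform_within_open[OF _ V zero, of P] by blast
qed

text \<open>\<open>h^2 = Q h\<close> turns \<open>h(x, x) / Q\<close> into
  \<open>|h x|^2 / Q^2\<close>; in this form the zeros of \<open>psi\<close> can be read
  off.\<close>

lemma psi_sum_squares:
  assumes s0: "s = 0" and rk: "Q 0 \<noteq> 0 \<Longrightarrow> (\<And>i j p l. h i j * h p l = h i l * h p j)"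
  shows "psi F x 0 = (x \<bullet> N0)\<^sup>2 + (\<Sum>k\<in>UNIV. (\<Sum>i\<in>UNIV. h k i * om x $ i)\<^sup>2) / (Q 0)\<^sup>2"
proof (cases "Q 0 = 0")
  case False
  have "(\<Sum>k\<in>UNIV. (\<Sum>i\<in>UNIV. h k i * om x $ i)\<^sup>2) = (\<Sum>k\<in>UNIV. \<Sum>i\<in>UNIV. \<Sum>j\<in>UNIV. om x $ i * om x $ j * (h i k * h k j))"
    unfolding power2_eq_square sum_product
    by (intro sum.cong refl) (subst h_sym, simp only: mult_ac)
  also have "\<dots> = (\<Sum>i\<in>UNIV. \<Sum>j\<in>UNIV. \<Sum>k\<in>UNIV. om x $ i * om x $ j * (h i k * h k j))"
    by (subst sum.swap) (intro sum.cong refl sum.swap)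
  also have "\<dots> = Q 0 * (\<Sum>i\<in>UNIV. \<Sum>j\<in>UNIV. om x $ i * om x $ j * h i j)"
    unfolding sum_distrib_left[symmetric] rank_one_square[OF rk[OF False]]
    unfolding sum_distrib_left by (simp add: mult_ac)
  finally show ?thesis using False by (simp add: psi_zero power2_eq_square)
qed (simp add: psi_zero)

lemma psi_zero_tangent:
  assumes "s = 0" "Q 0 \<noteq> 0 \<Longrightarrow> (\<And>i j p l. h i j * h p l = h i l * h p j)" "psi F x 0 = 0"
  shows "x \<in> tangent_space F 0"
proof -
  have "(x \<bullet> N0)\<^sup>2 + (\<Sum>k\<in>UNIV. (\<Sum>i\<in>UNIV. h k i * om x $ i)\<^sup>2) / (Q 0)\<^sup>2 = 0"
    using psi_sum_squares[OF assms(1,2)] assms(3) by simp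
  moreover have "(\<Sum>k\<in>UNIV. (\<Sum>i\<in>UNIV. h k i * om x $ i)\<^sup>2) / (Q 0)\<^sup>2 \<ge> 0" by (simp add: sum_nonneg)
  ultimately have "x \<bullet> N0 = 0" by (smt (verit) zero_le_power2 zero_eq_power2)
  moreover have "N 0 = N0" by (simp add: N_def jet_w grad_def jet_phi linear_0[OF J] flip: zero_vec_def)
  ultimately show ?thesis using tangent_space_F[OF zero] by simp
qed

text \<open>Besides \<open>N0\<close>, one row of \<open>h\<close> with a nonzero diagonal entry
  suffices, as rank one makes every other row a multiple of it; such a row exists when the trace
  \<open>Q 0\<close> is nonzero. If \<open>Q 0 = 0\<close>, only the condition from
  \<open>N0\<close> remains.\<close>

lemma psi_zero_exists:
  assumes s0: "s = 0" and rk: "Q 0 \<noteq> 0 \<Longrightarrow> (\<And>i j p l. h i j * h p l = h i l * h p j)"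
  shows "\<exists>b1 b2. \<forall>x. x \<bullet> b1 = 0 \<and> x \<bullet> b2 = 0 \<longrightarrow> psi F x 0 = 0"
proof (cases "Q 0 = 0")
  case True
  then show ?thesis by (intro exI[of _ N0]) (simp add: psi_zero)
next
  case False
  then obtain p where p: "h p p \<noteq> 0" unfolding Q_trace(1) by (meson sum.neutral)
  have "psi F x 0 = 0" if x: "x \<bullet> N0 = 0" "x \<bullet> J (\<chi> i. h p i) = 0" for x
  proof -
    have z: "(\<Sum>i\<in>UNIV. h p i * om x $ i) = 0" using x(2) unfolding inner_J om_inner by (simp add: mult.commute)
    have "h p p * (\<Sum>i\<in>UNIV. h k i * om x $ i) = (\<Sum>i\<in>UNIV. h k p * (h p i * om x $ i))" for k
      unfolding sum_distrib_left using rk[OF False] by (intro sum.cong refl) (metis mult.assoc mult.commute)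
    then have "h p p * (\<Sum>i\<in>UNIV. h k i * om x $ i) = 0" for k using z by (simp add: sum_distrib_left[symmetric])
    then have "(\<Sum>i\<in>UNIV. h k i * om x $ i) = 0" for k using p by simp
    then show ?thesis using psi_sum_squares[OF s0 rk] x(1) by simp
  qed
  then show ?thesis by blast
qed

end

section \<open>Constancy of the flat directions\<close>

text \<open>All these quantities depend only on the germ of the map, which lets a chart be replaced
  by the graph that it coincides with after a change of coordinates.\<close>

lemma geometry_cong:
  fixes f f' :: "real^'n::finite \<Rightarrow> real^'m::finite"
  assumes V: "open V" and y: "y \<in> V" and eq: "\<forall>z\<in>V. f z = f' z"
  shows "fd f y = fd f' y" "tangent_space f y = tangent_space f' y" "normal_part f y = normal_part f' y"
    "second_ff f y = second_ff f' y" "mean_curvature_vector f y = mean_curvature_vector f' y"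
    "second_ff_norm_sq f y = second_ff_norm_sq f' y" "scalar_curvature f y = scalar_curvature f' y"
    "eta f y = eta f' y" "psi f x y = psi f' x y"
proof -
  have d: "fd f z = fd f' z" if "z \<in> V" for z using fd_cong[OF V that] eq by blast
  show 1: "fd f y = fd f' y" by (rule d[OF y])
  show 2: "tangent_space f y = tangent_space f' y" unfolding tangent_space_def 1 ..
  show 3: "normal_part f y = normal_part f' y" by (intro ext) (simp add: normal_part_def 2)
  show 4: "second_ff f y = second_ff f' y"
  proof (intro ext)
    fix v w
    have "fd (\<lambda>x. fd f x w) y = fd (\<lambda>x. fd f' x w) y" by (rule fd_cong[OF V y]) (simp add: d)
    then show "second_ff f y v w = second_ff f' y v w" by (simp add: second_ff_def 3)
  qed
  have 5: "inverse_metric f y = inverse_metric f' y" by (simp add: inverse_metric_def induced_metric_def 1)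
  show 6: "mean_curvature_vector f y = mean_curvature_vector f' y" by (simp add: mean_curvature_vector_def 4 5)
  show 7: "second_ff_norm_sq f y = second_ff_norm_sq f' y" by (simp add: second_ff_norm_sq_def 4 5)
  show "scalar_curvature f y = scalar_curvature f' y" by (simp add: scalar_curvature_def 6 7)
  show 8: "eta f y = eta f' y" by (simp add: eta_def 6)
  show "psi f x y = psi f' x y" by (simp add: psi_def 3 4 6 8 tangent_coord_def 1)
qed

lemma immersion_on_cong:
  assumes "immersion_on V f" "\<And>z. z \<in> V \<Longrightarrow> f z = f' z"
  shows "immersion_on V f'"
  using assms smooth_on_cong[of V f f'] fd_cong[of V _ f f'] unfolding immersion_on_def by metis

lemma isometry_inner:
  fixes J :: "'a::real_inner \<Rightarrow> 'b::real_inner"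
  assumes "linear J" "\<And>v. norm (J v) = norm v"
  shows "J v \<bullet> J w = v \<bullet> w"
  using assms by (simp add: dot_norm linear_add[symmetric])

text \<open>The inverse function theorem applied to the tangential component of
  \<open>f - f u0\<close> gives the coordinates of the graph; the component along \<open>N0\<close>
  becomes \<open>\<phi>\<close>. The smooth inverse \<open>r\<close> of \<open>g\<close> is returned
  so that functions on the graph can be differentiated as functions on the chart.\<close>

lemma graph_chart_exists:
  fixes f :: "real^'n::finite \<Rightarrow> real^'m::finite"
  assumes I: "immersion_on D f" and u0: "u0 \<in> D" and card: "CARD('m) = CARD('n) + 1"
    and J: "linear J" "\<And>v w. J v \<bullet> J w = v \<bullet> w" "range J = tangent_space f u0"
    and N0: "N0 \<bullet> N0 = 1" "tangent_space f u0 = {w. w \<bullet> N0 = 0}"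
  obtains V \<phi> g U r where "graph V J N0 \<phi>" "reparam V g D" "g 0 = u0"
    "\<And>y. y \<in> V \<Longrightarrow> f (g y) = f u0 + J y + \<phi> y *\<^sub>R N0"
    "open U" "U \<subseteq> D" "u0 \<in> U" "homeomorphism V U g r" "smooth_on U r"
proof -
  note ID = immersion_onD[OF I]
  define Jt where "Jt w = (\<chi> i. w \<bullet> J (ax i))" for w :: "real^'m"
  have Jt: "linear Jt" by (intro linearI) (simp_all add: Jt_def vec_eq_iff inner_add_left)
  have blJt: "bounded_linear Jt" using Jt linear_conv_bounded_linear by blast
  have JtJ: "Jt (J v) = v" for v by (simp add: Jt_def J vec_eq_iff inner_axis)
  have JN: "J v \<bullet> N0 = 0" for v using N0(2) J(3) by blast
  have JtN: "Jt N0 = 0" using JN by (simp add: Jt_def vec_eq_iff inner_commute)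
  define h where "h u = Jt (f u - f u0)" for u
  have sdf: "smooth_on D (\<lambda>u. f u - f u0)"
    using smooth_on_add[OF ID(1,2) smooth_on_const[of D "- f u0"]] by simp
  have sh: "smooth_on D h" unfolding h_def[abs_def] by (rule smooth_on_linear_compose[OF blJt ID(1) sdf])
  have dh: "fd h u = (\<lambda>v. Jt (fd f u v))" if "u \<in> D" for u
    unfolding h_def[abs_def]
    by (intro fd_eq bounded_linear.has_derivative[OF blJt]) (auto intro!: derivative_eq_intros ID(5) that)
  have "inj (fd h u0)"
  proof (rule injI)
    fix a b assume "fd h u0 a = fd h u0 b"
    then have e: "Jt (fd f u0 a) = Jt (fd f u0 b)" by (simp add: dh[OF u0])
    have "fd f u0 a \<in> range J" "fd f u0 b \<in> range J" unfolding J(3) tangent_space_def by auto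
    then have "fd f u0 a = fd f u0 b" using e JtJ by (metis imageE)
    then show "a = b" using ID(3)[OF u0] by (simp add: inj_eq)
  qed
  then obtain U V g where G: "open U" "U \<subseteq> D" "u0 \<in> U" "open V" "h u0 \<in> V" "homeomorphism U V h g"
    "smooth_on V g" "\<And>y. y \<in> V \<Longrightarrow> bij (fd h (g y)) \<and> (g has_derivative inv (fd h (g y))) (at y)"
    using smooth_inverse_function[OF ID(1) sh u0] by metis
  have h0: "h u0 = 0" by (simp add: h_def linear_0[OF Jt])
  have zV: "0 \<in> V" and g0: "g 0 = u0" using G(3,5,6) h0 by (auto simp: homeomorphism_def)
  have gD: "g y \<in> D" if "y \<in> V" for y using that G(2,6) by (auto simp: homeomorphism_def)
  have hg: "h (g y) = y" if "y \<in> V" for y using that G(6) by (auto simp: homeomorphism_def)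
  have bg: "bij (fd g y)" if "y \<in> V" for y
  proof -
    have "fd g y = inv (fd h (g y))" using G(8)[OF that] fd_eq by blast
    then show ?thesis using G(8)[OF that] bij_imp_bij_inv by metis
  qed
  have R: "reparam V g D" unfolding reparam_def using G(4,7) gD bg by auto
  define \<phi> where "\<phi> y = (f (g y) - f u0) \<bullet> N0" for y
  have eq: "f (g y) = f u0 + J y + \<phi> y *\<^sub>R N0" if "y \<in> V" for y
  proof -
    let ?w = "f (g y) - f u0"
    have "?w - (?w \<bullet> N0) *\<^sub>R N0 \<in> range J" unfolding J(3) N0(2) using N0(1) by (simp add: inner_diff_left)
    then obtain v where v: "?w - (?w \<bullet> N0) *\<^sub>R N0 = J v" by blast
    then have "v = Jt (?w - (?w \<bullet> N0) *\<^sub>R N0)" using JtJ by simp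
    also have "\<dots> = h (g y)" by (simp add: linear_diff[OF Jt] linear_scale[OF Jt] JtN h_def)
    finally have "v = y" using hg[OF that] by simp
    then show ?thesis using v by (simp add: \<phi>_def algebra_simps)
  qed
  have s\<phi>: "smooth_on V \<phi>" unfolding \<phi>_def[abs_def]
    by (rule smooth_on_linear_compose[OF bounded_linear_inner_left G(4)])
       (use smooth_on_compose[OF G(4) ID(1) _ G(7) sdf] gD in blast)
  have "fd \<phi> 0 v = 0" for v
  proof -
    have "(\<phi> has_derivative (\<lambda>v. fd f (g 0) (fd g 0 v) \<bullet> N0)) (at 0)"
      unfolding \<phi>_def[abs_def]
      by (intro bounded_linear.has_derivative[OF bounded_linear_inner_left])
        (auto intro!: derivative_eq_intros has_derivative_compose[OF smooth_on_has_derivative[OF G(7) zV] ID(5)[OF gD[OF zV]]])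
    then have "fd \<phi> 0 v = fd f u0 (fd g 0 v) \<bullet> N0" using fd_eq g0 by metis
    moreover have "fd f u0 (fd g 0 v) \<in> {w. w \<bullet> N0 = 0}" unfolding N0(2)[symmetric] tangent_space_def by blast
    ultimately show ?thesis by simp
  qed
  then have "graph V J N0 \<phi>"
    by unfold_locales (use G(4) zV s\<phi> J(1,2) JN N0(1) card in \<open>auto simp: \<phi>_def g0 linear_add linear_scale\<close>)
  moreover have "homeomorphism V U g h" using G(6) homeomorphism_symD by blast
  moreover have "smooth_on U h" using smooth_on_subset[OF sh G(2)] .
  ultimately show thesis using that R g0 eq G(1-3) by blast
qed

definition expander_chart :: "(real^'n::finite) set \<Rightarrow> (real^'n \<Rightarrow> real^'m::finite) \<Rightarrow> real \<Rightarrow> bool" where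
  "expander_chart D f s \<longleftrightarrow> immersion_on D f \<and>
     (\<forall>u\<in>D. mean_curvature_vector f u = (1/2) *\<^sub>R normal_part f u (f u) \<and> scalar_curvature f u = s)"

lemma expander_chart_reparam:
  fixes f :: "real^'n::finite \<Rightarrow> real^'m::finite"
  assumes "expander_chart D f s" "reparam V g D" "CARD('m) = CARD('n) + 1"
  shows "expander_chart V (f \<circ> g) s"
proof -
  have I: "immersion_on D f" using assms(1) by (simp add: expander_chart_def)
  show ?thesis
    unfolding expander_chart_def
  proof (intro conjI ballI)
    show "immersion_on V (f \<circ> g)" by (rule immersion_reparam[OF I assms(2)])
    fix y assume y: "y \<in> V"
    note m = mean_curvature_reparam[OF I assms(2) y assms(3)] normal_part_reparam[OF I assms(2) y]
    show "mean_curvature_vector (f \<circ> g) y = (1/2) *\<^sub>R normal_part (f \<circ> g) y ((f \<circ> g) y)"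
      "scalar_curvature (f \<circ> g) y = s"
      unfolding scalar_curvature_def m comp_apply
      using assms(1) reparam_props(1)[OF I assms(2) y]
      by (auto simp: expander_chart_def scalar_curvature_def)
  qed
qed

lemma expander_chart_cong:
  fixes f :: "real^'n::finite \<Rightarrow> real^'m::finite"
  assumes "expander_chart V f s" "\<And>z. z \<in> V \<Longrightarrow> f z = f' z"
  shows "expander_chart V f' s"
proof -
  have V: "open V" "immersion_on V f" using assms(1) by (auto simp: expander_chart_def immersion_on_def)
  have "\<forall>z\<in>V. f z = f' z" using assms(2) by blast
  note c = geometry_cong[OF V(1) _ this]
  show ?thesis unfolding expander_chart_def
  proof (intro conjI ballI)
    show "immersion_on V f'" by (rule immersion_on_cong[OF V(2) assms(2)])
    fix u assume u: "u \<in> V"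
    show "mean_curvature_vector f' u = (1/2) *\<^sub>R normal_part f' u (f' u)" "scalar_curvature f' u = s"
      using assms(1) u c(3,5,7)[OF u] assms(2)[OF u] by (auto simp: expander_chart_def)
  qed
qed

lemma expander_graph_exists:
  fixes f :: "real^'n::finite \<Rightarrow> real^'m::finite"
  assumes E: "expander_chart D f s" and u0: "u0 \<in> D" and card: "CARD('m) = CARD('n) + 1"
  obtains V J N0 \<phi> g U r where "expander_graph V J (f u0) N0 \<phi> s" "reparam V g D" "g 0 = u0"
    "\<And>y. y \<in> V \<Longrightarrow> f (g y) = graph.F J (f u0) N0 \<phi> y" "expander_chart V (graph.F J (f u0) N0 \<phi>) s"
    "open U" "U \<subseteq> D" "u0 \<in> U" "homeomorphism V U g r" "smooth_on U r"
proof -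
  have I: "immersion_on D f" using E by (simp add: expander_chart_def)
  note ID = immersion_onD[OF I]
  obtain N0 where N0: "norm N0 = 1" "tangent_space f u0 = {w. w \<bullet> N0 = 0}"
    using unit_normal_exists[OF ID(4,3)[OF u0] card] by blast
  have s: "subspace (tangent_space f u0)"
    unfolding tangent_space_def using ID(4)[OF u0] linear_subspace_image subspace_UNIV by blast
  have d: "dim (tangent_space f u0) = CARD('n)"
    unfolding tangent_space_def using dim_image_eq[OF ID(4)[OF u0], of UNIV] ID(3)[OF u0] by simp
  obtain J :: "real^'n \<Rightarrow> real^'m" where J: "linear J" "range J = tangent_space f u0" "\<And>x. norm (J x) = norm x"
    using isometry_subspaces[of "UNIV :: (real^'n) set", OF subspace_UNIV s] d by auto
  have NN: "N0 \<bullet> N0 = 1" using N0(1) by (simp add: norm_eq_1)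
  obtain V \<phi> g U r where G: "graph V J N0 \<phi>" "reparam V g D" "g 0 = u0"
    "\<And>y. y \<in> V \<Longrightarrow> f (g y) = f u0 + J y + \<phi> y *\<^sub>R N0"
    "open U" "U \<subseteq> D" "u0 \<in> U" "homeomorphism V U g r" "smooth_on U r"
    using graph_chart_exists[OF I u0 card J(1) isometry_inner[OF J(1,3)] J(2) NN N0(2)] by metis
  interpret g: graph V J "f u0" N0 \<phi> by (rule G(1))
  have eq: "f (g y) = g.F y" if "y \<in> V" for y using G(4)[OF that] by (simp add: g.F_def)
  have EF: "expander_chart V g.F s"
    by (rule expander_chart_cong[OF expander_chart_reparam[OF E G(2) card]]) (simp add: eq)
  have "expander_graph V J (f u0) N0 \<phi> s"
    by unfold_locales (use EF in \<open>auto simp: expander_chart_def\<close>)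
  then show thesis using that G(2,3,5-9) eq EF by blast
qed

lemma expander_scal_zero:
  fixes f :: "real^'n::finite \<Rightarrow> real^'m::finite"
  assumes "expander_chart D f s" "CARD('m) = CARD('n) + 1" "u0 \<in> D" "s \<ge> 0"
  shows "s = 0"
proof -
  obtain V :: "(real^'n) set" and J N0 \<phi> where "expander_graph V J (f u0) N0 \<phi> s"
    by (rule expander_graph_exists[OF assms(1,3,2)]) blast
  then show ?thesis using expander_graph.scal_zero assms(4) by blast
qed

text \<open>The identities at the base point of a graph centred at \<open>u0\<close>, carried over
  by \<open>g\<close>. As \<open>fd g 0\<close> is onto, they hold for all vectors.\<close>

lemma expander_pointwise:
  fixes f :: "real^'n::finite \<Rightarrow> real^'m::finite"
  assumes E: "expander_chart D f 0" and card: "CARD('m) = CARD('n) + 1" and u0: "u0 \<in> D"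
  shows "eta f differentiable (at u0)"
    and "fd (eta f) u0 v *\<^sub>R second_ff f u0 w z = fd (eta f) u0 w *\<^sub>R second_ff f u0 v z"
    and "\<bar>fd (eta f) u0 v\<bar> \<le> norm (f u0) * norm (fd f u0 v) * eta f u0"
proof -
  have I: "immersion_on D f" using E by (simp add: expander_chart_def)
  obtain V J N0 \<phi> g U r where G: "expander_graph V J (f u0) N0 \<phi> 0" "reparam V g D" "g 0 = u0"
    "\<And>y. y \<in> V \<Longrightarrow> f (g y) = graph.F J (f u0) N0 \<phi> y" "expander_chart V (graph.F J (f u0) N0 \<phi>) 0"
    "open U" "U \<subseteq> D" "u0 \<in> U" "homeomorphism V U g r" "smooth_on U r"
    by (rule expander_graph_exists[OF E u0 card]) blast
  interpret g: expander_graph V J "f u0" N0 \<phi> 0 by (rule G(1))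
  note P = reparam_props[OF I G(2) g.zero]
  have "\<forall>z\<in>V. (f \<circ> g) z = g.F z" using G(4) by simp
  note c = geometry_cong[OF g.V _ this]
  have eq: "eta g.F y = eta f (g y)" if "y \<in> V" for y
    unfolding eta_def c(5)[OF that, symmetric] mean_curvature_reparam(1)[OF I G(2) that card] ..
  have r: "r u \<in> V" "g (r u) = u" if "u \<in> U" for u using G(9) that by (auto simp: homeomorphism_def)
  have "((\<lambda>u. eta g.F (r u)) has_derivative (\<lambda>v. fd (eta g.F) (r u0) (fd r u0 v))) (at u0)"
  proof (rule has_derivative_compose[OF smooth_on_has_derivative[OF G(10,8)]])
    show "(eta g.F has_derivative fd (eta g.F) (r u0)) (at (r u0))"
      using g.eta_derivative[OF r(1)[OF G(8)]] fd_works unfolding differentiable_def by blast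
  qed
  then have "(eta f has_derivative (\<lambda>v. fd (eta g.F) (r u0) (fd r u0 v))) (at u0)"
    by (rule has_derivative_transform_within_open[OF _ G(6,8)]) (use r eq in auto)
  then show d: "eta f differentiable (at u0)" unfolding differentiable_def by blast
  have "fd (eta g.F) 0 = fd (\<lambda>y. eta f (g y)) 0" by (rule fd_cong[OF g.V g.zero eq])
  then have de: "fd (eta g.F) 0 v = fd (eta f) u0 (fd g 0 v)" for v
    using fd_compose[OF P(2), of "eta f"] d G(3) by simp
  have sf: "second_ff g.F 0 a b = second_ff f u0 (fd g 0 a) (fd g 0 b)" for a b
    using c(4)[OF g.zero] second_ff_reparam[OF I G(2) g.zero card] G(3) by metis
  have ff: "fd g.F 0 a = fd f u0 (fd g 0 a)" for a
    using c(1)[OF g.zero] fd_reparam[OF I G(2) g.zero] G(3) by metis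
  have sj: "\<exists>a. fd g 0 a = b" for b using P(4) by (metis bij_pointE)
  show "fd (eta f) u0 v *\<^sub>R second_ff f u0 w z = fd (eta f) u0 w *\<^sub>R second_ff f u0 v z"
    using g.eta_second_ff_zero[unfolded de sf] sj by metis
  have "g.F 0 = f u0" using G(3,4) g.zero by metis
  then show "\<bar>fd (eta f) u0 v\<bar> \<le> norm (f u0) * norm (fd f u0 v) * eta f u0"
    using g.eta_log_derivative_bound[unfolded de ff eq[OF g.zero] G(3)] sj by metis
qed

text \<open>The alternative in the first claim guards against zeros of \<open>eta\<close> that have
  nonzeros nearby, where the quotient in \<open>psi\<close> would switch between its default value
  and a genuine one. \<open>expander_eta_zero_locally\<close> excludes such zeros.\<close>

lemma expander_psi:
  fixes f :: "real^'n::finite \<Rightarrow> real^'m::finite"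
  assumes E: "expander_chart D f 0" and card: "CARD('m) = CARD('n) + 1" and u0: "u0 \<in> D"
  shows "eta f u0 \<noteq> 0 \<or> (\<forall>u\<in>D. eta f u = 0) \<Longrightarrow> (psi f x has_derivative (\<lambda>v. 0)) (at u0)"
    and "psi f x u0 = 0 \<Longrightarrow> x \<in> tangent_space f u0"
    and "\<exists>b1 b2. \<forall>x. x \<bullet> b1 = 0 \<and> x \<bullet> b2 = 0 \<longrightarrow> psi f x u0 = 0"
proof -
  have I: "immersion_on D f" using E by (simp add: expander_chart_def)
  obtain V J N0 \<phi> g U r where G: "expander_graph V J (f u0) N0 \<phi> 0" "reparam V g D" "g 0 = u0"
    "\<And>y. y \<in> V \<Longrightarrow> f (g y) = graph.F J (f u0) N0 \<phi> y" "expander_chart V (graph.F J (f u0) N0 \<phi>) 0"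
    "open U" "U \<subseteq> D" "u0 \<in> U" "homeomorphism V U g r" "smooth_on U r"
    by (rule expander_graph_exists[OF E u0 card]) blast
  interpret g: expander_graph V J "f u0" N0 \<phi> 0 by (rule G(1))
  note P = reparam_props[OF I G(2) g.zero]
  have "\<forall>z\<in>V. (f \<circ> g) z = g.F z" using G(4) by simp
  note c = geometry_cong[OF g.V _ this]
  have eqe: "eta g.F y = eta f (g y)" if "y \<in> V" for y
    unfolding eta_def c(5)[OF that, symmetric] mean_curvature_reparam(1)[OF I G(2) that card] ..
  have eqp: "psi g.F x y = psi f x (g y)" if "y \<in> V" for y x
    unfolding c(9)[OF that, symmetric] by (rule psi_reparam[OF I G(2) that card])
  have r: "r u \<in> V" "g (r u) = u" if "u \<in> U" for u using G(9) that by (auto simp: homeomorphism_def)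
  have r0: "r u0 = 0" using G(3,9) g.zero by (auto simp: homeomorphism_def)
  \<comment> \<open>\<open>expander_pointwise\<close> is applied to the graph as a chart of its own:
    it centres a new graph at every \<open>y\<close>, and so gives the proportionality on all of
    \<open>V\<close>, ready to be differentiated in \<open>rank_one\<close>.\<close>
  have rk: "g.Q 0 \<noteq> 0 \<Longrightarrow> (\<And>i j p l. g.h i j * g.h p l = g.h i l * g.h p j)"
    by (rule g.rank_one[OF refl _ expander_pointwise(2)[OF G(5) card]])
  have eQ: "eta f (g y) = g.Q y * g.Q y * inverse (g.w y)" if "y \<in> V" for y
    using eqe[OF that] g.eta_et[OF that] by (simp add: g.et_def)
  show "(psi f x has_derivative (\<lambda>v. 0)) (at u0)" if e: "eta f u0 \<noteq> 0 \<or> (\<forall>u\<in>D. eta f u = 0)"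
  proof -
    have "g.Q y = 0" if "g.Q 0 = 0" "y \<in> V" for y
    proof -
      have "\<forall>u\<in>D. eta f u = 0" using e eQ[OF g.zero] that(1) G(3) by simp
      then have "eta f (g y) = 0" using reparam_props(1)[OF I G(2) that(2)] by blast
      then show ?thesis using eQ[OF that(2)] g.w_pos(2)[of y] by simp
    qed
    then have d: "(psi g.F x has_derivative (\<lambda>v. 0)) (at (r u0))"
      unfolding r0 using g.psi_derivative_zero[OF refl rk] by blast
    have "((\<lambda>u. psi g.F x (r u)) has_derivative (\<lambda>v. 0)) (at u0)"
      by (rule has_derivative_compose[OF smooth_on_has_derivative[OF G(10,8)] d])
    then show ?thesis
      by (rule has_derivative_transform_within_open[OF _ G(6,8)]) (use r eqp in auto)
  qed
  have "tangent_space g.F 0 = tangent_space f u0"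
    unfolding c(2)[OF g.zero, symmetric] tangent_space_reparam[OF I G(2) g.zero] G(3) ..
  then show "x \<in> tangent_space f u0" if "psi f x u0 = 0"
    using g.psi_zero_tangent[OF refl rk] eqp[OF g.zero] G(3) that by metis
  show "\<exists>b1 b2. \<forall>x. x \<bullet> b1 = 0 \<and> x \<bullet> b2 = 0 \<longrightarrow> psi f x u0 = 0"
    using g.psi_zero_exists[OF refl rk] eqp[OF g.zero] G(3) by simp
qed

text \<open>Gronwall along rays from \<open>u0\<close>: the bound on the derivative makes
  \<open>eta\<close> times \<open>exp (- K * t)\<close> nonincreasing, it starts at zero, and
  \<open>eta\<close> is nonnegative.\<close>

lemma expander_eta_zero_locally:
  fixes f :: "real^'n::finite \<Rightarrow> real^'m::finite"
  assumes E: "expander_chart D f 0" and card: "CARD('m) = CARD('n) + 1" and u0: "u0 \<in> D" and e0: "eta f u0 = 0"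
  obtains r where "r > 0" "ball u0 r \<subseteq> D" "\<And>u. u \<in> ball u0 r \<Longrightarrow> eta f u = 0"
proof -
  have I: "immersion_on D f" using E by (simp add: expander_chart_def)
  note ID = immersion_onD[OF I] and X = expander_pointwise[OF E card]
  obtain r where r: "r > 0" "cball u0 r \<subseteq> D" using ID(1) u0 open_contains_cball by blast
  define q where "q u = norm (f u) * (\<Sum>i\<in>UNIV. norm (fd f u (ax i)))" for u
  have cq: "continuous_on D q" unfolding q_def[abs_def]
    by (intro continuous_intros smooth_on_continuous[OF smooth_on_fd[OF ID(2)]] smooth_on_continuous[OF ID(2)])
  have "compact (q ` cball u0 r)"
    by (rule compact_continuous_image[OF continuous_on_subset[OF cq r(2)] compact_cball])
  then have "bounded (q ` cball u0 r)" by (rule compact_imp_bounded)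
  then obtain C where C: "\<And>u. u \<in> cball u0 r \<Longrightarrow> norm (q u) \<le> C"
    unfolding bounded_iff by blast
  have bd: "\<bar>fd (eta f) u v\<bar> \<le> C * norm v * eta f u" if u: "u \<in> cball u0 r" for u v
  proof -
    have uD: "u \<in> D" using u r by blast
    have "norm (fd f u v) = norm (\<Sum>i\<in>UNIV. (v $ i) *\<^sub>R fd f u (ax i))"
      using linear_ax[OF ID(4)[OF uD], of v] by simp
    also have "\<dots> \<le> (\<Sum>i\<in>UNIV. norm v * norm (fd f u (ax i)))"
      by (rule sum_norm_le) (simp add: mult_right_mono component_le_norm_cart)
    finally have "norm (fd f u v) \<le> norm v * (\<Sum>i\<in>UNIV. norm (fd f u (ax i)))" by (simp add: sum_distrib_left)
    from mult_left_mono[OF this norm_ge_zero[of "f u"]]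
    have "norm (f u) * norm (fd f u v) \<le> q u * norm v" unfolding q_def by (simp only: mult_ac)
    also have "\<dots> \<le> C * norm v" using C[OF u] by (intro mult_right_mono) auto
    finally have "norm (f u) * norm (fd f u v) * eta f u \<le> C * norm v * eta f u"
      by (rule mult_right_mono) (simp add: eta_def)
    then show ?thesis using X(3)[OF uD, of v] by linarith
  qed
  have "eta f u = 0" if u: "u \<in> ball u0 r" for u
  proof -
    define v where "v = u - u0"
    define K where "K = C * norm v"
    have seg: "u0 + t *\<^sub>R v \<in> cball u0 r" if "0 \<le> t" "t \<le> 1" for t
    proof -
      have "norm (t *\<^sub>R v) \<le> norm v" using that by (simp add: mult_left_le_one_le)
      then show ?thesis using u by (simp add: dist_norm v_def norm_minus_commute)
    qed
    define p where "p t = eta f (u0 + t *\<^sub>R v) * exp (- K * t)" for t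
    have dp: "DERIV p t :> (fd (eta f) (u0 + t *\<^sub>R v) v - K * eta f (u0 + t *\<^sub>R v)) * exp (- K * t)" if "0 \<le> t" "t \<le> 1" for t
    proof -
      have "u0 + t *\<^sub>R v \<in> D" using seg[OF that] r by blast
      note d = fd_works[OF X(1)[OF this]]
      have "((\<lambda>t. eta f (u0 + t *\<^sub>R v)) has_derivative (\<lambda>s. fd (eta f) (u0 + t *\<^sub>R v) (s *\<^sub>R v))) (at t)"
        by (rule has_derivative_compose[of "\<lambda>t. u0 + t *\<^sub>R v" "\<lambda>s. s *\<^sub>R v" t UNIV, OF _ d])
           (auto intro!: derivative_eq_intros)
      then have "DERIV (\<lambda>t. eta f (u0 + t *\<^sub>R v)) t :> fd (eta f) (u0 + t *\<^sub>R v) v"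
        unfolding has_field_derivative_def
        using linear_scale[OF has_derivative_linear[OF d]] by (simp add: mult_commute_abs)
      then show ?thesis unfolding p_def by (auto intro!: derivative_eq_intros simp: algebra_simps)
    qed
    have "p 1 \<le> p 0"
    proof (rule DERIV_nonpos_imp_nonincreasing[of 0 1 p])
      fix t :: real assume t: "0 \<le> t" "t \<le> 1"
      have "fd (eta f) (u0 + t *\<^sub>R v) v - K * eta f (u0 + t *\<^sub>R v) \<le> 0"
        using bd[OF seg[OF t], of v] by (simp add: K_def)
      then show "\<exists>y. DERIV p t :> y \<and> y \<le> 0" using dp[OF t] by (meson exp_ge_zero mult_nonpos_nonneg)
    qed simp
    then have "eta f u * exp (- K) \<le> 0" by (simp add: p_def v_def e0)
    moreover have "eta f u \<ge> 0" by (simp add: eta_def)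
    ultimately show ?thesis by (simp add: mult_le_0_iff)
  qed
  then show thesis using that[of r] r ball_subset_cball by blast
qed

section \<open>From charts to the whole hypersurface\<close>

definition parametrization :: "'p topology \<Rightarrow> (real^'n::finite) set \<Rightarrow> (real^'n \<Rightarrow> 'p) \<Rightarrow> bool" where
  "parametrization M D \<psi> \<longleftrightarrow>
     open D \<and> openin M (\<psi> ` D) \<and> homeomorphic_map (top_of_set D) (subtopology M (\<psi> ` D)) \<psi>"

lemma parametrizationD:
  assumes "parametrization M D \<psi>"
  shows "open D" "openin M (\<psi> ` D)" "inj_on \<psi> D" "continuous_map (top_of_set D) M \<psi>"
    "\<And>U. open U \<Longrightarrow> U \<subseteq> D \<Longrightarrow> openin M (\<psi> ` U)"
    "continuous_map (subtopology M (\<psi> ` D)) (top_of_set D) (inv_into D \<psi>)"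
    "\<And>u. u \<in> D \<Longrightarrow> \<psi> u \<in> topspace M"
proof -
  have h: "open D" "openin M (\<psi> ` D)" "homeomorphic_map (top_of_set D) (subtopology M (\<psi> ` D)) \<psi>"
    using assms unfolding parametrization_def by auto
  show "open D" "openin M (\<psi> ` D)" by fact+
  show inj: "inj_on \<psi> D" using homeomorphic_imp_injective_map[OF h(3)] by simp
  show "continuous_map (top_of_set D) M \<psi>"
    using homeomorphic_imp_continuous_map[OF h(3)] continuous_map_into_fulltopology by blast
  have om: "open_map (top_of_set D) (subtopology M (\<psi> ` D)) \<psi>" by (rule homeomorphic_imp_open_map[OF h(3)])
  show "openin M (\<psi> ` U)" if "open U" "U \<subseteq> D" for U
  proof -
    have "openin (top_of_set D) U" using that by (simp add: openin_open_eq h(1))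
    then have "openin (subtopology M (\<psi> ` D)) (\<psi> ` U)" using om by (simp add: open_map_def)
    then show ?thesis using h(2) openin_open_subtopology by blast
  qed
  show "\<psi> u \<in> topspace M" if "u \<in> D" for u using openin_subset[OF h(2)] that by blast
  show "continuous_map (subtopology M (\<psi> ` D)) (top_of_set D) (inv_into D \<psi>)"
  proof -
    obtain g where g: "homeomorphic_maps (top_of_set D) (subtopology M (\<psi> ` D)) \<psi> g"
      using h(3) homeomorphic_map_maps by blast
    then have "continuous_map (subtopology M (\<psi> ` D)) (top_of_set D) g" by (simp add: homeomorphic_maps_def)
    moreover have "g x = inv_into D \<psi> x" if "x \<in> topspace (subtopology M (\<psi> ` D))" for x
      using that g inj by (auto simp: homeomorphic_maps_def)
    ultimately show ?thesis using continuous_map_eq by blast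
  qed
qed

lemma smooth_manifold_parametrization:
  "smooth_manifold M \<A> \<Longrightarrow> (D,\<psi>) \<in> \<A> \<Longrightarrow> parametrization M D \<psi>"
  unfolding smooth_manifold_def parametrization_def by auto

lemmas smooth_manifoldD = parametrizationD[OF smooth_manifold_parametrization]

text \<open>On \<open>W\<close> the immersion \<open>F \<circ> \<psi>\<close> factors as
  \<open>F \<circ> \<theta>\<close> after \<open>\<tau>\<close>; hence the derivative of
  \<open>\<tau>\<close> is injective, and bijective by dimension.\<close>

lemma transition_reparam:
  fixes \<A> :: "('n::finite, 'p) atlas" and F :: "'p \<Rightarrow> real^'m::finite"
  assumes M: "immersed_hypersurface M \<A> F" and D: "(D,\<psi>) \<in> \<A>" and E: "(E,\<theta>) \<in> \<A>"
  defines "W \<equiv> {u \<in> D. \<psi> u \<in> \<theta> ` E}" and "\<tau> \<equiv> inv_into E \<theta> \<circ> \<psi>"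
  shows "reparam W \<tau> E" and "\<And>u. u \<in> W \<Longrightarrow> \<theta> (\<tau> u) = \<psi> u"
proof -
  have sm: "smooth_manifold M \<A>" using M by (simp add: immersed_hypersurface_def)
  note Dp = smooth_manifoldD[OF sm D] and Ep = smooth_manifoldD[OF sm E]
  have imD: "immersion_on D (F \<circ> \<psi>)" and imE: "immersion_on E (F \<circ> \<theta>)"
    using M D E Dp(1) Ep(1) unfolding immersed_hypersurface_def immersion_on_def by auto
  have W: "open W"
  proof -
    have "openin (top_of_set D) {u \<in> topspace (top_of_set D). \<psi> u \<in> \<theta> ` E}"
      using Dp(4) Ep(2) by (rule openin_continuous_map_preimage)
    then show ?thesis using Dp(1) by (simp add: W_def openin_open_eq)
  qed
  show t: "\<theta> (\<tau> u) = \<psi> u" if "u \<in> W" for u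
    using that by (auto simp: W_def \<tau>_def f_inv_into_f)
  have tE: "\<tau> u \<in> E" if "u \<in> W" for u
    using that unfolding W_def \<tau>_def comp_def by (metis (mono_tags, lifting) inv_into_into mem_Collect_eq)
  have st: "smooth_on W \<tau>"
    using sm D E unfolding smooth_manifold_def W_def \<tau>_def by fast
  have "bij (fd \<tau> u)" if u: "u \<in> W" for u
  proof -
    have dt: "\<tau> differentiable (at u)" using smooth_on_differentiable[OF st u] .
    have dt': "(F \<circ> \<theta>) differentiable (at (\<tau> u))"
      using immersion_onD(5)[OF imE tE[OF u]] unfolding differentiable_def by blast
    have "fd (F \<circ> \<psi>) u = fd (\<lambda>x. (F \<circ> \<theta>) (\<tau> x)) u"
      by (rule fd_cong[OF W u]) (simp add: t)
    also have "\<dots> = (\<lambda>v. fd (F \<circ> \<theta>) (\<tau> u) (fd \<tau> u v))"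
      by (rule fd_compose[OF dt dt'])
    finally have e: "fd (F \<circ> \<psi>) u = (\<lambda>v. fd (F \<circ> \<theta>) (\<tau> u) (fd \<tau> u v))" .
    have "inj (fd (F \<circ> \<psi>) u)" using immersion_onD(3)[OF imD] u by (simp add: W_def)
    then have "inj (fd \<tau> u)" unfolding e by (auto simp: inj_def)
    then show ?thesis
      using linear_injective_imp_surjective[OF linear_frechet_derivative[OF dt]] by (simp add: bij_def)
  qed
  then show "reparam W \<tau> E" unfolding reparam_def using W st tE by auto
qed

text \<open>Connectedness: \<open>inv\<close> and \<open>cng\<close> make the truth of
  \<open>P\<close> at a point independent of the chart, and \<open>lc\<close> makes the sets where
  it holds and where it fails open. They partition \<open>M\<close>, so one of them is empty. It
  serves for the zeros of \<open>eta\<close> and of \<open>psi\<close>.\<close>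

lemma chart_property_global:
  fixes \<A> :: "('n::finite, 'p) atlas" and F :: "'p \<Rightarrow> real^'m::finite"
    and P :: "(real^'n \<Rightarrow> real^'m) \<Rightarrow> real^'n \<Rightarrow> bool"
  assumes M: "immersed_hypersurface M \<A> F"
    and inv: "\<And>D f V g y. immersion_on D f \<Longrightarrow> reparam V g D \<Longrightarrow> y \<in> V \<Longrightarrow> P (f \<circ> g) y = P f (g y)"
    and cng: "\<And>V f f' y. open V \<Longrightarrow> y \<in> V \<Longrightarrow> \<forall>z\<in>V. f z = f' z \<Longrightarrow> P f y = P f' y"
    and lc: "\<And>D \<psi> u. (D,\<psi>) \<in> \<A> \<Longrightarrow> u \<in> D \<Longrightarrow> \<exists>W. open W \<and> u \<in> W \<and> W \<subseteq> D \<and> (\<forall>u'\<in>W. P (F \<circ> \<psi>) u' = P (F \<circ> \<psi>) u)"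
    and D: "(D,\<psi>) \<in> \<A>" "u \<in> D" and E: "(E,\<theta>) \<in> \<A>" "v \<in> E"
  shows "P (F \<circ> \<psi>) u = P (F \<circ> \<theta>) v"
proof -
  have sm: "smooth_manifold M \<A>" and con: "connected_space M" using M by (auto simp: immersed_hypersurface_def)
  define S where "S b = {p. \<exists>D \<psi> u. (D,\<psi>) \<in> \<A> \<and> u \<in> D \<and> \<psi> u = p \<and> P (F \<circ> \<psi>) u = b}" for b
  have consistent: "P (F \<circ> \<psi>) u = P (F \<circ> \<theta>) v"
    if D: "(D,\<psi>) \<in> \<A>" "u \<in> D" and E: "(E,\<theta>) \<in> \<A>" "v \<in> E" and eq: "\<psi> u = \<theta> v" for D \<psi> u E \<theta> v
  proof -
    let ?W = "{u \<in> D. \<psi> u \<in> \<theta> ` E}" and ?t = "inv_into E \<theta> \<circ> \<psi>"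
    note T = transition_reparam[OF M D(1) E(1)]
    have u: "u \<in> ?W" using D E eq by auto
    have W: "open ?W" using T(1) by (simp add: reparam_def)
    have tu: "?t u = v" using eq smooth_manifoldD(3)[OF sm E(1)] E(2) by simp
    have imE: "immersion_on E (F \<circ> \<theta>)"
      using M E smooth_manifoldD(1)[OF sm E(1)] unfolding immersed_hypersurface_def immersion_on_def by auto
    have "P (F \<circ> \<psi>) u = P ((F \<circ> \<theta>) \<circ> ?t) u"
      by (rule cng[OF W u]) (use T(2) in auto)
    also have "\<dots> = P (F \<circ> \<theta>) (?t u)" by (rule inv[OF imE T(1) u])
    finally show ?thesis unfolding tu .
  qed
  have op: "openin M (S b)" for b
  proof (subst openin_subopen, intro ballI)
    fix p assume "p \<in> S b"
    then obtain D \<psi> u where *: "(D,\<psi>) \<in> \<A>" "u \<in> D" "\<psi> u = p" "P (F \<circ> \<psi>) u = b" by (auto simp: S_def)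
    obtain W where W: "open W" "u \<in> W" "W \<subseteq> D" "\<forall>u'\<in>W. P (F \<circ> \<psi>) u' = P (F \<circ> \<psi>) u"
      using lc[OF *(1,2)] by blast
    have "openin M (\<psi> ` W)" using smooth_manifoldD(5)[OF sm *(1) W(1,3)] .
    moreover have "\<psi> ` W \<subseteq> S b" using W(3,4) *(1,4) unfolding S_def by blast
    ultimately show "\<exists>T. openin M T \<and> p \<in> T \<and> T \<subseteq> S b" using * W by blast
  qed
  have cover: "topspace M \<subseteq> S True \<union> S False"
  proof
    fix p assume "p \<in> topspace M"
    then obtain D \<psi> u where "(D,\<psi>) \<in> \<A>" "u \<in> D" "p = \<psi> u"
      using sm unfolding smooth_manifold_def by auto
    then show "p \<in> S True \<union> S False" unfolding S_def by (cases "P (F \<circ> \<psi>) u") auto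
  qed
  have disj: "S True \<inter> S False = {}" 
  proof (rule ccontr)
    assume "S True \<inter> S False \<noteq> {}"
    then obtain p where "p \<in> S True" "p \<in> S False" by blast
    then obtain D \<psi> u E \<theta> v where
      "(D,\<psi>) \<in> \<A>" "u \<in> D" "\<psi> u = p" "P (F \<circ> \<psi>) u" "(E,\<theta>) \<in> \<A>" "v \<in> E" "\<theta> v = p" "\<not> P (F \<circ> \<theta>) v"
      unfolding S_def by blast
    then show False using consistent by metis
  qed
  have e: "S True = {} \<or> S False = {}"
    using con op cover disj unfolding connected_space_def by metis
  have "\<psi> u \<in> S (P (F \<circ> \<psi>) u)" "\<theta> v \<in> S (P (F \<circ> \<theta>) v)" using D E by (auto simp: S_def)
  then show ?thesis using e by (cases "P (F \<circ> \<psi>) u"; cases "P (F \<circ> \<theta>) v") auto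
qed

text \<open>At one point, \<open>psi\<close> vanishes on a subspace of codimension at most two in
  the ambient space. Its zeros are the same at all points, and a zero of \<open>psi\<close> is a
  tangent vector. The zeros of \<open>eta\<close> are treated before, to supply the alternative in
  \<open>expander_psi\<close>.\<close>

lemma constant_tangent_subspace:
  fixes \<A> :: "('n::finite, 'p) atlas" and F :: "'p \<Rightarrow> real^'m::finite"
  assumes M: "immersed_hypersurface M \<A> F" and se: "self_expander \<A> F" and s: "s \<ge> 0"
    and sc: "\<forall>(D,\<psi>)\<in>\<A>. \<forall>u\<in>D. scalar_curvature (F \<circ> \<psi>) u = s"
  obtains K where "subspace K" "dim K = CARD('n) - 1"
    "\<And>D \<psi> u. (D,\<psi>) \<in> \<A> \<Longrightarrow> u \<in> D \<Longrightarrow> K \<subseteq> tangent_space (F \<circ> \<psi>) u"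
proof -
  have sm: "smooth_manifold M \<A>" and card: "CARD('m) = CARD('n) + 1" and ne: "topspace M \<noteq> {}"
    using M by (auto simp: immersed_hypersurface_def)
  obtain D0 \<psi>0 u0 where 0: "(D0,\<psi>0) \<in> \<A>" "u0 \<in> D0"
    using sm ne unfolding smooth_manifold_def by auto
  have Es: "expander_chart D (F \<circ> \<psi>) s" if "(D,\<psi>) \<in> \<A>" for D \<psi>
    using M se sc that smooth_manifoldD(1)[OF sm that]
    unfolding immersed_hypersurface_def self_expander_def expander_chart_def immersion_on_def by auto
  have s0: "s = 0" using expander_scal_zero[OF Es[OF 0(1)] card 0(2) s] .
  have E: "expander_chart D (F \<circ> \<psi>) 0" and I: "immersion_on D (F \<circ> \<psi>)" if "(D,\<psi>) \<in> \<A>" for D \<psi>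
    using Es[OF that] s0 by (auto simp: expander_chart_def)
  have eta_global: "(eta (F \<circ> \<psi>) u = 0) = (eta (F \<circ> \<theta>) v = 0)"
    if "(D,\<psi>) \<in> \<A>" "u \<in> D" "(E,\<theta>) \<in> \<A>" "v \<in> E" for D \<psi> u E \<theta> v
  proof (rule chart_property_global[OF M _ _ _ that, where P = "\<lambda>f u. eta f u = 0"])
    show "(eta (f \<circ> g) y = 0) = (eta f (g y) = 0)" if "immersion_on D f" "reparam V g D" "y \<in> V"
      for D and f :: "real^'n \<Rightarrow> real^'m" and V g y
      using mean_curvature_reparam(1)[OF that card] by (simp add: eta_def)
    show "(eta f y = 0) = (eta f' y = 0)" if "open V" "y \<in> V" "\<forall>z\<in>V. f z = f' z"
      for V and f f' :: "real^'n \<Rightarrow> real^'m" and y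
      using geometry_cong(8)[OF that] by simp
    fix D \<psi> u assume D: "(D,\<psi>) \<in> \<A>" "u \<in> D"
    have "open D" using I[OF D(1)] by (simp add: immersion_on_def)
    show "\<exists>W. open W \<and> u \<in> W \<and> W \<subseteq> D \<and> (\<forall>u'\<in>W. (eta (F \<circ> \<psi>) u' = 0) = (eta (F \<circ> \<psi>) u = 0))"
    proof (cases "eta (F \<circ> \<psi>) u = 0")
      case True
      then obtain r where "r > 0" "ball u r \<subseteq> D" "\<And>u'. u' \<in> ball u r \<Longrightarrow> eta (F \<circ> \<psi>) u' = 0"
        using expander_eta_zero_locally[OF E[OF D(1)] card D(2)] by blast
      then show ?thesis using True by (intro exI[of _ "ball u r"]) auto
    next
      case False
      have "continuous_on D (eta (F \<circ> \<psi>))"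
        using expander_pointwise(1)[OF E[OF D(1)] card] differentiable_imp_continuous_within
        by (intro continuous_at_imp_continuous_on) blast
      then have "open (D \<inter> eta (F \<circ> \<psi>) -` (- {0}))"
        by (rule continuous_open_preimage[OF _ \<open>open D\<close>]) auto
      then show ?thesis using False D by (intro exI[of _ "D \<inter> eta (F \<circ> \<psi>) -` (- {0})"]) auto
    qed
  qed
  have psi_global: "(psi (F \<circ> \<psi>) x u = 0) = (psi (F \<circ> \<theta>) x v = 0)"
    if "(D,\<psi>) \<in> \<A>" "u \<in> D" "(E,\<theta>) \<in> \<A>" "v \<in> E" for D \<psi> u E \<theta> v x
  proof (rule chart_property_global[OF M _ _ _ that, where P = "\<lambda>f u. psi f x u = 0"])
    show "(psi (f \<circ> g) x y = 0) = (psi f x (g y) = 0)" if "immersion_on D f" "reparam V g D" "y \<in> V"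
      for D and f :: "real^'n \<Rightarrow> real^'m" and V g y
      using psi_reparam[OF that card] by simp
    show "(psi f x y = 0) = (psi f' x y = 0)" if "open V" "y \<in> V" "\<forall>z\<in>V. f z = f' z"
      for V and f f' :: "real^'n \<Rightarrow> real^'m" and y
      using geometry_cong(9)[OF that] by simp
    fix D \<psi> u assume D: "(D,\<psi>) \<in> \<A>" "u \<in> D"
    have oD: "open D" using I[OF D(1)] by (simp add: immersion_on_def)
    obtain r where r: "r > 0" "ball u r \<subseteq> D" using oD D(2) openE by blast
    have "(psi (F \<circ> \<psi>) x has_derivative (\<lambda>v. 0)) (at u')" if "u' \<in> D" for u'
    proof (rule expander_psi(1)[OF E[OF D(1)] card that])
      show "eta (F \<circ> \<psi>) u' \<noteq> 0 \<or> (\<forall>u\<in>D. eta (F \<circ> \<psi>) u = 0)"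
        using eta_global[OF D(1) _ D(1) that] by blast
    qed
    then have e: "psi (F \<circ> \<psi>) x u' = psi (F \<circ> \<psi>) x u" if "u' \<in> ball u r" for u'
      using has_derivative_zero_unique[of "ball u r" "psi (F \<circ> \<psi>) x" u' u] that r
      by (meson centre_in_ball convex_ball has_derivative_at_withinI subsetD)
    show "\<exists>W. open W \<and> u \<in> W \<and> W \<subseteq> D \<and> (\<forall>u'\<in>W. (psi (F \<circ> \<psi>) x u' = 0) = (psi (F \<circ> \<psi>) x u = 0))"
    proof (intro exI[of _ "ball u r"] conjI ballI)
      show "(psi (F \<circ> \<psi>) x u' = 0) = (psi (F \<circ> \<psi>) x u = 0)" if "u' \<in> ball u r" for u'
        by (subst e[OF that]) (rule refl)
    qed (use r in auto)
  qed
  obtain b1 b2 where b: "\<And>x. x \<bullet> b1 = 0 \<and> x \<bullet> b2 = 0 \<Longrightarrow> psi (F \<circ> \<psi>0) x u0 = 0"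
    using expander_psi(3)[OF E[OF 0(1)] card 0(2)] by blast
  define B where "B = span {b1, b2}"
  define K0 where "K0 = {y \<in> UNIV. \<forall>x \<in> B. orthogonal x y}"
  have sB: "subspace B" by (simp add: B_def)
  have "dim K0 + dim B = CARD('m)"
    unfolding K0_def using dim_subspace_orthogonal_to_vectors[OF sB subspace_UNIV] by simp
  moreover have "dim B \<le> 2"
    unfolding B_def using dim_le_card[of "span {b1,b2}" "{b1,b2}"] card_insert_le_m1[of 2 "{b2}" b1] by simp
  ultimately have "CARD('n) - 1 \<le> dim K0" using card by simp
  \<comment> \<open>\<open>K0\<close> may be larger, as when \<open>b1\<close> and \<open>b2\<close>
    are dependent; the exact dimension is required for the isometry with the coordinate
    hyperplane.\<close>
  then obtain K where K: "subspace K" "K \<subseteq> span K0" "dim K = CARD('n) - 1"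
    using choose_subspace_of_subspace by blast
  have "subspace K0" unfolding K0_def
    by (auto simp: subspace_def orthogonal_def inner_add_right)
  then have KK: "K \<subseteq> K0" using K(2) span_eq_iff by blast
  have "K \<subseteq> tangent_space (F \<circ> \<psi>) u" if D: "(D,\<psi>) \<in> \<A>" "u \<in> D" for D \<psi> u
  proof
    fix x assume "x \<in> K"
    then have "x \<bullet> b1 = 0 \<and> x \<bullet> b2 = 0"
      using KK by (auto simp: K0_def B_def orthogonal_def inner_commute span_base)
    then have "psi (F \<circ> \<psi>) x u = 0" using b psi_global[OF 0 D] by blast
    then show "x \<in> tangent_space (F \<circ> \<psi>) u" by (rule expander_psi(2)[OF E[OF D(1)] card D(2)])
  qed
  then show thesis using that K(1,3) by blast
qed

section \<open>The Riemannian distance\<close>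

abbreviation speed :: "(real \<Rightarrow> 'a::real_normed_vector) \<Rightarrow> real \<Rightarrow> real" where
  "speed \<gamma> t \<equiv> norm (vector_derivative \<gamma> (at t))"

lemma pw_C1_curveD:
  assumes "pw_C1_curve M F c"
  shows "pathin M c" "continuous_on {0..1} (F \<circ> c)"
    "\<exists>S. finite S \<and> (\<forall>t\<in>{0..1} - S. (F \<circ> c) differentiable (at t))"
    "(speed (F \<circ> c) has_integral curve_length F c) {0..1}" "speed (F \<circ> c) integrable_on {0..1}"
  using assms unfolding pw_C1_curve_def piecewise_C1_differentiable_on_def curve_length_def C1_differentiable_on_eq
  by (auto simp: integrable_integral)

lemma curve_length_nonneg: "pw_C1_curve M F c \<Longrightarrow> curve_length F c \<ge> 0"
  using has_integral_nonneg[OF pw_C1_curveD(4)] by simp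

text \<open>The fundamental theorem of calculus off the finite exceptional set: a chord is no longer
  than its arc, and an arc no longer than the curve.\<close>

lemma curve_length_ge:
  fixes F :: "'p \<Rightarrow> real^'m::finite"
  assumes "pw_C1_curve M F c" and ab: "0 \<le> a" "a \<le> b" "b \<le> 1"
  shows "norm (F (c b) - F (c a)) \<le> curve_length F c"
proof -
  let ?g = "F \<circ> c"
  note C = pw_C1_curveD[OF assms(1)]
  obtain S where S: "finite S" "\<forall>t\<in>{0..1} - S. ?g differentiable (at t)" using C(3) by blast
  have i: "((\<lambda>t. vector_derivative ?g (at t)) has_integral (?g b - ?g a)) {a..b}"
  proof (rule fundamental_theorem_of_calculus_interior_strong[OF S(1) ab(2)])
    show "(?g has_vector_derivative vector_derivative ?g (at t)) (at t)" if "t \<in> {a<..<b} - S" for t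
      using S(2) that ab by (intro vector_derivative_works[THEN iffD1]) auto
    show "continuous_on {a..b} ?g" using C(2) ab by (auto intro: continuous_on_subset)
  qed
  have sub: "speed ?g integrable_on {a..b}"
    by (rule integrable_subinterval_real[OF C(5)]) (use ab in auto)
  have "norm (?g b - ?g a) \<le> integral {a..b} (speed ?g)"
    using integral_norm_bound_integral[OF has_integral_integrable[OF i] sub] integral_unique[OF i] by simp
  also have "\<dots> \<le> integral {0..1} (speed ?g)"
    by (rule integral_subset_le) (use ab sub C(5) in auto)
  finally show ?thesis by (simp add: curve_length_def)
qed

text \<open>The Jacobian of the affine change of variables is the factor that the chain rule gives
  to the speed, up to finitely many parameters. Negative \<open>m\<close> covers reversal, and
  \<open>m = 2\<close> the two halves of a joined curve.\<close>

lemma speed_affine: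
  fixes \<gamma> :: "real \<Rightarrow> 'a::real_normed_vector"
  assumes m: "m \<noteq> 0" and S: "finite S" "\<And>t. t \<in> I - S \<Longrightarrow> \<gamma> differentiable (at t)"
    and I: "I = {a..b}" and i: "(speed \<gamma> has_integral l) I"
    and J: "(\<lambda>t. m * t + c) ` J = I"
  shows "(speed (\<lambda>t. \<gamma> (m * t + c)) has_integral l) J"
proof -
  have J': "(\<lambda>x. (1 / m) *\<^sub>R x + - ((1 / m) *\<^sub>R c)) ` I = J"
    unfolding J[symmetric] image_image using m by (simp add: field_simps)
  have fin: "finite ((\<lambda>t. m * t + c) -` S)"
    by (rule finite_vimageI[OF S(1)]) (use m in \<open>auto simp: inj_def\<close>)
  have "((\<lambda>t. \<bar>m\<bar> *\<^sub>R speed \<gamma> (m *\<^sub>R t + c)) has_integral \<bar>m\<bar> *\<^sub>R ((1 / \<bar>m\<bar> ^ DIM(real)) *\<^sub>R l)) J"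
    using has_integral_affinity[OF i[unfolded I cbox_interval[symmetric]] m, of c] J'[unfolded I cbox_interval[symmetric]]
    by (intro has_integral_cmul) simp
  then have "((\<lambda>t. \<bar>m\<bar> * speed \<gamma> (m * t + c)) has_integral l) J" using m by simp
  then show ?thesis
  proof (rule has_integral_spike_finite[OF fin, rotated])
    fix t assume t: "t \<in> J - (\<lambda>t. m * t + c) -` S"
    then have "\<gamma> differentiable (at (m * t + c))" using S(2) J by blast
    then have "(\<gamma> has_vector_derivative vector_derivative \<gamma> (at (m * t + c))) (at (m * t + c))"
      by (simp add: vector_derivative_works)
    moreover have "((\<lambda>t. m * t + c) has_vector_derivative m) (at t)"
      by (auto intro!: derivative_eq_intros)
    ultimately have "((\<gamma> \<circ> (\<lambda>t. m * t + c)) has_vector_derivative m *\<^sub>R vector_derivative \<gamma> (at (m * t + c))) (at t)"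
      by (intro vector_diff_chain_at)
    then show "speed (\<lambda>t. \<gamma> (m * t + c)) t = \<bar>m\<bar> * speed \<gamma> (m * t + c)"
      by (simp add: vector_derivative_at comp_def)
  qed
qed

lemma pathin_affine:
  assumes "continuous_map (top_of_set {a..b}) M c" "(\<lambda>t. m * t + k) ` {0..1::real} \<subseteq> {a..b}"
  shows "pathin M (\<lambda>t. c (m * t + k))"
  unfolding pathin_def
proof (rule continuous_map_compose[OF _ assms(1), unfolded comp_def])
  show "continuous_map (top_of_set {0..1}) (top_of_set {a..b}) (\<lambda>t. m * t + k)"
    using assms(2) by (auto simp: continuous_map_in_subtopology intro!: continuous_intros)
qed

lemma pw_C1_reverse:
  fixes F :: "'p \<Rightarrow> real^'m::finite"
  assumes c: "pw_C1_curve M F c"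
  obtains c' where "pw_C1_curve M F c'" "c' 0 = c 1" "c' 1 = c 0" "curve_length F c' = curve_length F c"
proof -
  let ?c = "\<lambda>t. c ((-1) * t + 1)"
  note C = pw_C1_curveD[OF c]
  obtain S where S: "finite S" "\<forall>t\<in>{0..1} - S. (F \<circ> c) differentiable (at t)" using C(3) by blast
  have im: "(\<lambda>t. (-1) * t + 1) ` {0..1::real} = {0..1}"
    using image_affinity_atLeastAtMost[of "-1" 1 0 1] by simp
  have "(speed (\<lambda>t. (F \<circ> c) ((-1) * t + 1)) has_integral curve_length F c) {0..1}"
    by (rule speed_affine[OF _ S(1) _ refl C(4) im]) (use S(2) in auto)
  then have i: "(speed (F \<circ> ?c) has_integral curve_length F c) {0..1}" by (simp add: comp_def)
  have "(F \<circ> c \<circ> (\<lambda>t. (-1) *\<^sub>R t + 1)) piecewise_C1_differentiable_on {0..1}"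
    by (rule piecewise_C1_differentiable_affine) (use c im in \<open>simp add: pw_C1_curve_def\<close>)
  then have "pw_C1_curve M F ?c"
    unfolding pw_C1_curve_def using pathin_affine[of 0 1 M c "-1" 1] C(1) im i
    by (auto simp: comp_def pathin_def has_integral_integrable)
  moreover have "curve_length F ?c = curve_length F c" using i by (simp add: curve_length_def integral_unique)
  ultimately show thesis using that by simp
qed

lemma speed_cong_open:
  assumes "open S" "t \<in> S" "\<And>x. x \<in> S \<Longrightarrow> f x = g x"
  shows "speed f t = speed g t"
proof -
  have "(f has_vector_derivative d) (at t) \<longleftrightarrow> (g has_vector_derivative d) (at t)" for d
    using has_vector_derivative_transform_within_open[OF _ assms(1,2)] assms(3) by metis
  then show ?thesis unfolding vector_derivative_def by simp
qed

lemma pw_C1_join: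
  fixes F :: "'p \<Rightarrow> real^'m::finite"
  assumes c1: "pw_C1_curve M F c1" and c2: "pw_C1_curve M F c2" and eq: "c1 1 = c2 0"
  obtains c where "pw_C1_curve M F c" "c 0 = c1 0" "c 1 = c2 1" "curve_length F c = curve_length F c1 + curve_length F c2"
proof -
  let ?c = "\<lambda>t. if t \<le> 1/2 then c1 (2 * t + 0) else c2 (2 * t + (-1))"
  note C1 = pw_C1_curveD[OF c1] and C2 = pw_C1_curveD[OF c2]
  obtain S1 where S1: "finite S1" "\<forall>t\<in>{0..1} - S1. (F \<circ> c1) differentiable (at t)" using C1(3) by blast
  obtain S2 where S2: "finite S2" "\<forall>t\<in>{0..1} - S2. (F \<circ> c2) differentiable (at t)" using C2(3) by blast
  have im1: "(\<lambda>t. 2 * t + 0) ` {0..1/2::real} = {0..1}"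
    using image_affinity_atLeastAtMost[of 2 0 0 "1/2"] by simp
  have im2: "(\<lambda>t. 2 * t + (-1)) ` {1/2..1::real} = {0..1}"
    using image_affinity_atLeastAtMost[of 2 "-1" "1/2" 1] by simp
  have "(speed (\<lambda>t. (F \<circ> c1) (2 * t + 0)) has_integral curve_length F c1) {0..1/2}"
    by (rule speed_affine[OF _ S1(1) _ refl C1(4) im1]) (use S1(2) in auto)
  then have i1: "(speed (F \<circ> ?c) has_integral curve_length F c1) {0..1/2}"
  proof (rule has_integral_spike_finite[of "{1/2}", rotated 2])
    fix t :: real assume t: "t \<in> {0..1/2} - {1/2}"
    show "speed (F \<circ> ?c) t = speed (\<lambda>t. (F \<circ> c1) (2 * t + 0)) t"
      by (rule speed_cong_open[of "{..<1/2}"]) (use t in auto)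
  qed simp
  have "(speed (\<lambda>t. (F \<circ> c2) (2 * t + (-1))) has_integral curve_length F c2) {1/2..1}"
    by (rule speed_affine[OF _ S2(1) _ refl C2(4) im2]) (use S2(2) in auto)
  then have i2: "(speed (F \<circ> ?c) has_integral curve_length F c2) {1/2..1}"
  proof (rule has_integral_spike_finite[of "{1/2}", rotated 2])
    fix t :: real assume t: "t \<in> {1/2..1} - {1/2}"
    show "speed (F \<circ> ?c) t = speed (\<lambda>t. (F \<circ> c2) (2 * t + (-1))) t"
      by (rule speed_cong_open[of "{1/2<..}"]) (use t in auto)
  qed simp
  have i: "(speed (F \<circ> ?c) has_integral (curve_length F c1 + curve_length F c2)) {0..1}"
    by (rule has_integral_combine[OF _ _ i1 i2]) auto
  have "(F \<circ> c1 \<circ> (\<lambda>t. 2 *\<^sub>R t + 0)) piecewise_C1_differentiable_on {0..1/2}"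
    by (rule piecewise_C1_differentiable_affine) (use c1 im1 in \<open>simp add: pw_C1_curve_def\<close>)
  moreover have "(F \<circ> c2 \<circ> (\<lambda>t. 2 *\<^sub>R t + (-1))) piecewise_C1_differentiable_on {1/2..1}"
    by (rule piecewise_C1_differentiable_affine) (use c2 im2 in \<open>simp add: pw_C1_curve_def\<close>)
  ultimately have "(\<lambda>t. if t \<le> 1/2 then (F \<circ> c1 \<circ> (\<lambda>t. 2 *\<^sub>R t + 0)) t else (F \<circ> c2 \<circ> (\<lambda>t. 2 *\<^sub>R t + (-1))) t)
     piecewise_C1_differentiable_on {0..1}"
    by (rule piecewise_C1_differentiable_cases) (use eq in auto)
  moreover have "(\<lambda>t. if t \<le> 1/2 then (F \<circ> c1 \<circ> (\<lambda>t. 2 *\<^sub>R t + 0)) t else (F \<circ> c2 \<circ> (\<lambda>t. 2 *\<^sub>R t + (-1))) t) = F \<circ> ?c"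
    by (auto simp: fun_eq_iff)
  ultimately have p: "(F \<circ> ?c) piecewise_C1_differentiable_on {0..1}" by simp
  have "pathin M ?c"
    unfolding pathin_def
  proof (rule continuous_map_cases_le)
    let ?T = "top_of_set {0..1::real}"
    have sub1: "subtopology ?T {x \<in> topspace ?T. x \<le> 1/2} = top_of_set {0..1/2}"
      by (simp add: subtopology_subtopology) (rule arg_cong[of _ _ "subtopology euclidean"], auto)
    have sub2: "subtopology ?T {x \<in> topspace ?T. 1/2 \<le> x} = top_of_set {1/2..1}"
      by (simp add: subtopology_subtopology) (rule arg_cong[of _ _ "subtopology euclidean"], auto)
    have cc: "continuous_map (top_of_set {0..1}) M c1" "continuous_map (top_of_set {0..1}) M c2"
      using C1(1) C2(1) by (auto simp: pathin_def)
    have k: "continuous_map (top_of_set J) (top_of_set {0..1}) (\<lambda>t. 2 * t + k)"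
      if "(\<lambda>t. 2 * t + k) ` J = {0..1}" for J and k :: real
      using that by (auto simp: continuous_map_in_subtopology intro!: continuous_intros)
    show "continuous_map (subtopology ?T {x \<in> topspace ?T. x \<le> 1/2}) M (\<lambda>t. c1 (2 * t + 0))"
      unfolding sub1 using continuous_map_compose[OF k[OF im1] cc(1)] by (simp add: comp_def)
    show "continuous_map (subtopology ?T {x \<in> topspace ?T. 1/2 \<le> x}) M (\<lambda>t. c2 (2 * t + (-1)))"
      unfolding sub2 using continuous_map_compose[OF k[OF im2] cc(2)] by (simp add: comp_def)
    show "c1 (2 * t + 0) = c2 (2 * t + (-1))" if "t = 1/2" for t unfolding that using eq by simp
  qed (auto intro: continuous_intros)
  then have "pw_C1_curve M F ?c" using p i by (auto simp: pw_C1_curve_def has_integral_integrable)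
  moreover have "curve_length F ?c = curve_length F c1 + curve_length F c2"
    using i by (simp add: curve_length_def integral_unique)
  ultimately show thesis using that by simp
qed

lemma pw_C1_const:
  assumes "p \<in> topspace M"
  shows "pw_C1_curve M F (\<lambda>t. p)" "curve_length F (\<lambda>t. p) = 0"
  using assms integrable_0[of "{0..1::real}", where 'b = real]
  by (simp_all add: pw_C1_curve_def curve_length_def comp_def piecewise_C1_differentiable_const)

text \<open>Only the values of \<open>F \<circ> c\<close> on the closed unit interval are
  prescribed. The end points therefore join the exceptional set, as a two-sided derivative there
  depends on how \<open>c\<close> continues.\<close>

lemma pw_C1_smooth:
  fixes F :: "'p \<Rightarrow> real^'m::finite"
  assumes c: "pathin M c" and g: "\<And>t. t \<in> {0..1} \<Longrightarrow> (\<gamma> has_vector_derivative \<gamma>' t) (at t)"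
    and eq: "\<And>t. t \<in> {0..1} \<Longrightarrow> F (c t) = \<gamma> t"
    and g': "continuous_on {0..1} \<gamma>'" and B: "\<And>t. t \<in> {0..1} \<Longrightarrow> norm (\<gamma>' t) \<le> B"
  shows "pw_C1_curve M F c" "curve_length F c \<le> B"
proof -
  have vd: "((F \<circ> c) has_vector_derivative \<gamma>' t) (at t)" if "t \<in> {0<..<1}" for t
    by (rule has_vector_derivative_transform_within_open[OF g, of _ "{0<..<1}"]) (use eq that in auto)
  have "continuous_on {0..1} \<gamma>"
    using g by (intro continuous_at_imp_continuous_on ballI) (rule has_vector_derivative_continuous)
  then have "continuous_on {0..1} (F \<circ> c)" by (rule continuous_on_eq) (simp add: eq)
  moreover have "(F \<circ> c) C1_differentiable_on ({0..1} - {0,1})"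
    unfolding C1_differentiable_on_def using vd continuous_on_subset[OF g']
    by (intro exI[of _ \<gamma>']) (auto simp: less_le)
  moreover have int: "(speed (F \<circ> c) has_integral integral {0..1} (\<lambda>t. norm (\<gamma>' t))) {0..1}"
  proof (rule has_integral_spike_finite[of "{0,1}"])
    show "((\<lambda>t. norm (\<gamma>' t)) has_integral integral {0..1} (\<lambda>t. norm (\<gamma>' t))) {0..1}"
      by (intro integrable_integral integrable_continuous_real continuous_intros g')
    show "speed (F \<circ> c) t = norm (\<gamma>' t)" if "t \<in> {0..1} - {0,1}" for t
      using vector_derivative_at[OF vd, of t] that by auto
  qed simp
  ultimately show "pw_C1_curve M F c"
    using c unfolding pw_C1_curve_def piecewise_C1_differentiable_on_def
    by (meson finite.emptyI finite.insertI has_integral_integrable)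
  have "curve_length F c = integral {0..1} (\<lambda>t. norm (\<gamma>' t))"
    using int by (simp add: curve_length_def integral_unique)
  also have "\<dots> \<le> integral {0..1::real} (\<lambda>t. B)"
    by (intro integral_le integrable_continuous_real continuous_intros g' B)
  finally show "curve_length F c \<le> B" by simp
qed

lemma riem_dist_commute:
  fixes F :: "'p \<Rightarrow> real^'m::finite"
  shows "riem_dist M F p q = riem_dist M F q p"
proof -
  have "{curve_length F c |c. pw_C1_curve M F c \<and> c 0 = p \<and> c 1 = q} \<subseteq> {curve_length F c |c. pw_C1_curve M F c \<and> c 0 = q \<and> c 1 = p}" for p q
  proof clarify
    fix c assume "pw_C1_curve M F c"
    from pw_C1_reverse[OF this] obtain c' where "pw_C1_curve M F c'" "c' 0 = c 1" "c' 1 = c 0" "curve_length F c' = curve_length F c" .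
    then show "\<exists>c'. curve_length F c = curve_length F c' \<and> pw_C1_curve M F c' \<and> c' 0 = c 1 \<and> c' 1 = c 0" by metis
  qed
  then have "{curve_length F c |c. pw_C1_curve M F c \<and> c 0 = p \<and> c 1 = q} = {curve_length F c |c. pw_C1_curve M F c \<and> c 0 = q \<and> c 1 = p}"
    by blast
  then show ?thesis unfolding riem_dist_def by auto
qed

lemma riem_dist_le:
  assumes "pw_C1_curve M F c" "c 0 = p" "c 1 = q"
  shows "riem_dist M F p q \<le> curve_length F c"
proof -
  have "p \<in> topspace M" "q \<in> topspace M"
    using assms pw_C1_curveD(1)[OF assms(1)] path_start_in_topspace path_finish_in_topspace by blast+
  moreover have "bdd_below {curve_length F c |c. pw_C1_curve M F c \<and> c 0 = p \<and> c 1 = q}"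
    by (rule bdd_belowI[of _ 0]) (auto simp: curve_length_nonneg)
  ultimately show ?thesis unfolding riem_dist_def using assms by (auto intro!: cInf_lower)
qed

section \<open>The distance induces the given topology\<close>

context
  fixes M :: "'p topology" and \<A> :: "('n::finite, 'p) atlas" and F :: "'p \<Rightarrow> real^'m::finite"
  assumes M: "immersed_hypersurface M \<A> F"
begin

lemma hypersurface_facts:
  shows "smooth_manifold M \<A>" "connected_space M" "Hausdorff_space M" "CARD('m) = CARD('n) + 1"
    "\<And>D \<psi>. (D,\<psi>) \<in> \<A> \<Longrightarrow> immersion_on D (F \<circ> \<psi>)"
    "\<And>p. p \<in> topspace M \<Longrightarrow> \<exists>D \<psi> u. (D,\<psi>) \<in> \<A> \<and> u \<in> D \<and> \<psi> u = p"
proof -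
  show "smooth_manifold M \<A>" "connected_space M" "Hausdorff_space M" "CARD('m) = CARD('n) + 1"
    using M by (auto simp: immersed_hypersurface_def smooth_manifold_def)
  then show "immersion_on D (F \<circ> \<psi>)" if "(D,\<psi>) \<in> \<A>" for D \<psi>
    using M that smooth_manifoldD(1)[OF _ that] unfolding immersed_hypersurface_def immersion_on_def by auto
  show "\<exists>D \<psi> u. (D,\<psi>) \<in> \<A> \<and> u \<in> D \<and> \<psi> u = p" if "p \<in> topspace M" for p
    using that \<open>smooth_manifold M \<A>\<close> unfolding smooth_manifold_def by auto
qed

text \<open>Images of straight segments in a chart: their length is at most the coordinate length
  times a bound \<open>C\<close> for the derivative on a compact ball.\<close>

lemma short_curves:
  assumes q: "q \<in> topspace M" and e: "e > 0"
  obtains U where "openin M U" "q \<in> U" "\<And>p. p \<in> U \<Longrightarrow> \<exists>c. pw_C1_curve M F c \<and> c 0 = q \<and> c 1 = p \<and> curve_length F c < e"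
proof -
  obtain D \<psi> u where D: "(D,\<psi>) \<in> \<A>" "u \<in> D" "\<psi> u = q" using hypersurface_facts(6)[OF q] by blast
  note sm = smooth_manifoldD[OF hypersurface_facts(1) D(1)]
  define f where "f = F \<circ> \<psi>"
  note I = immersion_onD[OF hypersurface_facts(5)[OF D(1), folded f_def]]
  obtain r where r: "r > 0" "cball u r \<subseteq> D" using I(1) D(2) open_contains_cball by blast
  define k where "k x = (\<Sum>i\<in>UNIV. norm (fd f x (ax i)))" for x
  have ck: "continuous_on D k" unfolding k_def[abs_def]
    by (intro continuous_intros smooth_on_continuous[OF smooth_on_fd[OF I(2)]])
  have "compact (k ` cball u r)"
    by (rule compact_continuous_image[OF continuous_on_subset[OF ck r(2)] compact_cball])
  then have "bounded (k ` cball u r)" by (rule compact_imp_bounded)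
  then obtain C where C: "\<And>x. x \<in> cball u r \<Longrightarrow> norm (k x) \<le> C" unfolding bounded_iff by blast
  have C0: "C \<ge> 0" using C[of u] r by (smt (verit) centre_in_cball norm_ge_zero)
  have bd: "norm (fd f x v) \<le> C * norm v" if x: "x \<in> cball u r" for x v
  proof -
    have xD: "x \<in> D" using x r by blast
    have "norm (fd f x v) = norm (\<Sum>i\<in>UNIV. (v $ i) *\<^sub>R fd f x (ax i))"
      using linear_ax[OF I(4)[OF xD], of v] by simp
    also have "\<dots> \<le> (\<Sum>i\<in>UNIV. norm v * norm (fd f x (ax i)))"
      by (rule sum_norm_le) (simp add: mult_right_mono component_le_norm_cart)
    also have "\<dots> = k x * norm v" by (simp add: k_def sum_distrib_left mult.commute)
    also have "\<dots> \<le> C * norm v" using C[OF x] by (intro mult_right_mono) auto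
    finally show ?thesis .
  qed
  \<comment> \<open>The summand \<open>1\<close> allows for \<open>C = 0\<close> and makes the
    length strictly less than \<open>e\<close>.\<close>
  define d where "d = min r (e / (C + 1))"
  have d: "d > 0" "d \<le> r" using r e C0 by (auto simp: d_def)
  have "\<exists>c. pw_C1_curve M F c \<and> c 0 = q \<and> c 1 = \<psi> x \<and> curve_length F c < e" if x: "x \<in> ball u d" for x
  proof -
    define v where "v = x - u"
    have nv: "norm v < d" using x by (simp add: v_def dist_norm norm_minus_commute)
    have seg: "u + t *\<^sub>R v \<in> ball u r" if "t \<in> {-1/2..1}" for t
    proof -
      have "norm (t *\<^sub>R v) \<le> norm v" using that mult_left_le_one_le[of "norm v" "\<bar>t\<bar>"] by (simp add: abs_le_iff)
      then show ?thesis using nv d by (simp add: dist_norm)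
    qed
    define c where "c t = \<psi> (u + t *\<^sub>R v)" for t
    have segD: "u + t *\<^sub>R v \<in> D" "u + t *\<^sub>R v \<in> cball u r" if "t \<in> {0..1}" for t
      using seg[of t] r(2) that by auto
    have pc: "pathin M c" unfolding pathin_def c_def
    proof (rule continuous_map_compose[OF _ sm(4), unfolded comp_def])
      show "continuous_map (top_of_set {0..1}) (top_of_set D) (\<lambda>t. u + t *\<^sub>R v)"
        using segD by (auto simp: continuous_map_in_subtopology intro!: continuous_intros)
    qed
    have vd: "((\<lambda>t. f (u + t *\<^sub>R v)) has_vector_derivative fd f (u + t *\<^sub>R v) v) (at t)" if "t \<in> {0..1}" for t
    proof -
      have "((\<lambda>t. f (u + t *\<^sub>R v)) has_derivative (\<lambda>s. fd f (u + t *\<^sub>R v) (s *\<^sub>R v))) (at t)"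
        by (rule has_derivative_compose[of "\<lambda>t. u + t *\<^sub>R v" "\<lambda>s. s *\<^sub>R v" t UNIV, OF _ I(5)[OF segD(1)[OF that]]])
           (auto intro!: derivative_eq_intros)
      then show ?thesis unfolding has_vector_derivative_def using linear_scale[OF I(4)[OF segD(1)[OF that]]] by simp
    qed
    have cf: "continuous_on {0..1} (\<lambda>t. fd f (u + t *\<^sub>R v) v)"
    proof (rule continuous_on_compose2[OF smooth_on_continuous[OF smooth_on_fd[OF I(2), of v]]])
      show "continuous_on {0..1} (\<lambda>t. u + t *\<^sub>R v)" by (intro continuous_intros)
    qed (use segD in auto)
    have B: "norm (fd f (u + t *\<^sub>R v) v) \<le> C * norm v" if "t \<in> {0..1}" for t
      using bd[OF segD(2)[OF that]] .
    have fc: "F (c t) = f (u + t *\<^sub>R v)" for t by (simp add: c_def f_def)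
    note pw = pw_C1_smooth[of M c "\<lambda>t. f (u + t *\<^sub>R v)" "\<lambda>t. fd f (u + t *\<^sub>R v) v" F "C * norm v", OF pc vd fc cf B]
    have "C * norm v \<le> C * (e / (C + 1))"
      using nv C0 by (intro mult_left_mono) (auto simp: d_def)
    also have "\<dots> < e" using e C0 by (simp add: field_simps)
    finally show ?thesis using pw D(3) by (intro exI[of _ c]) (auto simp: c_def v_def)
  qed
  moreover have "openin M (\<psi> ` ball u d)" by (rule sm(5)) (use d r in auto)
  moreover have "q \<in> \<psi> ` ball u d" using d D by auto
  ultimately show thesis by (intro that[of "\<psi> ` ball u d"]) blast+
qed

text \<open>The set of points joined to \<open>p\<close> is open by \<open>short_curves\<close>, and
  so is its complement, because short curves can be reversed; \<open>M\<close> is connected.\<close>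

lemma curve_exists:
  assumes p: "p \<in> topspace M" and q: "q \<in> topspace M"
  obtains c where "pw_C1_curve M F c" "c 0 = p" "c 1 = q"
proof -
  define R where "R = {x \<in> topspace M. \<exists>c. pw_C1_curve M F c \<and> c 0 = p \<and> c 1 = x}"
  have trans: "\<exists>c. pw_C1_curve M F c \<and> c 0 = a \<and> c 1 = z"
    if c1: "pw_C1_curve M F c1" "c1 0 = a" "c1 1 = b" and c2: "pw_C1_curve M F c2" "c2 0 = b" "c2 1 = z" for a b z c1 c2
    using pw_C1_join[OF c1(1) c2(1)] that by metis
  have sym: "\<exists>c'. pw_C1_curve M F c' \<and> c' 0 = b \<and> c' 1 = a"
    if c1: "pw_C1_curve M F c1" "c1 0 = a" "c1 1 = b" for a b c1
    using pw_C1_reverse[OF c1(1)] c1 by metis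
  have op: "openin M R"
  proof (subst openin_subopen, intro ballI)
    fix x assume x: "x \<in> R"
    then have "x \<in> topspace M" by (simp add: R_def)
    from short_curves[OF this zero_less_one] obtain U where U: "openin M U" "x \<in> U"
      "\<And>p. p \<in> U \<Longrightarrow> \<exists>c. pw_C1_curve M F c \<and> c 0 = x \<and> c 1 = p \<and> curve_length F c < 1" by metis
    have "U \<subseteq> R"
    proof
      fix y assume y: "y \<in> U"
      then have "y \<in> topspace M" using U(1) openin_subset by blast
      moreover have "\<exists>c. pw_C1_curve M F c \<and> c 0 = p \<and> c 1 = y" using x U(3)[OF y] trans unfolding R_def by blast
      ultimately show "y \<in> R" by (simp add: R_def)
    qed
    then show "\<exists>T. openin M T \<and> x \<in> T \<and> T \<subseteq> R" using U by blast
  qed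
  have cl: "openin M (topspace M - R)"
  proof (subst openin_subopen, intro ballI)
    fix x assume x: "x \<in> topspace M - R"
    then have "x \<in> topspace M" by simp
    from short_curves[OF this zero_less_one] obtain U where U: "openin M U" "x \<in> U"
      "\<And>p. p \<in> U \<Longrightarrow> \<exists>c. pw_C1_curve M F c \<and> c 0 = x \<and> c 1 = p \<and> curve_length F c < 1" by metis
    have "U \<subseteq> topspace M - R"
    proof
      fix y assume y: "y \<in> U"
      then have "y \<in> topspace M" using U(1) openin_subset by blast
      moreover have "y \<notin> R"
      proof
        assume "y \<in> R"
        then have "\<exists>c. pw_C1_curve M F c \<and> c 0 = p \<and> c 1 = x" using sym U(3)[OF y] trans unfolding R_def by blast
        then show False using x by (simp add: R_def)
      qed
      ultimately show "y \<in> topspace M - R" by simp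
    qed
    then show "\<exists>T. openin M T \<and> x \<in> T \<and> T \<subseteq> topspace M - R" using U by blast
  qed
  have "p \<in> R" using pw_C1_const[OF p] p unfolding R_def by blast
  then have "topspace M - R = {}"
    using hypersurface_facts(2) op cl unfolding connected_space_def
    by (metis Diff_disjoint Un_Diff_cancel empty_iff sup.cobounded2)
  then have "q \<in> R" using q by blast
  then show thesis using that by (auto simp: R_def)
qed

lemma riem_dist_attained:
  assumes p: "p \<in> topspace M" and q: "q \<in> topspace M" and e: "riem_dist M F p q < e"
  obtains c where "pw_C1_curve M F c" "c 0 = p" "c 1 = q" "curve_length F c < e"
proof -
  obtain c where c: "pw_C1_curve M F c" "c 0 = p" "c 1 = q" by (rule curve_exists[OF p q])
  have "Inf {curve_length F c |c. pw_C1_curve M F c \<and> c 0 = p \<and> c 1 = q} < e"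
    using e p q by (simp add: riem_dist_def)
  then obtain l where "l \<in> {curve_length F c |c. pw_C1_curve M F c \<and> c 0 = p \<and> c 1 = q}" "l < e"
    using cInf_lessD[of "{curve_length F c |c. pw_C1_curve M F c \<and> c 0 = p \<and> c 1 = q}" e] c by blast
  then show thesis using that by blast
qed

lemma riem_dist_nonneg: "riem_dist M F p q \<ge> 0"
proof (cases "p \<in> topspace M \<and> q \<in> topspace M")
  case True
  then obtain c where "pw_C1_curve M F c" "c 0 = p" "c 1 = q" using curve_exists by blast
  then have "{curve_length F c |c. pw_C1_curve M F c \<and> c 0 = p \<and> c 1 = q} \<noteq> {}" by blast
  then have "Inf {curve_length F c |c. pw_C1_curve M F c \<and> c 0 = p \<and> c 1 = q} \<ge> 0"
    by (rule cInf_greatest) (auto simp: curve_length_nonneg)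
  then show ?thesis using True by (simp add: riem_dist_def)
qed (auto simp: riem_dist_def)

text \<open>A curve leaving a small coordinate ball meets its boundary sphere, whose image under \<open>F\<close> has
  positive distance from the image of the centre.\<close>

lemma riem_dist_separates:
  assumes U: "openin M U" and q: "q \<in> U"
  obtains e where "e > 0" "\<And>p. p \<in> topspace M \<Longrightarrow> riem_dist M F q p < e \<Longrightarrow> p \<in> U"
proof -
  have qM: "q \<in> topspace M" using U q openin_subset by blast
  obtain D \<psi> u where D: "(D,\<psi>) \<in> \<A>" "u \<in> D" "\<psi> u = q" using hypersurface_facts(6)[OF qM] by blast
  note sm = smooth_manifoldD[OF hypersurface_facts(1) D(1)]
  define f where "f = F \<circ> \<psi>"
  note I = immersion_onD[OF hypersurface_facts(5)[OF D(1), folded f_def]]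
  \<comment> \<open>The left inverse makes \<open>f\<close> injective on \<open>W\<close>, so that
    the image of the sphere misses \<open>f u\<close>; compactness then gives the positive distance
    \<open>e\<close>.\<close>
  obtain W V r0 where W: "open W" "W \<subseteq> D" "u \<in> W" "\<And>x. x \<in> W \<Longrightarrow> r0 (f x) = x"
    using immersion_left_inverse[OF I(1,2) D(2) I(3)[OF D(2)]] by metis
  have "openin (top_of_set D) {x \<in> topspace (top_of_set D). \<psi> x \<in> U}"
    using sm(4) U by (rule openin_continuous_map_preimage)
  then have "open {x \<in> D. \<psi> x \<in> U}" using sm(1) by (simp add: openin_open_eq)
  then have "open (W \<inter> {x \<in> D. \<psi> x \<in> U})" "u \<in> W \<inter> {x \<in> D. \<psi> x \<in> U}" using W D q by auto
  then obtain r where r: "r > 0" "cball u r \<subseteq> W \<inter> {x \<in> D. \<psi> x \<in> U}" using open_contains_cball by metis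
  have cb: "cball u r \<subseteq> D" "cball u r \<subseteq> W" "\<psi> ` cball u r \<subseteq> U" using r(2) by auto
  have cs: "compact (sphere u r)" "sphere u r \<noteq> {}" using r(1) by auto
  have "sphere u r \<subseteq> D" using cb(1) by auto
  then have "continuous_on (sphere u r) (\<lambda>x. norm (f x - f u))"
    using continuous_on_subset[OF smooth_on_continuous[OF I(2)]] by (intro continuous_intros) auto
  from continuous_attains_inf[OF cs this] obtain x0 where x0: "x0 \<in> sphere u r"
    "\<And>x. x \<in> sphere u r \<Longrightarrow> norm (f x0 - f u) \<le> norm (f x - f u)" by blast
  define e where "e = norm (f x0 - f u)"
  have "x0 \<in> W" "x0 \<noteq> u" using x0(1) cb(2) r(1) by auto
  then have "f x0 \<noteq> f u" using W(3,4) by metis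
  then have e: "e > 0" by (simp add: e_def)
  have "p \<in> U" if p: "p \<in> topspace M" and d: "riem_dist M F q p < e" for p
  proof (rule ccontr)
    assume pU: "p \<notin> U"
    obtain c where c: "pw_C1_curve M F c" "c 0 = q" "c 1 = p" "curve_length F c < e"
      by (rule riem_dist_attained[OF qM p d])
    have cont: "continuous_map (top_of_set {0..1}) M c" using pw_C1_curveD(1)[OF c(1)] by (simp add: pathin_def)
    define A where "A = {t \<in> {0..1}. c t \<in> \<psi> ` ball u r}"
    define B where "B = {t \<in> {0..1}. c t \<in> topspace M - \<psi> ` cball u r}"
    have oA: "openin (top_of_set {0..1}) A"
      using openin_continuous_map_preimage[OF cont sm(5)[of "ball u r"]] cb(1) ball_subset_cball[of u r]
      by (simp add: A_def subset_trans)
    have "continuous_map (top_of_set (cball u r)) M \<psi>"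
      using continuous_map_from_subtopology_mono[OF sm(4) cb(1)] .
    then have "compactin M (\<psi> ` cball u r)"
      using image_compactin[of "top_of_set (cball u r)" "cball u r" M \<psi>] by (simp add: compactin_subtopology)
    then have "closedin M (\<psi> ` cball u r)" using hypersurface_facts(3) compactin_imp_closedin by blast
    then have oB: "openin (top_of_set {0..1}) B"
      using openin_continuous_map_preimage[OF cont, of "topspace M - \<psi> ` cball u r"]
      by (simp add: B_def openin_diff)
    have AB: "A \<union> B \<noteq> {0..1}"
    proof
      assume un: "A \<union> B = {0..1}"
      have "A \<inter> B = {}" using ball_subset_cball[of u r] by (auto simp: A_def B_def)
      moreover have "0 \<in> A" unfolding A_def using c(2) D(3) r(1) by (auto intro!: image_eqI[of _ _ u])
      moreover have "1 \<in> B" using c(3) p pU cb(3) by (auto simp: B_def)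
      ultimately have "\<not> connected {0..1::real}"
        unfolding connected_openin using oA oB un by blast
      then show False by simp
    qed
    then obtain t where t: "t \<in> {0..1}" "t \<notin> A" "t \<notin> B" unfolding A_def B_def by blast
    have "c t \<in> topspace M" using continuous_map_image_subset_topspace[OF cont] t(1) by auto
    then have "c t \<in> \<psi> ` cball u r" "c t \<notin> \<psi> ` ball u r" using t by (auto simp: A_def B_def)
    then obtain x where x: "x \<in> sphere u r" "c t = \<psi> x" by (auto simp: image_iff)
    have "norm (f x - f u) \<le> curve_length F c"
      using curve_length_ge[OF c(1), of 0 t] t(1) c(2) x(2) D(3) by (simp add: f_def)
    then show False using x0(2)[OF x(1)] c(4) by (simp add: e_def)
  qed
  then show thesis using that e by blast
qed

lemma riem_metric: "Metric_space (topspace M) (riem_dist M F)"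
proof
  fix p q
  show "0 \<le> riem_dist M F p q" by (rule riem_dist_nonneg)
  show "riem_dist M F p q = riem_dist M F q p" by (rule riem_dist_commute)
  assume p: "p \<in> topspace M" and q: "q \<in> topspace M"
  show "(riem_dist M F p q = 0) = (p = q)"
  proof
    assume 0: "riem_dist M F p q = 0"
    show "p = q"
    proof (rule ccontr)
      assume "p \<noteq> q"
      then obtain U where U: "openin M U" "p \<in> U" "q \<notin> U"
        using hypersurface_facts(3) p q unfolding Hausdorff_space_def disjnt_def by (metis disjoint_iff)
      obtain e where "e > 0" "\<And>x. x \<in> topspace M \<Longrightarrow> riem_dist M F p x < e \<Longrightarrow> x \<in> U"
        by (rule riem_dist_separates[OF U(1,2)]) blast
      then show False using 0 q U(3) by auto
    qed
  next
    assume "p = q"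
    then have "riem_dist M F p q \<le> 0" using riem_dist_le[OF pw_C1_const(1)[OF p]] pw_C1_const(2)[OF p] by metis
    then show "riem_dist M F p q = 0" using riem_dist_nonneg[of p q] by simp
  qed
  fix z assume z: "z \<in> topspace M"
  show "riem_dist M F p z \<le> riem_dist M F p q + riem_dist M F q z"
  proof (rule field_le_epsilon)
    fix e :: real assume e: "e > 0"
    have e2: "riem_dist M F p q < riem_dist M F p q + e / 2" "riem_dist M F q z < riem_dist M F q z + e / 2"
      using e by auto
    obtain c1 where c1: "pw_C1_curve M F c1" "c1 0 = p" "c1 1 = q" "curve_length F c1 < riem_dist M F p q + e / 2"
      by (rule riem_dist_attained[OF p q e2(1)])
    obtain c2 where c2: "pw_C1_curve M F c2" "c2 0 = q" "c2 1 = z" "curve_length F c2 < riem_dist M F q z + e / 2"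
      by (rule riem_dist_attained[OF q z e2(2)])
    have "c1 1 = c2 0" using c1 c2 by simp
    from pw_C1_join[OF c1(1) c2(1) this] obtain c where
      "pw_C1_curve M F c" "c 0 = c1 0" "c 1 = c2 1" "curve_length F c = curve_length F c1 + curve_length F c2" .
    then show "riem_dist M F p z \<le> riem_dist M F p q + riem_dist M F q z + e"
      using riem_dist_le[of M F c p z] c1 c2 by simp
  qed
qed

text \<open>\<open>riem_dist_separates\<close> and \<open>short_curves\<close> are the two
  inclusions. The identity lets completeness, a statement about \<open>riem_dist\<close>, produce
  limits in \<open>M\<close>.\<close>

lemma riem_topology: "Metric_space.mtopology (topspace M) (riem_dist M F) = M"
proof -
  interpret R: Metric_space "topspace M" "riem_dist M F" by (rule riem_metric)
  have "openin R.mtopology U = openin M U" for U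
  proof
    assume "openin M U"
    then show "openin R.mtopology U"
      unfolding R.openin_mtopology
    proof (intro conjI allI impI)
      fix x assume "openin M U" "x \<in> U"
      from riem_dist_separates[OF this] obtain e where "e > 0" "\<And>p. p \<in> topspace M \<Longrightarrow> riem_dist M F x p < e \<Longrightarrow> p \<in> U" by blast
      then show "\<exists>r>0. R.mball x r \<subseteq> U" by (auto simp: R.mball_def)
    qed (auto dest: openin_subset)
  next
    assume U: "openin R.mtopology U"
    show "openin M U"
    proof (subst openin_subopen, intro ballI)
      fix x assume x: "x \<in> U"
      obtain r where r: "r > 0" "R.mball x r \<subseteq> U" using U x by (auto simp: R.openin_mtopology)
      have xM: "x \<in> topspace M" using U x by (auto simp: R.openin_mtopology)
      obtain V where V: "openin M V" "x \<in> V"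
        "\<And>p. p \<in> V \<Longrightarrow> \<exists>c. pw_C1_curve M F c \<and> c 0 = x \<and> c 1 = p \<and> curve_length F c < r"
        by (rule short_curves[OF xM r(1)]) blast
      have "V \<subseteq> R.mball x r"
      proof
        fix p assume p: "p \<in> V"
        then obtain c where "pw_C1_curve M F c" "c 0 = x" "c 1 = p" "curve_length F c < r" using V(3) by blast
        then have "riem_dist M F x p < r" using riem_dist_le by fastforce
        then show "p \<in> R.mball x r" using p V(1) xM openin_subset by (auto simp: R.mball_def)
      qed
      then show "\<exists>T. openin M T \<and> x \<in> T \<and> T \<subseteq> U" using V r by blast
    qed
  qed
  then show ?thesis by (simp add: topology_eq)
qed

lemma complete_limit:
  assumes "complete_hypersurface M F" "range \<sigma> \<subseteq> topspace M"
    and "\<And>e. e > 0 \<Longrightarrow> \<exists>N. \<forall>n n'. N \<le> n \<longrightarrow> N \<le> n' \<longrightarrow> riem_dist M F (\<sigma> n) (\<sigma> n') < e"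
  obtains q where "limitin M \<sigma> q sequentially"
proof -
  interpret R: Metric_space "topspace M" "riem_dist M F" by (rule riem_metric)
  have "R.MCauchy \<sigma>" using assms(2,3) by (auto simp: R.MCauchy_def)
  then obtain q where "limitin R.mtopology \<sigma> q sequentially"
    using assms(1) unfolding complete_hypersurface_def R.mcomplete_def by blast
  then show thesis using that by (simp add: riem_topology)
qed

end

section \<open>Charts adapted to the flat directions\<close>

lemma coord_hyperplane_subspace: "subspace (coord_hyperplane k)"
  by (auto simp: coord_hyperplane_def subspace_def)

lemma dim_coord_hyperplane: "dim (coord_hyperplane (k :: 'n::finite)) = CARD('n) - 1"
proof -
  have "coord_hyperplane k = {x. axis k 1 \<bullet> x = 0}"
    by (auto simp: coord_hyperplane_def inner_axis')
  then show ?thesis using dim_hyperplane[of "axis k 1 :: real^'n"] by (simp add: axis_eq_0_iff)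
qed

lemma hyperplane_part_linear: "linear (hyperplane_part k)"
  by (intro linearI) (simp_all add: hyperplane_part_def algebra_simps)

lemma hyperplane_part_in: "hyperplane_part k u \<in> coord_hyperplane k"
  by (simp add: hyperplane_part_def coord_hyperplane_def axis_def)

lemma hyperplane_part_id: "y \<in> coord_hyperplane k \<Longrightarrow> hyperplane_part k y = y"
  by (simp add: hyperplane_part_def coord_hyperplane_def)

lemma hyperplane_decomp: "u = (u $ k) *\<^sub>R axis k 1 + hyperplane_part k u"
  by (simp add: hyperplane_part_def)

lemma hyperplane_part_axis: "hyperplane_part k (c *\<^sub>R axis k 1) = 0"
  by (simp add: hyperplane_part_def axis_def)

lemma hyperplane_inner: "u \<bullet> v = (u $ k) * (v $ k) + hyperplane_part k u \<bullet> hyperplane_part k v"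
  by (simp add: hyperplane_part_def inner_diff_left inner_diff_right inner_axis inner_axis')

text \<open>The orthogonal sum of an isometry of the coordinate hyperplane onto \<open>K\<close> and
  one of R^2 onto the orthogonal complement of \<open>K\<close>, whose dimension is (n + 1) - (n -
  1) = 2.\<close>

lemma splitting_isometry_exists:
  fixes K :: "(real^'m::finite) set" and k :: "'n::finite"
  assumes K: "subspace K" "dim K = CARD('n) - 1" and card: "CARD('m) = CARD('n) + 1"
  obtains T :: "(real^2) \<times> (real^'n) \<Rightarrow> real^'m" where "linear T"
    "\<And>z y. y \<in> coord_hyperplane k \<Longrightarrow> norm (T (z, y)) = norm (z, y)"
    "\<And>y. y \<in> coord_hyperplane k \<Longrightarrow> T (0, y) \<in> K"
proof -
  obtain f1 :: "real^'n \<Rightarrow> real^'m" where f1: "linear f1" "f1 ` coord_hyperplane k = K"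
    "\<And>x. x \<in> coord_hyperplane k \<Longrightarrow> norm (f1 x) = norm x"
    using isometry_subspaces[OF coord_hyperplane_subspace[of k] K(1)] dim_coord_hyperplane[of k] K(2) by metis
  define P where "P = {y \<in> UNIV. \<forall>x \<in> K. orthogonal x y}"
  have sP: "subspace P" unfolding P_def by (auto simp: subspace_def orthogonal_def inner_add_right)
  have "dim P + dim K = CARD('m)"
    unfolding P_def using dim_subspace_orthogonal_to_vectors[OF K(1) subspace_UNIV] by simp
  moreover have "CARD('n) \<ge> 1" by (simp add: Suc_leI)
  ultimately have "dim P = 2" using K(2) card by linarith
  then obtain f2 :: "real^2 \<Rightarrow> real^'m" where f2: "linear f2" "range f2 = P" "\<And>x. norm (f2 x) = norm x"
    using isometry_subspaces[of "UNIV :: (real^2) set", OF subspace_UNIV sP] by auto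
  define T where "T zy = f2 (fst zy) + f1 (snd zy)" for zy
  have "linear T" unfolding T_def
    by (intro linearI) (simp_all add: linear_add[OF f1(1)] linear_add[OF f2(1)] linear_scale[OF f1(1)] linear_scale[OF f2(1)] algebra_simps)
  moreover have "norm (T (z, y)) = norm (z, y)" if y: "y \<in> coord_hyperplane k" for z y
  proof -
    have "f1 y \<in> K" "f2 z \<in> P" using f1(2) f2(2) y by auto
    then have "orthogonal (f1 y) (f2 z)" by (simp add: P_def)
    then have "(norm (f2 z + f1 y))\<^sup>2 = (norm (f2 z))\<^sup>2 + (norm (f1 y))\<^sup>2"
      by (intro norm_add_Pythagorean) (simp add: orthogonal_commute)
    then have "norm (T (z, y)) = sqrt ((norm z)\<^sup>2 + (norm y)\<^sup>2)"
      using f1(3)[OF y] f2(3) by (simp add: T_def) (metis norm_ge_zero real_sqrt_unique)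
    then show ?thesis by (simp add: norm_Pair)
  qed
  moreover have "T (0, y) \<in> K" if "y \<in> coord_hyperplane k" for y
    using f1(2) that linear_0[OF f2(1)] by (auto simp: T_def)
  ultimately show thesis using that by blast
qed

text \<open>What the curvature argument hands over to the splitting: an isometric copy of the flat
  factor, \<open>T (0, y)\<close> for \<open>y\<close> in the hyperplane, that lies in every tangent
  space.\<close>

locale splitting =
  fixes M :: "'p topology" and \<A> :: "('n::finite, 'p) atlas" and F :: "'p \<Rightarrow> real^'m::finite"
    and k :: 'n and T :: "(real^2) \<times> (real^'n) \<Rightarrow> real^'m"
  assumes M: "immersed_hypersurface M \<A> F"
    and linT: "linear T"
    and normT: "\<And>z y. y \<in> coord_hyperplane k \<Longrightarrow> norm (T (z, y)) = norm (z, y)"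
    and tangT: "\<And>D \<psi> u y. (D,\<psi>) \<in> \<A> \<Longrightarrow> u \<in> D \<Longrightarrow> y \<in> coord_hyperplane k \<Longrightarrow> T (0, y) \<in> tangent_space (F \<circ> \<psi>) u"
begin

abbreviation H :: "(real^'n) set" where "H \<equiv> coord_hyperplane k"
abbreviation hp :: "real^'n \<Rightarrow> real^'n" where "hp \<equiv> hyperplane_part k"

lemmas facts = hypersurface_facts[OF M]

lemma H_closed: "y \<in> H \<Longrightarrow> y' \<in> H \<Longrightarrow> y + y' \<in> H" "y \<in> H \<Longrightarrow> c *\<^sub>R y \<in> H" "0 \<in> H"
  "y \<in> H \<Longrightarrow> y' \<in> H \<Longrightarrow> y - y' \<in> H" "y \<in> H \<Longrightarrow> - y \<in> H"
  by (auto simp: coord_hyperplane_def)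

lemma T_add: "T (z, y) + T (z', y') = T (z + z', y + y')"
  using linear_add[OF linT, of "(z, y)" "(z', y')"] by simp

lemma T_scale: "c *\<^sub>R T (z, y) = T (c *\<^sub>R z, c *\<^sub>R y)"
  using linear_scale[OF linT, of c "(z, y)"] by simp

lemma T_zero: "T (0, 0) = 0" using linear_0[OF linT] by (simp add: zero_prod_def)

lemma innerT: "y \<in> H \<Longrightarrow> y' \<in> H \<Longrightarrow> T (z, y) \<bullet> T (z', y') = z \<bullet> z' + y \<bullet> y'"
proof -
  assume y: "y \<in> H" "y' \<in> H"
  have "T (z, y) \<bullet> T (z', y') = (z, y) \<bullet> (z', y')"
    unfolding dot_norm T_add using normT y H_closed(1)[OF y] by simp
  then show ?thesis by simp
qed

lemma T_inj: "y \<in> H \<Longrightarrow> y' \<in> H \<Longrightarrow> T (z, y) = T (z', y') \<Longrightarrow> z = z' \<and> y = y'"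
proof -
  assume y: "y \<in> H" "y' \<in> H" and eq: "T (z, y) = T (z', y')"
  have "T (z - z', y - y') = 0" using eq linear_diff[OF linT, of "(z, y)" "(z', y')"] by simp
  then have "norm (z - z', y - y') = 0" using normT[OF H_closed(4)[OF y], of "z - z'"] by simp
  then show ?thesis by (simp add: zero_prod_def)
qed

text \<open>The domain of \<open>T\<close> has one dimension too many, so \<open>T\<close> can be
  inverted only on the product of R^2 with \<open>H\<close>. There it is injective, and onto by a
  dimension count.\<close>

lemma T_inverse: "\<exists>S. linear S \<and> (\<forall>z. \<forall>y\<in>H. S (T (z, y)) = (z, y)) \<and> (\<forall>x. snd (S x) \<in> H \<and> T (S x) = x)"
proof -
  let ?V = "(UNIV :: (real^2) set) \<times> H"
  have sV: "subspace ?V" using coord_hyperplane_subspace[of k] by (intro subspace_Times) auto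
  have inj: "inj_on T ?V" using T_inj by (auto simp: inj_on_def)
  have "dim ?V = dim (UNIV :: (real^2) set) + dim H"
    by (rule dim_Times) (auto simp: coord_hyperplane_subspace)
  then have "dim ?V = 2 + (CARD('n) - 1)" using dim_coord_hyperplane[of k] by simp
  then have dV: "dim ?V = CARD('m)" using facts(4) by simp
  have spV: "span ?V = ?V" using sV by (rule span_eq_iff[THEN iffD2])
  have "dim (T ` ?V) = dim ?V" by (rule dim_image_eq[OF linT]) (simp add: spV inj)
  then have "T ` ?V = UNIV"
    using subspace_dim_equal[OF linear_subspace_image[OF linT sV] subspace_UNIV] dV by simp
  moreover obtain S where "linear S" "\<forall>v\<in>?V. S (T v) = v"
    using linear_exists_left_inverse_on[OF linT sV inj] by blast
  ultimately show ?thesis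
  proof (intro exI[of _ S] conjI allI ballI)
    fix x
    obtain v where "v \<in> ?V" "x = T v" using \<open>T ` ?V = UNIV\<close> by blast
    then show "snd (S x) \<in> H" "T (S x) = x" using \<open>\<forall>v\<in>?V. S (T v) = v\<close> by auto
  qed auto
qed

definition S :: "real^'m \<Rightarrow> (real^2) \<times> (real^'n)" where
  "S = (SOME S. linear S \<and> (\<forall>z. \<forall>y\<in>H. S (T (z, y)) = (z, y)) \<and> (\<forall>x. snd (S x) \<in> H \<and> T (S x) = x))"

lemma S: "linear S" "y \<in> H \<Longrightarrow> S (T (z, y)) = (z, y)" "snd (S x) \<in> H" "T (S x) = x"
  using someI_ex[OF T_inverse, folded S_def] by auto

text \<open>A product neighbourhood for the splitting of R^n into the axis \<open>k\<close> and
  \<open>H\<close>. It is convex in the flat directions, so straight segments within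
  \<open>H\<close> cannot leave it in between.\<close>

definition cylinder :: "real^'n \<Rightarrow> real \<Rightarrow> (real^'n) set" where
  "cylinder y0 r = {u. \<bar>u $ k\<bar> < r \<and> norm (hp u - y0) < r}"

lemma open_cylinder: "open (cylinder y0 r)"
proof -
  have "continuous_on UNIV hp" using hyperplane_part_linear linear_continuous_on linear_conv_bounded_linear by blast
  then show ?thesis unfolding cylinder_def by (intro open_Collect_conj open_Collect_less continuous_intros)
qed

text \<open>A graph over the tangent space whose coordinates are aligned with \<open>T\<close>. The
  function \<open>\<phi>\<close> is constant in the flat directions, so on a cylinder it depends on
  coordinate \<open>k\<close> alone, and \<open>F\<close> splits into a plane curve and a linear
  part. Coordinates are shifted so that the \<open>H\<close> part of the chart is that of the
  position.\<close>

lemma adapted_chart: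
  assumes p0: "p0 \<in> topspace M"
  obtains r \<theta> \<alpha> where "r > 0" "inj_on \<theta> (cylinder (snd (S (F p0))) r)"
    "continuous_map (top_of_set (cylinder (snd (S (F p0))) r)) M \<theta>"
    "\<And>U. open U \<Longrightarrow> U \<subseteq> cylinder (snd (S (F p0))) r \<Longrightarrow> openin M (\<theta> ` U)"
    "\<theta> (snd (S (F p0))) = p0"
    "\<And>u. u \<in> cylinder (snd (S (F p0))) r \<Longrightarrow> F (\<theta> u) = T (\<alpha> (u $ k), hp u)"
    "smooth_on {-r<..<r} \<alpha>" "\<And>s. s \<in> {-r<..<r} \<Longrightarrow> fd \<alpha> s 1 \<noteq> 0" "inj_on \<alpha> {-r<..<r}"
proof -
  define y0 where "y0 = snd (S (F p0))"
  define a0 where "a0 = fst (S (F p0))"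
  have y0: "y0 \<in> H" unfolding y0_def by (rule S)
  have F0: "F p0 = T (a0, y0)" unfolding y0_def a0_def by (simp add: S(4))
  obtain D \<psi> u0 where D: "(D,\<psi>) \<in> \<A>" "u0 \<in> D" "\<psi> u0 = p0" using facts(6)[OF p0] by blast
  note sm = smooth_manifoldD[OF facts(1) D(1)]
  define f where "f = F \<circ> \<psi>"
  note imf = facts(5)[OF D(1), folded f_def]
  note I = immersion_onD[OF imf]
  have f0: "f u0 = F p0" using D by (simp add: f_def)
  obtain N0 where N0: "norm N0 = 1" "tangent_space f u0 = {w. w \<bullet> N0 = 0}"
    using unit_normal_exists[OF I(4,3)[OF D(2)] facts(4)] by blast
  have NN: "N0 \<bullet> N0 = 1" using N0(1) by (simp add: norm_eq_1)
  have TN: "T (0, y) \<bullet> N0 = 0" if "y \<in> H" for y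
    using tangT[OF D(1,2) that] N0(2) by (simp add: f_def)
  define \<nu> where "\<nu> = fst (S N0)"
  define y1 where "y1 = snd (S N0)"
  have N1: "N0 = T (\<nu>, y1)" "y1 \<in> H" unfolding \<nu>_def y1_def by (simp_all add: S)
  \<comment> \<open>The normal is orthogonal to every flat direction, in particular to
    \<open>T (0, y1)\<close>; hence its own flat component is zero.\<close>
  have "y1 \<bullet> y1 = 0" using TN[OF N1(2)] innerT[OF N1(2) N1(2), of 0 \<nu>] N1(1) by simp
  then have N2: "N0 = T (\<nu>, 0)" using N1(1) by simp
  have nn: "\<nu> \<bullet> \<nu> = 1" using NN innerT[OF H_closed(3) H_closed(3), of \<nu> \<nu>] N2 by simp
  \<comment> \<open>\<open>\<nu>\<close> rotated by a right angle: \<open>T (e, 0)\<close> is the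
    tangent direction orthogonal to the flat ones and becomes the axis \<open>k\<close>.\<close>
  define e where "e = (\<chi> i. if i = 1 then - (\<nu> $ 2) else \<nu> $ 1 :: real^2)"
  have e: "e \<bullet> \<nu> = 0" "e \<bullet> e = 1"
    using nn by (simp_all add: e_def inner_vec_def sum_2)
  define J where "J u = T ((u $ k) *\<^sub>R e, hp u)" for u
  have linJ: "linear J" unfolding J_def
    by (intro linearI) (simp_all add: T_add T_scale scaleR_add_left linear_add[OF hyperplane_part_linear] linear_scale[OF hyperplane_part_linear])
  have JJ: "J v \<bullet> J w = v \<bullet> w" for v w
    by (simp add: J_def innerT hyperplane_part_in e hyperplane_inner[of v w k])
  have JH: "J y = T (0, y)" if "y \<in> H" for y using that by (simp add: J_def hyperplane_part_id coord_hyperplane_def)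
  have "range J \<subseteq> {w. w \<bullet> N0 = 0}"
    using innerT[OF hyperplane_part_in H_closed(3)] e(1) by (auto simp: J_def N2)
  moreover have "inj J"
  proof (rule injI)
    fix a b assume "J a = J b"
    then have "J (a - b) = 0" by (simp add: linear_diff[OF linJ])
    then have "(a - b) \<bullet> (a - b) = 0" using JJ[of "a - b" "a - b"] by simp
    then show "a = b" by simp
  qed
  then have "dim (range J) = CARD('n)" using dim_image_eq[OF linJ, of UNIV] by simp
  moreover have "dim {w. w \<bullet> N0 = 0} = CARD('m) - 1"
    using dim_hyperplane[of N0] N0(1) by (simp add: inner_commute flip: zero_less_norm_iff)
  ultimately have rJ: "range J = tangent_space f u0"
    unfolding N0(2) using facts(4) linear_subspace_image[OF linJ subspace_UNIV]
    by (intro subspace_dim_equal subspace_hyperplane2) auto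
  obtain V \<phi> g U h where G: "graph V J N0 \<phi>" "reparam V g D" "g 0 = u0"
    "\<And>y. y \<in> V \<Longrightarrow> f (g y) = f u0 + J y + \<phi> y *\<^sub>R N0"
    "open U" "U \<subseteq> D" "u0 \<in> U" "homeomorphism V U g h" "smooth_on U h"
    by (rule graph_chart_exists[OF imf D(2) facts(4) linJ JJ rJ NN N0(2)]) blast
  interpret G: graph V J "F p0" N0 \<phi> by (rule G(1))
  have Gf: "f (g y) = G.F y" if "y \<in> V" for y using G(4)[OF that] by (simp add: G.F_def f0)
  \<comment> \<open>The vector \<open>T (0, y)\<close> is tangent to the graph at every point and
    has no component along \<open>N0\<close>, so the gradient of \<open>\<phi>\<close> annihilates
    \<open>y\<close>.\<close>
  have dphi: "fd \<phi> u y = 0" if u: "u \<in> V" and y: "y \<in> H" for u y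
  proof -
    have "tangent_space G.F u = tangent_space (f \<circ> g) u"
      by (rule geometry_cong(2)[OF G.V u]) (simp add: Gf)
    also have "\<dots> = tangent_space f (g u)" by (rule tangent_space_reparam[OF imf G(2) u])
    finally have "T (0, y) \<in> tangent_space G.F u"
      using tangT[OF D(1) reparam_props(1)[OF imf G(2) u] y] by (simp add: f_def)
    then obtain v where v: "T (0, y) = fd G.F u v" by (auto simp: tangent_space_def)
    then have j: "J y = J v + (G.grad u \<bullet> v) *\<^sub>R N0" by (simp add: JH[OF y] G.fd_F[OF u])
    then have "J y \<bullet> N0 = (J v + (G.grad u \<bullet> v) *\<^sub>R N0) \<bullet> N0" by simp
    then have g0: "G.grad u \<bullet> v = 0" by (simp add: inner_add_left G.JN NN)
    then have "v = y" using j \<open>inj J\<close> by (simp add: inj_eq)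
    then show ?thesis using g0 G.fd_phi[OF u] by simp
  qed
  obtain \<rho> where \<rho>: "\<rho> > 0" "ball 0 \<rho> \<subseteq> V" using G.V G.zero openE by blast
  \<comment> \<open>Half of \<open>\<rho>\<close>, since the norm of a point of the shifted cylinder
    is bounded by the sum of the two radii.\<close>
  define r where "r = \<rho> / 2"
  have r: "r > 0" using \<rho> by (simp add: r_def)
  have inV: "s *\<^sub>R ax k + y \<in> V" if "\<bar>s\<bar> < r" "norm y < r" for s y
  proof -
    have "norm (s *\<^sub>R ax k + y) \<le> \<bar>s\<bar> + norm y" using norm_triangle_ineq[of "s *\<^sub>R ax k" y] by simp
    also have "\<dots> < \<rho>" using that by (simp add: r_def)
    finally show ?thesis using \<rho>(2) by (auto simp: dist_norm)
  qed
  have phik: "\<phi> (s *\<^sub>R ax k + y) = \<phi> (s *\<^sub>R ax k)" if s: "\<bar>s\<bar> < r" and y: "norm y < r" "y \<in> H" for s y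
  proof -
    let ?q = "\<lambda>t. \<phi> (s *\<^sub>R ax k + t *\<^sub>R y)"
    have "(?q has_real_derivative 0) (at t)" if t: "0 \<le> t" "t \<le> 1" for t
    proof -
      have "norm (t *\<^sub>R y) < r" using t y(1) mult_left_le_one_le[of "norm y" t] by simp
      then have v: "s *\<^sub>R ax k + t *\<^sub>R y \<in> V" by (rule inV[OF s])
      have "(?q has_derivative (\<lambda>\<tau>. fd \<phi> (s *\<^sub>R ax k + t *\<^sub>R y) (\<tau> *\<^sub>R y))) (at t)"
        by (rule has_derivative_compose[of "\<lambda>t. s *\<^sub>R ax k + t *\<^sub>R y" "\<lambda>\<tau>. \<tau> *\<^sub>R y" t UNIV, OF _ smooth_on_has_derivative[OF G.sm v]])
           (auto intro!: derivative_eq_intros)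
      then show ?thesis using dphi[OF v H_closed(2)[OF y(2)]] by (simp add: has_field_derivative_def lambda_zero)
    qed
    then have "?q 1 = ?q 0"
      using DERIV_isconst2[of 0 1 ?q 1] DERIV_isCont continuous_at_imp_continuous_on
      by (smt (verit, best) atLeastAtMost_iff)
    then show ?thesis by simp
  qed
  define B where "B = cylinder y0 r"
  define \<theta> where "\<theta> u = \<psi> (g (u - y0))" for u
  define \<alpha> where "\<alpha> s = a0 + s *\<^sub>R e + \<phi> (s *\<^sub>R ax k) *\<^sub>R \<nu>" for s
  have hp0: "hp (u - y0) = hp u - y0" for u
    by (simp add: linear_diff[OF hyperplane_part_linear] hyperplane_part_id[OF y0])
  have k0: "(u - y0) $ k = u $ k" for u using y0 by (simp add: coord_hyperplane_def)
  have dec: "u - y0 = (u $ k) *\<^sub>R ax k + (hp u - y0)" for u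
    using hyperplane_decomp[of "u - y0" k] unfolding hp0 k0 .
  have BV: "u - y0 \<in> V" if "u \<in> B" for u
    unfolding dec[of u] using inV[of "u $ k" "hp u - y0"] that by (simp add: B_def cylinder_def)
  have FT: "F (\<theta> u) = T (\<alpha> (u $ k), hp u)" if u: "u \<in> B" for u
  proof -
    have p: "\<phi> (u - y0) = \<phi> ((u $ k) *\<^sub>R ax k)"
      unfolding dec[of u] using phik[of "u $ k" "hp u - y0"] u H_closed(4)[OF hyperplane_part_in y0]
      by (simp add: B_def cylinder_def)
    have j: "J (u - y0) = T ((u $ k) *\<^sub>R e, hp u - y0)" unfolding J_def hp0 k0 ..
    have "F (\<theta> u) = F p0 + J (u - y0) + \<phi> (u - y0) *\<^sub>R N0"
      using Gf[OF BV[OF u], unfolded G.F_def] by (simp add: \<theta>_def f_def)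
    then show ?thesis unfolding p j F0 N2 T_scale T_add by (simp add: \<alpha>_def)
  qed
  have cg: "continuous_on V g" using G(8) by (simp add: homeomorphism_def)
  have gD: "g y \<in> D" if "y \<in> V" for y using reparam_props(1)[OF imf G(2) that] .
  have openg: "open (g ` W)" if "open W" "W \<subseteq> V" for W
  proof -
    have "homeomorphism U V h g" using G(8) homeomorphism_symD by blast
    then have "g ` W = U \<inter> h -` W" using that(2) by (auto simp: homeomorphism_def image_iff) (metis imageI)
    then show ?thesis using continuous_open_preimage[OF _ G(5) that(1), of h] G(8) by (simp add: homeomorphism_def)
  qed
  have smk: "smooth_on {-r<..<r} (\<lambda>s. \<phi> (s *\<^sub>R ax k))"
    by (rule smooth_on_compose[OF _ G.V _ _ G.sm])
       (use inV[of _ 0] r in \<open>auto simp: intro!: smooth_on_linear bounded_linear_scaleR_left\<close>)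
  have sa: "smooth_on {-r<..<r} \<alpha>" unfolding \<alpha>_def[abs_def]
    by (intro smooth_on_add smooth_on_const smooth_on_linear smooth_on_linear_compose[OF bounded_linear_scaleR_left _ smk] bounded_linear_scaleR_left)
       auto
  \<comment> \<open>The component of \<open>\<alpha>\<close> along \<open>e\<close> is the parameter
    plus a constant; this gives the nonzero derivative and the injectivity.\<close>
  have ae: "\<alpha> s \<bullet> e = a0 \<bullet> e + s" for s
    using e by (simp add: \<alpha>_def inner_add_left inner_commute[of \<nu>])
  have "fd \<alpha> s 1 \<noteq> 0" if s: "s \<in> {-r<..<r}" for s
  proof -
    have "fd \<alpha> s 1 \<bullet> e = fd (\<lambda>s. \<alpha> s \<bullet> e) s 1" using fd_inner[OF smooth_on_differentiable[OF sa s]] by simp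
    also have "(\<lambda>s. \<alpha> s \<bullet> e) = (\<lambda>s. a0 \<bullet> e + s)" using ae by blast
    also have "fd (\<lambda>s. a0 \<bullet> e + s) s 1 = 1"
      by (subst fd_eq[of _ "\<lambda>x. x"]) (auto intro!: derivative_eq_intros)
    finally show ?thesis by auto
  qed
  moreover have "inj_on \<alpha> {-r<..<r}" using ae by (metis add_left_imp_eq inj_onI)
  moreover have "inj_on \<theta> B"
  proof (rule inj_onI)
    fix a b assume ab: "a \<in> B" "b \<in> B" "\<theta> a = \<theta> b"
    then have "g (a - y0) = g (b - y0)" using sm(3) gD BV by (auto simp: \<theta>_def inj_on_def)
    then have "a - y0 = b - y0" using G(8) BV[OF ab(1)] BV[OF ab(2)] by (metis homeomorphism_apply1)
    then show "a = b" by simp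
  qed
  moreover have "continuous_map (top_of_set B) M \<theta>"
    unfolding \<theta>_def
  proof (rule continuous_map_compose[OF _ sm(4), unfolded comp_def])
    have "continuous_on B (\<lambda>u. g (u - y0))"
      by (rule continuous_on_compose2[OF cg]) (use BV in \<open>auto intro!: continuous_intros\<close>)
    then show "continuous_map (top_of_set B) (top_of_set D) (\<lambda>u. g (u - y0))"
      using BV gD by (auto simp: continuous_map_in_subtopology)
  qed
  moreover have "openin M (\<theta> ` W)" if W: "open W" "W \<subseteq> B" for W
  proof -
    have "open ((\<lambda>u. u - y0) ` W)" using W(1) open_translation_subtract by blast
    then have "open (g ` (\<lambda>u. u - y0) ` W)" by (rule openg) (use W(2) BV in auto)
    then have "openin M (\<psi> ` g ` (\<lambda>u. u - y0) ` W)" by (rule sm(5)) (use W(2) BV gD in auto)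
    then show ?thesis by (simp add: \<theta>_def image_image)
  qed
  moreover have "\<theta> y0 = p0" by (simp add: \<theta>_def G(3) D(3))
  ultimately show thesis
    using that[of r \<theta> \<alpha>] r FT sa unfolding B_def y0_def by blast
qed

end

section \<open>Translations along the flat directions\<close>

lemma immersed_hypersurface_continuous:
  fixes \<A> :: "('n::finite, 'p) atlas" and F :: "'p \<Rightarrow> real^'m::finite"
  assumes M: "immersed_hypersurface M \<A> F"
  shows "continuous_map M euclidean F"
  unfolding continuous_map
proof (intro conjI allI impI)
  fix U :: "(real^'m) set" assume U: "openin euclidean U"
  note facts = hypersurface_facts[OF M]
  show "openin M {p \<in> topspace M. F p \<in> U}"
  proof (subst openin_subopen, intro ballI)
    fix p assume p: "p \<in> {p \<in> topspace M. F p \<in> U}"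
    then obtain D \<psi> u where D: "(D,\<psi>) \<in> \<A>" "u \<in> D" "\<psi> u = p" using facts(6) by blast
    note sm = smooth_manifoldD[OF facts(1) D(1)]
    have c: "continuous_on D (F \<circ> \<psi>)" using smooth_on_continuous[OF immersion_onD(2)[OF facts(5)[OF D(1)]]] .
    have "open (D \<inter> (F \<circ> \<psi>) -` U)" using continuous_open_preimage[OF c sm(1)] U by simp
    then have "openin M (\<psi> ` (D \<inter> (F \<circ> \<psi>) -` U))" by (rule sm(5)) auto
    moreover have "\<psi> ` (D \<inter> (F \<circ> \<psi>) -` U) \<subseteq> {p \<in> topspace M. F p \<in> U}" using sm(7) by auto
    moreover have "p \<in> \<psi> ` (D \<inter> (F \<circ> \<psi>) -` U)" using D p by auto
    ultimately show "\<exists>T. openin M T \<and> p \<in> T \<and> T \<subseteq> {p \<in> topspace M. F p \<in> U}" by blast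
  qed
qed auto

context splitting
begin

lemmas F_continuous = immersed_hypersurface_continuous[OF M]

definition base :: "'p \<Rightarrow> real^'n" where "base p = snd (S (F p))"

lemma base_H: "base p \<in> H" unfolding base_def by (rule S)

definition adapted :: "'p \<Rightarrow> real \<Rightarrow> (real^'n \<Rightarrow> 'p) \<Rightarrow> (real \<Rightarrow> real^2) \<Rightarrow> bool" where
  "adapted p r \<theta> \<alpha> \<longleftrightarrow> r > 0 \<and> inj_on \<theta> (cylinder (base p) r) \<and> continuous_map (top_of_set (cylinder (base p) r)) M \<theta> \<and>
     (\<forall>U. open U \<longrightarrow> U \<subseteq> cylinder (base p) r \<longrightarrow> openin M (\<theta> ` U)) \<and> \<theta> (base p) = p \<and>
     (\<forall>u\<in>cylinder (base p) r. F (\<theta> u) = T (\<alpha> (u $ k), hp u)) \<and>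
     smooth_on {-r<..<r} \<alpha> \<and> (\<forall>s\<in>{-r<..<r}. fd \<alpha> s 1 \<noteq> 0) \<and> inj_on \<alpha> {-r<..<r}"

lemma adapted_exists: "p \<in> topspace M \<Longrightarrow> \<exists>r \<theta> \<alpha>. adapted p r \<theta> \<alpha>"
  unfolding adapted_def base_def by (erule adapted_chart) blast

lemma base_in_cylinder: "r > 0 \<Longrightarrow> base p \<in> cylinder (base p) r"
  using base_H[of p] by (simp add: cylinder_def hyperplane_part_id) (simp add: coord_hyperplane_def)

lemma adaptedD:
  assumes "adapted p r \<theta> \<alpha>"
  shows "r > 0" "inj_on \<theta> (cylinder (base p) r)" "continuous_map (top_of_set (cylinder (base p) r)) M \<theta>"
    "\<And>U. open U \<Longrightarrow> U \<subseteq> cylinder (base p) r \<Longrightarrow> openin M (\<theta> ` U)" "\<theta> (base p) = p"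
    "\<And>u. u \<in> cylinder (base p) r \<Longrightarrow> F (\<theta> u) = T (\<alpha> (u $ k), hp u)"
    "openin M (\<theta> ` cylinder (base p) r)" "p \<in> \<theta> ` cylinder (base p) r"
    "\<And>u. u \<in> cylinder (base p) r \<Longrightarrow> \<theta> u \<in> topspace M"
    "continuous_map (subtopology M (\<theta> ` cylinder (base p) r)) (top_of_set (cylinder (base p) r)) (inv_into (cylinder (base p) r) \<theta>)"
    "inj_on F (\<theta> ` cylinder (base p) r)"
proof -
  let ?B = "cylinder (base p) r"
  show a: "r > 0" "inj_on \<theta> ?B" "continuous_map (top_of_set ?B) M \<theta>"
    "\<And>U. open U \<Longrightarrow> U \<subseteq> ?B \<Longrightarrow> openin M (\<theta> ` U)" "\<theta> (base p) = p"
    "\<And>u. u \<in> ?B \<Longrightarrow> F (\<theta> u) = T (\<alpha> (u $ k), hp u)"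
    using assms unfolding adapted_def by blast+
  show o: "openin M (\<theta> ` ?B)" by (rule a(4)[OF open_cylinder]) simp
  show "p \<in> \<theta> ` ?B" using base_in_cylinder[OF a(1)] a(5) by (metis imageI)
  show "\<theta> u \<in> topspace M" if "u \<in> ?B" for u using openin_subset[OF o] that by blast
  show "continuous_map (subtopology M (\<theta> ` ?B)) (top_of_set ?B) (inv_into ?B \<theta>)"
    unfolding continuous_map
  proof (intro conjI allI impI)
    fix U assume "openin (top_of_set ?B) U"
    then have U: "open U" "U \<subseteq> ?B" using open_cylinder openin_open_eq by blast+
    have "{x \<in> topspace (subtopology M (\<theta> ` ?B)). inv_into ?B \<theta> x \<in> U} = \<theta> ` U"
      using U(2) a(2) openin_subset[OF o] by (auto simp: image_iff)
    moreover have "openin (subtopology M (\<theta> ` ?B)) (\<theta> ` U)"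
      using a(4)[OF U] U(2) by (simp add: openin_open_subtopology[OF o] image_mono)
    ultimately show "openin (subtopology M (\<theta> ` ?B)) {x \<in> topspace (subtopology M (\<theta> ` ?B)). inv_into ?B \<theta> x \<in> U}" by simp
  qed (auto simp: inv_into_into)
  show "inj_on F (\<theta> ` ?B)"
  proof (rule inj_onI, clarify)
    fix u v assume uv: "u \<in> ?B" "v \<in> ?B" "F (\<theta> u) = F (\<theta> v)"
    then have "\<alpha> (u $ k) = \<alpha> (v $ k) \<and> hp u = hp v"
      using a(6) T_inj[OF hyperplane_part_in hyperplane_part_in] by metis
    moreover have "inj_on \<alpha> {-r<..<r}" using assms by (simp add: adapted_def)
    moreover have "u $ k \<in> {-r<..<r}" "v $ k \<in> {-r<..<r}" using uv by (auto simp: cylinder_def abs_less_iff)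
    ultimately have "u $ k = v $ k" "hp u = hp v" by (auto simp: inj_on_def)
    then show "\<theta> u = \<theta> v" by (metis hyperplane_decomp)
  qed
qed

section \<open>Lifts of segments in flat directions\<close>

lemma locally_injective: "p \<in> topspace M \<Longrightarrow> \<exists>U. openin M U \<and> p \<in> U \<and> inj_on F U"
  using adapted_exists adaptedD(7,8,11) by meson

text \<open>The set where the two lifts agree is open because \<open>F\<close> is locally injective
  and closed because \<open>M\<close> is Hausdorff, and the interval is connected.\<close>

lemma lift_unique:
  fixes a b :: real
  assumes c: "continuous_map (top_of_set {a..b}) M c" and c': "continuous_map (top_of_set {a..b}) M c'"
    and eq: "\<And>s. s \<in> {a..b} \<Longrightarrow> F (c s) = F (c' s)" and a: "c a = c' a" and t: "t \<in> {a..b}"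
  shows "c t = c' t"
proof -
  let ?I = "{a..b}"
  define E where "E = {s \<in> ?I. c s = c' s}"
  have cM: "c s \<in> topspace M" "c' s \<in> topspace M" if "s \<in> ?I" for s
    using continuous_map_image_subset_topspace[OF c] continuous_map_image_subset_topspace[OF c'] that by auto
  have pre: "openin (top_of_set ?I) {s \<in> ?I. c s \<in> U \<and> c' s \<in> U'}" if "openin M U" "openin M U'" for U U'
  proof -
    have "openin (top_of_set ?I) ({s \<in> ?I. c s \<in> U} \<inter> {s \<in> ?I. c' s \<in> U'})"
      using openin_continuous_map_preimage[OF c that(1)] openin_continuous_map_preimage[OF c' that(2)]
      by (intro openin_Int) simp_all
    moreover have "{s \<in> ?I. c s \<in> U} \<inter> {s \<in> ?I. c' s \<in> U'} = {s \<in> ?I. c s \<in> U \<and> c' s \<in> U'}" by blast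
    ultimately show ?thesis by simp
  qed
  have oE: "openin (top_of_set ?I) E"
  proof (subst openin_subopen, intro ballI)
    fix s assume s: "s \<in> E"
    then obtain U where U: "openin M U" "c s \<in> U" "inj_on F U" using locally_injective cM unfolding E_def by blast
    have "{s \<in> ?I. c s \<in> U \<and> c' s \<in> U} \<subseteq> E" using eq U(3) by (auto simp: E_def inj_on_def)
    then show "\<exists>W. openin (top_of_set ?I) W \<and> s \<in> W \<and> W \<subseteq> E"
      using pre[OF U(1) U(1)] s U(2) by (intro exI[of _ "{s \<in> ?I. c s \<in> U \<and> c' s \<in> U}"]) (auto simp: E_def)
  qed
  moreover have "openin (top_of_set ?I) (?I - E)"
  proof (subst openin_subopen, intro ballI)
    fix s assume s: "s \<in> ?I - E"
    then have "c s \<noteq> c' s" "c s \<in> topspace M" "c' s \<in> topspace M" using cM by (auto simp: E_def)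
    then obtain U U' where U: "openin M U" "openin M U'" "c s \<in> U" "c' s \<in> U'" "disjnt U U'"
      using facts(3) unfolding Hausdorff_space_def by metis
    have "{s \<in> ?I. c s \<in> U \<and> c' s \<in> U'} \<subseteq> ?I - E" using U(5) by (auto simp: E_def disjnt_def)
    then show "\<exists>W. openin (top_of_set ?I) W \<and> s \<in> W \<and> W \<subseteq> ?I - E"
      using pre[OF U(1,2)] s U(3,4) by (intro exI[of _ "{s \<in> ?I. c s \<in> U \<and> c' s \<in> U'}"]) auto
  qed
  then have cE: "closedin (top_of_set ?I) E" by (auto simp: closedin_def E_def)
  have "connected ?I" by (rule connected_Icc)
  then have "E = {} \<or> E = ?I" unfolding connected_clopen using oE cE by blast
  moreover have "E \<noteq> {}" using a t by (force simp: E_def)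
  ultimately have "t \<in> E" using t by simp
  then show ?thesis by (simp add: E_def)
qed

definition lift :: "'p \<Rightarrow> real^'n \<Rightarrow> real \<Rightarrow> (real \<Rightarrow> 'p) \<Rightarrow> bool" where
  "lift p y t c \<longleftrightarrow> continuous_map (top_of_set {0..t}) M c \<and> c 0 = p \<and> (\<forall>s\<in>{0..t}. F (c s) = F p + T (0, s *\<^sub>R y))"

text \<open>A relation instead of a function, because without completeness a lift need not exist up
  to time \<open>t\<close>; its end point is unique by \<open>lift_unique\<close>.\<close>

definition reach :: "'p \<Rightarrow> real^'n \<Rightarrow> real \<Rightarrow> 'p \<Rightarrow> bool" where
  "reach p y t q \<longleftrightarrow> 0 \<le> t \<and> (\<exists>c. lift p y t c \<and> c t = q)"

lemma reach_facts:
  assumes "reach p y t q"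
  shows "0 \<le> t" "p \<in> topspace M" "q \<in> topspace M" "F q = F p + T (0, t *\<^sub>R y)"
proof -
  obtain c where c: "continuous_map (top_of_set {0..t}) M c" "c 0 = p" "\<forall>s\<in>{0..t}. F (c s) = F p + T (0, s *\<^sub>R y)" "c t = q"
    and t: "0 \<le> t" using assms by (auto simp: reach_def lift_def)
  show "0 \<le> t" by fact
  have "c s \<in> topspace M" if "s \<in> {0..t}" for s
    using continuous_map_image_subset_topspace[OF c(1)] that by auto
  from this[of 0] this[of t] show "p \<in> topspace M" "q \<in> topspace M" using c(2,4) t by auto
  show "F q = F p + T (0, t *\<^sub>R y)" using bspec[OF c(3), of t] c(4) t by simp
qed

lemma reach_zero: "p \<in> topspace M \<Longrightarrow> reach p y 0 p"
  unfolding reach_def lift_def by (auto intro!: exI[of _ "\<lambda>s. p"] simp: T_zero)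

lemma reach_unique: "reach p y t q \<Longrightarrow> reach p y t q' \<Longrightarrow> q = q'"
proof -
  assume "reach p y t q" "reach p y t q'"
  then obtain c c' where c: "lift p y t c" "c t = q" and c': "lift p y t c'" "c' t = q'" and t: "0 \<le> t"
    unfolding reach_def by blast
  have "c t = c' t"
    by (rule lift_unique[of 0 t]) (use c(1) c'(1) t in \<open>simp_all add: lift_def\<close>)
  then show "q = q'" using c(2) c'(2) by simp
qed

lemma reach_restrict:
  assumes "lift p y t c" "0 \<le> s" "s \<le> t"
  shows "reach p y s (c s)"
proof -
  have "continuous_map (top_of_set {0..t}) M c" using assms(1) by (simp add: lift_def)
  then have "continuous_map (top_of_set {0..s}) M c"
    by (rule continuous_map_from_subtopology_mono) (use assms(3) in simp)
  then have "lift p y s c" using assms by (simp add: lift_def)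
  then show ?thesis using assms(2) unfolding reach_def by blast
qed

lemma reach_split:
  assumes "reach p y t q" "0 \<le> s" "s \<le> t"
  obtains q' where "reach p y s q'" "reach q' y (t - s) q"
proof -
  obtain c where c: "lift p y t c" "c t = q" using assms(1) unfolding reach_def by blast
  have "reach (c s) y (t - s) q"
    unfolding reach_def
  proof (intro conjI exI[of _ "\<lambda>x. c (x + s)"])
    have "continuous_map (top_of_set {0..t - s}) (top_of_set {0..t}) (\<lambda>x. x + s)"
      using assms(2,3) by (auto simp: continuous_map_in_subtopology intro!: continuous_intros)
    then have "continuous_map (top_of_set {0..t - s}) M (\<lambda>x. c (x + s))"
      using c(1) continuous_map_compose unfolding lift_def comp_def by blast
    moreover have "F (c (x + s)) = F (c s) + T (0, x *\<^sub>R y)" if "x \<in> {0..t - s}" for x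
      using c(1) assms(2,3) that unfolding lift_def by (auto simp: T_add algebra_simps)
    ultimately show "lift (c s) y (t - s) (\<lambda>x. c (x + s))" by (simp add: lift_def)
  qed (use assms c in auto)
  then show thesis using that reach_restrict[OF c(1) assms(2,3)] by blast
qed

lemma reach_trans:
  assumes "reach p y t q" "reach q y t' q'"
  shows "reach p y (t + t') q'"
proof -
  obtain c where c: "continuous_map (top_of_set {0..t}) M c" "c 0 = p" "\<forall>s\<in>{0..t}. F (c s) = F p + T (0, s *\<^sub>R y)" "c t = q" "0 \<le> t"
    using assms(1) by (auto simp: reach_def lift_def)
  obtain c' where c': "continuous_map (top_of_set {0..t'}) M c'" "c' 0 = q" "\<forall>s\<in>{0..t'}. F (c' s) = F q + T (0, s *\<^sub>R y)" "c' t' = q'" "0 \<le> t'"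
    using assms(2) by (auto simp: reach_def lift_def)
  let ?c = "\<lambda>s. if s \<le> t then c s else c' (s - t)"
  let ?T = "top_of_set {0..t + t'}"
  have sub1: "subtopology ?T {x \<in> topspace ?T. x \<le> t} = top_of_set {0..t}"
    using c'(5) by (simp add: subtopology_subtopology) (rule arg_cong[of _ _ "subtopology euclidean"], auto)
  have sub2: "subtopology ?T {x \<in> topspace ?T. t \<le> x} = top_of_set {t..t + t'}"
    using c(5) by (simp add: subtopology_subtopology) (rule arg_cong[of _ _ "subtopology euclidean"], auto)
  have "continuous_map ?T M ?c"
  proof (rule continuous_map_cases_le)
    show "continuous_map (subtopology ?T {x \<in> topspace ?T. x \<le> t}) M c" unfolding sub1 by (rule c)
    have "continuous_map (top_of_set {t..t + t'}) (top_of_set {0..t'}) (\<lambda>s. s - t)"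
      by (auto simp: continuous_map_in_subtopology intro!: continuous_intros)
    then show "continuous_map (subtopology ?T {x \<in> topspace ?T. t \<le> x}) M (\<lambda>s. c' (s - t))"
      unfolding sub2 by (rule continuous_map_compose[OF _ c'(1), unfolded comp_def])
  qed (use c(4) c'(2) in \<open>auto intro: continuous_intros\<close>)
  moreover have "F (?c s) = F p + T (0, s *\<^sub>R y)" if "s \<in> {0..t + t'}" for s
  proof (cases "s \<le> t")
    case False
    then have "F (?c s) = F q + T (0, (s - t) *\<^sub>R y)" using bspec[OF c'(3), of "s - t"] that by simp
    moreover have "F q = F p + T (0, t *\<^sub>R y)" using bspec[OF c(3), of t] c(4,5) by simp
    ultimately show ?thesis by (simp add: T_add algebra_simps)
  qed (use c(3) that in auto)
  ultimately have "lift p y (t + t') ?c" using c(2,5) by (simp add: lift_def)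
  moreover have "?c (t + t') = q'" using c'(2,4,5) c(4) by (cases "t' = 0") auto
  moreover have "0 \<le> t + t'" using c(5) c'(5) by simp
  ultimately show ?thesis unfolding reach_def by blast
qed

lemma reach_scale:
  assumes "reach p y t q"
  shows "reach p (t *\<^sub>R y) 1 q"
proof -
  obtain c where c: "lift p y t c" "c t = q" and t: "0 \<le> t" using assms by (auto simp: reach_def)
  have "continuous_map (top_of_set {0..1}) (top_of_set {0..t}) (\<lambda>x. t * x)"
    using t by (auto simp: continuous_map_in_subtopology mult_left_le intro!: continuous_intros)
  then have "continuous_map (top_of_set {0..1}) M (\<lambda>x. c (t * x))"
    using c(1) continuous_map_compose unfolding lift_def comp_def by blast
  moreover have "F (c (t * s)) = F p + T (0, s *\<^sub>R t *\<^sub>R y)" if "s \<in> {0..1}" for s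
  proof -
    have "t * s \<in> {0..t}" using t that by (auto simp: mult_left_le)
    then show ?thesis using c(1) unfolding lift_def by (simp add: mult.commute)
  qed
  ultimately have "lift p (t *\<^sub>R y) 1 (\<lambda>x. c (t * x))" using c(1) by (simp add: lift_def)
  then show ?thesis using c(2) unfolding reach_def by force
qed

lemma reach_dist:
  assumes "reach p y t q" "y \<in> H"
  shows "riem_dist M F p q \<le> t * norm y"
proof -
  obtain c where c: "lift p (t *\<^sub>R y) 1 c" "c 1 = q" using reach_scale[OF assms(1)] by (auto simp: reach_def)
  have t: "t \<ge> 0" using reach_facts(1)[OF assms(1)] .
  have T0: "T (0, s *\<^sub>R x) = s *\<^sub>R T (0, x)" for s x by (simp add: T_scale)
  have pc: "pathin M c" using c(1) by (simp add: lift_def pathin_def)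
  have vd: "((\<lambda>s. F p + s *\<^sub>R T (0, t *\<^sub>R y)) has_vector_derivative T (0, t *\<^sub>R y)) (at s)" for s
    by (auto intro!: derivative_eq_intros)
  have eq: "F (c s) = F p + s *\<^sub>R T (0, t *\<^sub>R y)" if "s \<in> {0..1}" for s
    using c(1) that unfolding lift_def T0 by blast
  have "norm (T (0, t *\<^sub>R y)) = norm (0 :: real^2, t *\<^sub>R y)" by (rule normT[OF H_closed(2)[OF assms(2)]])
  then have B: "norm (T (0, t *\<^sub>R y)) \<le> t * norm y" using t by (simp add: norm_Pair)
  note pw = pw_C1_smooth[of M c "\<lambda>s. F p + s *\<^sub>R T (0, t *\<^sub>R y)" "\<lambda>s. T (0, t *\<^sub>R y)" F, OF pc vd eq continuous_on_const B]
  have "c 0 = p" using c(1) by (simp add: lift_def)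
  then show ?thesis using riem_dist_le[OF pw(1) _ c(2)] pw(2) by fastforce
qed

lemma cylinder_shift:
  assumes "u \<in> cylinder y0 r" "y \<in> H"
  shows "u + y \<in> cylinder y0 r \<longleftrightarrow> norm (hp u + y - y0) < r"
  using assms by (simp add: cylinder_def linear_add[OF hyperplane_part_linear] hyperplane_part_id) (simp add: coord_hyperplane_def)

text \<open>In an adapted chart the lift is a straight coordinate segment. It stays in the cylinder
  because its \<open>H\<close> part runs inside a ball.\<close>

lemma reach_local:
  assumes A: "adapted p r \<theta> \<alpha>" and u: "u \<in> cylinder (base p) r" and y: "y \<in> H" and t: "0 \<le> t"
    and ut: "u + t *\<^sub>R y \<in> cylinder (base p) r"
  shows "reach (\<theta> u) y t (\<theta> (u + t *\<^sub>R y))"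
proof -
  note AD = adaptedD[OF A]
  let ?B = "cylinder (base p) r"
  have seg: "u + s *\<^sub>R y \<in> ?B" if s: "s \<in> {0..t}" for s
  proof (cases "t = 0")
    case False
    define l where "l = s / t"
    have l: "0 \<le> l" "l \<le> 1" "s = l * t" using s t False by (auto simp: l_def)
    have "hp u - base p \<in> ball 0 r" "hp u + t *\<^sub>R y - base p \<in> ball 0 r"
      using u ut cylinder_shift[OF u H_closed(2)[OF y]] by (auto simp: cylinder_def)
    then have "(1 - l) *\<^sub>R (hp u - base p) + l *\<^sub>R (hp u + t *\<^sub>R y - base p) \<in> ball 0 r"
      using l by (intro convexD_alt[OF convex_ball]) auto
    moreover have "(1 - l) *\<^sub>R (hp u - base p) + l *\<^sub>R (hp u + t *\<^sub>R y - base p) = hp u + s *\<^sub>R y - base p"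
      by (simp add: l(3) algebra_simps)
    ultimately show ?thesis using cylinder_shift[OF u H_closed(2)[OF y]] by simp
  qed (use u s in auto)
  have "continuous_map (top_of_set {0..t}) (top_of_set ?B) (\<lambda>s. u + s *\<^sub>R y)"
    using seg by (auto simp: continuous_map_in_subtopology intro!: continuous_intros)
  then have "continuous_map (top_of_set {0..t}) M (\<lambda>s. \<theta> (u + s *\<^sub>R y))"
    by (rule continuous_map_compose[OF _ AD(3), unfolded comp_def])
  moreover have "F (\<theta> (u + s *\<^sub>R y)) = F (\<theta> u) + T (0, s *\<^sub>R y)" if "s \<in> {0..t}" for s
  proof -
    have "y $ k = 0" using y by (simp add: coord_hyperplane_def)
    moreover have "hp (u + s *\<^sub>R y) = hp u + s *\<^sub>R y"
      by (simp add: linear_add[OF hyperplane_part_linear] hyperplane_part_id[OF H_closed(2)[OF y]])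
    ultimately show ?thesis using AD(6)[OF seg[OF that]] AD(6)[OF u] by (simp add: T_add)
  qed
  ultimately have "lift (\<theta> u) y t (\<lambda>s. \<theta> (u + s *\<^sub>R y))" by (simp add: lift_def)
  then show ?thesis using t unfolding reach_def by blast
qed

end

locale complete_splitting = splitting M \<A> F k T
  for M :: "'p topology" and \<A> :: "('n::finite, 'p) atlas" and F :: "'p \<Rightarrow> real^'m::finite" and k T +
  assumes complete: "complete_hypersurface M F"
begin

text \<open>Continuation: with \<open>\<tau>\<close> the supremum of the reachable times, the points
  at times tending to \<open>\<tau>\<close> form a Cauchy sequence, as lifts are no longer than
  their segments. An adapted chart at the limit lets the lift run beyond
  \<open>\<tau>\<close>.\<close>

lemma reach_exists:
  assumes p: "p \<in> topspace M" and y: "y \<in> H" and t: "0 \<le> t"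
  shows "\<exists>q. reach p y t q"
proof (rule ccontr)
  assume no: "\<nexists>q. reach p y t q"
  define G where "G = {s. \<exists>q. reach p y s q}"
  have G0: "0 \<in> G" using reach_zero[OF p] by (auto simp: G_def)
  have Gle: "s \<le> t" if sG: "s \<in> G" for s
  proof (rule ccontr)
    assume st: "\<not> s \<le> t"
    obtain q where "reach p y s q" using sG by (auto simp: G_def)
    from reach_split[OF this t] obtain q' where "reach p y t q'" using st by auto
    then show False using no by blast
  qed
  define \<tau> where "\<tau> = Sup G"
  have bdd: "bdd_above G" by (rule bdd_aboveI[OF Gle])
  have up: "s \<le> \<tau>" if "s \<in> G" for s unfolding \<tau>_def using cSup_upper[OF that bdd] .
  have "\<exists>s\<in>G. \<tau> - 1 / real (Suc n) < s" for n
    using less_cSupD[of G "\<tau> - 1 / real (Suc n)"] G0 unfolding \<tau>_def by fastforce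
  then obtain \<sigma> where \<sigma>: "\<And>n. \<sigma> n \<in> G" "\<And>n. \<tau> - 1 / real (Suc n) < \<sigma> n" by metis
  have "\<forall>n. \<exists>q. reach p y (\<sigma> n) q" using \<sigma>(1) by (simp add: G_def)
  from choice[OF this] obtain q where q: "\<And>n. reach p y (\<sigma> n) (q n)" by blast
  note qf = reach_facts[OF q]
  have dist: "riem_dist M F (q n) (q m) \<le> \<bar>\<sigma> n - \<sigma> m\<bar> * norm y" for n m
  proof -
    have le: "riem_dist M F (q n) (q m) \<le> (\<sigma> m - \<sigma> n) * norm y" if nm: "\<sigma> n \<le> \<sigma> m" for n m
    proof -
      obtain q' where q': "reach p y (\<sigma> n) q'" "reach q' y (\<sigma> m - \<sigma> n) (q m)"
        using reach_split[OF q[of m] qf(1)[of n] nm] by blast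
      then have "q' = q n" using reach_unique q by blast
      then show ?thesis using reach_dist[OF q'(2) y] by simp
    qed
    show ?thesis
      using le[of n m] le[of m n] riem_dist_commute[of M F "q n" "q m"] by (cases "\<sigma> n \<le> \<sigma> m") auto
  qed
  have conv: "\<sigma> \<longlonglongrightarrow> \<tau>"
  proof (rule tendsto_sandwich[of "\<lambda>n. \<tau> - 1 / real (Suc n)" _ _ "\<lambda>n. \<tau>"])
    have "(\<lambda>n. \<tau> - 1 / real (Suc n)) \<longlonglongrightarrow> \<tau> - 0" by (intro tendsto_intros LIMSEQ_Suc lim_1_over_n)
    then show "(\<lambda>n. \<tau> - 1 / real (Suc n)) \<longlonglongrightarrow> \<tau>" by simp
    show "\<forall>\<^sub>F n in sequentially. \<tau> - 1 / real (Suc n) \<le> \<sigma> n"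
      using less_imp_le[OF \<sigma>(2)] by (intro always_eventually) blast
    show "\<forall>\<^sub>F n in sequentially. \<sigma> n \<le> \<tau>" using up[OF \<sigma>(1)] by (intro always_eventually) blast
  qed simp
  have "\<exists>N. \<forall>n n'. N \<le> n \<longrightarrow> N \<le> n' \<longrightarrow> riem_dist M F (q n) (q n') < e" if e: "e > 0" for e
  proof -
    have "e / (norm y + 1) > 0" using e by (simp add: add_nonneg_pos)
    then obtain N where N: "\<And>n n'. N \<le> n \<Longrightarrow> N \<le> n' \<Longrightarrow> dist (\<sigma> n) (\<sigma> n') < e / (norm y + 1)"
      using LIMSEQ_imp_Cauchy[OF conv] unfolding Cauchy_def by metis
    have "riem_dist M F (q n) (q n') < e" if "N \<le> n" "N \<le> n'" for n n'
    proof -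
      have "\<bar>\<sigma> n - \<sigma> n'\<bar> * (norm y + 1) < e"
        using N[OF that] by (simp add: dist_real_def pos_less_divide_eq add_nonneg_pos)
      then have "\<bar>\<sigma> n - \<sigma> n'\<bar> * norm y < e" by (simp add: distrib_left)
      then show ?thesis using dist[of n n'] by linarith
    qed
    then show ?thesis by blast
  qed
  then obtain z where z: "limitin M q z sequentially"
    using complete_limit[OF M complete, of q] qf(3) by blast
  have zM: "z \<in> topspace M" using z by (simp add: limitin_def)
  obtain r \<theta> \<alpha> where A: "adapted z r \<theta> \<alpha>" using adapted_exists[OF zM] by blast
  note AD = adaptedD[OF A]
  let ?B = "cylinder (base z) (r / 2)"
  have sub: "?B \<subseteq> cylinder (base z) r" using AD(1) by (auto simp: cylinder_def)
  have "openin M (\<theta> ` ?B)" by (rule AD(4)[OF open_cylinder sub])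
  moreover have "z \<in> \<theta> ` ?B" using base_in_cylinder[of "r/2" z] AD(1,5) by (metis half_gt_zero imageI)
  ultimately have ev: "eventually (\<lambda>n. q n \<in> \<theta> ` ?B) sequentially" using z by (simp add: limitin_def)
  \<comment> \<open>From the half cylinder a step of \<open>\<delta> *\<^sub>R y\<close> stays in
    the full one. As \<open>\<delta>\<close> does not depend on the index, starting later than
    \<open>\<tau> - \<delta>\<close> leads past \<open>\<tau>\<close>.\<close>
  define \<delta> where "\<delta> = r / (2 * (norm y + 1))"
  have \<delta>: "\<delta> > 0" using AD(1) by (simp add: \<delta>_def add_nonneg_pos)
  have "\<delta> * norm y \<le> \<delta> * (norm y + 1)" using \<delta> by (simp add: distrib_left)
  also have "\<dots> = r / 2" unfolding \<delta>_def using add_nonneg_pos[OF norm_ge_zero[of y] zero_less_one] by (simp add: field_simps)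
  finally have \<delta>y: "norm (\<delta> *\<^sub>R y) \<le> r / 2" using \<delta> by simp
  have "eventually (\<lambda>n. \<tau> - \<delta> < \<sigma> n) sequentially" using conv \<delta> by (simp add: order_tendstoD(1))
  from eventually_conj[OF ev this] obtain n where n: "q n \<in> \<theta> ` ?B" "\<tau> - \<delta> < \<sigma> n"
    using eventually_happens'[OF sequentially_bot] by blast
  then obtain u where u: "u \<in> ?B" "q n = \<theta> u" by blast
  have uB: "u \<in> cylinder (base z) r" using u(1) sub by blast
  have "norm (hp u + \<delta> *\<^sub>R y - base z) \<le> norm (hp u - base z) + norm (\<delta> *\<^sub>R y)"
    by (metis add_diff_eq add.commute norm_triangle_ineq diff_add_eq)
  also have "\<dots> < r" using u(1) \<delta>y by (simp add: cylinder_def)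
  finally have "u + \<delta> *\<^sub>R y \<in> cylinder (base z) r" using cylinder_shift[OF uB H_closed(2)[OF y]] by simp
  then have "reach (q n) y \<delta> (\<theta> (u + \<delta> *\<^sub>R y))"
    unfolding u(2) using reach_local[OF A uB y] \<delta> by simp
  then have "\<sigma> n + \<delta> \<in> G" using reach_trans[OF q[of n]] by (auto simp: G_def)
  then show False using up[of "\<sigma> n + \<delta>"] n(2) by simp
qed

end

lemma topcontinuous_atD:
  "topcontinuous_at X Y f x \<Longrightarrow> openin Y V \<Longrightarrow> f x \<in> V \<Longrightarrow> \<exists>U. openin X U \<and> x \<in> U \<and> (\<forall>y\<in>U. f y \<in> V)"
  unfolding topcontinuous_at_def by blast

context splitting
begin

lemma snd_S_linear: "snd (S (x + x')) = snd (S x) + snd (S x')"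
  using linear_add[OF S(1)] by simp

lemma base_continuous: "continuous_map M euclidean base"
proof -
  have "continuous_on UNIV (\<lambda>x. snd (S x))"
    using S(1) linear_continuous_on linear_conv_bounded_linear by (intro continuous_on_snd) blast
  then show ?thesis
    using continuous_map_compose[OF F_continuous, of euclidean "\<lambda>x. snd (S x)"]
    by (simp add: comp_def base_def[abs_def])
qed

end

context complete_splitting
begin

section \<open>Translations as a continuous action of the flat factor\<close>

definition translate :: "'p \<Rightarrow> real^'n \<Rightarrow> 'p" where "translate p y = (THE q. reach p y 1 q)"

lemma translate_eq: "reach p y 1 q \<Longrightarrow> translate p y = q"
  unfolding translate_def using reach_unique by blast

lemma translate_scale: "reach p y t q \<Longrightarrow> translate p (t *\<^sub>R y) = q"
  by (rule translate_eq[OF reach_scale])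

lemma translate_reach: "p \<in> topspace M \<Longrightarrow> y \<in> H \<Longrightarrow> 0 \<le> t \<Longrightarrow> reach p y t (translate p (t *\<^sub>R y))"
  using reach_exists translate_scale by metis

lemma translate_facts:
  assumes "p \<in> topspace M" "y \<in> H"
  shows "translate p y \<in> topspace M" "F (translate p y) = F p + T (0, y)" "base (translate p y) = base p + y"
proof -
  have r: "reach p y 1 (translate p y)" using translate_reach[OF assms, of 1] by simp
  show "translate p y \<in> topspace M" "F (translate p y) = F p + T (0, y)" using reach_facts[OF r] by auto
  then show "base (translate p y) = base p + y" using S(2)[OF assms(2), of 0] by (simp add: base_def snd_S_linear)
qed

lemma translate_zero: "p \<in> topspace M \<Longrightarrow> translate p 0 = p"
  using translate_scale[OF reach_zero, of p 0] by simp

lemma translate_ray: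
  assumes "p \<in> topspace M" "y \<in> H" "0 \<le> s" "s \<le> t"
  shows "translate (translate p (s *\<^sub>R y)) ((t - s) *\<^sub>R y) = translate p (t *\<^sub>R y)"
proof -
  have 1: "reach p y s (translate p (s *\<^sub>R y))" by (rule translate_reach[OF assms(1-3)])
  have "reach (translate p (s *\<^sub>R y)) y (t - s) (translate (translate p (s *\<^sub>R y)) ((t - s) *\<^sub>R y))"
    by (rule translate_reach) (use reach_facts[OF 1] assms in auto)
  from reach_trans[OF 1 this] show ?thesis using translate_scale by fastforce
qed

lemma translate_path_continuous:
  assumes "p \<in> topspace M" "y \<in> H"
  shows "continuous_map (top_of_set {0..1}) M (\<lambda>s. translate p (s *\<^sub>R y))"
proof -
  obtain c where c: "lift p y 1 c" using translate_reach[OF assms, of 1] unfolding reach_def by auto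
  have "continuous_map (top_of_set {0..1}) M c" using c by (simp add: lift_def)
  then show ?thesis
  proof (rule continuous_map_eq)
    fix s :: real assume "s \<in> topspace (top_of_set {0..1})"
    then show "c s = translate p (s *\<^sub>R y)" using translate_scale[OF reach_restrict[OF c]] by simp
  qed
qed

abbreviation P :: "('p \<times> (real^'n)) topology" where "P \<equiv> prod_topology M (top_of_set H)"

text \<open>Near \<open>p0\<close> and for short \<open>y\<close> both end points lie in one adapted
  chart, where \<open>translate\<close> is addition of \<open>y\<close> to the coordinates.\<close>

lemma translate_locally_continuous:
  assumes p0: "p0 \<in> topspace M"
  obtains U e where "openin M U" "p0 \<in> U" "e > 0"
    "\<And>p y. p \<in> U \<Longrightarrow> y \<in> H \<Longrightarrow> norm y < e \<Longrightarrow> topcontinuous_at P M (\<lambda>(p, y). translate p y) (p, y)"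
proof -
  obtain r \<theta> \<alpha> where A: "adapted p0 r \<theta> \<alpha>" using adapted_exists[OF p0] by blast
  note AD = adaptedD[OF A]
  let ?B = "cylinder (base p0) r" and ?B2 = "cylinder (base p0) (r/2)"
  let ?i = "inv_into ?B \<theta>"
  define U where "U = \<theta> ` ?B2"
  define Y where "Y = H \<inter> ball 0 (r/2)"
  have sub: "?B2 \<subseteq> ?B" using AD(1) by (auto simp: cylinder_def)
  have U: "openin M U" unfolding U_def by (rule AD(4)[OF open_cylinder sub])
  have pU: "p0 \<in> U" unfolding U_def using base_in_cylinder[of "r/2" p0] AD(1,5) by (metis half_gt_zero imageI)
  have Y: "openin (top_of_set H) Y" unfolding Y_def by (simp add: openin_open_Int)
  have iU: "?i p \<in> ?B2 \<and> \<theta> (?i p) = p" if "p \<in> U" for p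
    using that sub AD(2) unfolding U_def by (auto simp: inv_into_f_f subset_iff)
  have shift: "?i p + y \<in> ?B" if "p \<in> U" "y \<in> Y" for p y
  proof -
    have "norm (hp (?i p) + y - base p0) \<le> norm (hp (?i p) - base p0) + norm y"
      by (metis add_diff_eq add.commute norm_triangle_ineq diff_add_eq)
    also have "\<dots> < r" using iU[OF that(1)] that(2) by (simp add: cylinder_def Y_def)
    finally show ?thesis using cylinder_shift[of "?i p" "base p0" r y] iU[OF that(1)] sub that(2) by (auto simp: Y_def)
  qed
  have translate: "translate p y = \<theta> (?i p + y)" if "p \<in> U" "y \<in> Y" for p y
  proof (rule translate_eq)
    have "reach (\<theta> (?i p)) y 1 (\<theta> (?i p + 1 *\<^sub>R y))"
      by (rule reach_local[OF A]) (use iU[OF that(1)] sub shift[OF that] that(2) in \<open>auto simp: Y_def\<close>)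
    then show "reach p y 1 (\<theta> (?i p + y))" using iU[OF that(1)] by simp
  qed
  let ?N = "U \<times> Y"
  have N: "openin P ?N" using U Y by (simp add: openin_prod_Times_iff)
  have "continuous_map (subtopology P ?N) (subtopology M (\<theta> ` ?B)) fst"
  proof (rule continuous_map_into_subtopology)
    show "continuous_map (subtopology P ?N) M fst"
      by (rule continuous_map_from_subtopology[OF continuous_map_fst])
  qed (use sub in \<open>auto simp: U_def\<close>)
  from continuous_map_compose[OF this AD(10)]
  have "continuous_map (subtopology P ?N) (top_of_set ?B) (\<lambda>z. ?i (fst z))" by (simp add: comp_def)
  then have "continuous_map (subtopology P ?N) euclidean (\<lambda>z. ?i (fst z))" by (rule continuous_map_into_fulltopology)
  moreover have "continuous_map (subtopology P ?N) euclidean snd"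
    by (rule continuous_map_into_fulltopology[OF continuous_map_from_subtopology[OF continuous_map_snd]])
  ultimately have "continuous_map (subtopology P ?N) euclidean (\<lambda>z. ?i (fst z) + snd z)"
    by (rule continuous_map_add)
  then have "continuous_map (subtopology P ?N) (top_of_set ?B) (\<lambda>z. ?i (fst z) + snd z)"
    by (rule continuous_map_into_subtopology) (use shift in auto)
  from continuous_map_compose[OF this AD(3)]
  have G: "continuous_map (subtopology P ?N) M (\<lambda>z. \<theta> (?i (fst z) + snd z))" by (simp add: comp_def)
  have "topcontinuous_at P M (\<lambda>(p, y). translate p y) (p, y)" if p: "p \<in> U" and y: "y \<in> Y" for p y
    unfolding topcontinuous_at_def
  proof (intro conjI allI impI)
    show "(p, y) \<in> topspace P" using openin_subset[OF N] p y by blast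
    show "(\<lambda>(p, y). translate p y) \<in> topspace P \<rightarrow> topspace M" using translate_facts(1) by auto
    fix V assume V: "openin M V \<and> (case (p, y) of (p, y) \<Rightarrow> translate p y) \<in> V"
    let ?W = "{z \<in> topspace (subtopology P ?N). \<theta> (?i (fst z) + snd z) \<in> V}"
    have "openin (subtopology P ?N) ?W" using openin_continuous_map_preimage[OF G] V by blast
    then have "openin P ?W" using openin_open_subtopology[OF N] by blast
    moreover have "(p, y) \<in> ?W" using V translate[OF p y] p y openin_subset[OF N] by auto
    moreover have "\<forall>z\<in>?W. (case z of (p, y) \<Rightarrow> translate p y) \<in> V" using translate by auto
    ultimately show "\<exists>W. openin P W \<and> (p, y) \<in> W \<and> (\<forall>z\<in>W. (case z of (p, y) \<Rightarrow> translate p y) \<in> V)" by blast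
  qed
  then show thesis using that[OF U pU, of "r/2"] AD(1) by (auto simp: Y_def)
qed

text \<open>Continuity propagates along the path \<open>t \<mapsto> translate p0 (t y0)\<close>.\<close>

lemma translate_continuous: "continuous_map P M (\<lambda>(p, y). translate p y)"
  unfolding continuous_map_eq_topcontinuous_at
proof
  fix z assume z: "z \<in> topspace P"
  obtain p0 y0 where z0: "z = (p0, y0)" by (cases z)
  have p0: "p0 \<in> topspace M" and y0: "y0 \<in> H" using z z0 by auto
  define good where "good t \<longleftrightarrow> topcontinuous_at P M (\<lambda>(p, y). translate p (t *\<^sub>R y)) (p0, y0)" for t
  \<comment> \<open>By \<open>translate_ray\<close> the translation by \<open>b y\<close> is that by
    \<open>a y\<close> followed by that by \<open>(b - a) y\<close>; the second is continuous at the
    point reached from \<open>p0\<close> at time \<open>a\<close>.\<close>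
  have step: "good b" if a: "good a" and ab: "0 \<le> a" "a \<le> b"
      and c: "topcontinuous_at P M (\<lambda>(p, y). translate p y) (translate p0 (a *\<^sub>R y0), (b - a) *\<^sub>R y0)" for a b
    unfolding good_def topcontinuous_at_def
  proof (intro conjI allI impI)
    show "(p0, y0) \<in> topspace P" using z z0 by simp
    show "(\<lambda>(p, y). translate p (b *\<^sub>R y)) \<in> topspace P \<rightarrow> topspace M" using translate_facts(1) H_closed(2) by auto
    fix V assume "openin M V \<and> (case (p0, y0) of (p, y) \<Rightarrow> translate p (b *\<^sub>R y)) \<in> V"
    then have V: "openin M V" "translate (translate p0 (a *\<^sub>R y0)) ((b - a) *\<^sub>R y0) \<in> V"
      using translate_ray[OF p0 y0 ab] by auto
    have "\<exists>W. openin P W \<and> (translate p0 (a *\<^sub>R y0), (b - a) *\<^sub>R y0) \<in> W \<and> (\<forall>z\<in>W. (case z of (p, y) \<Rightarrow> translate p y) \<in> V)"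
      using topcontinuous_atD[OF c V(1)] V(2) by simp
    then obtain W where W: "openin P W" "(translate p0 (a *\<^sub>R y0), (b - a) *\<^sub>R y0) \<in> W" "\<forall>z\<in>W. (case z of (p, y) \<Rightarrow> translate p y) \<in> V"
      by blast
    obtain U1 Y1 where UY: "openin M U1" "openin (top_of_set H) Y1" "translate p0 (a *\<^sub>R y0) \<in> U1" "(b - a) *\<^sub>R y0 \<in> Y1" "U1 \<times> Y1 \<subseteq> W"
      using W(1)[unfolded openin_prod_topology_alt, rule_format, OF W(2)] by metis
    have "\<exists>W. openin P W \<and> (p0, y0) \<in> W \<and> (\<forall>z\<in>W. (case z of (p, y) \<Rightarrow> translate p (a *\<^sub>R y)) \<in> U1)"
      using topcontinuous_atD[OF a[unfolded good_def] UY(1)] UY(3) by simp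
    then obtain W1 where W1: "openin P W1" "(p0, y0) \<in> W1" "\<forall>z\<in>W1. (case z of (p, y) \<Rightarrow> translate p (a *\<^sub>R y)) \<in> U1"
      by metis
    have "continuous_map (top_of_set H) (top_of_set H) (\<lambda>y. (b - a) *\<^sub>R y)"
      using H_closed(2) by (auto simp: continuous_map_in_subtopology intro!: continuous_intros)
    then have "openin (top_of_set H) {y \<in> H. (b - a) *\<^sub>R y \<in> Y1}"
      using openin_continuous_map_preimage[OF _ UY(2), of "top_of_set H" "\<lambda>y. (b - a) *\<^sub>R y"] by simp
    then have "openin P (topspace M \<times> {y \<in> H. (b - a) *\<^sub>R y \<in> Y1})" by (simp add: openin_prod_Times_iff)
    then have "openin P (W1 \<inter> topspace M \<times> {y \<in> H. (b - a) *\<^sub>R y \<in> Y1})" using W1(1) by blast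
    moreover have "(p0, y0) \<in> W1 \<inter> topspace M \<times> {y \<in> H. (b - a) *\<^sub>R y \<in> Y1}" using W1(2) p0 y0 UY(4) by auto
    moreover have "translate p (b *\<^sub>R y) \<in> V" if "(p, y) \<in> W1 \<inter> topspace M \<times> {y \<in> H. (b - a) *\<^sub>R y \<in> Y1}" for p y
    proof -
      have "translate p (a *\<^sub>R y) \<in> U1" using bspec[OF W1(3), of "(p, y)"] that by simp
      then have "(translate p (a *\<^sub>R y), (b - a) *\<^sub>R y) \<in> W" using that UY(5) by blast
      from bspec[OF W(3) this] have "translate (translate p (a *\<^sub>R y)) ((b - a) *\<^sub>R y) \<in> V" by simp
      then show ?thesis using translate_ray[of p y a b] that ab by auto
    qed
    ultimately show "\<exists>U. openin P U \<and> (p0, y0) \<in> U \<and> (\<forall>y\<in>U. (case y of (p, y) \<Rightarrow> translate p (b *\<^sub>R y)) \<in> V)"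
      by (intro exI[of _ "W1 \<inter> topspace M \<times> {y \<in> H. (b - a) *\<^sub>R y \<in> Y1}"]) auto
  qed
  \<comment> \<open>The bisection principle: it suffices that continuity passes from
    \<open>a\<close> to \<open>b\<close> on all short intervals around each time \<open>x\<close>.
    Their length comes from the local statement at the point reached at time
    \<open>x\<close>.\<close>
  have "0 \<le> (0::real) \<longrightarrow> 1 \<le> (1::real) \<longrightarrow> good 0 \<longrightarrow> good 1"
  proof (rule Bolzano[of 0 1 "\<lambda>a b. 0 \<le> a \<longrightarrow> b \<le> 1 \<longrightarrow> good a \<longrightarrow> good b"])
    fix x :: real assume x: "0 \<le> x" "x \<le> 1"
    show "\<exists>d>0. \<forall>a b. a \<le> x \<and> x \<le> b \<and> b - a < d \<longrightarrow> 0 \<le> a \<longrightarrow> b \<le> 1 \<longrightarrow> good a \<longrightarrow> good b"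
    proof -
      define q where "q = translate p0 (x *\<^sub>R y0)"
      have q: "q \<in> topspace M" unfolding q_def by (rule translate_facts(1)[OF p0 H_closed(2)[OF y0]])
      obtain U e where U: "openin M U" "q \<in> U" "e > 0"
        "\<And>p y. p \<in> U \<Longrightarrow> y \<in> H \<Longrightarrow> norm y < e \<Longrightarrow> topcontinuous_at P M (\<lambda>(p, y). translate p y) (p, y)"
        by (rule translate_locally_continuous[OF q]) blast
      have "openin (top_of_set {0..1}) {t \<in> {0..1}. translate p0 (t *\<^sub>R y0) \<in> U}"
        using openin_continuous_map_preimage[OF translate_path_continuous[OF p0 y0] U(1)] by simp
      then obtain d1 where d1: "d1 > 0" "\<And>t. t \<in> {0..1} \<Longrightarrow> dist t x < d1 \<Longrightarrow> translate p0 (t *\<^sub>R y0) \<in> U"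
        using x U(2) unfolding openin_euclidean_subtopology_iff q_def by (metis (mono_tags, lifting) atLeastAtMost_iff mem_Collect_eq)
      define d where "d = min d1 (e / (norm y0 + 1))"
      have d: "d > 0" using d1 U(3) by (simp add: d_def add_nonneg_pos)
      have "0 \<le> a \<longrightarrow> b \<le> 1 \<longrightarrow> good a \<longrightarrow> good b" if ab: "a \<le> x \<and> x \<le> b \<and> b - a < d" for a b
      proof (intro impI)
        assume *: "0 \<le> a" "b \<le> 1" "good a"
        have "translate p0 (a *\<^sub>R y0) \<in> U" by (rule d1(2)) (use * ab in \<open>auto simp: dist_real_def d_def\<close>)
        moreover have "norm ((b - a) *\<^sub>R y0) < e"
        proof -
          have "(b - a) * (norm y0 + 1) < e"
            using ab by (simp add: d_def pos_less_divide_eq add_nonneg_pos)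
          moreover have "norm ((b - a) *\<^sub>R y0) \<le> (b - a) * (norm y0 + 1)" using ab by (simp add: distrib_left)
          ultimately show ?thesis by linarith
        qed
        ultimately show "good b" using step[OF *(3,1)] U(4) H_closed(2)[OF y0] ab by auto
      qed
      then show ?thesis using d by blast
    qed
  qed auto
  then have "good 0 \<longrightarrow> good 1" by simp
  moreover have "good 0"
  proof -
    have "continuous_map P M (\<lambda>(p, y). translate p (0 *\<^sub>R y))"
      by (rule continuous_map_eq[OF continuous_map_fst]) (auto simp: translate_zero)
    then show ?thesis unfolding good_def continuous_map_eq_topcontinuous_at
      by (rule bspec) (use z z0 in simp)
  qed
  ultimately show "topcontinuous_at P M (\<lambda>(p, y). translate p y) z" unfolding good_def z0 by simp
qed

lemma translate_continuous_compose:
  assumes "continuous_map X M f" "continuous_map X euclidean g" "\<And>x. x \<in> topspace X \<Longrightarrow> g x \<in> H"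
  shows "continuous_map X M (\<lambda>x. translate (f x) (g x))"
proof -
  have "continuous_map X P (\<lambda>x. (f x, g x))"
    using assms by (auto simp: continuous_map_pairedI continuous_map_in_subtopology)
  from continuous_map_compose[OF this translate_continuous] show ?thesis by (simp add: comp_def)
qed

text \<open>The path with additional shift \<open>s y'\<close> is in general not on a ray from
  \<open>p\<close>, so its continuity rests on \<open>translate_continuous\<close>. It lies over a
  segment in direction \<open>y'\<close>, and uniqueness of lifts identifies its end.\<close>

lemma translate_add:
  assumes p: "p \<in> topspace M" and y: "y \<in> H" and y': "y' \<in> H"
  shows "translate (translate p y) y' = translate p (y + y')"
proof (rule translate_eq)
  have "continuous_map (top_of_set {0..1}) M (\<lambda>s. translate p (y + s *\<^sub>R y'))"
    by (rule translate_continuous_compose) (use p y y' H_closed in \<open>auto intro!: continuous_intros\<close>)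
  moreover have "F (translate p (y + s *\<^sub>R y')) = F (translate p y) + T (0, s *\<^sub>R y')" for s
    using translate_facts(2)[OF p] y y' H_closed by (simp add: T_add add.assoc)
  ultimately have "lift (translate p y) y' 1 (\<lambda>s. translate p (y + s *\<^sub>R y'))" by (simp add: lift_def)
  then show "reach (translate p y) y' 1 (translate p (y + y'))" unfolding reach_def by force
qed

end

section \<open>Products with a curve\<close>

text \<open>In the chart, \<open>h\<close> is a continuous lift of the smooth map
  \<open>F \<circ> h\<close> through the immersion \<open>F \<circ> \<theta>\<close>, so
  \<open>smooth_on_lift_immersion\<close> applies. The transition maps of the curve and the
  smoothness of \<open>\<Phi>\<close> and \<open>\<Psi>\<close> all rest on this.\<close>

lemma chart_expression:
  fixes F :: "'p \<Rightarrow> real^'m::finite" and \<theta> :: "real^'n::finite \<Rightarrow> 'p" and D :: "(real^'l::finite) set"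
  assumes E: "parametrization X E \<theta>" and im: "immersion_on E (F \<circ> \<theta>)"
    and D: "open D" and h: "continuous_map (top_of_set D) X h" and sm: "smooth_on D (F \<circ> h)"
  defines "W \<equiv> {u \<in> D. h u \<in> \<theta> ` E}"
  shows "open W" "smooth_on W (inv_into E \<theta> \<circ> h)" "\<And>u. u \<in> W \<Longrightarrow> (inv_into E \<theta> \<circ> h) u \<in> E"
    "\<And>u. u \<in> W \<Longrightarrow> \<theta> ((inv_into E \<theta> \<circ> h) u) = h u"
proof -
  note Ep = parametrizationD[OF E]
  have "openin (top_of_set D) {u \<in> topspace (top_of_set D). h u \<in> \<theta> ` E}"
    using h Ep(2) by (rule openin_continuous_map_preimage)
  then show W: "open W" using D by (simp add: W_def openin_open_eq)
  show gE: "(inv_into E \<theta> \<circ> h) u \<in> E" if "u \<in> W" for u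
    using that inv_into_into[of "h u" \<theta> E] by (simp add: W_def)
  show t: "\<theta> ((inv_into E \<theta> \<circ> h) u) = h u" if "u \<in> W" for u
    using that f_inv_into_f[of "h u" \<theta> E] by (simp add: W_def)
  have WD: "W \<subseteq> D" by (auto simp: W_def)
  have "continuous_map (top_of_set W) (subtopology X (\<theta> ` E)) h"
    by (rule continuous_map_into_subtopology[OF continuous_map_from_subtopology_mono[OF h WD]]) (auto simp: W_def)
  from continuous_map_compose[OF this Ep(6)]
  have c: "continuous_on W (inv_into E \<theta> \<circ> h)" using continuous_map_into_fulltopology by fastforce
  have "smooth_on W (\<lambda>u. (F \<circ> \<theta>) ((inv_into E \<theta> \<circ> h) u))"
    using smooth_on_subset[OF sm WD] smooth_on_cong[OF W, of "\<lambda>u. (F \<circ> \<theta>) ((inv_into E \<theta> \<circ> h) u)" "F \<circ> h"] t by simp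
  then show "smooth_on W (inv_into E \<theta> \<circ> h)"
    using smooth_on_lift_immersion[OF immersion_onD(1,2,3)[OF im] W _ c] gE by blast
qed

lemma vec_nth_one: "vec (x $ 1) = (x :: real^1)"
  by (simp add: vec_eq_iff forall_1)

lemma vec_linear: "bounded_linear (vec :: real \<Rightarrow> real^1)"
  by (simp add: linear_conv_bounded_linear[symmetric] linearI vec_eq_iff)

context splitting
begin

context
  fixes \<beta> :: "real^1 \<Rightarrow> real^2" and D :: "(real^1) set"
  assumes im: "immersion_on D \<beta>"
begin

abbreviation D' :: "(real^'n) set" where "D' \<equiv> {u. vec (u $ k) \<in> D}"
definition product_map :: "real^'n \<Rightarrow> real^'m" where "product_map u = T (\<beta> (vec (u $ k)), hp u)"

lemma open_D': "open D'"
proof -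
  have "continuous_on UNIV (\<lambda>u :: real^'n. vec (u $ k) :: real^1)"
    by (intro linear_continuous_on bounded_linear_compose[OF vec_linear bounded_linear_vec_nth])
  from open_vimage[OF immersion_onD(1)[OF im] this] show ?thesis by (simp add: vimage_def)
qed

lemma T_bounded: "bounded_linear T" using linT linear_conv_bounded_linear by blast

lemma product_map_derivative:
  assumes u: "u \<in> D'"
  shows "(product_map has_derivative (\<lambda>v. T (fd \<beta> (vec (u $ k)) (vec (v $ k)), hp v))) (at u)"
proof -
  have v: "((\<lambda>u :: real^'n. vec (u $ k) :: real^1) has_derivative (\<lambda>v. vec (v $ k))) (at u)"
    by (intro bounded_linear_imp_has_derivative bounded_linear_compose[OF vec_linear bounded_linear_vec_nth])
  have h: "(hp has_derivative hp) (at u)"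
    using hyperplane_part_linear linear_conv_bounded_linear by (intro bounded_linear_imp_has_derivative) blast
  have "((\<lambda>u. \<beta> (vec (u $ k))) has_derivative (\<lambda>v. fd \<beta> (vec (u $ k)) (vec (v $ k)))) (at u)"
    by (rule has_derivative_compose[OF v]) (use immersion_onD(5)[OF im] u in auto)
  then show ?thesis unfolding product_map_def[abs_def]
    by (intro bounded_linear.has_derivative[OF T_bounded] has_derivative_Pair h)
qed

lemma fd_product_map: "u \<in> D' \<Longrightarrow> fd product_map u v = T (fd \<beta> (vec (u $ k)) (vec (v $ k)), hp v)"
  using fd_eq[OF product_map_derivative] by simp

lemma immersion_product_map: "immersion_on D' product_map"
  unfolding immersion_on_def
proof (intro conjI ballI open_D')
  have "smooth_on D' (\<lambda>u. \<beta> (vec (u $ k)))"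
    by (rule smooth_on_compose[OF open_D' immersion_onD(1)[OF im] _ _ immersion_onD(2)[OF im]])
       (auto intro!: smooth_on_linear bounded_linear_compose[OF vec_linear bounded_linear_vec_nth])
  moreover have T1: "bounded_linear (\<lambda>z. T (z, 0))" and T2: "bounded_linear (\<lambda>y. T (0, y))"
    by (intro bounded_linear_compose[OF T_bounded] bounded_linear_Pair bounded_linear_ident bounded_linear_zero)+
  moreover have "smooth_on D' (\<lambda>u. T (0, hp u))"
    using hyperplane_part_linear linear_conv_bounded_linear
    by (intro smooth_on_linear bounded_linear_compose[OF T2]) blast
  ultimately have "smooth_on D' (\<lambda>u. T (\<beta> (vec (u $ k)), 0) + T (0, hp u))"
    by (intro smooth_on_add[OF open_D'] smooth_on_linear_compose[OF T1 open_D'])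
  then show "smooth_on D' product_map" by (simp add: product_map_def[abs_def] T_add)
  fix u assume u: "u \<in> D'"
  show "inj (fd product_map u)"
  proof (rule injI)
    fix a b assume "fd product_map u a = fd product_map u b"
    then have "fd \<beta> (vec (u $ k)) (vec (a $ k)) = fd \<beta> (vec (u $ k)) (vec (b $ k))" "hp a = hp b"
      using T_inj[OF hyperplane_part_in hyperplane_part_in] by (auto simp: fd_product_map[OF u])
    moreover have "inj (fd \<beta> (vec (u $ k)))" using immersion_onD(3)[OF im] u by simp
    ultimately have "(vec (a $ k) :: real^1) = vec (b $ k)" "hp a = hp b" by (auto dest: injD)
    then have "a $ k = b $ k" "hp a = hp b" by (auto simp: vec_eq_iff)
    then show "a = b" by (metis hyperplane_decomp)
  qed
qed

lemma induced_metric_product_map: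
  assumes u: "u \<in> D'"
  shows "induced_metric product_map u v w = induced_metric \<beta> (vec (u $ k)) (vec (v $ k)) (vec (w $ k)) + hp v \<bullet> hp w"
  unfolding induced_metric_def fd_product_map[OF u] by (simp add: innerT hyperplane_part_in)

text \<open>The normal of the curve, placed in the plane factor, is orthogonal to both factors of
  the derivative, and in codimension one a unit normal determines the tangent space.\<close>

lemma product_map_normal:
  assumes u: "u \<in> D'"
  obtains N' where "norm N' = 1" "tangent_space \<beta> (vec (u $ k)) = {z. z \<bullet> N' = 0}"
    "norm (T (N', 0)) = 1" "tangent_space product_map u = {x. x \<bullet> T (N', 0) = 0}"
proof -
  have w: "vec (u $ k) \<in> D" using u by simp
  note I = immersion_onD[OF im] and I' = immersion_onD[OF immersion_product_map]
  obtain N' where N': "norm N' = 1" "tangent_space \<beta> (vec (u $ k)) = {z. z \<bullet> N' = 0}"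
    using unit_normal_exists[of \<beta> "vec (u $ k)", OF I(4)[OF w] I(3)[OF w]] by auto
  have n: "norm (T (N', 0)) = 1" using normT[OF H_closed(3), of N'] N'(1) by (simp add: norm_Pair)
  have "fd product_map u v \<bullet> T (N', 0) = 0" for v
  proof -
    have "fd \<beta> (vec (u $ k)) (vec (v $ k)) \<in> {z. z \<bullet> N' = 0}" unfolding N'(2)[symmetric] tangent_space_def by blast
    then show ?thesis by (simp add: fd_product_map[OF u] innerT hyperplane_part_in H_closed(3))
  qed
  then have "tangent_space product_map u = {x. x \<bullet> T (N', 0) = 0}"
    using tangent_space_unit_normal[OF I'(4)[OF u] I'(3)[OF u] facts(4) n] by blast
  then show thesis using that N' n by blast
qed

lemma normal_part_product_map:
  assumes u: "u \<in> D'" and y: "y \<in> H"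
  shows "normal_part product_map u (T (z, y)) = T (normal_part \<beta> (vec (u $ k)) z, 0)"
proof -
  obtain N' where N': "norm N' = 1" "tangent_space \<beta> (vec (u $ k)) = {z. z \<bullet> N' = 0}"
    "norm (T (N', 0)) = 1" "tangent_space product_map u = {x. x \<bullet> T (N', 0) = 0}" by (rule product_map_normal[OF u])
  show ?thesis
    unfolding normal_part_eq[OF N'(2,1)] normal_part_eq[OF N'(4,3)]
    using y by (simp add: innerT H_closed(3) T_scale)
qed

text \<open>The derivative in direction \<open>w\<close> has the constant flat part
  \<open>hp w\<close>, so a second derivative sees only the curve, and its normal part is taken in
  the plane.\<close>

lemma second_ff_product_map:
  assumes u: "u \<in> D'"
  shows "second_ff product_map u v w = T (second_ff \<beta> (vec (u $ k)) (vec (v $ k)) (vec (w $ k)), 0)"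
proof -
  let ?d = "\<lambda>x. fd \<beta> x (vec (w $ k))"
  have vd: "((\<lambda>u :: real^'n. vec (u $ k) :: real^1) has_derivative (\<lambda>v. vec (v $ k))) (at u)"
    by (intro bounded_linear_imp_has_derivative bounded_linear_compose[OF vec_linear bounded_linear_vec_nth])
  have "((\<lambda>x. ?d (vec (x $ k))) has_derivative (\<lambda>v. fd ?d (vec (u $ k)) (vec (v $ k)))) (at u)"
    by (rule has_derivative_compose[OF vd]) (use immersion_onD(7)[OF im] u in auto)
  then have "((\<lambda>x. T (?d (vec (x $ k)), hp w)) has_derivative (\<lambda>v. T (fd ?d (vec (u $ k)) (vec (v $ k)), 0))) (at u)"
    by (intro bounded_linear.has_derivative[OF T_bounded] has_derivative_Pair has_derivative_const)
  then have "fd (\<lambda>x. T (?d (vec (x $ k)), hp w)) u v = T (fd ?d (vec (u $ k)) (vec (v $ k)), 0)"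
    using fd_eq by metis
  moreover have "fd (\<lambda>x. fd product_map x w) u = fd (\<lambda>x. T (?d (vec (x $ k)), hp w)) u"
    by (rule fd_cong[OF open_D' u]) (rule fd_product_map)
  ultimately show ?thesis
    unfolding second_ff_def using normal_part_product_map[OF u H_closed(3)] by simp
qed

text \<open>A unit vector of the curve on axis \<open>k\<close> together with the standard basis of
  \<open>H\<close> is a frame of the product. Only the index \<open>k\<close> contributes to the
  trace, as the second fundamental form ignores \<open>H\<close>.\<close>

lemma mean_curvature_product_map:
  assumes u: "u \<in> D'"
  shows "mean_curvature_vector product_map u = T (mean_curvature_vector \<beta> (vec (u $ k)), 0)"
proof -
  have w: "vec (u $ k) \<in> D" using u by simp
  note I = immersion_onD[OF im]
  obtain E1 where E1: "orthonormal_frame \<beta> (vec (u $ k)) E1"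
    using orthonormal_frame_exists[OF I(4)[OF w] I(3)[OF w]] by blast
  have l1: "linear E1" using E1 by (simp add: orthonormal_frame_def)
  define E where "E v = (E1 (vec (v $ k)) $ 1) *\<^sub>R ax k + hp v" for v
  have va: "vec (a + b) = (vec a + vec b :: real^1)" "vec (c * a) = (c *\<^sub>R vec a :: real^1)" for a b c :: real
    by (simp_all add: vec_eq_iff)
  have vi: "(vec a :: real^1) \<bullet> vec b = a * b" for a b by (simp add: inner_vec_def)
  have Ek: "vec (E v $ k) = E1 (vec (v $ k))" for v
    using hyperplane_part_in[of k v] by (simp add: E_def vec_nth_one coord_hyperplane_def)
  have Eh: "hp (E v) = hp v" for v
    by (simp add: E_def linear_add[OF hyperplane_part_linear] hyperplane_part_axis hyperplane_part_id[OF hyperplane_part_in])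
  have "linear E" unfolding E_def
    by (intro linearI) (simp_all add: va linear_add[OF l1] linear_scale[OF l1] linear_add[OF hyperplane_part_linear]
      linear_scale[OF hyperplane_part_linear] algebra_simps)
  moreover have "fd product_map u (E v) \<bullet> fd product_map u (E v') = v \<bullet> v'" for v v'
  proof -
    have "fd product_map u (E v) \<bullet> fd product_map u (E v') = fd \<beta> (vec (u $ k)) (E1 (vec (v $ k))) \<bullet> fd \<beta> (vec (u $ k)) (E1 (vec (v' $ k))) + hp v \<bullet> hp v'"
      unfolding fd_product_map[OF u] Ek Eh by (simp add: innerT hyperplane_part_in)
    also have "\<dots> = (vec (v $ k) :: real^1) \<bullet> vec (v' $ k) + hp v \<bullet> hp v'" using E1 by (simp add: orthonormal_frame_def)
    also have "\<dots> = v \<bullet> v'" by (simp add: vi hyperplane_inner[of v v' k])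
    finally show ?thesis .
  qed
  ultimately have E: "orthonormal_frame product_map u E" by (simp add: orthonormal_frame_def)
  let ?s = "second_ff \<beta> (vec (u $ k)) (E1 1) (E1 1)"
  have a1: "ax 1 = (1 :: real^1)" by (simp add: vec_eq_iff axis_def forall_1)
  have card1: "CARD(2) = CARD(1) + 1" by simp
  have A0: "second_ff \<beta> (vec (u $ k)) 0 0 = 0"
    using second_ff_bilinear[OF im w card1] by (rule bilinear_lzero)
  have "second_ff product_map u (E (ax i)) (E (ax i)) = (if i = k then T (?s, 0) else 0)" for i
  proof (cases "i = k")
    case True
    then show ?thesis unfolding second_ff_product_map[OF u] Ek by simp
  next
    case False
    have "(vec 0 :: real^1) = 0" by (simp add: vec_eq_iff)
    then have "E1 (vec (ax i $ k)) = 0" using False linear_0[OF l1] by (simp add: axis_def)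
    then show ?thesis unfolding second_ff_product_map[OF u] Ek using False A0 by (simp add: T_zero)
  qed
  then have "mean_curvature_vector product_map u = T (?s, 0)"
    unfolding mean_curvature_frame[OF immersion_product_map u facts(4) E] by simp
  moreover have "mean_curvature_vector \<beta> (vec (u $ k)) = ?s"
    unfolding mean_curvature_frame[OF im w card1 E1] by (simp add: a1)
  ultimately show ?thesis by simp
qed

end

end

section \<open>The curve\<close>

context complete_splitting
begin

definition \<Gamma> :: "'p set" where "\<Gamma> = {p \<in> topspace M. base p = 0}"
definition C :: "'p topology" where "C = subtopology M \<Gamma>"
definition gam :: "'p \<Rightarrow> real^2" where "gam p = fst (S (F p))"

text \<open>All parametrizations compatible with \<open>gam\<close>; two of them are smoothly related because a
  continuous map is smooth as soon as its composition with an immersion is.\<close>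

definition \<G> :: "(1, 'p) atlas" where
  "\<G> = {(D, \<psi>). parametrization C D \<psi> \<and> immersion_on D (gam \<circ> \<psi>)}"

lemma F_gam: "F p = T (gam p, base p)"
  unfolding gam_def base_def by (simp add: S(4))

lemma topspace_C: "topspace C = \<Gamma>"
  unfolding C_def \<Gamma>_def by auto

text \<open>The adapted chart restricted to the axis \<open>k\<close>. At a point of height
  \<open>0\<close> the cylinder is centred at the origin and \<open>base\<close> is the
  \<open>H\<close> part of the coordinates, so the axis is exactly the part of the chart inside
  \<open>\<Gamma>\<close>.\<close>

lemma curve_chart_exists:
  assumes p: "p \<in> \<Gamma>"
  obtains D \<psi> v where "(D, \<psi>) \<in> \<G>" "v \<in> D" "\<psi> v = p"
proof -
  have pM: "p \<in> topspace M" and b: "base p = 0" using p by (auto simp: \<Gamma>_def)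
  obtain r \<theta> \<alpha> where A: "adapted p r \<theta> \<alpha>" using adapted_exists[OF pM] by blast
  note AD = adaptedD[OF A]
  let ?B = "cylinder (base p) r"
  define D where "D = {v :: real^1. \<bar>v $ 1\<bar> < r}"
  define \<psi> where "\<psi> v = \<theta> ((v $ 1) *\<^sub>R ax k)" for v :: "real^1"
  have D: "open D" unfolding D_def by (intro open_Collect_less continuous_intros)
  have inB: "(v $ 1) *\<^sub>R ax k \<in> ?B" if "v \<in> D" for v
    using that AD(1) by (simp add: D_def cylinder_def b hyperplane_part_axis)
  have Fpsi: "F (\<psi> v) = T (\<alpha> (v $ 1), 0)" if "v \<in> D" for v
    using AD(6)[OF inB[OF that]] by (simp add: \<psi>_def hyperplane_part_axis)
  have gpsi: "gam (\<psi> v) = \<alpha> (v $ 1)" and bpsi: "base (\<psi> v) = 0" if "v \<in> D" for v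
    unfolding gam_def base_def using Fpsi[OF that] S(2)[OF H_closed(3)] by auto
  have psiG: "\<psi> v \<in> \<Gamma>" if "v \<in> D" for v
    using AD(9)[OF inB[OF that]] bpsi[OF that] by (simp add: \<Gamma>_def \<psi>_def)
  have im: "\<psi> ` D = \<Gamma> \<inter> \<theta> ` ?B"
  proof
    show "\<psi> ` D \<subseteq> \<Gamma> \<inter> \<theta> ` ?B" using psiG inB by (auto simp: \<psi>_def)
    show "\<Gamma> \<inter> \<theta> ` ?B \<subseteq> \<psi> ` D"
    proof
      fix q assume q: "q \<in> \<Gamma> \<inter> \<theta> ` ?B"
      then obtain u where u: "u \<in> ?B" "q = \<theta> u" by blast
      have "base q = hp u" unfolding base_def u(2) AD(6)[OF u(1)] S(2)[OF hyperplane_part_in] by simp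
      then have "hp u = 0" using q by (simp add: \<Gamma>_def)
      then have "u = (u $ k) *\<^sub>R ax k" using hyperplane_decomp[of u k] by simp
      then have "q = \<psi> (vec (u $ k))" using u(2) by (simp add: \<psi>_def)
      moreover have "vec (u $ k) \<in> D" using u(1) by (simp add: D_def cylinder_def)
      ultimately show "q \<in> \<psi> ` D" by blast
    qed
  qed
  have op: "openin C (\<psi> ` D)" unfolding im C_def openin_subtopology using AD(7) by blast
  have c1: "continuous_map (top_of_set D) (subtopology C (\<psi> ` D)) \<psi>"
  proof (intro continuous_map_into_subtopology)
    have "continuous_map (top_of_set D) (top_of_set ?B) (\<lambda>v. (v $ 1) *\<^sub>R ax k)"
      using inB by (auto simp: continuous_map_in_subtopology intro!: continuous_intros)
    from continuous_map_compose[OF this AD(3)] have "continuous_map (top_of_set D) M \<psi>"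
      by (simp add: comp_def \<psi>_def[abs_def])
    then show "continuous_map (top_of_set D) C \<psi>" unfolding C_def
      by (rule continuous_map_into_subtopology) (use psiG in auto)
  qed auto
  define h where "h q = (vec (inv_into ?B \<theta> q $ k) :: real^1)" for q
  have hpsi: "h (\<psi> v) = v" if "v \<in> D" for v
    using inv_into_f_f[OF AD(2) inB[OF that]] by (simp add: h_def \<psi>_def vec_nth_one)
  have c2: "continuous_map (subtopology C (\<psi> ` D)) (top_of_set D) h"
  proof (rule continuous_map_into_subtopology)
    have "subtopology C (\<psi> ` D) = subtopology (subtopology M (\<theta> ` ?B)) (\<psi> ` D)"
      unfolding C_def subtopology_subtopology im by (rule arg_cong[of _ _ "subtopology M"]) auto
    then have "continuous_map (subtopology C (\<psi> ` D)) euclidean (inv_into ?B \<theta>)"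
      using continuous_map_from_subtopology[OF continuous_map_into_fulltopology[OF AD(10)]] by simp
    moreover have "continuous_on UNIV (\<lambda>x. vec (x $ k) :: real^1)"
      by (intro linear_continuous_on bounded_linear_compose[OF vec_linear bounded_linear_vec_nth])
    ultimately show "continuous_map (subtopology C (\<psi> ` D)) euclidean h"
      using continuous_map_compose[of _ euclidean "inv_into ?B \<theta>" euclidean "\<lambda>x. vec (x $ k) :: real^1"]
      by (simp add: comp_def h_def[abs_def])
    show "h \<in> topspace (subtopology C (\<psi> ` D)) \<rightarrow> D" using hpsi by auto
  qed
  have "homeomorphic_map (top_of_set D) (subtopology C (\<psi> ` D)) \<psi>"
    unfolding homeomorphic_map_maps homeomorphic_maps_def using c1 c2 hpsi by fastforce
  then have par: "parametrization C D \<psi>" unfolding parametrization_def using D op by blast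
  have sa: "smooth_on {-r<..<r} \<alpha>" "\<And>s. s \<in> {-r<..<r} \<Longrightarrow> fd \<alpha> s 1 \<noteq> 0" using A by (auto simp: adapted_def)
  have D1: "v $ 1 \<in> {-r<..<r}" if "v \<in> D" for v using that by (auto simp: D_def abs_less_iff)
  have "smooth_on D (\<lambda>v. \<alpha> (v $ 1))"
    by (rule smooth_on_compose[OF D _ _ _ sa(1)]) (use D1 in \<open>auto intro!: smooth_on_linear bounded_linear_vec_nth\<close>)
  moreover have "inj (fd (\<lambda>v. \<alpha> (v $ 1)) v)" if v: "v \<in> D" for v
  proof -
    have da: "(\<alpha> has_derivative fd \<alpha> (v $ 1)) (at (v $ 1))" by (rule smooth_on_has_derivative[OF sa(1) D1[OF v]])
    have c: "fd (\<lambda>v. \<alpha> (v $ 1)) v = (\<lambda>x. fd \<alpha> (v $ 1) (x $ 1))"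
      by (intro fd_eq has_derivative_compose[OF bounded_linear_imp_has_derivative[OF bounded_linear_vec_nth] da])
    have "fd \<alpha> (v $ 1) s = s *\<^sub>R fd \<alpha> (v $ 1) 1" for s
      using linear_scale[OF has_derivative_linear[OF da], of s 1] by simp
    then have e: "fd (\<lambda>v. \<alpha> (v $ 1)) v = (\<lambda>x. (x $ 1) *\<^sub>R fd \<alpha> (v $ 1) 1)" unfolding c by blast
    show ?thesis unfolding e
    proof (rule injI)
      fix x y :: "real^1" assume "(x $ 1) *\<^sub>R fd \<alpha> (v $ 1) 1 = (y $ 1) *\<^sub>R fd \<alpha> (v $ 1) 1"
      then have "x $ 1 = y $ 1" using sa(2)[OF D1[OF v]] by (simp only: scaleR_cancel_right) simp
      then show "x = y" by (metis vec_nth_one)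
    qed
  qed
  ultimately have "immersion_on D (\<lambda>v. \<alpha> (v $ 1))" unfolding immersion_on_def using D by blast
  then have "immersion_on D (gam \<circ> \<psi>)" by (rule immersion_on_cong) (simp add: gpsi)
  then have "(D, \<psi>) \<in> \<G>" using par by (simp add: \<G>_def)
  moreover have "0 \<in> D" using AD(1) by (simp add: D_def)
  moreover have "\<psi> 0 = p" using AD(5) b by (simp add: \<psi>_def)
  ultimately show thesis by (rule that)
qed

lemma \<G>D: "(D,\<psi>) \<in> \<G> \<Longrightarrow> parametrization C D \<psi>" "(D,\<psi>) \<in> \<G> \<Longrightarrow> immersion_on D (gam \<circ> \<psi>)"
  by (auto simp: \<G>_def)

text \<open>Translating back to height \<open>0\<close> projects \<open>M\<close> onto
  \<open>\<Gamma>\<close>. The curve is connected as the image of this map, which is also the first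
  component of \<open>\<Psi>\<close>.\<close>

lemma retraction: "continuous_map M C (\<lambda>p. translate p (- base p))" "p \<in> topspace M \<Longrightarrow> translate p (- base p) \<in> \<Gamma>"
proof -
  show r: "translate p (- base p) \<in> \<Gamma>" if "p \<in> topspace M" for p
    using translate_facts(1,3)[OF that H_closed(5)[OF base_H[of p]]] by (simp add: \<Gamma>_def)
  have "continuous_map M M (\<lambda>p. translate p (- base p))"
    by (rule translate_continuous_compose) (use base_continuous base_H H_closed(5) in \<open>auto intro!: continuous_intros\<close>)
  then show "continuous_map M C (\<lambda>p. translate p (- base p))"
    unfolding C_def by (rule continuous_map_into_subtopology) (use r in auto)
qed

lemma retraction_id: "p \<in> \<Gamma> \<Longrightarrow> translate p (- base p) = p"
  by (simp add: \<Gamma>_def translate_zero)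

lemma immersed_C: "immersed_hypersurface C \<G> gam"
  unfolding immersed_hypersurface_def
proof (intro conjI)
  have sM: "Hausdorff_space M" "second_countable M"
    using facts(1) by (auto simp: smooth_manifold_def)
  show "smooth_manifold C \<G>"
    unfolding smooth_manifold_def
  proof (intro conjI)
    show "Hausdorff_space C" "second_countable C"
      using sM by (simp_all add: C_def Hausdorff_space_subtopology second_countable_subtopology)
    show "\<forall>(D,\<psi>)\<in>\<G>. open D \<and> openin C (\<psi> ` D) \<and> homeomorphic_map (top_of_set D) (subtopology C (\<psi> ` D)) \<psi>"
      using \<G>D(1) by (auto simp: parametrization_def)
    show "topspace C = (\<Union>(D,\<psi>)\<in>\<G>. \<psi> ` D)"
    proof
      show "topspace C \<subseteq> (\<Union>(D,\<psi>)\<in>\<G>. \<psi> ` D)"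
      proof
        fix p assume "p \<in> topspace C"
        then have "p \<in> \<Gamma>" by (simp add: topspace_C)
        from curve_chart_exists[OF this] obtain D \<psi> v where "(D, \<psi>) \<in> \<G>" "v \<in> D" "\<psi> v = p" .
        then show "p \<in> (\<Union>(D,\<psi>)\<in>\<G>. \<psi> ` D)" by blast
      qed
      show "(\<Union>(D,\<psi>)\<in>\<G>. \<psi> ` D) \<subseteq> topspace C"
        using parametrizationD(7)[OF \<G>D(1)] by blast
    qed
    show "\<forall>(D,\<psi>)\<in>\<G>. \<forall>(E,\<theta>)\<in>\<G>. smooth_on {u \<in> D. \<psi> u \<in> \<theta> ` E} (inv_into E \<theta> \<circ> \<psi>)"
    proof clarify
      fix D \<psi> E \<theta> assume D: "(D,\<psi>) \<in> \<G>" and E: "(E,\<theta>) \<in> \<G>"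
      show "smooth_on {u \<in> D. \<psi> u \<in> \<theta> ` E} (inv_into E \<theta> \<circ> \<psi>)"
        by (rule chart_expression(2)[OF \<G>D[OF E] parametrizationD(1)[OF \<G>D(1)[OF D]] parametrizationD(4)[OF \<G>D(1)[OF D]]
            immersion_onD(2)[OF \<G>D(2)[OF D]]])
    qed
  qed
  have "(\<lambda>p. translate p (- base p)) ` topspace M = \<Gamma>"
  proof
    show "\<Gamma> \<subseteq> (\<lambda>p. translate p (- base p)) ` topspace M"
    proof
      fix p assume p: "p \<in> \<Gamma>"
      show "p \<in> (\<lambda>p. translate p (- base p)) ` topspace M"
        using retraction_id[OF p] p by (intro image_eqI[of _ _ p]) (simp_all add: \<Gamma>_def)
    qed
  qed (use retraction(2) in auto)
  moreover have "connectedin C ((\<lambda>p. translate p (- base p)) ` topspace M)"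
    by (rule connectedin_continuous_map_image[OF retraction(1)]) (use facts(2) in \<open>simp add: connectedin_topspace\<close>)
  ultimately show "connected_space C" by (metis connectedin_topspace topspace_C)
  have "topspace M \<noteq> {}" using M by (simp add: immersed_hypersurface_def)
  then show "topspace C \<noteq> {}" unfolding topspace_C using retraction(2) by blast
  show "\<forall>(D,\<psi>)\<in>\<G>. smooth_on D (gam \<circ> \<psi>) \<and> (\<forall>u\<in>D. inj (fd (gam \<circ> \<psi>) u))"
    using \<G>D(2) by (auto simp: immersion_on_def)
qed simp

text \<open>On \<open>\<Gamma>\<close> one has \<open>F p = T (gam p, 0)\<close>, and
  \<open>T\<close> is isometric on the plane factor. The speeds agree except at break points and at
  the two ends, where only one side is known to stay in \<open>\<Gamma>\<close>.\<close>

lemma curve_in_C: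
  assumes c: "pw_C1_curve C gam c"
  shows "pw_C1_curve M F c" "curve_length F c = curve_length gam c"
proof -
  have cM: "pathin M c" and cG: "\<And>t. t \<in> {0..1} \<Longrightarrow> c t \<in> \<Gamma>"
    using pw_C1_curveD(1)[OF c] unfolding C_def pathin_subtopology by auto
  have bl: "bounded_linear (\<lambda>z. T (z, 0))"
    by (intro bounded_linear_compose[OF linT[unfolded linear_conv_bounded_linear]] bounded_linear_Pair bounded_linear_ident bounded_linear_zero)
  have eq: "F (c t) = T (gam (c t), 0)" if "t \<in> {0..1}" for t
    using cG[OF that] F_gam[of "c t"] by (simp add: \<Gamma>_def)
  obtain A where A: "continuous_on {0..1} (gam \<circ> c)" "finite A" "(gam \<circ> c) C1_differentiable_on ({0..1} - A)"
    using c unfolding pw_C1_curve_def piecewise_C1_differentiable_on_def by blast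
  obtain d where d: "\<And>t. t \<in> {0..1} - A \<Longrightarrow> ((gam \<circ> c) has_vector_derivative d t) (at t)" "continuous_on ({0..1} - A) d"
    using A(3) unfolding C1_differentiable_on_def by blast
  have dF: "((F \<circ> c) has_vector_derivative T (d t, 0)) (at t)" if "t \<in> {0..1} - (A \<union> {0,1})" for t
  proof (rule has_vector_derivative_transform_within_open[of "\<lambda>t. T (gam (c t), 0)" _ _ "{0<..<1}"])
    show "((\<lambda>t. T (gam (c t), 0)) has_vector_derivative T (d t, 0)) (at t)"
      using bounded_linear.has_vector_derivative[OF bl d(1)[of t]] that by (simp add: comp_def)
  qed (use that eq in auto)
  have n: "norm (T (z, 0)) = norm z" for z using normT[OF H_closed(3), of z] by (simp add: norm_Pair)
  have i: "(speed (F \<circ> c) has_integral curve_length gam c) {0..1}"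
  proof (rule has_integral_spike_finite[OF _ _ pw_C1_curveD(4)[OF c]])
    show "finite (A \<union> {0,1})" using A(2) by simp
    show "speed (F \<circ> c) t = speed (gam \<circ> c) t" if "t \<in> {0..1} - (A \<union> {0,1})" for t
      using vector_derivative_at[OF dF[OF that]] vector_derivative_at[OF d(1), of t] that n by simp
  qed
  have "continuous_on {0..1} (\<lambda>t. T (gam (c t), 0))"
    using bounded_linear.continuous_on[OF bl A(1)] by (simp add: comp_def)
  then have "continuous_on {0..1} (F \<circ> c)" by (rule continuous_on_eq) (simp add: eq)
  moreover have "(F \<circ> c) C1_differentiable_on ({0..1} - (A \<union> {0,1}))"
    unfolding C1_differentiable_on_def
  proof (intro exI[of _ "\<lambda>t. T (d t, 0)"] conjI ballI dF)
    show "continuous_on ({0..1} - (A \<union> {0,1})) (\<lambda>t. T (d t, 0))"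
      by (rule bounded_linear.continuous_on[OF bl continuous_on_subset[OF d(2)]]) auto
  qed
  ultimately show "pw_C1_curve M F c"
    unfolding pw_C1_curve_def piecewise_C1_differentiable_on_def using cM i A(2)
    by (meson finite.emptyI finite.insertI finite_UnI has_integral_integrable)
  show "curve_length F c = curve_length gam c" using i by (simp add: curve_length_def[of F] integral_unique)
qed

text \<open>A curve in \<open>C\<close> is a curve in \<open>M\<close> of equal length, so the
  distance of \<open>C\<close> dominates that of \<open>M\<close> and Cauchy sequences remain
  Cauchy. The limit lies in the closed set \<open>\<Gamma>\<close>, and \<open>riem_topology\<close>
  for \<open>C\<close> converts topological convergence back into convergence of distances.\<close>

lemma complete_C: "complete_hypersurface C gam"
proof -
  interpret RC: Metric_space "topspace C" "riem_dist C gam" by (rule riem_metric[OF immersed_C])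
  have le: "riem_dist M F p q \<le> riem_dist C gam p q" if pq: "p \<in> topspace C" "q \<in> topspace C" for p q
  proof (rule field_le_epsilon)
    fix e :: real assume "e > 0"
    then have "riem_dist C gam p q < riem_dist C gam p q + e" by simp
    from riem_dist_attained[OF immersed_C pq this] obtain c
      where c: "pw_C1_curve C gam c" "c 0 = p" "c 1 = q" "curve_length gam c < riem_dist C gam p q + e" .
    then show "riem_dist M F p q \<le> riem_dist C gam p q + e"
      using riem_dist_le[OF curve_in_C(1)[OF c(1)] c(2,3)] curve_in_C(2)[OF c(1)] by simp
  qed
  have CM: "topspace C \<subseteq> topspace M" by (auto simp: topspace_C \<Gamma>_def)
  have clG: "closedin M \<Gamma>"
    using closedin_continuous_map_preimage[OF base_continuous, of "{0}"] by (simp add: \<Gamma>_def)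
  show ?thesis
    unfolding complete_hypersurface_def RC.mcomplete_def
  proof (intro allI impI)
    fix \<sigma> assume s: "RC.MCauchy \<sigma>"
    then have r: "range \<sigma> \<subseteq> topspace C"
      and ca: "\<And>e. e > 0 \<Longrightarrow> \<exists>N. \<forall>n n'. N \<le> n \<longrightarrow> N \<le> n' \<longrightarrow> riem_dist C gam (\<sigma> n) (\<sigma> n') < e"
      by (auto simp: RC.MCauchy_def)
    have sC: "\<sigma> n \<in> topspace C" for n using r by auto
    have rM: "range \<sigma> \<subseteq> topspace M" using r CM by blast
    have caM: "\<exists>N. \<forall>n n'. N \<le> n \<longrightarrow> N \<le> n' \<longrightarrow> riem_dist M F (\<sigma> n) (\<sigma> n') < e" if "e > 0" for e
      using ca[OF that] le[OF sC sC] by (meson le_less_trans)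
    obtain q where q: "limitin M \<sigma> q sequentially" by (rule complete_limit[OF M complete rM caM])
    have "q \<in> \<Gamma>"
      by (rule limitin_closedin[OF q clG]) (use sC topspace_C in \<open>auto intro: always_eventually\<close>)
    then have "limitin C \<sigma> q sequentially"
      using q sC unfolding C_def limitin_subtopology by (simp add: topspace_C[unfolded C_def])
    then show "\<exists>x. limitin RC.mtopology \<sigma> x sequentially"
      unfolding riem_topology[OF immersed_C] by blast
  qed
qed

section \<open>The splitting map and its inverse\<close>

definition \<Phi> :: "'p \<times> (real^'n) \<Rightarrow> 'p" where "\<Phi> = (\<lambda>(p, y). translate p y)"

context
  fixes D \<psi> assumes D: "(D,\<psi>) \<in> \<G>"
begin

lemma prod_param_in: "u \<in> D' D \<Longrightarrow> prod_param k \<psi> u \<in> \<Gamma> \<times> H"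
  using parametrizationD(7)[OF \<G>D(1)[OF D], of "vec (u $ k)"] topspace_C
  by (simp add: prod_param_def hyperplane_part_in)

lemma prod_param_continuous: "continuous_map (top_of_set (D' D)) (prod_space k C) (prod_param k \<psi>)"
  unfolding prod_space_def prod_param_def[abs_def]
proof (intro continuous_map_pairedI)
  have "continuous_on (D' D) (\<lambda>u. vec (u $ k) :: real^1)"
    by (intro linear_continuous_on bounded_linear_compose[OF vec_linear bounded_linear_vec_nth])
  then have "continuous_map (top_of_set (D' D)) (top_of_set D) (\<lambda>u. vec (u $ k))"
    by (auto simp: continuous_map_in_subtopology)
  from continuous_map_compose[OF this parametrizationD(4)[OF \<G>D(1)[OF D]]]
  show "continuous_map (top_of_set (D' D)) C (\<lambda>u. \<psi> (vec (u $ k)))" by (simp add: comp_def)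
  have "continuous_on (D' D) hp"
    using hyperplane_part_linear[of k] by (intro linear_continuous_on) (simp add: linear_conv_bounded_linear)
  then show "continuous_map (top_of_set (D' D)) (top_of_set H) hp"
    by (auto simp: continuous_map_in_subtopology hyperplane_part_in)
qed

lemma prod_param_image: "prod_param k \<psi> ` D' D = \<psi> ` D \<times> H"
proof
  show "prod_param k \<psi> ` D' D \<subseteq> \<psi> ` D \<times> H" by (auto simp: prod_param_def hyperplane_part_in)
  show "\<psi> ` D \<times> H \<subseteq> prod_param k \<psi> ` D' D"
  proof clarify
    fix v y assume v: "v \<in> D" and y: "y \<in> H"
    let ?u = "(v $ 1) *\<^sub>R ax k + y"
    have u: "y $ k = 0" "hp ?u = y"
      using y by (simp_all add: coord_hyperplane_def linear_add[OF hyperplane_part_linear] hyperplane_part_axis hyperplane_part_id[OF y])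
    show "(\<psi> v, y) \<in> prod_param k \<psi> ` D' D"
      by (rule image_eqI[of _ _ ?u]) (use v in \<open>simp_all add: prod_param_def u vec_nth_one\<close>)
  qed
qed

text \<open>The inverse is explicit: coordinate \<open>k\<close> is read off from the chart of the
  curve, and the \<open>H\<close> part is the second component.\<close>

lemma prod_param_parametrization: "parametrization (prod_space k C) (D' D) (prod_param k \<psi>)"
  unfolding parametrization_def
proof (intro conjI)
  note Dp = parametrizationD[OF \<G>D(1)[OF D]]
  show "open (D' D)" by (rule open_D'[OF \<G>D(2)[OF D]])
  have sub: "subtopology (prod_space k C) (\<psi> ` D \<times> H) = prod_topology (subtopology C (\<psi> ` D)) (top_of_set H)"
    by (simp add: prod_space_def subtopology_Times subtopology_subtopology)
  show "openin (prod_space k C) (prod_param k \<psi> ` D' D)"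
    unfolding prod_param_image prod_space_def using Dp(2) by (simp add: openin_prod_Times_iff)
  let ?h = "\<lambda>(q, y). (inv_into D \<psi> q $ 1) *\<^sub>R ax k + y"
  have hp: "?h (prod_param k \<psi> u) = u" if "u \<in> D' D" for u
    using that inv_into_f_f[OF Dp(3)] hyperplane_decomp[of u k] by (simp add: prod_param_def)
  have c1: "continuous_map (top_of_set (D' D)) (subtopology (prod_space k C) (prod_param k \<psi> ` D' D)) (prod_param k \<psi>)"
    by (rule continuous_map_into_subtopology[OF prod_param_continuous]) auto
  have c2: "continuous_map (subtopology (prod_space k C) (prod_param k \<psi> ` D' D)) (top_of_set (D' D)) ?h"
  proof (rule continuous_map_into_subtopology)
    let ?X = "prod_topology (subtopology C (\<psi> ` D)) (top_of_set H)"
    have "continuous_map ?X euclidean (inv_into D \<psi> \<circ> fst)"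
      by (rule continuous_map_compose[OF continuous_map_fst continuous_map_into_fulltopology[OF Dp(6)]])
    then have a: "continuous_map ?X euclidean (\<lambda>z. inv_into D \<psi> (fst z))" by (simp add: comp_def)
    have "continuous_map euclidean euclidean (\<lambda>v :: real^1. (v $ 1) *\<^sub>R ax k :: real^'n)"
      by (auto intro!: continuous_intros)
    from continuous_map_compose[OF a this]
    have b: "continuous_map ?X euclidean (\<lambda>z. (inv_into D \<psi> (fst z) $ 1) *\<^sub>R ax k :: real^'n)" by (simp add: comp_def)
    have "continuous_map ?X euclidean snd"
      by (rule continuous_map_into_fulltopology[OF continuous_map_snd])
    from continuous_map_add[OF b this]
    show "continuous_map (subtopology (prod_space k C) (prod_param k \<psi> ` D' D)) euclidean ?h"
      unfolding prod_param_image sub by (simp add: case_prod_unfold)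
    show "?h \<in> topspace (subtopology (prod_space k C) (prod_param k \<psi> ` D' D)) \<rightarrow> D' D"
    proof
      fix z assume "z \<in> topspace (subtopology (prod_space k C) (prod_param k \<psi> ` D' D))"
      then obtain u where "u \<in> D' D" "z = prod_param k \<psi> u" by auto
      then show "?h z \<in> D' D" using hp[of u] by simp
    qed
  qed
  have "homeomorphic_maps (top_of_set (D' D)) (subtopology (prod_space k C) (prod_param k \<psi> ` D' D)) (prod_param k \<psi>) ?h"
    unfolding homeomorphic_maps_def
  proof (intro conjI ballI c1 c2)
    show "?h (prod_param k \<psi> u) = u" if "u \<in> topspace (top_of_set (D' D))" for u using hp that by simp
    fix z assume "z \<in> topspace (subtopology (prod_space k C) (prod_param k \<psi> ` D' D))"
    then obtain u where "u \<in> D' D" "z = prod_param k \<psi> u" by auto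
    then show "prod_param k \<psi> (?h z) = z" using hp[of u] by simp
  qed
  then show "homeomorphic_map (top_of_set (D' D)) (subtopology (prod_space k C) (prod_param k \<psi> ` D' D)) (prod_param k \<psi>)"
    using homeomorphic_map_maps by blast
qed

end

lemma Phi_continuous: "continuous_map (prod_space k C) M \<Phi>"
proof -
  have "continuous_map (prod_topology C (top_of_set H)) M fst"
    using continuous_map_fst[of C "top_of_set H"] unfolding C_def by (rule continuous_map_into_fulltopology)
  moreover have "continuous_map (prod_topology C (top_of_set H)) euclidean snd"
    by (rule continuous_map_into_fulltopology[OF continuous_map_snd])
  ultimately have "continuous_map (prod_topology C (top_of_set H)) M (\<lambda>x. translate (fst x) (snd x))"
    by (rule translate_continuous_compose) auto
  then show ?thesis by (simp add: prod_space_def \<Phi>_def case_prod_unfold)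
qed

lemma F_Phi: "p \<in> \<Gamma> \<Longrightarrow> y \<in> H \<Longrightarrow> F (\<Phi> (p, y)) = T (gam p, y)"
  using translate_facts(2)[of p y] F_gam[of p] by (simp add: \<Phi>_def \<Gamma>_def T_add)

lemma F_Phi_prod_param: "(D,\<psi>) \<in> \<G> \<Longrightarrow> u \<in> D' D \<Longrightarrow> F (\<Phi> (prod_param k \<psi> u)) = product_map (gam \<circ> \<psi>) u"
  using prod_param_in[of D \<psi> u] F_Phi[of "\<psi> (vec (u $ k))" "hp u"] by (simp add: prod_param_def product_map_def[OF \<G>D(2)])

lemma Phi_chart:
  assumes D: "(D,\<psi>) \<in> \<G>"
  shows "continuous_map (top_of_set (D' D)) M (\<Phi> \<circ> prod_param k \<psi>)"
    "immersion_on (D' D) (F \<circ> (\<Phi> \<circ> prod_param k \<psi>))"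
  using continuous_map_compose[OF prod_param_continuous[OF D] Phi_continuous]
    immersion_on_cong[OF immersion_product_map[OF \<G>D(2)[OF D]], of "F \<circ> (\<Phi> \<circ> prod_param k \<psi>)"] F_Phi_prod_param[OF D]
  by simp_all

text \<open>On the slice of height \<open>0\<close> the position is \<open>T (gam p, 0)\<close>, so
  both sides of the expander equation of \<open>M\<close> lie in the image of the plane factor, and
  injectivity of \<open>T\<close> gives the equation of the curve.\<close>

lemma self_expander_C:
  assumes se: "self_expander \<A> F"
  shows "self_expander \<G> gam"
  unfolding self_expander_def
proof clarify
  fix D \<psi> v assume D: "(D,\<psi>) \<in> \<G>" and v: "v \<in> D"
  note im = \<G>D(2)[OF D] and Ph = Phi_chart[OF D]
  let ?\<Theta> = "\<Phi> \<circ> prod_param k \<psi>"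
  define u where "u = (v $ 1) *\<^sub>R ax k"
  have uk: "vec (u $ k) = v" and hu: "hp u = 0" by (simp_all add: u_def vec_nth_one hyperplane_part_axis)
  have u: "u \<in> D' D" using uk v by simp
  have "?\<Theta> u \<in> topspace M" using continuous_map_image_subset_topspace[OF Ph(1)] u by auto
  then obtain E \<theta> e where E: "(E,\<theta>) \<in> \<A>" "e \<in> E" "\<theta> e = ?\<Theta> u" using facts(6) by blast
  note par = smooth_manifold_parametrization[OF facts(1) E(1)] and imE = facts(5)[OF E(1)]
  define W where "W = {u \<in> D' D. ?\<Theta> u \<in> \<theta> ` E}"
  define g where "g = inv_into E \<theta> \<circ> ?\<Theta>"
  note ce = chart_expression[OF par imE immersion_onD(1)[OF Ph(2)] Ph(1) immersion_onD(2)[OF Ph(2)], folded W_def g_def]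
  have uW: "u \<in> W" using u imageI[OF E(2), of \<theta>] E(3) by (simp add: W_def)
  have Wpf: "((F \<circ> \<theta>) \<circ> g) x = product_map (gam \<circ> \<psi>) x" if x: "x \<in> W" for x
    using ce(4)[OF x] F_Phi_prod_param[OF D, of x] x by (simp add: W_def)
  have R: "reparam W g E"
    unfolding reparam_def
  proof (intro conjI ballI ce(1,2))
    show "g ` W \<subseteq> E" using ce(3) by blast
    fix x assume x: "x \<in> W"
    have dg: "g differentiable (at x)" by (rule smooth_on_differentiable[OF ce(2) x])
    have df: "(F \<circ> \<theta>) differentiable (at (g x))"
      using immersion_onD(5)[OF imE ce(3)[OF x]] unfolding differentiable_def by blast
    have "fd (product_map (gam \<circ> \<psi>)) x = fd (\<lambda>y. (F \<circ> \<theta>) (g y)) x"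
      by (rule fd_cong[OF ce(1) x]) (use Wpf in simp)
    then have e: "fd (product_map (gam \<circ> \<psi>)) x = (\<lambda>w. fd (F \<circ> \<theta>) (g x) (fd g x w))"
      by (simp only: fd_compose[OF dg df])
    have "inj (fd (product_map (gam \<circ> \<psi>)) x)" using immersion_onD(3)[OF immersion_product_map[OF im]] x by (simp add: W_def)
    then have "inj (fd g x)" unfolding e by (auto simp: inj_def)
    then show "bij (fd g x)"
      using linear_injective_imp_surjective[OF linear_frechet_derivative[OF dg]] by (simp add: bij_def)
  qed
  have gc: "\<forall>z\<in>W. product_map (gam \<circ> \<psi>) z = ((F \<circ> \<theta>) \<circ> g) z" using Wpf by simp
  note cong = geometry_cong[OF ce(1) uW gc]
  have pu: "product_map (gam \<circ> \<psi>) u = T (gam (\<psi> v), 0)" by (simp add: product_map_def[OF im] uk hu)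
  have "F (\<theta> (g u)) = T (gam (\<psi> v), 0)" using Wpf[OF uW] pu by simp
  then have "mean_curvature_vector (product_map (gam \<circ> \<psi>)) u = (1/2) *\<^sub>R normal_part (product_map (gam \<circ> \<psi>)) u (T (gam (\<psi> v), 0))"
    unfolding cong mean_curvature_reparam(1)[OF imE R uW facts(4)] normal_part_reparam[OF imE R uW]
    using se E(1) ce(3)[OF uW] unfolding self_expander_def by fastforce
  then have "T (mean_curvature_vector (gam \<circ> \<psi>) v, 0) = T ((1/2) *\<^sub>R normal_part (gam \<circ> \<psi>) v (gam (\<psi> v)), 0)"
    unfolding mean_curvature_product_map[OF im u] normal_part_product_map[OF im u H_closed(3)] uk T_scale by simp
  then show "mean_curvature_vector (gam \<circ> \<psi>) v = (1/2) *\<^sub>R normal_part (gam \<circ> \<psi>) v (gam (\<psi> v))"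
    using T_inj[OF H_closed(3) H_closed(3)] by blast
qed

lemma Phi_smooth: "smooth_map (prod_space k C) (prod_atlas k \<G>) M \<A> \<Phi>"
  unfolding smooth_map_def
proof (intro conjI Phi_continuous ballI, clarify)
  fix D1 \<psi>1 E \<theta> assume "(D1, \<psi>1) \<in> prod_atlas k \<G>" and E: "(E,\<theta>) \<in> \<A>"
  then obtain D \<psi> where D: "(D,\<psi>) \<in> \<G>" "D1 = D' D" "\<psi>1 = prod_param k \<psi>" by (auto simp: prod_atlas_def)
  note Ph = Phi_chart[OF D(1)]
  show "smooth_on {u \<in> D1. \<Phi> (\<psi>1 u) \<in> \<theta> ` E} (inv_into E \<theta> \<circ> \<Phi> \<circ> \<psi>1)"
    using chart_expression(2)[OF smooth_manifold_parametrization[OF facts(1) E] facts(5)[OF E]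
      immersion_onD(1)[OF Ph(2)] Ph(1) immersion_onD(2)[OF Ph(2)]]
    unfolding D(2,3) comp_assoc by simp
qed

definition \<Psi> :: "'p \<Rightarrow> 'p \<times> (real^'n)" where "\<Psi> p = (translate p (- base p), base p)"

lemma Psi_continuous: "continuous_map M (prod_space k C) \<Psi>"
  unfolding prod_space_def \<Psi>_def[abs_def]
  by (intro continuous_map_pairedI retraction(1) continuous_map_into_subtopology[OF base_continuous])
     (use base_H in auto)

lemma F_Psi:
  assumes p: "p \<in> topspace M"
  shows "T (gam (fst (\<Psi> p)), snd (\<Psi> p)) = F p"
proof -
  note t = translate_facts[OF p H_closed(5)[OF base_H[of p]]]
  have "T (gam p, 0) = T (gam (translate p (- base p)), 0)"
    using t(2) F_gam[of p] F_gam[of "translate p (- base p)"] t(3) by (simp add: T_add)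
  then have "gam (translate p (- base p)) = gam p" using T_inj[OF H_closed(3) H_closed(3)] by simp
  then show ?thesis by (simp add: \<Psi>_def F_gam[of p])
qed

text \<open>The map \<open>?G\<close> immerses the product, and composed with \<open>\<Psi>\<close>
  it is \<open>F\<close> on \<open>M\<close>; so \<open>chart_expression\<close> applies with the
  product as target and \<open>?G\<close> as its immersion.\<close>

lemma Psi_smooth: "smooth_map M \<A> (prod_space k C) (prod_atlas k \<G>) \<Psi>"
  unfolding smooth_map_def
proof (intro conjI Psi_continuous ballI, clarify)
  fix D1 \<psi>1 E \<theta> assume "(D1, \<psi>1) \<in> prod_atlas k \<G>" and E: "(E,\<theta>) \<in> \<A>"
  then obtain D \<psi> where D: "(D,\<psi>) \<in> \<G>" "D1 = D' D" "\<psi>1 = prod_param k \<psi>" by (auto simp: prod_atlas_def)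
  note Ep = smooth_manifoldD[OF facts(1) E]
  let ?G = "\<lambda>z. T (gam (fst z), snd z)"
  have "?G \<circ> prod_param k \<psi> = product_map (gam \<circ> \<psi>)"
    by (rule ext) (simp add: prod_param_def product_map_def[OF \<G>D(2)[OF D(1)]])
  then have im: "immersion_on (D' D) (?G \<circ> prod_param k \<psi>)"
    using immersion_product_map[OF \<G>D(2)[OF D(1)]] by simp
  have "smooth_on E (?G \<circ> (\<Psi> \<circ> \<theta>)) \<longleftrightarrow> smooth_on E (F \<circ> \<theta>)"
    by (rule smooth_on_cong[OF Ep(1)]) (use F_Psi Ep(7) in simp)
  then have sm: "smooth_on E (?G \<circ> (\<Psi> \<circ> \<theta>))" using immersion_onD(2)[OF facts(5)[OF E]] by simp
  show "smooth_on {u \<in> E. \<Psi> (\<theta> u) \<in> \<psi>1 ` D1} (inv_into D1 \<psi>1 \<circ> \<Psi> \<circ> \<theta>)"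
    using chart_expression(2)[OF prod_param_parametrization[OF D(1)] im Ep(1)
      continuous_map_compose[OF Ep(4) Psi_continuous] sm]
    unfolding D(2,3) comp_assoc by simp
qed

lemma Phi_diffeomorphism: "diffeomorphism (prod_space k C) (prod_atlas k \<G>) M \<A> \<Phi>"
  unfolding diffeomorphism_def
proof (intro conjI exI[of _ \<Psi>] ballI Phi_smooth Psi_smooth)
  fix z assume "z \<in> topspace (prod_space k C)"
  then obtain p y where z: "z = (p, y)" "p \<in> topspace M" "base p = 0" "y \<in> H"
    by (auto simp: prod_space_def topspace_C \<Gamma>_def)
  then show "\<Psi> (\<Phi> z) = z"
    using translate_facts(3)[OF z(2,4)] translate_add[OF z(2,4) H_closed(5)[OF z(4)]] translate_zero[OF z(2)]
    by (simp add: \<Phi>_def \<Psi>_def)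
next
  fix p assume p: "p \<in> topspace M"
  then show "\<Phi> (\<Psi> p) = p"
    using translate_add[OF p H_closed(5)[OF base_H[of p]] base_H[of p]] translate_zero[OF p] by (simp add: \<Phi>_def \<Psi>_def)
qed

lemma product_with_curve: "is_product_with_curve k M \<A> F C \<G> gam"
  unfolding is_product_with_curve_def
proof (intro exI[of _ T] exI[of _ \<Phi>] conjI linT Phi_diffeomorphism)
  show "\<forall>z. \<forall>y\<in>H. norm (T (z, y)) = norm (z, y)" using normT by blast
  show "\<forall>p\<in>topspace C. \<forall>y\<in>H. F (\<Phi> (p, y)) = T (gam p, y)" using F_Phi topspace_C by blast
  show "\<forall>(D,\<psi>)\<in>\<G>. \<forall>u v w. vec (u $ k) \<in> D \<longrightarrow>
     induced_metric (F \<circ> \<Phi> \<circ> prod_param k \<psi>) u v w = prod_metric_form k (gam \<circ> \<psi>) u v w"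
  proof clarify
    fix D \<psi> and u v w :: "real^'n" assume D: "(D,\<psi>) \<in> \<G>" and "vec (u $ k) \<in> D"
    then have u: "u \<in> D' D" by simp
    have "fd (F \<circ> \<Phi> \<circ> prod_param k \<psi>) u = fd (product_map (gam \<circ> \<psi>)) u"
      by (rule fd_cong[OF open_D'[OF \<G>D(2)[OF D]] u]) (simp add: F_Phi_prod_param[OF D])
    then have "induced_metric (F \<circ> \<Phi> \<circ> prod_param k \<psi>) u v w = induced_metric (product_map (gam \<circ> \<psi>)) u v w"
      by (simp add: induced_metric_def)
    then show "induced_metric (F \<circ> \<Phi> \<circ> prod_param k \<psi>) u v w = prod_metric_form k (gam \<circ> \<psi>) u v w"
      unfolding induced_metric_product_map[OF \<G>D(2)[OF D] u] prod_metric_form_def .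
  qed
qed

end

theorem theorem6p1:
  fixes M :: "'p topology"
    and \<A> :: "('n::finite, 'p) atlas"
    and F :: "'p \<Rightarrow> real^'m::finite"
    and k :: 'n
    and s :: real
  assumes "immersed_hypersurface M \<A> F"
    and "complete_hypersurface M F"
    and "self_expander \<A> F"
    and "s \<ge> 0"
    and "\<forall>(D,\<psi>)\<in>\<A>. \<forall>u\<in>D. scalar_curvature (F \<circ> \<psi>) u = s"
  shows "\<exists>(C :: 'p topology) (\<G> :: (1, 'p) atlas) (\<gamma> :: 'p \<Rightarrow> real^2).
           immersed_hypersurface C \<G> \<gamma> \<and> complete_hypersurface C \<gamma> \<and> self_expander \<G> \<gamma> \<and>
           is_product_with_curve k M \<A> F C \<G> \<gamma>"
proof -
  obtain K where K: "subspace K" "dim K = CARD('n) - 1"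
    "\<And>D \<psi> u. (D,\<psi>) \<in> \<A> \<Longrightarrow> u \<in> D \<Longrightarrow> K \<subseteq> tangent_space (F \<circ> \<psi>) u"
    by (rule constant_tangent_subspace[OF assms(1,3,4,5)]) blast
  have card: "CARD('m) = CARD('n) + 1" using assms(1) by (simp add: immersed_hypersurface_def)
  obtain T :: "(real^2) \<times> (real^'n) \<Rightarrow> real^'m" where T: "linear T"
    "\<And>z y. y \<in> coord_hyperplane k \<Longrightarrow> norm (T (z, y)) = norm (z, y)"
    "\<And>y. y \<in> coord_hyperplane k \<Longrightarrow> T (0, y) \<in> K"
    by (rule splitting_isometry_exists[OF K(1,2) card, of k]) blast
  interpret complete_splitting M \<A> F k T
  proof (intro complete_splitting.intro splitting.intro complete_splitting_axioms.intro assms(1,2) T(1,2))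
    show "T (0, y) \<in> tangent_space (F \<circ> \<psi>) u"
      if "(D,\<psi>) \<in> \<A>" "u \<in> D" "y \<in> coord_hyperplane k" for D \<psi> u y
      using K(3)[OF that(1,2)] T(3)[OF that(3)] by blast
  qed
  show ?thesis
    using immersed_C complete_C self_expander_C[OF assms(3)] product_with_curve by blast
qed

end
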